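(* For any simple network $\mathscr{S}^0$ there exists a unique $\phi$-curvature flow $\{\mathscr{S}(t)\}_{t\in[0,T^\dag)}$ starting from $\mathscr{S}^0$ on a maximal time interval $[0,T^\dag)$, $T^\dag\in(0,+\infty]$. Moreover, if $T^\dag<+\infty$, then some segment of $\mathscr{S}(t)$ vanishes as $t\nearrow T^\dag$.
   Context: Anisotropy. $\phi$ is the norm on $\mathbb{R}^2$ whose closed unit ball (Wulff shape) $B^\phi=\{\phi\le 1\}$ is the regular hexagon circumscribed to the unit circle centered at the origin with two horizontal facets (vertices $(\pm\frac{2}{\sqrt3},0)$, $(\pm\frac1{\sqrt3},\pm1)$, sidelength $\frac2{\sqrt3}$). Its dual norm is $\phi^o(\xi)=\sup_{\phi(\eta)=1}\xi\cdot\eta$. Facets are closed sides. Curves. A curve is a closed set $\Gamma=\gamma(I)\subset\mathbb{R}^2$, $I\in\{[0,1],[0,1),(0,1)\}$, with $\gamma$ absolutely continuous and injective on $(0,1)$; it is closed if $I=[0,1]$ and $\gamma(0)=\gamma(1)$. It is oriented by the parametrization; $\tau$ is the unit tangent and $\nu$ is $\tau$ rotated by $90^\circ$ counterclockwise. Two oriented segments/half-lines are parallel if they lie on parallel lines and their unit normals coincide. Networks. A network $\mathscr{S}$ is a (connected) closed set consisting of finitely many oriented curves with pairwise disjoint relative interiors such that each endpoint of each curve is also an endpoint of at least two other curves (if the curve is not closed) or of another curve (if it is closed); such endpoints are the multiple junctions, and an $m$-junction is one at which $m$ curve ends meet. A polygonal network is one whose curves are finite unions of segments and half-lines; it is written $\mathscr{S}=\cup_i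 S_i$ with $S_i$ its oriented segments/half-lines. Endpoints of the $S_i$ are vertices; a vertex that is not a multiple junction is simple. A polygonal network is admissible if each $S_i$ is parallel (in direction) to some facet of $B^\phi$ and the angle at each simple vertex is $120^\circ$. An admissible network is simple if its only multiple junctions are triple junctions at which the three segments/half-lines meet at $120^\circ$ angles. Cahn–Hoffman (CH) fields. A CH field on $\mathscr{S}$ is a family of vector fields, one for each curve of the network, with values in $\partial B^\phi$, Lipschitz along the curve, with $N\cdot\nu=\phi^o(\nu)$ a.e., and such that at each multiple junction $X$ the balance condition $\sum_j(-1)^{\sigma_j}N_{i_j}(X)=0$ holds, the sum being over the curve ends at $X$, with $\sigma_j=0$ if the curve is oriented from $X$ and $\sigma_j=1$ otherwise. A network admitting a CH field is $\phi$-regular. A minimal CH field of a polygonal admissible network is a minimizer, among CH fields $N$, of $\sum_i\int_{S_i}[\mathrm{div}_\tau N|_{S_i}]^2\phi^o(\nu_{S_i})\,d\mathcal{H}^1$, where $\mathrm{div}_\tau N$ is the derivative of $N$ along the curve scalarly multiplied by $\tau$. If every triple junction coincides near the junction with three half-lines (from one point) admitting a constant CH field on each half-line, minimal CH fields exist, and the $\phi$-curvature $\kappa^\phi_{S_i}:=\mathrm{div}_\tau N^0|_{S_i}$ ($N^0$ minimal) is a constant on each $S_i$ independent of the choice of $N^0$; it is $0$ on half-lines. This applies to simple networks. Parallel networks and heights. A polygonal network $\bar{\mathscr{S}}=\cup_i\bar S_i$ is parallel to $\mathscr{S}=\cup_iS_i$ (same index set) if each $\bar S_i$ is parallel to $S_i$;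 $\bar S_i$ is a segment if $S_i$ is; $\bar S_i$ is a half-line with $S_i\Delta\bar S_i$ bounded if $S_i$ is a half-line; and whenever $m\ge2$ of the $S_i$ share a common endpoint, so do the corresponding $\bar S_i$. For parallel $S,T$ lying on lines $L_S,L_T$, the distance vector $H(S,T)$ is the vector orthogonal to $L_S$ with $L_T=L_S+H(S,T)$. Flow. Given a $\phi$-regular admissible $\mathscr{S}^0=\cup_iS_i^0$ and $T\in(0,+\infty]$, a family $\{\mathscr{S}(t)\}_{t\in[0,T)}$, $\mathscr{S}(t)=\cup_iS_i(t)$, is a (regular) $\phi$-curvature flow starting from $\mathscr{S}^0$ if $\mathscr{S}(0)=\mathscr{S}^0$, each $\mathscr{S}(t)$ is parallel to $\mathscr{S}^0$, and the heights $h_i(t):=H(S_i^0,S_i(t))\cdot\nu_{S_i^0}$ belong to $C^1((0,T))\cap C^0([0,T))$ and satisfy $h_i'(t)=-\phi^o(\nu_{S_i(t)})\,\kappa^\phi_{S_i(t)}$ for $t\in(0,T)$ and all $i$. "Some segment vanishes as $t\nearrow T^\dag$" means that $\liminf_{t\nearrow T^\dag}\mathcal{H}^1(S_i(t))=0$ for some $i$ such that $S_i^0$ is a segment. *)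

theory Defs
  imports "HOL-Analysis.Analysis"
begin

section \<open>The hexagonal anisotropy\<close>

type_synonym plane = "real^2"

definition pt :: "real \<Rightarrow> real \<Rightarrow> plane"
  where "pt x y = vector [x, y]"

definition wulff :: "plane set"
  where "wulff = convex hull
    {pt (2 / sqrt 3) 0, pt (1 / sqrt 3) 1, pt (- 1 / sqrt 3) 1,
     pt (- 2 / sqrt 3) 0, pt (- 1 / sqrt 3) (- 1), pt (1 / sqrt 3) (- 1)}"

text \<open>The norm with closed unit ball \<^const>\<open>wulff\<close>, as the Minkowski gauge of that set.\<close>

definition phi :: "plane \<Rightarrow> real"
  where "phi x = Inf {r. 0 \<le> r \<and> x \<in> (*\<^sub>R) r ` wulff}"

definition phi_dual :: "plane \<Rightarrow> real"
  where "phi_dual \<xi> = (SUP \<eta>\<in>{\<eta>. phi \<eta> = 1}. \<xi> \<bullet> \<eta>)"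

definition rot90 :: "plane \<Rightarrow> plane"
  where "rot90 v = pt (- v $ 2) (v $ 1)"

definition vec_angle :: "plane \<Rightarrow> plane \<Rightarrow> real"
  where "vec_angle u v = arccos ((u \<bullet> v) / (norm u * norm v))"

section \<open>Oriented segments and half-lines\<close>

text \<open>
  \<open>Segment a b\<close> runs from \<open>a\<close> to \<open>b\<close>. The vector \<open>u\<close> is the unit tangent of a half-line:
  \<open>Outgoing a u\<close> starts at \<open>a\<close>, \<open>Incoming b u\<close> comes from infinity and stops at \<open>b\<close>.
\<close>

datatype piece = Segment plane plane | Outgoing plane plane | Incoming plane plane

fun valid_piece :: "piece \<Rightarrow> bool" where
  "valid_piece (Segment a b) \<longleftrightarrow> a \<noteq> b"
| "valid_piece (Outgoing a u) \<longleftrightarrow> norm u = 1"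
| "valid_piece (Incoming b u) \<longleftrightarrow> norm u = 1"

fun is_segment :: "piece \<Rightarrow> bool" where
  "is_segment (Segment a b) \<longleftrightarrow> True"
| "is_segment _ \<longleftrightarrow> False"

fun tangent :: "piece \<Rightarrow> plane" where
  "tangent (Segment a b) = sgn (b - a)"
| "tangent (Outgoing a u) = u"
| "tangent (Incoming b u) = u"

definition normal :: "piece \<Rightarrow> plane"
  where "normal P = rot90 (tangent P)"

fun tail :: "piece \<Rightarrow> plane option" where
  "tail (Segment a b) = Some a"
| "tail (Outgoing a u) = Some a"
| "tail (Incoming b u) = None"

fun head :: "piece \<Rightarrow> plane option" where
  "head (Segment a b) = Some b"
| "head (Outgoing a u) = None"
| "head (Incoming b u) = Some b"

definition endpoints :: "piece \<Rightarrow> plane set"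
  where "endpoints P = set_option (tail P) \<union> set_option (head P)"

text \<open>
  Arclength parametrization: a piece is the image of \<open>arc_domain\<close> under \<open>arc_point\<close>, and
  one-dimensional Hausdorff measure on it is the image of Lebesgue measure.
\<close>

fun arc_domain :: "piece \<Rightarrow> real set" where
  "arc_domain (Segment a b) = {0..dist a b}"
| "arc_domain (Outgoing a u) = {0..}"
| "arc_domain (Incoming b u) = {..0}"

fun arc_point :: "piece \<Rightarrow> real \<Rightarrow> plane" where
  "arc_point (Segment a b) s = a + s *\<^sub>R sgn (b - a)"
| "arc_point (Outgoing a u) s = a + s *\<^sub>R u"
| "arc_point (Incoming b u) s = b + s *\<^sub>R u"

definition points :: "piece \<Rightarrow> plane set"
  where "points P = arc_point P ` arc_domain P"

definition piece_length :: "piece \<Rightarrow> ennreal"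
  where "piece_length P = emeasure lborel (arc_domain P)"

text \<open>Direction in which \<open>P\<close> leaves its endpoint \<open>X\<close>.\<close>

definition dir_from :: "piece \<Rightarrow> plane \<Rightarrow> plane"
  where "dir_from P X = (if tail P = Some X then tangent P else - tangent P)"

definition parallel_pieces :: "piece \<Rightarrow> piece \<Rightarrow> bool"
  where "parallel_pieces P Q \<longleftrightarrow>
    affine_parallel (affine hull points P) (affine hull points Q) \<and> normal P = normal Q"

definition distance_vector :: "piece \<Rightarrow> piece \<Rightarrow> plane"
  where "distance_vector P Q =
    (THE H. H \<bullet> tangent P = 0 \<and> affine hull points Q = (+) H ` (affine hull points P))"

definition height :: "piece \<Rightarrow> piece \<Rightarrow> real"
  where "height P Q = distance_vector P Q \<bullet> normal P"

section \<open>Polygonal networks\<close>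

text \<open>
  Absolute continuity on every compact subinterval; on a half-open or open parameter interval
  this is the only reading that admits unbounded curves.
\<close>

definition abs_continuous_on :: "real set \<Rightarrow> (real \<Rightarrow> plane) \<Rightarrow> bool"
  where "abs_continuous_on I \<gamma> \<longleftrightarrow>
    (\<forall>a b. {a..b} \<subseteq> I \<longrightarrow>
      (\<forall>\<epsilon>>0. \<exists>\<delta>>0. \<forall>n (u :: nat \<Rightarrow> real) v.
        (\<forall>i<n. a \<le> u i \<and> u i \<le> v i \<and> v i \<le> b) \<and>
        (\<forall>i<n. \<forall>j<n. i \<noteq> j \<longrightarrow> {u i<..<v i} \<inter> {u j<..<v j} = {}) \<and>
        (\<Sum>i<n. v i - u i) < \<delta>
        \<longrightarrow> (\<Sum>i<n. dist (\<gamma> (u i)) (\<gamma> (v i))) < \<epsilon>))"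

definition curve :: "real set \<Rightarrow> (real \<Rightarrow> plane) \<Rightarrow> bool"
  where "curve I \<gamma> \<longleftrightarrow>
    I \<in> {{0..1}, {0..<1}, {0<..<1}} \<and> abs_continuous_on I \<gamma> \<and>
    inj_on \<gamma> {0<..<1} \<and> closed (\<gamma> ` I)"

text \<open>The curve runs through the pieces \<open>Ps\<close> one after the other, in their orientation.\<close>

definition traverses :: "real set \<Rightarrow> (real \<Rightarrow> plane) \<Rightarrow> piece list \<Rightarrow> bool"
  where "traverses I \<gamma> Ps \<longleftrightarrow> Ps \<noteq> [] \<and>
    (\<exists>s :: nat \<Rightarrow> real. s 0 = 0 \<and> s (length Ps) = 1 \<and>
      (\<forall>j<length Ps. s j < s (Suc j) \<and> valid_piece (Ps ! j) \<and>
        \<gamma> ` (I \<inter> {s j..s (Suc j)}) = points (Ps ! j) \<and>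
        (\<forall>x\<in>I \<inter> {s j..s (Suc j)}. \<forall>y\<in>I \<inter> {s j..s (Suc j)}.
          x < y \<longrightarrow> 0 < (\<gamma> y - \<gamma> x) \<bullet> tangent (Ps ! j))))"

text \<open>
  A polygonal network is given by the list of its oriented curves, each of them written as the
  list of its consecutive oriented pieces. Its pieces are indexed by pairs
  (curve, position on the curve).
\<close>

type_synonym network = "piece list list"

definition pieces :: "network \<Rightarrow> (nat \<times> nat) set"
  where "pieces S = {(k, j). k < length S \<and> j < length (S ! k)}"

definition piece_at :: "network \<Rightarrow> nat \<times> nat \<Rightarrow> piece"
  where "piece_at S i = S ! fst i ! snd i"

definition support :: "network \<Rightarrow> plane set"
  where "support S = (\<Union>i\<in>pieces S. points (piece_at S i))"

definition curve_start :: "piece list \<Rightarrow> plane option"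
  where "curve_start Ps = tail (hd Ps)"

definition curve_end :: "piece list \<Rightarrow> plane option"
  where "curve_end Ps = head (last Ps)"

definition curve_endpoints :: "piece list \<Rightarrow> plane set"
  where "curve_endpoints Ps = set_option (curve_start Ps) \<union> set_option (curve_end Ps)"

definition closed_curve :: "piece list \<Rightarrow> bool"
  where "closed_curve Ps \<longleftrightarrow> curve_start Ps \<noteq> None \<and> curve_start Ps = curve_end Ps"

text \<open>
  The relative interior of a curve is the image of \<open>(0,1)\<close>; closedness of the support is automatic.
\<close>

definition polygonal_network :: "network \<Rightarrow> bool"
  where "polygonal_network S \<longleftrightarrow>
    (\<exists>I \<gamma>. (\<forall>k<length S. curve (I k) (\<gamma> k) \<and> traverses (I k) (\<gamma> k) (S ! k)) \<and>
      (\<forall>k<length S. \<forall>l<length S. k \<noteq> l \<longrightarrow>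
        \<gamma> k ` {0<..<1} \<inter> \<gamma> l ` {0<..<1} = {})) \<and>
    (\<forall>k<length S. \<forall>X\<in>curve_endpoints (S ! k).
      (if closed_curve (S ! k) then 1 else 2)
        \<le> card {l. l < length S \<and> l \<noteq> k \<and> X \<in> curve_endpoints (S ! l)}) \<and>
    closed (support S) \<and> connected (support S)"

definition junctions :: "network \<Rightarrow> plane set"
  where "junctions S = (\<Union>k<length S. curve_endpoints (S ! k))"

definition junction_order :: "network \<Rightarrow> plane \<Rightarrow> nat"
  where "junction_order S X =
    card {k. k < length S \<and> curve_start (S ! k) = Some X} +
    card {k. k < length S \<and> curve_end (S ! k) = Some X}"

definition vertices :: "network \<Rightarrow> plane set"
  where "vertices S = (\<Union>i\<in>pieces S. endpoints (piece_at S i))"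

definition incident :: "network \<Rightarrow> plane \<Rightarrow> (nat \<times> nat) set"
  where "incident S X = {i \<in> pieces S. X \<in> endpoints (piece_at S i)}"

definition angles_120 :: "network \<Rightarrow> plane \<Rightarrow> bool"
  where "angles_120 S X \<longleftrightarrow>
    (\<forall>i\<in>incident S X. \<forall>j\<in>incident S X. i \<noteq> j \<longrightarrow>
      vec_angle (dir_from (piece_at S i) X) (dir_from (piece_at S j) X) = 2 * pi / 3)"

definition admissible :: "network \<Rightarrow> bool"
  where "admissible S \<longleftrightarrow> polygonal_network S \<and>
    (\<forall>i\<in>pieces S. \<exists>F. F facet_of wulff \<and>
      affine_parallel (affine hull points (piece_at S i)) (affine hull F)) \<and>
    (\<forall>X\<in>vertices S - junctions S. angles_120 S X)"

definition simple_network :: "network \<Rightarrow> bool"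
  where "simple_network S \<longleftrightarrow> admissible S \<and>
    (\<forall>X\<in>junctions S. junction_order S X = 3 \<and> card (incident S X) = 3 \<and> angles_120 S X)"

text \<open>
  Endpoints of corresponding pieces are matched through the orientation (tail to tail, head to
  head), and endpoints that coincide in \<open>S\<close> must coincide in \<open>S'\<close>. As coincidence is an
  equivalence relation, treating pairs of pieces covers any number of pieces with a common endpoint.
\<close>

definition parallel_network :: "network \<Rightarrow> network \<Rightarrow> bool"
  where "parallel_network S S' \<longleftrightarrow> polygonal_network S' \<and>
    length S' = length S \<and> (\<forall>k<length S. length (S' ! k) = length (S ! k)) \<and>
    (\<forall>i\<in>pieces S.
      parallel_pieces (piece_at S i) (piece_at S' i) \<and>
      (is_segment (piece_at S i) \<longrightarrow> is_segment (piece_at S' i)) \<and>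
      (\<not> is_segment (piece_at S i) \<longrightarrow> \<not> is_segment (piece_at S' i) \<and>
        bounded (sym_diff (points (piece_at S i)) (points (piece_at S' i))))) \<and>
    (\<forall>i\<in>pieces S. \<forall>j\<in>pieces S. \<forall>e\<in>{tail, head}. \<forall>f\<in>{tail, head}.
      e (piece_at S i) \<noteq> None \<and> e (piece_at S i) = f (piece_at S j) \<longrightarrow>
      e (piece_at S' i) = f (piece_at S' j))"

section \<open>Cahn--Hoffman fields and the crystalline curvature\<close>

text \<open>
  The balance condition is a sum over curve ends: a start at \<open>X\<close> counts with sign \<open>+\<close>, an end
  at \<open>X\<close> with sign \<open>-\<close>.

  \<open>N i\<close> is the field on piece \<open>i\<close>; only its values on that piece matter. Being Lipschitz along a
  polygonal curve means being Lipschitz on each of its finitely many pieces and taking the same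
  value on consecutive pieces at their common vertex.
\<close>

type_synonym field = "nat \<times> nat \<Rightarrow> plane \<Rightarrow> plane"

definition CH_field :: "network \<Rightarrow> field \<Rightarrow> bool"
  where "CH_field S N \<longleftrightarrow>
    (\<forall>i\<in>pieces S.
      N i ` points (piece_at S i) \<subseteq> frontier wulff \<and>
      (\<exists>C. C-lipschitz_on (points (piece_at S i)) (N i)) \<and>
      (AE s in lebesgue. s \<in> arc_domain (piece_at S i) \<longrightarrow>
        N i (arc_point (piece_at S i) s) \<bullet> normal (piece_at S i)
          = phi_dual (normal (piece_at S i)))) \<and>
    (\<forall>k j X. (k, Suc j) \<in> pieces S \<longrightarrow> head (piece_at S (k, j)) = Some X \<longrightarrow>
      N (k, j) X = N (k, Suc j) X) \<and>
    (\<forall>X\<in>junctions S.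
      (\<Sum>k | k < length S \<and> curve_start (S ! k) = Some X. N (k, 0) X) -
      (\<Sum>k | k < length S \<and> curve_end (S ! k) = Some X. N (k, length (S ! k) - 1) X) = 0)"

definition phi_regular :: "network \<Rightarrow> bool"
  where "phi_regular S \<longleftrightarrow> (\<exists>N. CH_field S N)"

definition tangential_div :: "network \<Rightarrow> field \<Rightarrow> nat \<times> nat \<Rightarrow> real \<Rightarrow> real"
  where "tangential_div S N i s =
    vector_derivative (\<lambda>r. N i (arc_point (piece_at S i) r)) (at s) \<bullet> tangent (piece_at S i)"

definition CH_energy :: "network \<Rightarrow> field \<Rightarrow> ennreal"
  where "CH_energy S N = (\<Sum>i\<in>pieces S.
    \<integral>\<^sup>+ s. ennreal ((tangential_div S N i s)\<^sup>2 * phi_dual (normal (piece_at S i)))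
      * indicator (arc_domain (piece_at S i)) s \<partial>lebesgue)"

definition minimal_CH_field :: "network \<Rightarrow> field \<Rightarrow> bool"
  where "minimal_CH_field S N \<longleftrightarrow>
    CH_field S N \<and> (\<forall>M. CH_field S M \<longrightarrow> CH_energy S N \<le> CH_energy S M)"

text \<open>
  Relational, so that a network on which the curvature is not well defined has no curvature
  rather than an arbitrary one.
\<close>

definition has_phi_curvature :: "network \<Rightarrow> nat \<times> nat \<Rightarrow> real \<Rightarrow> bool"
  where "has_phi_curvature S i \<kappa> \<longleftrightarrow>
    (\<exists>N. minimal_CH_field S N) \<and>
    (\<forall>N. minimal_CH_field S N \<longrightarrow>
      (AE s in lebesgue. s \<in> arc_domain (piece_at S i) \<longrightarrow> tangential_div S N i s = \<kappa>))"

section \<open>The flow\<close>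

text \<open>Only the values \<open>S t\<close> with \<open>0 \<le> t < T\<close> are constrained.\<close>

definition phi_curvature_flow :: "network \<Rightarrow> ereal \<Rightarrow> (real \<Rightarrow> network) \<Rightarrow> bool"
  where "phi_curvature_flow S0 T S \<longleftrightarrow>
    admissible S0 \<and> phi_regular S0 \<and> 0 < T \<and> S 0 = S0 \<and>
    (\<forall>t. 0 \<le> t \<and> ereal t < T \<longrightarrow> parallel_network S0 (S t)) \<and>
    (\<forall>i\<in>pieces S0. let h = (\<lambda>t. height (piece_at S0 i) (piece_at (S t) i)) in
      continuous_on {t. 0 \<le> t \<and> ereal t < T} h \<and>
      h C1_differentiable_on {t. 0 < t \<and> ereal t < T} \<and>
      (\<forall>t. 0 < t \<and> ereal t < T \<longrightarrow>
        (\<exists>\<kappa>. has_phi_curvature (S t) i \<kappa> \<and>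
          (h has_real_derivative - phi_dual (normal (piece_at (S t) i)) * \<kappa>) (at t))))"

definition some_segment_vanishes :: "network \<Rightarrow> real \<Rightarrow> (real \<Rightarrow> network) \<Rightarrow> bool"
  where "some_segment_vanishes S0 T S \<longleftrightarrow>
    (\<exists>i\<in>pieces S0. is_segment (piece_at S0 i) \<and>
      Liminf (at_left T) (\<lambda>t. piece_length (piece_at (S t) i)) = 0)"

end

theory Submission
  imports Defs "HOL-Analysis.Analysis"
begin

text \<open>
  A network parallel to \<open>S0\<close> is determined by the signed distances (heights) of its pieces from those of \<open>S0\<close>: two heights fix the position of a vertex, and at a triple junction the
  third height follows (\<open>parallel_network_heights\<close>). On a segment with tangent \<open>\<tau>\<close> and normal \<open>\<nu>\<close> a
  Cahn--Hoffman field has the form \<open>\<nu> + g \<tau>\<close> with \<open>\<bar>g\<bar> \<le> 1 / sqrt 3\<close>. For given values of \<open>g\<close> at the two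
  ends the energy is least when \<open>g\<close> is affine, so minimal fields solve a quadratic problem in finitely
  many unknowns over a convex set that does not depend on the network (\<open>phi_curvature_net\<close>). Two
  variational inequalities show that the curvatures are Lipschitz functions of the lengths as long as
  these are bounded from below (\<open>curv_lipschitz\<close>). The flow is therefore a system of ordinary
  differential equations for the heights. Its solutions respect the relation between the heights at a
  junction because the signed curvatures there add up to zero (\<open>curv_junction\<close>).

  A solution of this system is a flow only while it describes a network, and it could cease to do so
  without any length tending to zero, when pieces without a common vertex collide. The main point is
  that this never happens (\<open>embedded_at_end\<close>). In a first collision two parallel pieces come to
  overlap, or a vertex runs into the interior of a piece or into another vertex. All of these except
  two would already have produced an intersection a moment earlier. When two parallel
  pieces squeeze a strip of width \<open>y\<close>, the network is still embedded, and this forces on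
  either side of the strip the end of one of the pieces to be a simple vertex with edges bending away,
  at which the field has reached the end of its facet. Comparing the two affine fields at both sides yields \<open>y' \<ge> - C * y\<close>, so that
  \<open>y\<close> cannot reach zero in finite time. When two simple vertices with exactly opposite
  wedges meet, the same sign information says that both wedges recede, so that they would have had to
  cross before.

  Uniqueness and the description of the maximal time are then those of a Lipschitz system whose only
  singularities are vanishing lengths: as long as the lengths stay bounded from below, the equation
  with lengths truncated from below continues the solution (\<open>extension\<close>).

  The passage from the energy of a Lipschitz field to the values of \<open>g\<close> rests on Rademacher's theorem in
  dimension one, which is derived from the theorem of Radon and Nikodym.
\<close>

section \<open>Lipschitz functions of one variable\<close>

lemma bilipschitz_bij:
 fixes k :: "real => real"
 assumes c: "continuous_on UNIV k" and k: "!!x y. x <= y ==> y - x <= k y - k x"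
 shows "bij k" "strict_mono k"
proof -
 show sm: "strict_mono k"
 proof (rule strict_monoI)
  fix x y :: real assume "x < y"
  then show "k x < k y" using k[of x y] by simp
 qed
 have "\<exists>x. k x = y" for y
 proof -
  define r where "r = \<bar>y - k 0\<bar>"
  have "k (- r) <= y" "y <= k r" using k[of "-r" 0] k[of 0 r] by (auto simp: r_def)
  then show ?thesis using IVT'[of k "-r" y r] continuous_on_subset[OF c] by (auto simp: r_def)
 qed
 then show "bij k" using strict_mono_imp_inj_on[OF sm] by (metis bijI surjI)
qed

text \<open>After adding a linear function, \<open>g\<close> becomes a bi-Lipschitz homeomorphism. It maps
null sets to null sets, so the image of Lebesgue measure under its inverse has a density.\<close>
lemma lipschitz_density:
 fixes g :: "real => real"
 assumes L: "L-lipschitz_on UNIV g"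
 obtains f where "f \<in> borel_measurable borel" "!!a b. a <= b ==> (f has_integral g b - g a) {a..b}"
proof -
 have L0: "0 <= L" using L lipschitz_on_nonneg by blast
 define k where "k x = g x + (L + 1) * x" for x
 have ab: "\<bar>g y - g x\<bar> <= L * (y - x)" if "x <= y" for x y
  using lipschitz_onD[OF L, of y x] that by (simp add: dist_real_def)
 have kc: "continuous_on UNIV k" unfolding k_def using lipschitz_on_continuous_on[OF L] by (intro continuous_intros)
 have k1: "y - x <= k y - k x" "k y - k x <= (2 * L + 1) * (y - x)" if "x <= y" for x y
  using ab[OF that] by (simp_all add: k_def algebra_simps)
 note bij = bilipschitz_bij[OF kc k1(1)]
 define \<kappa> :: "real => real" where "\<kappa> = inv k"
 have vim: "\<kappa> -` A = k ` A" for A :: "real set" unfolding \<kappa>_def using bij(1) by (simp add: bij_vimage_eq_inv_image bij_imp_bij_inv inv_inv_eq)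
 have "mono \<kappa>" unfolding \<kappa>_def using bij by (simp add: mono_inv strict_mono_mono bij_is_surj bij_is_inj)
 then have \<kappa>m: "\<kappa> \<in> borel_measurable borel" by (rule borel_measurable_mono)
 define N where "N = distr lborel borel \<kappa>"
 have N: "emeasure N A = emeasure lborel (k ` A)" if "A \<in> sets borel" for A :: "real set"
  unfolding N_def using that \<kappa>m by (simp add: emeasure_distr vim)
 have "absolutely_continuous lborel N"
  unfolding absolutely_continuous_def
 proof
  fix A :: "real set" assume "A \<in> null_sets lborel"
  then have A: "A \<in> sets borel" "negligible A" by (auto simp: negligible_iff_null_sets null_sets_completionI)
  have "negligible (k ` A)"
  proof (rule negligible_locally_Lipschitz_image[OF _ A(2)])
   fix x
   have "norm (k y - k x) <= (2 * L + 1) * norm (y - x)" for y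
    using k1[of x y] k1[of y x] by (cases "x <= y") auto
   then show "\<exists>T B. open T \<and> x \<in> T \<and> (\<forall>y\<in>A \<inter> T. norm (k y - k x) <= B * norm (y - x))" by (intro exI[of _ UNIV]) auto
  qed simp
  moreover have "k ` A \<in> sets borel" unfolding vim[symmetric] using measurable_sets[OF \<kappa>m A(1)] by simp
  ultimately have "emeasure lborel (k ` A) = 0" by (simp add: negligible_iff_emeasure0)
  then show "A \<in> null_sets N" using N[OF A(1)] A(1) by (auto simp: null_sets_def N_def)
 qed
 then obtain F where F: "F \<in> borel_measurable lborel" "density lborel F = N"
  using sigma_finite_measure.Radon_Nikodym[OF sigma_finite_lborel, of N] by (auto simp: N_def)
 define f where "f x = enn2real (F x) - (L + 1)" for x
 have F': "((\<lambda>x. enn2real (F x)) has_integral k b - k a) {a..b}" if le: "a <= b" for a b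
 proof -
  have m: "k a <= k b" using k1(1)[OF le] le by simp
  have im: "k ` {a..b} = {k a..k b}"
  proof -
   have "\<exists>x\<in>{a..b}. k x = y" if "k a <= y" "y <= k b" for y
    using IVT'[of k a y b] that le continuous_on_subset[OF kc] by auto
   then show ?thesis using bij(2) by (auto simp: strict_mono_less_eq image_iff) metis
  qed
  have "(\<integral>\<^sup>+x. F x * indicator {a..b} x \<partial>lborel) = emeasure N {a..b}"
   using emeasure_density[OF F(1), of "{a..b}"] F(2) by simp
  also have "... = ennreal (k b - k a)" using m by (simp add: N im)
  finally have I: "(\<integral>\<^sup>+x. F x * indicator {a..b} x \<partial>lborel) = ennreal (k b - k a)" .
  have "AE x in lborel. F x * indicator {a..b} x ~= \<infinity>"
   using F(1) I by (intro nn_integral_PInf_AE) auto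
  then have "(\<integral>\<^sup>+x. ennreal (enn2real (F x) * indicator {a..b} x) \<partial>lborel) = ennreal (k b - k a)"
   unfolding I[symmetric] by (intro nn_integral_cong_AE) (auto simp: indicator_def less_top)
  then have "((\<lambda>x. enn2real (F x) * indicator {a..b} x) has_integral k b - k a) UNIV"
   by (rule nn_integral_has_integral[rotated 2]) (use F(1) m in simp_all)
  also have "(\<lambda>x. enn2real (F x) * indicator {a..b} x) = (\<lambda>x. if x \<in> {a..b} then enn2real (F x) else 0)" by (auto simp: indicator_def)
  finally show ?thesis by (simp only: has_integral_restrict_UNIV)
 qed
 show ?thesis
 proof (rule that[of f])
  show "f \<in> borel_measurable borel" unfolding f_def using F(1) by simp
  fix a b :: real assume le: "a <= b"
  have "((\<lambda>x. enn2real (F x) - (L + 1)) has_integral (k b - k a) - (b - a) * (L + 1)) {a..b}"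
   using has_integral_diff[OF F'[OF le] has_integral_const_real[of "L + 1" a b]] le by simp
  then show "(f has_integral g b - g a) {a..b}" unfolding f_def by (simp add: k_def algebra_simps)
 qed
qed

text \<open>Lebesgue's differentiation theorem is applied to the intervals \<open>{x..x + h}\<close>; the
other one-sided derivative follows by reflection in \<open>integral_derivative\<close>.\<close>
lemma right_derivative:
 fixes f g :: "real => real"
 assumes I: "!!a b. a <= b ==> (f has_integral g b - g a) {a..b}"
 shows "AE x in lebesgue. ((\<lambda>h. (g (x + h) - g x) / h) \<longlongrightarrow> f x) (at_right 0)"
proof -
 have "f integrable_on cbox a b" for a b using I[of a b] by (cases "a <= b") (auto simp: integrable_on_def)
 then obtain N where N: "negligible N" "!!x e. x \<notin> N ==> 0 < e ==>
   \<exists>d>0. \<forall>h. 0 < h \<and> h < d --> norm (integral (cbox x (x + h *\<^sub>R One)) f /\<^sub>R h ^ DIM(real) - f x) < e"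
  using integrable_ccontinuous_explicit by blast
 have "AE x in lebesgue. x \<notin> N" using N(1) by (metis AE_not_in negligible_iff_null_sets)
 then show ?thesis
 proof eventually_elim
  case (elim x)
  show ?case
  proof (rule tendstoI)
   fix e :: real assume "0 < e"
   then obtain d where d: "d > 0" "\<forall>h. 0 < h \<and> h < d --> norm (integral (cbox x (x + h *\<^sub>R One)) f /\<^sub>R h ^ DIM(real) - f x) < e"
    using N(2)[OF elim] by blast
   have "dist ((g (x + h) - g x) / h) (f x) < e" if h: "0 < h" "h < d" for h
    using d(2)[rule_format, of h] h integral_unique[OF I[of x "x + h"]] by (simp add: dist_real_def divide_inverse_commute)
   then show "\<forall>\<^sub>F h in at_right 0. dist ((g (x + h) - g x) / h) (f x) < e"
    unfolding eventually_at_right_field using d(1) by blast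
  qed
 qed
qed

lemma integral_derivative:
 fixes f g :: "real => real"
 assumes I: "!!a b. a <= b ==> (f has_integral g b - g a) {a..b}"
 shows "AE x in lebesgue. (g has_real_derivative f x) (at x)"
proof -
 have "((\<lambda>x. f (- x)) has_integral - g (- b) - - g (- a)) {a..b}" if "a <= b" for a b
  using I[of "-b" "-a"] that has_integral_reflect_real[of f _ "-a" "-b"] by (simp add: algebra_simps)
 then have "AE x in lebesgue. ((\<lambda>h. (- g (- (x + h)) - - g (- x)) / h) \<longlongrightarrow> f (- x)) (at_right 0)"
  by (rule right_derivative)
 then have "\<exists>N. negligible N \<and> (\<forall>x. x \<notin> N --> ((\<lambda>h. (- g (- (x + h)) - - g (- x)) / h) \<longlongrightarrow> f (- x)) (at_right 0))"
  unfolding eventually_ae_filter by (auto simp: negligible_iff_null_sets)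
 then obtain N where N: "negligible N" "!!x. x \<notin> N ==> ((\<lambda>h. (- g (- (x + h)) - - g (- x)) / h) \<longlongrightarrow> f (- x)) (at_right 0)" by blast
 have "negligible (uminus ` N)"
 proof (rule negligible_locally_Lipschitz_image[OF _ N(1)])
  show "\<exists>T B. open T \<and> x \<in> T \<and> (\<forall>y\<in>N \<inter> T. norm (- y - - x) <= B * norm (y - x))" for x
   by (intro exI[of _ UNIV] exI[of _ 1]) (simp add: abs_minus_commute)
 qed simp
 then have "AE x in lebesgue. x \<notin> uminus ` N" by (metis AE_not_in negligible_iff_null_sets)
 moreover have "AE x in lebesgue. ((\<lambda>h. (g (x + h) - g x) / h) \<longlongrightarrow> f x) (at_right 0)" by (rule right_derivative) (rule I)
 ultimately show ?thesis
 proof eventually_elim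
  case (elim x)
  have "- x \<notin> N" using elim(1) by force
  have "(- g (- (- x + h)) - - g (- (- x))) / h = (g (x + - h) - g x) / - h" for h
   by (cases "h = 0") (simp_all add: field_simps)
  with N(2)[OF \<open>- x \<notin> N\<close>] have "((\<lambda>h. (g (x + - h) - g x) / - h) \<longlongrightarrow> f x) (at_right 0)" by simp
  then have "((\<lambda>h. (g (x + h) - g x) / h) \<longlongrightarrow> f x) (at_left 0)" by (subst filterlim_at_left_to_right) simp
  then show ?case using elim(2) unfolding DERIV_def by (simp add: filterlim_at_split)
 qed
qed

text \<open>The inequality is \<open>0 \<le> \<integral> (g' - c)\<^sup>2\<close>, and equality forces
\<open>g' = c\<close>. The integrand \<open>D\<close> may be arbitrary where \<open>g\<close> is not
differentiable, like a derivative defined by choice.\<close>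
lemma lipschitz_energy:
 fixes g :: "real => real"
 assumes lip: "L-lipschitz_on {a..b} g" and ab: "a < b"
  and D: "!!s. a < s ==> s < b ==> g differentiable (at s) ==> D s = deriv g s"
 defines "c \<equiv> (g b - g a) / (b - a)"
 shows "ennreal (c\<^sup>2 * (b - a)) <= (\<integral>\<^sup>+s. ennreal ((D s)\<^sup>2) * indicator {a..b} s \<partial>lebesgue)" (is ?ge)
  and "(\<integral>\<^sup>+s. ennreal ((D s)\<^sup>2) * indicator {a..b} s \<partial>lebesgue) <= ennreal (c\<^sup>2 * (b - a)) ==>
   AE s in lebesgue. s \<in> {a..b} --> D s = c" (is "?le ==> ?AE")
proof -
 \<comment> \<open>extension by constants, so that the results for the whole line apply\<close>
 define G where "G x = g (max a (min b x))" for x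
 have G: "L-lipschitz_on UNIV G"
 proof (rule lipschitz_onI)
  fix x y
  have "dist (G x) (G y) <= L * dist (max a (min b x)) (max a (min b y))"
   unfolding G_def using ab by (intro lipschitz_onD[OF lip]) auto
  also have "... <= L * dist x y"
   using lipschitz_on_nonneg[OF lip] by (intro mult_left_mono) (auto simp: dist_real_def)
  finally show "dist (G x) (G y) <= L * dist x y" .
 qed (rule lipschitz_on_nonneg[OF lip])
 obtain f where f: "f \<in> borel_measurable borel" "!!a b. a <= b ==> (f has_integral G b - G a) {a..b}"
  using lipschitz_density[OF G] by blast
 have der: "AE x in lebesgue. (G has_real_derivative f x) (at x)" by (rule integral_derivative[OF f(2)])
 have fL: "\<bar>f x\<bar> <= L" if "(G has_real_derivative f x) (at x)" for x
 proof (rule tendsto_upperbound)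
  show "((\<lambda>h. \<bar>(G (x + h) - G x) / h\<bar>) \<longlongrightarrow> \<bar>f x\<bar>) (at 0)" using that unfolding DERIV_def by (rule tendsto_rabs)
  have "\<bar>(G (x + h) - G x) / h\<bar> <= L" if "h ~= 0" for h
   using lipschitz_onD[OF G, of "x + h" x] that by (simp add: dist_real_def divide_le_eq)
  then show "\<forall>\<^sub>F h in at 0. \<bar>(G (x + h) - G x) / h\<bar> <= L" by (simp add: eventually_at_filter)
 qed simp
 define E where "E x = (if \<bar>f x\<bar> <= L then f x else 0)" for x
 have fE: "AE x in lebesgue. E x = f x" using der by eventually_elim (simp add: E_def fL)
 note [measurable] = f(1)
 have Em: "E \<in> borel_measurable lebesgue" unfolding E_def by (intro measurable_completion) measurable
 have E: "E \<in> borel_measurable lebesgue" "!!x. \<bar>E x\<bar> <= L"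
  using Em lipschitz_on_nonneg[OF G] by (auto simp: E_def)
 have DE: "AE s in lebesgue. s \<in> {a..b} --> D s = E s"
 proof -
  have "AE s in lebesgue. s \<notin> {a, b}" by (intro AE_not_in) (simp add: negligible_iff_null_sets[symmetric])
  with der fE show ?thesis
  proof eventually_elim
   case (elim s)
   show ?case
   proof
    assume "s \<in> {a..b}"
    with elim have s: "a < s" "s < b" by auto
    have "(g has_real_derivative f s) (at s)"
     by (rule has_field_derivative_transform_within_open[OF elim(1), of "{a<..<b}"]) (use s in \<open>auto simp: G_def\<close>)
    then show "D s = E s" using D[OF s] elim(2) by (metis DERIV_imp_deriv real_differentiable_def)
   qed
  qed
 qed
 have eq: "(\<integral>\<^sup>+s. ennreal ((D s)\<^sup>2) * indicator {a..b} s \<partial>lebesgue) = (\<integral>\<^sup>+s. ennreal ((E s)\<^sup>2 * indicator {a..b} s) \<partial>lebesgue)"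
 proof (rule nn_integral_cong_AE)
  show "AE s in lebesgue. ennreal ((D s)\<^sup>2) * indicator {a..b} s = ennreal ((E s)\<^sup>2 * indicator {a..b} s)"
   using DE by eventually_elim (auto simp: indicator_def)
 qed
 have int: "integrable lebesgue (\<lambda>s. f s * indicator {a..b} s)" if "f \<in> borel_measurable lebesgue" "!!x. \<bar>f x\<bar> <= B" for f :: "real => real" and B
 proof (rule Bochner_Integration.integrable_bound)
  show "integrable lebesgue (\<lambda>x. B * indicator {a..b} x :: real)"
   by (intro integrable_mult_right integrable_real_indicator) (auto simp: emeasure_lborel_Icc_eq)
  show "AE x in lebesgue. norm (f x * indicator {a..b} x) <= norm (B * indicator {a..b} x)"
   using that(2) by (auto simp: indicator_def intro: order_trans[OF _ abs_ge_self])
  have I: "(indicator {a..b} :: real => real) \<in> borel_measurable lebesgue" by (intro borel_measurable_indicator) auto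
  show "(\<lambda>x. f x * indicator {a..b} x) \<in> borel_measurable lebesgue" by (intro borel_measurable_times that(1) I)
 qed
 have i1: "integrable lebesgue (\<lambda>s. E s * indicator {a..b} s)" using E by (intro int) auto
 have E3: "(LINT s|lebesgue. E s * indicator {a..b} s) = G b - G a"
 proof -
  have "(E has_integral G b - G a) {a..b}"
  proof (rule has_integral_spike[OF _ _ f(2)])
   show "negligible {x. E x ~= f x}"
    using fE unfolding eventually_ae_filter by (auto simp: negligible_iff_null_sets[symmetric] intro: negligible_subset)
  qed (use ab in auto)
  moreover have "((\<lambda>x. if x \<in> {a..b} then E x else 0) has_integral (LINT s|lebesgue. E s * indicator {a..b} s)) UNIV"
   using has_integral_integral_lebesgue[OF i1] by (rule has_integral_eq[rotated]) (simp add: indicator_def)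
  then have "(E has_integral (LINT s|lebesgue. E s * indicator {a..b} s)) {a..b}" by (simp only: has_integral_restrict_UNIV)
  ultimately show ?thesis by (metis has_integral_unique)
 qed
 have "\<bar>(E s)\<^sup>2\<bar> <= L\<^sup>2" for s
  using power_mono[OF E(2)[of s] abs_ge_zero, of 2] by simp
 then have i2: "integrable lebesgue (\<lambda>s. (E s)\<^sup>2 * indicator {a..b} s)" using E(1) by (intro int[where B="L\<^sup>2"]) auto
 have i3: "integrable lebesgue (\<lambda>s. indicator {a..b} s :: real)"
  by (intro integrable_real_indicator) (auto simp: emeasure_lborel_Icc_eq)
 define I where "I = (LINT s|lebesgue. (E s)\<^sup>2 * indicator {a..b} s)"
 have eqI: "(\<integral>\<^sup>+s. ennreal ((E s)\<^sup>2 * indicator {a..b} s) \<partial>lebesgue) = ennreal I"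
  unfolding I_def using i2 by (intro nn_integral_eq_integral) auto
 have gab: "G a = g a" "G b = g b" using ab by (auto simp: G_def)
 have expand: "(E s - c)\<^sup>2 * indicator {a..b} s = (E s)\<^sup>2 * indicator {a..b} s - 2 * c * (E s * indicator {a..b} s) + c\<^sup>2 * indicator {a..b} s" for s
  by (simp add: power2_diff algebra_simps)
 have i4: "integrable lebesgue (\<lambda>s. (E s - c)\<^sup>2 * indicator {a..b} s)"
  unfolding expand using i1 i2 i3 by auto
 have "(LINT s|lebesgue. (E s - c)\<^sup>2 * indicator {a..b} s) = I - 2 * c * (g b - g a) + c\<^sup>2 * (b - a)"
  unfolding expand using i1 i2 i3 E3 gab ab
  by (subst Bochner_Integration.integral_add integral_diff; simp add: I_def)+
 also have "... = I - c\<^sup>2 * (b - a)"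
 proof -
  have "g b - g a = c * (b - a)" using ab by (simp add: c_def)
  then show ?thesis by (simp add: power2_eq_square)
 qed
 finally have key: "(LINT s|lebesgue. (E s - c)\<^sup>2 * indicator {a..b} s) = I - c\<^sup>2 * (b - a)" .
 have "0 <= (LINT s|lebesgue. (E s - c)\<^sup>2 * indicator {a..b} s)" by (intro integral_nonneg_AE) auto
 then have "c\<^sup>2 * (b - a) <= I" using key by simp
 then show ?ge unfolding eq eqI by (rule ennreal_leI)
 assume ?le
 then have "I <= c\<^sup>2 * (b - a)" unfolding eq eqI using ab by (subst (asm) ennreal_le_iff) auto
 then have "(LINT s|lebesgue. (E s - c)\<^sup>2 * indicator {a..b} s) = 0"
  using key \<open>0 <= (LINT s|lebesgue. (E s - c)\<^sup>2 * indicator {a..b} s)\<close> by simp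
 then have "AE s in lebesgue. (E s - c)\<^sup>2 * indicator {a..b} s = 0"
  using i4 by (subst (asm) integral_nonneg_eq_0_iff_AE) auto
 with DE show ?AE by eventually_elim (auto simp: indicator_def)
qed

section \<open>Lipschitz systems of ordinary differential equations\<close>

text \<open>With the weight \<open>exp (- lam * t)\<close> the Picard operator contracts on the whole
half-line at once.\<close>
lemma ode_global_existence:
 fixes f :: "('i => real) => ('i => real)" and A :: "'i set"
 assumes A: "finite A"
  and lip: "!!u v i. i \<in> A ==> \<bar>f u i - f v i\<bar> <= C * (\<Sum>j\<in>A. \<bar>u j - v j\<bar>)" and C: "0 <= C"
  and bd: "!!u i. i \<in> A ==> \<bar>f u i\<bar> <= M" and M0: "0 <= M"
 shows "\<exists>u. (\<forall>i\<in>A. continuous_on {0..} (u i)) \<and> (\<forall>i\<in>A. u i 0 = 0) \<and>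
  (\<forall>i\<in>A. \<forall>t>0. (u i has_real_derivative f (\<lambda>j. u j t) i) (at t))"
proof -
 \<comment> \<open>one factor from the sum in the Lipschitz condition, one from the sum over the hat functions\<close>
 define K where "K = C * real (card A) * real (card A) + 1"
 have K: "1 <= K" "C * real (card A) * real (card A) <= K" using C by (auto simp: K_def)
 define lam where "lam = 2 * K"
 have lam: "0 < lam" using K by (simp add: lam_def)
 obtain e :: "'i => nat" where e: "inj_on e A" using finite_imp_inj_to_nat_seg[OF A] by blast
 have fcont: "continuous_on S (\<lambda>s. f (\<lambda>j. w j s) i)" if "!!j. continuous_on S (w j)" "i \<in> A" for S :: "real set" and w i
 proof (rule continuous_onI)
  fix x \<epsilon> assume x: "x \<in> S" and \<epsilon>: "0 < (\<epsilon>::real)"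
  have "continuous_on S (\<lambda>s. C * (\<Sum>j\<in>A. \<bar>w j s - w j x\<bar>))" using that by (intro continuous_intros) auto
  then obtain d where d: "0 < d" "!!s. s \<in> S ==> dist s x < d ==> dist (C * (\<Sum>j\<in>A. \<bar>w j s - w j x\<bar>)) (C * (\<Sum>j\<in>A. \<bar>w j x - w j x\<bar>)) < \<epsilon>"
   using x \<epsilon> unfolding continuous_on_iff by meson
  show "\<exists>d>0. \<forall>x'\<in>S. dist x' x < d --> dist (f (\<lambda>j. w j x') i) (f (\<lambda>j. w j x) i) <= \<epsilon>"
  proof (intro exI[of _ d] conjI ballI impI d(1))
   fix s assume s: "s \<in> S" "dist s x < d"
   have "dist (f (\<lambda>j. w j s) i) (f (\<lambda>j. w j x) i) <= C * (\<Sum>j\<in>A. \<bar>w j s - w j x\<bar>)"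
    unfolding dist_real_def by (rule lip[OF that(2)])
   also have "... <= \<epsilon>" using d(2)[OF s] by (simp add: dist_real_def)
   finally show "dist (f (\<lambda>j. w j s) i) (f (\<lambda>j. w j x) i) <= \<epsilon>" .
  qed
 qed
 \<comment> \<open>A family indexed by \<open>A\<close> is stored as one function of two real variables, by linear interpolation
   between the integer values of the first variable.\<close>
 define hat where "hat k x = max 0 (1 - \<bar>x - real k\<bar>)" for k :: nat and x
 have hat: "\<bar>hat k x\<bar> <= 1" "hat k (real l) = (if k = l then 1 else 0)" for k l x
 proof -
  show "\<bar>hat k x\<bar> <= 1" by (auto simp: hat_def max_def)
  have "1 <= \<bar>real l - real k\<bar>" if "k ~= l" using that by linarith
  then show "hat k (real l) = (if k = l then 1 else 0)" by (auto simp: hat_def)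
 qed
 define R where "R v j s = exp (lam * s) * apply_bcontfun v (real (e j), s)" for v :: "(real \<times> real) \<Rightarrow>\<^sub>C real" and j s
 have Rc: "continuous_on S (R v j)" for S v j
 proof -
  have "continuous_on UNIV (\<lambda>s. apply_bcontfun v (real (e j), s))"
   by (rule continuous_on_compose2[OF continuous_on_apply_bcontfun[of UNIV v]]) (auto intro!: continuous_intros)
  then have "continuous_on S (\<lambda>s. apply_bcontfun v (real (e j), s))" by (rule continuous_on_subset) simp
  then show ?thesis unfolding R_def[abs_def] by (intro continuous_intros)
 qed
 define J where "J v i t = integral {0..t} (\<lambda>s. f (\<lambda>j. R v j s) i)" for v i t
 define W where "W v i t = exp (- lam * max 0 t) * J v i (max 0 t)" for v i t
 define P where "P v = (\<lambda>(x, t). \<Sum>i\<in>A. hat (e i) x * W v i t)" for v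
 have fi: "(\<lambda>s. f (\<lambda>j. R v j s) i) integrable_on {a..b}" if "i \<in> A" for v i a b
  by (intro integrable_continuous_real fcont Rc that)
 have Jb: "\<bar>J v i t\<bar> <= M * t" if "0 <= t" "i \<in> A" for v i t
  using integral_bound[of 0 t "\<lambda>s. f (\<lambda>j. R v j s) i" M] that bd fcont[of "{0..t}" "R v" i] Rc unfolding J_def by auto
 have Wb: "\<bar>W v i t\<bar> <= M" if i: "i \<in> A" for v i t
 proof -
  define t' where "t' = max 0 t"
  have t': "0 <= t'" by (simp add: t'_def)
  have "\<bar>W v i t\<bar> = exp (- lam * t') * \<bar>J v i t'\<bar>" by (simp add: W_def t'_def abs_mult)
  also have "... <= exp (- lam * t') * (M * t')" using Jb[OF t' i] by (intro mult_left_mono) auto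
  also have "... <= M"
  proof -
   have "t' <= lam * t'" using t' K by (simp add: lam_def mult_le_cancel_right1)
   also have "... <= exp (lam * t')" using exp_ge_add_one_self[of "lam * t'"] by linarith
   finally have "M * t' <= M * exp (lam * t')" using M0 by (rule mult_left_mono)
   then have "exp (- lam * t') * (M * t') <= exp (- lam * t') * (M * exp (lam * t'))"
    by (rule mult_left_mono) simp
   also have "... = M" by (simp add: exp_minus)
   finally show ?thesis .
  qed
  finally show ?thesis .
 qed
 have Wc: "continuous_on UNIV (W v i)" if i: "i \<in> A" for v i
 proof -
  have "continuous_on {0..b} (J v i)" for b
   unfolding J_def[abs_def] by (rule indefinite_integral_continuous_1[OF fi[OF i]])
  then have "continuous_on {..<real n} (\<lambda>t. J v i (max 0 t))" for n
   by (rule continuous_on_compose2[where t = "{0..real n}"]) (auto intro!: continuous_intros)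
  then have "continuous_on (\<Union>n. {..<real n}) (\<lambda>t. J v i (max 0 t))"
   by (intro continuous_on_open_UN) auto
  moreover have "(\<Union>n. {..<real n}) = UNIV" using reals_Archimedean2 by auto
  ultimately have "continuous_on UNIV (\<lambda>t. J v i (max 0 t))" by simp
  then show ?thesis unfolding W_def[abs_def] by (intro continuous_intros)
 qed
 have Pb: "P v \<in> bcontfun" for v
 proof (rule bcontfun_normI)
  have "continuous_on UNIV (\<lambda>p. W v i (snd p))" if "i \<in> A" for i
   by (rule continuous_on_compose2[OF Wc[OF that]]) (auto intro!: continuous_intros)
  then show "continuous_on UNIV (P v)" unfolding P_def split_def hat_def by (intro continuous_intros) auto
  fix p :: "real \<times> real"
  have "norm (P v p) <= (\<Sum>i\<in>A. \<bar>hat (e i) (fst p) * W v i (snd p)\<bar>)" unfolding P_def split_def by (simp add: sum_abs)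
  also have "... <= (\<Sum>i\<in>A. 1 * M)"
   unfolding abs_mult using hat Wb by (intro sum_mono mult_mono) auto
  finally show "norm (P v p) <= (\<Sum>i\<in>A. 1 * M)" .
 qed
 define \<Phi> where "\<Phi> v = Bcontfun (P v)" for v
 have Phi: "apply_bcontfun (\<Phi> v) = P v" for v unfolding \<Phi>_def using Pb by (rule Bcontfun_inverse)
 have "dist (\<Phi> v) (\<Phi> w) <= (1/2) * dist v w" for v w
 proof (rule dist_bound)
  fix p :: "real \<times> real"
  obtain x t where x: "p = (x, t)" by (cases p) auto
  define t' where "t' = max 0 t"
  have t': "0 <= t'" by (simp add: t'_def)
  define B where "B = C * real (card A) * dist v w"
  have B0: "0 <= B" using C by (simp add: B_def)
  have WB: "\<bar>W v i t - W w i t\<bar> <= B / lam" if i: "i \<in> A" for i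
  proof -
   have fB: "\<bar>f (\<lambda>j. R v j s) i - f (\<lambda>j. R w j s) i\<bar> <= B * exp (lam * s)" for s
   proof -
    have "\<bar>f (\<lambda>j. R v j s) i - f (\<lambda>j. R w j s) i\<bar> <= C * (\<Sum>j\<in>A. \<bar>R v j s - R w j s\<bar>)" by (rule lip[OF i])
    also have "... <= C * (\<Sum>j\<in>A. exp (lam * s) * dist v w)"
    proof (intro mult_left_mono sum_mono C)
     fix j
     have "\<bar>R v j s - R w j s\<bar> = exp (lam * s) * dist (apply_bcontfun v (real (e j), s)) (apply_bcontfun w (real (e j), s))"
      by (simp add: R_def dist_real_def abs_mult flip: right_diff_distrib)
     also have "... <= exp (lam * s) * dist v w" by (intro mult_left_mono dist_bounded) auto
     finally show "\<bar>R v j s - R w j s\<bar> <= exp (lam * s) * dist v w" .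
    qed
    finally show ?thesis by (simp add: B_def algebra_simps)
   qed
   have hi: "((\<lambda>s. B * exp (lam * s)) has_integral (B * exp (lam * t') / lam - B * exp (lam * 0) / lam)) {0..t'}"
    using t' lam by (intro fundamental_theorem_of_calculus)
     (auto intro!: derivative_eq_intros simp flip: has_real_derivative_iff_has_vector_derivative)
   then have I2: "(\<lambda>s. B * exp (lam * s)) integrable_on {0..t'}" by (rule has_integral_integrable)
   have I1: "integral {0..t'} (\<lambda>s. B * exp (lam * s)) <= B * exp (lam * t') / lam"
    using integral_unique[OF hi] B0 lam by simp
   have "\<bar>J v i t' - J w i t'\<bar> = norm (integral {0..t'} (\<lambda>s. f (\<lambda>j. R v j s) i - f (\<lambda>j. R w j s) i))"
    unfolding J_def by (subst Henstock_Kurzweil_Integration.integral_diff[OF fi[OF i] fi[OF i]]) simp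
   also have "... <= integral {0..t'} (\<lambda>s. B * exp (lam * s))"
    using fB by (intro integral_norm_bound_integral integrable_diff fi i I2) auto
   also have "... <= B * exp (lam * t') / lam" by (rule I1)
   finally have le: "\<bar>J v i t' - J w i t'\<bar> <= B * exp (lam * t') / lam" .
   have "\<bar>W v i t - W w i t\<bar> = exp (- lam * t') * \<bar>J v i t' - J w i t'\<bar>"
    unfolding W_def by (simp add: t'_def abs_mult flip: right_diff_distrib)
   also have "... <= exp (- lam * t') * (B * exp (lam * t') / lam)" using le by (rule mult_left_mono) simp
   also have "... = B / lam" by (simp add: exp_minus)
   finally show ?thesis .
  qed
  have "dist (apply_bcontfun (\<Phi> v) p) (apply_bcontfun (\<Phi> w) p) = \<bar>\<Sum>i\<in>A. hat (e i) x * (W v i t - W w i t)\<bar>"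
   unfolding Phi x P_def dist_real_def by (simp add: right_diff_distrib sum_subtractf)
  also have "... <= (\<Sum>i\<in>A. \<bar>hat (e i) x\<bar> * \<bar>W v i t - W w i t\<bar>)" by (rule order_trans[OF sum_abs]) (simp add: abs_mult)
  also have "... <= (\<Sum>i\<in>A. 1 * (B / lam))" using hat WB B0 lam by (intro sum_mono mult_mono) auto
  also have "... <= (1/2) * dist v w"
  proof -
   have "C * real (card A) * real (card A) * dist v w <= K * dist v w" using K by (intro mult_right_mono) auto
   then show ?thesis using lam K by (simp add: B_def lam_def field_simps)
  qed
  finally show "dist (apply_bcontfun (\<Phi> v) p) (apply_bcontfun (\<Phi> w) p) <= (1/2) * dist v w" .
 qed
 then obtain v where v: "\<Phi> v = v" using banach_fix_type[of "1/2" \<Phi>] by auto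
 have RJ: "R v i t = J v i t" if t: "0 <= t" and i: "i \<in> A" for i t
 proof -
  have "apply_bcontfun v (real (e i), t) = P v (real (e i), t)" using Phi[of v] v by simp
  also have "... = (\<Sum>j\<in>A. if j = i then W v j t else 0)"
   unfolding P_def split_def using e i by (auto simp: hat inj_on_eq_iff intro!: sum.cong)
  also have "... = W v i t" using A i by simp
  finally show ?thesis using t by (simp add: R_def W_def exp_minus)
 qed
 have der: "(R v i has_real_derivative f (\<lambda>j. R v j t) i) (at t)" if t: "0 < t" and i: "i \<in> A" for i t
 proof -
  have "(J v i has_real_derivative f (\<lambda>j. R v j t) i) (at t within {0..t+1})"
   unfolding J_def[abs_def] using t by (intro integral_has_real_derivative fcont Rc i) auto
  moreover have "t \<in> interior {0..t+1}" using t by simp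
  ultimately have J: "(J v i has_real_derivative f (\<lambda>j. R v j t) i) (at t)" by (metis at_within_interior)
  have "eventually (\<lambda>s. R v i s = J v i s) (nhds t)"
   using t RJ[OF _ i] by (intro eventually_nhds_in_open[of "{0<..}", THEN eventually_mono]) auto
  then show ?thesis using J DERIV_cong_ev[OF refl _ refl] by blast
 qed
 show ?thesis
 proof (intro exI[of _ "R v"] conjI ballI allI impI)
  fix i assume i: "i \<in> A"
  show "continuous_on {0..} (R v i)" by (rule Rc)
  show "R v i 0 = 0" using RJ[of 0 i] i by (simp add: J_def)
  fix t :: real assume "0 < t"
  then show "(R v i has_real_derivative f (\<lambda>j. R v j t) i) (at t)" using der i by blast
 qed
qed

text \<open>Gronwall's argument for the sum of the squared differences.\<close>
lemma ode_uniqueness: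
 fixes f :: "('i => real) => ('i => real)" and A :: "'i set"
 assumes A: "finite A"
  and lip: "!!u v i. i \<in> A ==> \<bar>f u i - f v i\<bar> <= C * (\<Sum>j\<in>A. \<bar>u j - v j\<bar>)" and C: "0 <= C"
  and cu: "!!i. i \<in> A ==> continuous_on {a..b} (u i)" and cv: "!!i. i \<in> A ==> continuous_on {a..b} (v i)"
  and du: "!!i t. i \<in> A ==> a < t ==> t < b ==> (u i has_real_derivative f (\<lambda>j. u j t) i) (at t)"
  and dv: "!!i t. i \<in> A ==> a < t ==> t < b ==> (v i has_real_derivative f (\<lambda>j. v j t) i) (at t)"
  and eq: "!!i. i \<in> A ==> u i a = v i a"
  and t: "a <= t" "t <= b" and i: "i \<in> A"
 shows "u i t = v i t"
proof -
 define D where "D t = (\<Sum>i\<in>A. (u i t - v i t)\<^sup>2)" for t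
 define K where "K = 2 * C * real (card A)"
 define \<phi> where "\<phi> t = exp (- K * t) * D t" for t
 have sumsq: "(\<Sum>i\<in>A. \<bar>x i\<bar>)\<^sup>2 <= real (card A) * (\<Sum>i\<in>A. (x i)\<^sup>2)" for x :: "'i => real"
  using Cauchy_Schwarz_ineq_sum[of "\<lambda>_. 1" "\<lambda>i. \<bar>x i\<bar>" A] by simp
 have der: "\<exists>y. (\<phi> has_real_derivative y) (at t) \<and> y <= 0" if t: "a < t" "t < b" for t
 proof -
  let ?d = "\<Sum>i\<in>A. 2 * (u i t - v i t) * (f (\<lambda>j. u j t) i - f (\<lambda>j. v j t) i)"
  have "(D has_real_derivative ?d) (at t)"
   unfolding D_def[abs_def] using du[OF _ t] dv[OF _ t]
   by (auto intro!: derivative_eq_intros sum.cong simp: power2_eq_square)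
  then have "(\<phi> has_real_derivative exp (- K * t) * ?d - K * exp (- K * t) * D t) (at t)"
   unfolding \<phi>_def[abs_def] by (auto intro!: derivative_eq_intros)
  moreover have "exp (- K * t) * ?d - K * exp (- K * t) * D t <= 0"
  proof -
   have "?d <= (\<Sum>i\<in>A. 2 * \<bar>u i t - v i t\<bar> * (C * (\<Sum>j\<in>A. \<bar>u j t - v j t\<bar>)))"
   proof (rule sum_mono)
    fix i assume i: "i \<in> A"
    have "2 * (u i t - v i t) * (f (\<lambda>j. u j t) i - f (\<lambda>j. v j t) i) <= 2 * \<bar>u i t - v i t\<bar> * \<bar>f (\<lambda>j. u j t) i - f (\<lambda>j. v j t) i\<bar>"
     by (metis abs_ge_self abs_mult abs_numeral)
    also have "... <= 2 * \<bar>u i t - v i t\<bar> * (C * (\<Sum>j\<in>A. \<bar>u j t - v j t\<bar>))"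
     using lip[OF i] by (intro mult_left_mono) auto
    finally show "2 * (u i t - v i t) * (f (\<lambda>j. u j t) i - f (\<lambda>j. v j t) i) <= 2 * \<bar>u i t - v i t\<bar> * (C * (\<Sum>j\<in>A. \<bar>u j t - v j t\<bar>))" .
   qed
   also have "... = 2 * C * (\<Sum>j\<in>A. \<bar>u j t - v j t\<bar>)\<^sup>2"
    by (simp add: power2_eq_square sum_distrib_left sum_distrib_right algebra_simps)
   also have "... <= 2 * C * (real (card A) * D t)"
    unfolding D_def using sumsq C by (intro mult_left_mono) auto
   also have "... = K * D t" by (simp add: K_def)
   finally have "exp (- K * t) * ?d <= exp (- K * t) * (K * D t)" by (intro mult_left_mono) auto
   then show ?thesis by (simp add: algebra_simps)
  qed
  ultimately show ?thesis by blast
 qed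
 have "continuous_on {a..t} \<phi>"
  unfolding \<phi>_def[abs_def] D_def[abs_def] using t
  by (intro continuous_intros continuous_on_subset[OF cu] continuous_on_subset[OF cv]) auto
 then have "\<phi> t <= \<phi> a"
  using DERIV_nonpos_imp_decreasing_open[of a t \<phi>] t der by force
 moreover have "\<phi> a = 0" using eq by (simp add: \<phi>_def D_def)
 ultimately have "D t <= 0" by (simp add: \<phi>_def mult_le_0_iff)
 then have "D t = 0" unfolding D_def by (intro antisym sum_nonneg) auto
 then show ?thesis using A i unfolding D_def by (simp add: sum_nonneg_eq_0_iff)
qed

section \<open>The plane and the hexagon\<close>

lemma pt_nth [simp]: "pt x y $ 1 = x" "pt x y $ 2 = y"
 by (simp_all add: pt_def)

lemma pt_eq_iff [simp]: "pt a b = pt c d \<longleftrightarrow> a = c \<and> b = d"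
 by (metis pt_nth)

lemma plane_eq_iff: "x = y \<longleftrightarrow> x $ 1 = y $ 1 \<and> x $ 2 = (y :: plane) $ 2"
 by (simp add: vec_eq_iff forall_2)

lemma inner_plane: "x \<bullet> y = x $ 1 * y $ 1 + x $ 2 * (y :: plane) $ 2"
 by (simp add: inner_vec_def sum_2)

lemma rot90_nth [simp]: "rot90 x $ 1 = - x $ 2" "rot90 x $ 2 = x $ 1"
 by (simp_all add: rot90_def)

lemma rot90_add: "rot90 (x + y) = rot90 x + rot90 y"
 and rot90_diff: "rot90 (x - y) = rot90 x - rot90 y"
 and rot90_scaleR: "rot90 (c *\<^sub>R x) = c *\<^sub>R rot90 x"
 and rot90_minus: "rot90 (- x) = - rot90 x"
 and rot90_zero: "rot90 0 = 0"
 and rot90_rot90: "rot90 (rot90 x) = - x"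
 by (simp_all add: plane_eq_iff)

lemma pt_arith: "rot90 (pt a b) = pt (- b) a" "c *\<^sub>R pt a b = pt (c * a) (c * b)"
 "pt a b + pt a' b' = pt (a + a') (b + b')" "pt a b - pt a' b' = pt (a - a') (b - b')" "- pt a b = pt (- a) (- b)"
 by (simp_all add: plane_eq_iff)

lemmas rot90_simps = rot90_add rot90_diff rot90_scaleR rot90_minus rot90_zero rot90_rot90

lemma inner_rot90_self [simp]: "x \<bullet> rot90 x = 0" "rot90 x \<bullet> x = 0"
 and inner_rot90_rot90 [simp]: "rot90 x \<bullet> rot90 y = x \<bullet> y"
 and inner_rot90_left: "rot90 x \<bullet> y = - (x \<bullet> rot90 y)"
 by (simp_all add: inner_plane algebra_simps)

lemma norm_rot90 [simp]: "norm (rot90 x) = norm x"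
 by (simp add: norm_eq_sqrt_inner)

lemma rot90_inj [simp]: "rot90 x = rot90 y \<longleftrightarrow> x = y"
 by (auto simp: plane_eq_iff)

lemma norm_one_inner: "norm (e :: plane) = 1 \<longleftrightarrow> e \<bullet> e = 1"
 by (simp add: norm_eq_1)

lemma frame_decomp:
 fixes e :: plane
 assumes "norm e = 1"
 shows "x = (x \<bullet> e) *\<^sub>R e + (x \<bullet> rot90 e) *\<^sub>R rot90 e"
proof -
 have 1: "e$1 * e$1 + e$2 * e$2 = 1" using assms by (simp add: norm_one_inner inner_plane)
 have "(x \<bullet> e) * e$1 + (x \<bullet> rot90 e) * (- e$2) = x$1 * (e$1 * e$1 + e$2 * e$2)"
  "(x \<bullet> e) * e$2 + (x \<bullet> rot90 e) * e$1 = x$2 * (e$1 * e$1 + e$2 * e$2)"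
  by (simp_all add: inner_plane algebra_simps)
 then show ?thesis using 1 by (simp add: plane_eq_iff)
qed

lemma frame_eqI:
 fixes e :: plane
 assumes "norm e = 1" "x \<bullet> e = y \<bullet> e" "x \<bullet> rot90 e = y \<bullet> rot90 e"
 shows "x = y"
 using frame_decomp[OF assms(1), of x] frame_decomp[OF assms(1), of y] assms by simp

lemma frame_inner:
 fixes e :: plane
 assumes "norm e = 1"
 shows "x \<bullet> y = (x \<bullet> e) * (y \<bullet> e) + (x \<bullet> rot90 e) * (y \<bullet> rot90 e)"
proof -
 have "x \<bullet> y = ((x \<bullet> e) *\<^sub>R e + (x \<bullet> rot90 e) *\<^sub>R rot90 e) \<bullet> y"
  using frame_decomp[OF assms, of x] by simp
 then show ?thesis by (simp add: inner_add_left inner_commute[of y])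
qed

text \<open>The directions of the sides: the facet with normal \<open>rot90 e\<close> consists of the points
\<open>rot90 e + g *\<^sub>R e\<close> with \<open>\<bar>g\<bar> \<le> 1 / sqrt 3\<close>.\<close>
definition hexdir :: "plane set" where
 "hexdir = {pt 1 0, pt (1/2) (sqrt 3/2), pt (-1/2) (sqrt 3/2),
      pt (-1) 0, pt (-1/2) (- sqrt 3/2), pt (1/2) (- sqrt 3/2)}"

lemma hexdir_norm: "d \<in> hexdir ==> norm d = 1"
 by (auto simp: hexdir_def norm_one_inner inner_plane)

lemma hexdir_uminus: "d \<in> hexdir ==> - d \<in> hexdir"
 unfolding hexdir_def by (elim insertE emptyE; simp add: plane_eq_iff)

lemma hexdir_inner: "d \<in> hexdir ==> e \<in> hexdir ==> d \<bullet> e \<in> {1, -1, 1/2, -1/2}"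
 unfolding hexdir_def by (elim insertE emptyE; simp add: inner_plane)

lemma unit_inner_one:
 fixes d e :: plane
 assumes "norm d = 1" "norm e = 1"
 shows "d \<bullet> e = 1 \<longleftrightarrow> d = e" "d \<bullet> e = -1 \<longleftrightarrow> d = - e"
proof -
 have "(d - e) \<bullet> (d - e) = 2 - 2 * (d \<bullet> e)" "(d + e) \<bullet> (d + e) = 2 + 2 * (d \<bullet> e)"
  using assms by (simp_all add: norm_one_inner inner_diff inner_add inner_commute)
 moreover have "d = e \<longleftrightarrow> (d - e) \<bullet> (d - e) = 0" "d = - e \<longleftrightarrow> (d + e) \<bullet> (d + e) = 0"
  unfolding inner_eq_zero_iff by (simp_all add: eq_neg_iff_add_eq_0)
 ultimately show "d \<bullet> e = 1 \<longleftrightarrow> d = e" "d \<bullet> e = -1 \<longleftrightarrow> d = - e"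
  by linarith+
qed

lemma unit_inner_sq:
 fixes d e :: plane
 assumes "norm d = 1" "norm e = 1"
 shows "(d \<bullet> e)\<^sup>2 + (d \<bullet> rot90 e)\<^sup>2 = 1"
 using frame_inner[OF assms(2), of d d] assms by (simp add: norm_one_inner power2_eq_square)

lemma unit_inner_half:
 fixes d e :: plane
 assumes "norm d = 1" "norm e = 1" "\<bar>d \<bullet> e\<bar> = 1/2"
 shows "d \<bullet> rot90 e = sqrt 3 / 2 \<or> d \<bullet> rot90 e = - (sqrt 3 / 2)"
proof -
 have "(d \<bullet> e)\<^sup>2 = 1/4" using assms(3) by (metis one_power2 power2_abs power_divide four_x_squared mult_2 numeral_Bit0 power2_eq_square div_by_1 times_divide_eq_right divide_divide_eq_left nonzero_mult_div_cancel_left one_add_one power_one)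
 then have "(d \<bullet> rot90 e)\<^sup>2 = (sqrt 3 / 2)\<^sup>2" using unit_inner_sq[OF assms(1,2)] by (simp add: power_divide)
 then show ?thesis by (simp add: power2_eq_iff)
qed

lemma hexdir_cases:
 assumes d: "d \<in> hexdir" and e: "e \<in> hexdir"
 obtains (same) "d = e" | (opp) "d = - e"
 | (half) s c where "s = 1 \<or> s = -1" "c = 1 \<or> c = -1" "d = (c/2) *\<^sub>R e + (s * sqrt 3 / 2) *\<^sub>R rot90 e"
proof -
 have n: "norm d = 1" "norm e = 1" using d e hexdir_norm by auto
 consider "d \<bullet> e = 1" | "d \<bullet> e = -1" | "\<bar>d \<bullet> e\<bar> = 1/2" using hexdir_inner[OF d e] by auto
 then show thesis
 proof cases
  case 1 then show thesis using same unit_inner_one[OF n] by simp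
 next
  case 2 then show thesis using opp unit_inner_one[OF n] by simp
 next
  case 3
  define c where "c = 2 * (d \<bullet> e)"
  obtain s where s: "s = 1 \<or> s = -1" "d \<bullet> rot90 e = s * sqrt 3 / 2" using unit_inner_half[OF n 3]
   by (metis (no_types, opaque_lifting) minus_divide_left mult_1 mult_minus1)
  have "c = 1 \<or> c = -1" using 3 by (auto simp: c_def abs_if split: if_splits)
  moreover have "d = (c/2) *\<^sub>R e + (s * sqrt 3 / 2) *\<^sub>R rot90 e"
   using frame_decomp[OF n(2), of d] s(2) by (simp add: c_def)
  ultimately show thesis using half s(1) by blast
 qed
qed

subsection \<open>Facets of the Wulff shape\<close>

abbreviation wulff_vertices :: "plane set" where
 "wulff_vertices \<equiv> {pt (2 / sqrt 3) 0, pt (1 / sqrt 3) 1, pt (- 1 / sqrt 3) 1,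
  pt (- 2 / sqrt 3) 0, pt (- 1 / sqrt 3) (- 1), pt (1 / sqrt 3) (- 1)}"

lemma div_sqrt3: "x / sqrt 3 = x * sqrt 3 / 3"
 by (simp add: field_simps)

lemma wulff_convex: "convex wulff"
 unfolding wulff_def by (rule convex_convex_hull)

lemma wulff_closed: "closed wulff"
 unfolding wulff_def by (intro compact_imp_closed compact_convex_hull finite_imp_compact) simp

lemma wulff_halfplane:
 assumes e: "e \<in> hexdir" and x: "x \<in> wulff"
 shows "x \<bullet> rot90 e <= 1"
proof -
 have "wulff \<subseteq> {x. rot90 e \<bullet> x <= 1}"
  unfolding wulff_def
 proof (rule hull_minimal)
  show "wulff_vertices \<subseteq> {x. rot90 e \<bullet> x <= 1}"
   using e unfolding hexdir_def by (elim insertE emptyE; simp add: inner_plane field_simps)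
 qed (rule convex_halfspace_le)
 then show ?thesis using x by (auto simp: inner_commute)
qed

lemma facet_end_mem:
 assumes e: "e \<in> hexdir" and s: "s = 1 \<or> s = -1"
 shows "rot90 e + (s / sqrt 3) *\<^sub>R e \<in> wulff"
proof -
 have "rot90 e + (sqrt 3 / 3) *\<^sub>R e \<in> wulff_vertices" "rot90 e - (sqrt 3 / 3) *\<^sub>R e \<in> wulff_vertices"
  using e unfolding hexdir_def div_sqrt3 by (elim insertE emptyE; simp add: pt_arith)+
 then have "rot90 e + (s / sqrt 3) *\<^sub>R e \<in> wulff_vertices" using s by (auto simp: div_sqrt3)
 then show ?thesis unfolding wulff_def by (rule hull_inc)
qed

lemma facet_mem_wulff:
 assumes e: "e \<in> hexdir" and g: "\<bar>g\<bar> <= 1 / sqrt 3"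
 shows "rot90 e + g *\<^sub>R e \<in> wulff"
proof -
 define u where "u = (1 + g * sqrt 3) / 2"
 have "\<bar>g * sqrt 3\<bar> <= 1" using g by (simp add: abs_mult field_simps)
 then have u: "0 <= u" "0 <= 1 - u" by (auto simp: u_def)
 have "u *\<^sub>R (rot90 e + (1 / sqrt 3) *\<^sub>R e) + (1 - u) *\<^sub>R (rot90 e + (-1 / sqrt 3) *\<^sub>R e) \<in> wulff"
  using u by (intro convexD[OF wulff_convex] facet_end_mem e) auto
 moreover have "u *\<^sub>R (rot90 e + (1 / sqrt 3) *\<^sub>R e) + (1 - u) *\<^sub>R (rot90 e + (-1 / sqrt 3) *\<^sub>R e)
  = rot90 e + ((2 * u - 1) / sqrt 3) *\<^sub>R e"
  by (simp add: plane_eq_iff algebra_simps add_divide_distrib diff_divide_distrib)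
 moreover have "2 * u - 1 = g * sqrt 3" unfolding u_def by (simp add: field_simps)
 ultimately show ?thesis by simp
qed

lemma hexdir_rot60:
 assumes e: "e \<in> hexdir"
 shows "(1/2) *\<^sub>R e + (sqrt 3 / 2) *\<^sub>R rot90 e \<in> hexdir"
 using e unfolding hexdir_def by (elim insertE emptyE; simp add: pt_arith)

lemma hexdir_neighbours:
 assumes e: "e \<in> hexdir" and s: "s = 1 \<or> s = -1" and c: "c = 1 \<or> c = -1"
 shows "(c/2) *\<^sub>R e + (s * sqrt 3 / 2) *\<^sub>R rot90 e \<in> hexdir"
proof -
 let ?R = "\<lambda>e. (1/2) *\<^sub>R e + (sqrt 3 / 2) *\<^sub>R rot90 e"
 have eq: "(c/2) *\<^sub>R e + (s * sqrt 3 / 2) *\<^sub>R rot90 e = (if s = 1 then if c = 1 then ?R e else ?R (?R e)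
   else if c = 1 then - ?R (?R e) else - ?R e)"
  using s c by (elim disjE; simp add: plane_eq_iff algebra_simps)
 have 1: "?R e \<in> hexdir" using e by (rule hexdir_rot60)
 then have 2: "?R (?R e) \<in> hexdir" by (rule hexdir_rot60)
 show ?thesis unfolding eq
  using 1 2 hexdir_uminus[OF 1] hexdir_uminus[OF 2] by presburger
qed

text \<open>The two neighbouring sides bound the position on a side.\<close>
lemma facet_bound:
 assumes e: "e \<in> hexdir" and x: "x \<in> wulff" and x1: "x \<bullet> rot90 e = 1"
 shows "\<bar>x \<bullet> e\<bar> <= 1 / sqrt 3"
proof -
 have "x \<bullet> rot90 ((1/2) *\<^sub>R e + (s * sqrt 3 / 2) *\<^sub>R rot90 e) <= 1" if "s = 1 \<or> s = -1" for s
  using that by (intro wulff_halfplane[OF hexdir_neighbours[OF e that, of 1] x]) auto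
 from this[of 1] this[of "-1"] x1
 have "- (sqrt 3 * (x \<bullet> e)) <= 1" "sqrt 3 * (x \<bullet> e) <= 1"
  by (simp_all add: rot90_simps inner_add_right inner_diff_right)
 then have "\<bar>sqrt 3 * (x \<bullet> e)\<bar> <= 1" by linarith
 then show ?thesis by (simp add: abs_mult field_simps)
qed

lemma facet_frontier:
 assumes e: "e \<in> hexdir" and g: "\<bar>g\<bar> <= 1 / sqrt 3"
 shows "rot90 e + g *\<^sub>R e \<in> frontier wulff"
proof -
 let ?x = "rot90 e + g *\<^sub>R e"
 have n: "e \<bullet> e = 1" using hexdir_norm[OF e] by (simp add: norm_one_inner)
 have "?x \<notin> interior wulff"
 proof
  assume "?x \<in> interior wulff"
  then obtain r where r: "0 < r" "ball ?x r \<subseteq> wulff" by (meson mem_interior)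
  have "?x + (r/2) *\<^sub>R rot90 e \<in> ball ?x r" using r n by (simp add: dist_norm norm_rot90 hexdir_norm[OF e])
  then have "(?x + (r/2) *\<^sub>R rot90 e) \<bullet> rot90 e <= 1" using r wulff_halfplane[OF e] by blast
  then show False using r n by (simp add: inner_add_left)
 qed
 then show ?thesis using facet_mem_wulff[OF e g] by (simp add: frontier_def wulff_closed closure_closed)
qed

lemma facet_point_eq:
 assumes e: "e \<in> hexdir" and x: "x \<in> frontier wulff" and x1: "x \<bullet> rot90 e = 1"
 shows "x = rot90 e + (x \<bullet> e) *\<^sub>R e" "\<bar>x \<bullet> e\<bar> <= 1 / sqrt 3"
proof -
 show "x = rot90 e + (x \<bullet> e) *\<^sub>R e"
  using frame_decomp[OF hexdir_norm[OF e], of x] x1 by (simp add: add.commute)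
 have "x \<in> wulff" using x wulff_closed by (simp add: frontier_def)
 then show "\<bar>x \<bullet> e\<bar> <= 1 / sqrt 3" by (rule facet_bound[OF e _ x1])
qed

lemma wulff_absorbing: "\<exists>r\<ge>0. x \<in> (*\<^sub>R) r ` wulff"
proof (cases "x = 0")
 case True
 have "pt 1 0 \<in> hexdir" by (simp add: hexdir_def)
 from facet_mem_wulff[OF this, of 0] show ?thesis using True by (intro exI[of _ 0]) (auto simp: image_iff)
next
 case False
 define r where "r = \<bar>x$1\<bar> + \<bar>x$2\<bar>"
 have r: "0 < r" using False by (auto simp: r_def plane_eq_iff)
 have p: "pt s 0 \<in> wulff" "pt 0 s \<in> wulff" if s: "s = 1 \<or> s = -1" for s
 proof -
  have V: "v \<in> wulff_vertices ==> v \<in> wulff" for v unfolding wulff_def by (rule hull_inc)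
  have "pt s 0 = ((1 + sqrt 3/2)/2) *\<^sub>R pt (2 * s / sqrt 3) 0 + ((1 - sqrt 3/2)/2) *\<^sub>R pt (- 2 * s / sqrt 3) 0"
   by (simp add: plane_eq_iff field_simps)
  moreover have "... \<in> wulff"
   using s by (intro convexD[OF wulff_convex] V) (auto simp: field_simps real_le_lsqrt real_less_lsqrt intro: order_trans[of _ 2])
  ultimately show "pt s 0 \<in> wulff" by simp
  have "pt 0 s = (1/2) *\<^sub>R pt (1 / sqrt 3) s + (1/2) *\<^sub>R pt (- 1 / sqrt 3) s"
   by (simp add: plane_eq_iff field_simps)
  moreover have "... \<in> wulff"
   using s by (intro convexD[OF wulff_convex] V) (auto simp: field_simps)
  ultimately show "pt 0 s \<in> wulff" by simp
 qed
 define sg where "sg y = (if 0 <= y then 1 else -1 :: real)" for y :: real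
 have "(\<bar>x$1\<bar> / r) *\<^sub>R pt (sg (x$1)) 0 + (\<bar>x$2\<bar> / r) *\<^sub>R pt 0 (sg (x$2)) \<in> wulff"
  using r by (intro convexD[OF wulff_convex] p) (auto simp: sg_def r_def add_divide_distrib[symmetric])
 moreover have "x = r *\<^sub>R ((\<bar>x$1\<bar> / r) *\<^sub>R pt (sg (x$1)) 0 + (\<bar>x$2\<bar> / r) *\<^sub>R pt 0 (sg (x$2)))"
  using r by (auto simp: plane_eq_iff sg_def)
 ultimately show ?thesis using r by (intro exI[of _ r]) auto
qed

lemma phi_one_le:
 assumes e: "e \<in> hexdir" and \<eta>: "phi \<eta> = 1"
 shows "rot90 e \<bullet> \<eta> <= 1"
proof (rule field_le_epsilon)
 fix \<epsilon> :: real assume "0 < \<epsilon>"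
 have "\<exists>r. r \<in> {r. 0 <= r \<and> \<eta> \<in> (*\<^sub>R) r ` wulff}" using wulff_absorbing by auto
 then have "\<exists>r\<in>{r. 0 <= r \<and> \<eta> \<in> (*\<^sub>R) r ` wulff}. r < 1 + \<epsilon>"
  using \<eta> \<open>0 < \<epsilon>\<close> unfolding phi_def by (intro cInf_lessD) auto
 then obtain r w where r: "0 <= r" "w \<in> wulff" "\<eta> = r *\<^sub>R w" "r < 1 + \<epsilon>" by auto
 have "rot90 e \<bullet> \<eta> = r * (w \<bullet> rot90 e)" using r by (simp add: inner_commute)
 also have "... <= r * 1" using wulff_halfplane[OF e r(2)] r(1) by (intro mult_left_mono) auto
 finally show "rot90 e \<bullet> \<eta> <= 1 + \<epsilon>" using r by simp
qed

lemma phi_rot90: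
 assumes e: "e \<in> hexdir"
 shows "phi (rot90 e) = 1"
 unfolding phi_def
proof (rule cInf_eq_minimum)
 have n: "e \<bullet> e = 1" using hexdir_norm[OF e] by (simp add: norm_one_inner)
 show "1 \<in> {r. 0 <= r \<and> rot90 e \<in> (*\<^sub>R) r ` wulff}"
  using facet_mem_wulff[OF e, of 0] by (auto simp: image_iff)
 fix r assume "r \<in> {r. 0 <= r \<and> rot90 e \<in> (*\<^sub>R) r ` wulff}"
 then obtain w where r: "0 <= r" "w \<in> wulff" "rot90 e = r *\<^sub>R w" by auto
 have "1 = rot90 e \<bullet> rot90 e" using n by simp
 also have "... = r * (w \<bullet> rot90 e)" using r(3) by (metis inner_scaleR_left)
 also have "... <= r * 1" using wulff_halfplane[OF e r(2)] r(1) by (intro mult_left_mono) auto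
 finally show "1 <= r" by simp
qed

lemma phi_dual_rot90:
 assumes e: "e \<in> hexdir"
 shows "phi_dual (rot90 e) = 1"
 unfolding phi_dual_def
proof (rule cSup_eq_maximum)
 have "e \<bullet> e = 1" using hexdir_norm[OF e] by (simp add: norm_one_inner)
 then show "1 \<in> (\<lambda>\<eta>. rot90 e \<bullet> \<eta>) ` {\<eta>. phi \<eta> = 1}"
  using phi_rot90[OF e] by (intro image_eqI[of _ _ "rot90 e"]) auto
qed (use phi_one_le[OF e] in auto)

lemma wulff_vertices_conv: "wulff_vertices = (\<lambda>(p, q). pt (p / sqrt 3) q) ` {(2,0),(1,1),(-1,1),(-2,0),(-1,-1),(1,-1)}"
 by simp

text \<open>Vertices in coordinates scaled by \<open>sqrt 3\<close>: two of them that maximize the same linear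
form are neighbours, since for any other pair the six inequalities make the form vanish.\<close>
lemma hexagon_edge_index:
 fixes p q p' q' A B b :: real
 assumes "(p, q) \<in> {(2,0),(1,1),(-1,1),(-2,0),(-1,-1),(1,-1)}" "(p', q') \<in> {(2,0),(1,1),(-1,1),(-2,0),(-1,-1),(1,-1)}"
  "(p, q) ~= (p', q')" "A ~= 0 \<or> B ~= 0" "p * A + q * B = b" "p' * A + q' * B = b"
  "2 * A <= b" "A + B <= b" "B - A <= b" "- (2 * A) <= b" "- A - B <= b" "A - B <= b"
 shows "(p - p', q - q') \<in> {(1,-1),(2,0),(1,1),(-1,1),(-2,0),(-1,-1)}"
 using assms(1,2) by (elim insertE emptyE; use assms(3-) in simp; linarith?)

lemma wulff_edge_direction:
 assumes u: "u \<in> wulff_vertices" and v: "v \<in> wulff_vertices" and uv: "u ~= v"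
  and le: "!!w. w \<in> wulff_vertices ==> a \<bullet> w <= b" and eq: "a \<bullet> u = b" "a \<bullet> v = b" and a: "a ~= 0"
 shows "\<exists>d\<in>hexdir. \<exists>c. c ~= 0 \<and> u - v = c *\<^sub>R d"
proof -
 define A where "A = a$1 / sqrt 3"
 define B where "B = a$2"
 let ?L = "{(2,0),(1,1),(-1,1),(-2,0),(-1,-1),(1,-1)} :: (real \<times> real) set"
 have nz: "A ~= 0 \<or> B ~= 0" using a by (auto simp: A_def B_def plane_eq_iff)
 have ip: "a \<bullet> pt (p / sqrt 3) q = p * A + q * B" for p q by (simp add: inner_plane A_def B_def)
 have le': "p * A + q * B <= b" if "(p, q) \<in> ?L" for p q
 proof -
  have "pt (p / sqrt 3) q \<in> wulff_vertices" unfolding wulff_vertices_conv using that by (rule rev_image_eqI) simp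
  from le[OF this] show ?thesis by (simp only: ip)
 qed
 have ex: "\<exists>p q. (p, q) \<in> ?L \<and> w = pt (p / sqrt 3) q" if w: "w \<in> wulff_vertices" for w
 proof -
  from w show ?thesis unfolding wulff_vertices_conv image_iff
  proof (rule bexE)
   fix z assume "z \<in> ?L" "w = (\<lambda>(p, q). pt (p / sqrt 3) q) z"
   then show ?thesis by (intro exI[of _ "fst z"] exI[of _ "snd z"]) (simp only: case_prod_unfold prod.collapse)
  qed
 qed
 obtain p q where p: "(p, q) \<in> ?L" "u = pt (p / sqrt 3) q" using ex[OF u] by blast
 obtain p' q' where p': "(p', q') \<in> ?L" "v = pt (p' / sqrt 3) q'" using ex[OF v] by blast
 have ne: "(p, q) ~= (p', q')" using uv p p' by auto
 have eqs: "p * A + q * B = b" "p' * A + q' * B = b" using eq p p' ip by auto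
 have bounds: "2 * A <= b" "A + B <= b" "B - A <= b" "- (2 * A) <= b" "- A - B <= b" "A - B <= b"
  using le'[of 2 0] le'[of 1 1] le'[of "-1" 1] le'[of "-2" 0] le'[of "-1" "-1"] le'[of 1 "-1"] by simp_all
 have "(p - p', q - q') \<in> {(1,-1),(2,0),(1,1),(-1,1),(-2,0),(-1,-1)}"
  by (rule hexagon_edge_index[OF p(1) p'(1) ne nz eqs bounds])
 then have "(sqrt 3 / 2) *\<^sub>R (u - v) \<in> hexdir"
 proof -
  assume PQ: "(p - p', q - q') \<in> {(1,-1),(2,0),(1,1),(-1,1),(-2,0),(-1,-1)}"
  have "(sqrt 3 / 2) *\<^sub>R (u - v) = pt ((p - p') / 2) (sqrt 3 / 2 * (q - q'))"
   unfolding p(2) p'(2) pt_arith by (simp add: diff_divide_distrib[symmetric])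
  then show ?thesis using PQ unfolding hexdir_def by (elim insertE emptyE; simp)
 qed
 moreover have "u - v = (2 / sqrt 3) *\<^sub>R ((sqrt 3 / 2) *\<^sub>R (u - v))" by simp
 moreover have "2 / sqrt 3 ~= 0" by simp
 ultimately show ?thesis by blast
qed

text \<open>A facet is exposed, hence spanned by two vertices on a supporting line.\<close>
lemma facet_of_wulff_direction:
 assumes F: "F facet_of wulff"
 shows "\<exists>u\<in>F. \<exists>v\<in>F. \<exists>d\<in>hexdir. \<exists>c. c ~= 0 \<and> u - v = c *\<^sub>R d"
proof -
 have nc: "\<not> collinear wulff"
 proof
  assume "collinear wulff"
  then obtain w where w: "!!x y. x \<in> wulff ==> y \<in> wulff ==> \<exists>c. x - y = c *\<^sub>R w" unfolding collinear_def by blast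
  have V: "v \<in> wulff_vertices ==> v \<in> wulff" for v unfolding wulff_def by (rule hull_inc)
  obtain c where c: "pt (1 / sqrt 3) 1 - pt (- 1 / sqrt 3) 1 = c *\<^sub>R w" using w V by (metis insertCI)
  obtain c' where c': "pt (1 / sqrt 3) 1 - pt (2 / sqrt 3) 0 = c' *\<^sub>R w" using w V by (metis insertCI)
  show False using c c' by (auto simp: plane_eq_iff)
 qed
 then have ad: "2 <= aff_dim wulff" by (simp add: collinear_aff_dim)
 have face: "F face_of wulff" and adF: "aff_dim F = aff_dim wulff - 1" using F by (auto simp: facet_of_def)
 have poly: "polyhedron wulff" unfolding wulff_def by (intro polytope_imp_polyhedron polytope_convex_hull) auto
 have "F exposed_face_of wulff" using face exposed_face_of_polyhedron[OF poly] by simp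
 then obtain a b where ab: "wulff \<subseteq> {x. a \<bullet> x <= b}" "F = wulff \<inter> {x. a \<bullet> x = b}" by (auto simp: exposed_face_of_def)
 obtain s where s: "s \<subseteq> wulff_vertices" "F = convex hull s"
  using face_of_convex_hull_subset[of wulff_vertices F] face unfolding wulff_def by (auto simp: finite_imp_compact)
 have "\<not> aff_dim F <= 0" using ad adF by simp
 then obtain u v where uv: "u \<in> s" "v \<in> s" "u ~= v"
 proof -
  have "\<not> (\<exists>x. s \<subseteq> {x})"
  proof
   assume "\<exists>x. s \<subseteq> {x}"
   then obtain x where "s \<subseteq> {x}" by blast
   then have "F \<subseteq> {x}" unfolding s(2) by (metis convex_hull_singleton hull_mono)
   then have "aff_dim F <= aff_dim {x}" by (rule aff_dim_subset)
   then show False using \<open>\<not> aff_dim F <= 0\<close> by simp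
  qed
  then show ?thesis using that by blast
 qed
 then have uF: "u \<in> F" "v \<in> F" using s(2) hull_inc by fastforce+
 have "a ~= 0"
 proof
  assume "a = 0"
  then have "F = wulff" using ab uF by auto
  then show False using adF by simp
 qed
 moreover have "a \<bullet> w <= b" if "w \<in> wulff_vertices" for w
  using ab(1) that hull_inc[of w wulff_vertices convex] unfolding wulff_def by blast
 moreover have "a \<bullet> u = b" "a \<bullet> v = b" using uF ab(2) by auto
 ultimately show ?thesis using wulff_edge_direction[of u v a b] uv s(1) uF by blast
qed

section \<open>Pieces\<close>

lemma endpoints_simps [simp]: "endpoints (Segment a b) = {a, b}" "endpoints (Outgoing a u) = {a}" "endpoints (Incoming a u) = {a}"
 by (auto simp: endpoints_def)

lemma endpoints_iff: "X \<in> endpoints P \<longleftrightarrow> tail P = Some X \<or> head P = Some X"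
 by (auto simp: endpoints_def)

lemma finite_endpoints [simp]: "finite (endpoints P)" and endpoints_nonempty [simp]: "endpoints P ~= {}"
 by (cases P; simp)+

lemma tangent_norm: "valid_piece P ==> norm (tangent P) = 1"
 by (cases P) (auto simp: norm_sgn)

lemma normal_norm: "valid_piece P ==> norm (normal P) = 1"
 by (simp add: normal_def tangent_norm)

lemma segment_tangent: "a ~= b ==> (b - a :: plane) = dist a b *\<^sub>R sgn (b - a)"
 by (simp add: sgn_div_norm dist_norm norm_minus_commute)

lemma tail_neq_head: "valid_piece P ==> tail P = Some X ==> head P ~= Some X"
 by (cases P) auto

lemma dir_from_cases: "dir_from P X = tangent P \<or> dir_from P X = - tangent P"
 by (simp add: dir_from_def)

lemma dir_from_norm: "valid_piece P ==> norm (dir_from P X) = 1"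
 by (simp add: dir_from_def tangent_norm)

text \<open>This description treats segments and half-lines, and the two ends of a segment, alike. Together
with \<open>mem_move_iff\<close> it is the basis of all intersection arguments.\<close>
lemma mem_points_iff:
 assumes "valid_piece P"
 shows "p \<in> points P \<longleftrightarrow> (\<forall>X\<in>endpoints P. \<exists>s\<ge>0. p = X + s *\<^sub>R dir_from P X)"
proof (cases P)
 case (Segment a b)
 then have ab: "a ~= b" using assms by simp
 define t where "t = sgn (b - a)"
 define L where "L = dist a b"
 have t: "b = a + L *\<^sub>R t" using segment_tangent[OF ab] by (simp add: t_def L_def algebra_simps)
 have tn: "t ~= 0" using ab by (simp add: t_def sgn_zero_iff)
 have d: "dir_from P a = t" "dir_from P b = - t" using Segment ab by (auto simp: dir_from_def t_def)
 have pts: "points P = (\<lambda>s. a + s *\<^sub>R t) ` {0..L}" using Segment by (auto simp: points_def t_def L_def)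
 have E: "endpoints P = {a, b}" using Segment by simp
 have "p \<in> points P \<longleftrightarrow> (\<exists>s\<ge>0. p = a + s *\<^sub>R t) \<and> (\<exists>s\<ge>0. p = b + s *\<^sub>R (- t))"
 proof (intro iffI conjI)
  assume "p \<in> points P"
  then obtain s where s: "0 <= s" "s <= L" "p = a + s *\<^sub>R t" using pts by auto
  then show "\<exists>s\<ge>0. p = a + s *\<^sub>R t" by blast
  have "p = b + (L - s) *\<^sub>R (- t)" unfolding s(3) t by (simp add: algebra_simps)
  then show "\<exists>s\<ge>0. p = b + s *\<^sub>R (- t)" using s by (intro exI[of _ "L - s"]) auto
 next
  assume "(\<exists>s\<ge>0. p = a + s *\<^sub>R t) \<and> (\<exists>s\<ge>0. p = b + s *\<^sub>R (- t))"
  then obtain s r where s: "0 <= s" "p = a + s *\<^sub>R t" and r: "0 <= r" "p = b + r *\<^sub>R (- t)" by blast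
  have "a + s *\<^sub>R t = a + L *\<^sub>R t + r *\<^sub>R (- t)" using s(2) r(2) t by simp
  then have "s *\<^sub>R t = (L - r) *\<^sub>R t" by (simp add: algebra_simps)
  then have "s = L - r" using tn by simp
  then show "p \<in> points P" unfolding pts using s r by auto
 qed
 then show ?thesis unfolding E by (simp add: d)
next
 case (Outgoing a u)
 then show ?thesis by (auto simp: points_def dir_from_def image_iff)
next
 case (Incoming a u)
 have "(\<exists>s\<le>0. p = a + s *\<^sub>R u) \<longleftrightarrow> (\<exists>s\<ge>0. p = a - s *\<^sub>R u)"
 proof (intro iffI)
  assume "\<exists>s\<le>0. p = a + s *\<^sub>R u"
  then obtain s where "s <= 0" "p = a + s *\<^sub>R u" by blast
  then show "\<exists>s\<ge>0. p = a - s *\<^sub>R u" by (intro exI[of _ "- s"]) auto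
 next
  assume "\<exists>s\<ge>0. p = a - s *\<^sub>R u"
  then obtain s where "s \<ge> 0" "p = a - s *\<^sub>R u" by blast
  then show "\<exists>s\<le>0. p = a + s *\<^sub>R u" by (intro exI[of _ "- s"]) auto
 qed
 then show ?thesis using Incoming by (auto simp: points_def dir_from_def image_iff Bex_def)
qed

lemma endpoints_subset_points:
 assumes "valid_piece P"
 shows "endpoints P \<subseteq> points P"
proof (cases P)
 case (Segment a b)
 then have "a ~= b" using assms by simp
 then have "b = a + dist a b *\<^sub>R sgn (b - a)" using segment_tangent[of a b] by (simp add: algebra_simps)
 then show ?thesis using Segment by (auto simp: points_def image_iff intro: bexI[of _ "0::real"] bexI[of _ "dist a b"])
qed (auto simp: points_def image_iff intro: bexI[of _ "0::real"])

lemma points_tail_le: "valid_piece P ==> tail P = Some a ==> p \<in> points P ==> 0 <= (p - a) \<bullet> tangent P"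
 using tangent_norm[of P] by (cases P) (auto simp: points_def norm_one_inner)

lemma points_head_le: "valid_piece P ==> head P = Some b ==> p \<in> points P ==> 0 <= (b - p) \<bullet> tangent P"
proof (cases P)
 case (Segment a c)
 assume h: "valid_piece P" "head P = Some b" "p \<in> points P"
 then obtain s where s: "s <= dist a b" "p = a + s *\<^sub>R sgn (b - a)" "a ~= b" using Segment by (auto simp: points_def)
 have "b - p = (dist a b - s) *\<^sub>R sgn (b - a)"
  using segment_tangent[OF s(3)] s(2) by (simp add: algebra_simps)
 then show ?thesis using s Segment h tangent_norm[of P] by (auto simp: norm_one_inner)
qed (auto simp: points_def norm_one_inner mult_le_0_iff)

lemma points_no_tail: "tail P = None ==> p \<in> points P ==> p - tangent P \<in> points P"
proof (cases P)
 case (Incoming b u)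
 assume "p \<in> points P"
 then obtain s where "s <= 0" "p = b + s *\<^sub>R u" using Incoming by (auto simp: points_def)
 then have "p - u = b + (s - 1) *\<^sub>R u" "s - 1 <= 0" by (auto simp: algebra_simps)
 then show ?thesis using Incoming by (auto simp: points_def)
qed auto

lemma points_no_head: "head P = None ==> p \<in> points P ==> p + tangent P \<in> points P"
proof (cases P)
 case (Outgoing b u)
 assume "p \<in> points P"
 then obtain s where "s \<ge> 0" "p = b + s *\<^sub>R u" using Outgoing by (auto simp: points_def)
 then have "p + u = b + (s + 1) *\<^sub>R u" "s + 1 \<ge> 0" by (auto simp: algebra_simps)
 then show ?thesis using Outgoing by (auto simp: points_def)
qed auto

lemma near_endpoint_mem:
 assumes "valid_piece P" "X \<in> endpoints P"
 shows "\<exists>\<rho>>0. \<forall>r. 0 <= r \<and> r <= \<rho> --> X + r *\<^sub>R dir_from P X \<in> points P"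
proof (cases P)
 case (Segment a b)
 then have ab: "a ~= b" using assms by simp
 define t where "t = sgn (b - a)"
 have t: "b = a + dist a b *\<^sub>R t" using segment_tangent[OF ab] by (simp add: t_def algebra_simps)
 have "X + r *\<^sub>R dir_from P X \<in> points P" if r: "0 <= r" "r <= dist a b" for r
 proof (cases "X = a")
  case True
  then show ?thesis using r Segment by (auto simp: points_def dir_from_def)
 next
  case False
  then have X: "X = b" using assms Segment by auto
  have "b + r *\<^sub>R - t = a + dist a b *\<^sub>R t + r *\<^sub>R - t" using t by simp
  then have "b + r *\<^sub>R - t = a + (dist a b - r) *\<^sub>R t" by (simp add: algebra_simps)
  then show ?thesis using r Segment X ab unfolding points_def dir_from_def by (auto simp: t_def image_iff intro!: bexI[of _ "dist a b - r"])
 qed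
 then show ?thesis using ab by (intro exI[of _ "dist a b"]) auto
next
 case (Outgoing a u)
 then show ?thesis using assms by (intro exI[of _ 1]) (auto simp: points_def dir_from_def)
next
 case (Incoming b u)
 have "b - r *\<^sub>R u \<in> points P" if "0 <= r" for r
  using Incoming that by (auto simp: points_def image_iff intro!: bexI[of _ "- r"])
 then show ?thesis using assms Incoming by (intro exI[of _ 1]) (auto simp: dir_from_def)
qed

lemma near_interior_mem:
 assumes v: "valid_piece P" and p: "p \<in> points P" and n: "p \<notin> endpoints P"
 shows "\<exists>\<rho>>0. \<forall>r. \<bar>r\<bar> <= \<rho> --> p + r *\<^sub>R tangent P \<in> points P"
proof -
 have tn: "tangent P ~= 0" using tangent_norm[OF v] by auto
 have "\<exists>\<rho>>0. \<forall>r. \<bar>r\<bar> <= \<rho> --> (\<exists>s\<ge>0. p + r *\<^sub>R tangent P = X + s *\<^sub>R dir_from P X)" if X: "X \<in> endpoints P" for X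
 proof -
  obtain s where s: "0 <= s" "p = X + s *\<^sub>R dir_from P X" using p X mem_points_iff[OF v] by blast
  have "s ~= 0" using n X s by auto
  obtain c where c: "dir_from P X = c *\<^sub>R tangent P" "c = 1 \<or> c = -1" using dir_from_cases[of P X] by (metis scaleR_minus1_left scaleR_one)
  have "p + r *\<^sub>R tangent P = X + (s + c * r) *\<^sub>R dir_from P X" for r
   using s(2) c by (auto simp: algebra_simps)
  moreover have "0 <= s + c * r" if "\<bar>r\<bar> <= s" for r using c that by auto
  ultimately show ?thesis using s \<open>s ~= 0\<close> by (intro exI[of _ s]) auto
 qed
 then obtain \<rho> where \<rho>: "!!X. X \<in> endpoints P ==> 0 < \<rho> X \<and> (\<forall>r. \<bar>r\<bar> <= \<rho> X --> (\<exists>s\<ge>0. p + r *\<^sub>R tangent P = X + s *\<^sub>R dir_from P X))"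
  by metis
 define m where "m = Min (\<rho> ` endpoints P)"
 have "0 < m" unfolding m_def using \<rho> by (subst Min_gr_iff) auto
 moreover have "m <= \<rho> X" if "X \<in> endpoints P" for X unfolding m_def using that by (intro Min_le) auto
 ultimately show ?thesis unfolding mem_points_iff[OF v] using \<rho> by (intro exI[of _ m]) (meson order_trans)
qed

lemma affine_hull_points:
 assumes v: "valid_piece P" and X: "X \<in> endpoints P"
 shows "affine hull (points P) = range (\<lambda>s. X + s *\<^sub>R tangent P)"
proof
 have aff: "affine (range (\<lambda>s. X + s *\<^sub>R tangent P))"
 proof -
  have "range (\<lambda>s. X + s *\<^sub>R tangent P) = (+) X ` span {tangent P}"
   by (auto simp: span_singleton image_iff)
  then show ?thesis by (metis affine_translation subspace_imp_affine subspace_span)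
 qed
 have "points P \<subseteq> range (\<lambda>s. X + s *\<^sub>R tangent P)"
 proof
  fix p assume "p \<in> points P"
  then obtain s where "p = X + s *\<^sub>R dir_from P X" using mem_points_iff[OF v] X by blast
  then have "p = X + s *\<^sub>R tangent P \<or> p = X + (- s) *\<^sub>R tangent P" using dir_from_cases[of P X] by auto
  then show "p \<in> range (\<lambda>s. X + s *\<^sub>R tangent P)" by blast
 qed
 then show "affine hull (points P) \<subseteq> range (\<lambda>s. X + s *\<^sub>R tangent P)" using aff by (rule hull_minimal)
 show "range (\<lambda>s. X + s *\<^sub>R tangent P) \<subseteq> affine hull (points P)"
 proof
  fix p assume "p \<in> range (\<lambda>s. X + s *\<^sub>R tangent P)"
  then obtain s where s: "p = X + s *\<^sub>R tangent P" by blast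
  obtain \<rho> where \<rho>: "0 < \<rho>" "!!r. 0 <= r ==> r <= \<rho> ==> X + r *\<^sub>R dir_from P X \<in> points P"
   using near_endpoint_mem[OF v X] by blast
  obtain c where c: "dir_from P X = c *\<^sub>R tangent P" "c * c = 1" using dir_from_cases[of P X]
   by (metis minus_mult_minus mult_1 scaleR_minus1_left scaleR_one)
  let ?k = "s * c / \<rho>"
  have "p = (1 - ?k) *\<^sub>R X + ?k *\<^sub>R (X + \<rho> *\<^sub>R dir_from P X)"
  proof -
   have "(1 - ?k) *\<^sub>R X + ?k *\<^sub>R (X + \<rho> *\<^sub>R dir_from P X) = X + (?k * \<rho>) *\<^sub>R dir_from P X" by (simp add: algebra_simps)
   also have "... = X + (s * (c * c)) *\<^sub>R tangent P" using \<rho>(1) c(1) by simp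
   finally show ?thesis using c s by simp
  qed
  moreover have "X \<in> affine hull (points P)" using X endpoints_subset_points[OF v] hull_subset by fast
  moreover have "X + \<rho> *\<^sub>R dir_from P X \<in> affine hull (points P)" using \<rho> hull_inc by (metis order_refl less_imp_le)
  ultimately show "p \<in> affine hull (points P)"
   by (metis (no_types, lifting) affine_affine_hull affine_def diff_add_cancel)
 qed
qed

lemma facet_parallel_direction:
 assumes v: "valid_piece P" and F: "F facet_of wulff" and par: "affine_parallel (affine hull points P) (affine hull F)"
 shows "tangent P \<in> hexdir"
proof -
 obtain u v d c where uv: "u \<in> F" "v \<in> F" "d \<in> hexdir" "c ~= 0" "u - v = c *\<^sub>R d"
  using facet_of_wulff_direction[OF F] by blast
 obtain X where X: "X \<in> endpoints P" using endpoints_nonempty by blast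
 obtain a where a: "affine hull F = (+) a ` (affine hull points P)" using par by (auto simp: affine_parallel_def)
 have "u \<in> affine hull F" "v \<in> affine hull F" using uv hull_inc by fast+
 then obtain s r where "u = a + (X + s *\<^sub>R tangent P)" "v = a + (X + r *\<^sub>R tangent P)"
  unfolding a affine_hull_points[OF v X] by blast
 then have eq: "c *\<^sub>R d = (s - r) *\<^sub>R tangent P" using uv(5) by (simp add: algebra_simps)
 have "\<bar>c\<bar> = \<bar>s - r\<bar>" using arg_cong[OF eq, of norm] tangent_norm[OF v] hexdir_norm[OF uv(3)] by simp
 then have "s - r = c \<or> s - r = - c" by linarith
 then have "d = tangent P \<or> d = - tangent P"
 proof
  assume "s - r = c" then show ?thesis using eq uv(4) by simp
 next
  assume "s - r = - c"
  then have "c *\<^sub>R d = c *\<^sub>R (- tangent P)" using eq by simp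
  then show ?thesis using uv(4) by (metis scaleR_cancel_left)
 qed
 then show ?thesis using uv(3) hexdir_uminus by fastforce
qed

lemma vec_angle_120:
 assumes "norm u = 1" "norm v = 1" "vec_angle u v = 2 * pi / 3"
 shows "u \<bullet> v = - 1 / 2"
proof -
 have "\<bar>u \<bullet> v\<bar> <= 1" using Cauchy_Schwarz_ineq2[of u v] assms by simp
 then have "cos (arccos (u \<bullet> v)) = u \<bullet> v" by (intro cos_arccos) auto
 moreover have "arccos (u \<bullet> v) = 2 * pi / 3" using assms by (simp add: vec_angle_def)
 ultimately show ?thesis using cos_120 by simp
qed

lemma three_at_120:
 fixes a b c :: plane
 assumes "norm a = 1" "norm b = 1" "norm c = 1" "a \<bullet> b = -1/2" "a \<bullet> c = -1/2" "b \<bullet> c = -1/2"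
 shows "a + b + c = 0"
proof -
 have "(a + b + c) \<bullet> (a + b + c) = 0"
  using assms by (simp add: norm_one_inner inner_add inner_commute)
 then show ?thesis by simp
qed

section \<open>Structure of a simple network\<close>

lemma piece_at_pair [simp]: "piece_at S (k, j) = S ! k ! j"
 by (simp add: piece_at_def)

lemma finite_pieces [simp]: "finite (pieces S)"
proof -
 have "pieces S = (SIGMA k:{..<length S}. {..<length (S ! k)})" by (auto simp: pieces_def)
 then show ?thesis by simp
qed

lemma finite_incident [simp]: "finite (incident S X)"
 by (simp add: incident_def)

lemma finite_vertices [simp]: "finite (vertices S)"
 by (simp add: vertices_def)

lemma extreme_endpoint:
 fixes \<gamma> :: "real => plane" and s :: real
 assumes im: "\<gamma> ` J = M" and e: "norm e = 1" and low: "!!x. x \<in> J ==> s * c <= s * x"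
  and inc: "!!x y. x \<in> J ==> y \<in> J ==> s * x < s * y ==> 0 < (\<gamma> y - \<gamma> x) \<bullet> e"
  and dense: "!!y. y \<in> J ==> s * c < s * y ==> \<exists>z\<in>J. s * z < s * y" and s: "s ~= 0"
  and some: "!!a. E = Some a ==> a \<in> M \<and> (\<forall>p\<in>M. 0 <= (p - a) \<bullet> e)" and none: "E = None ==> \<forall>p\<in>M. p - e \<in> M"
 shows "E = (if c \<in> J then Some (\<gamma> c) else None)"
proof (cases E)
 case None
 have "c \<notin> J"
 proof
  assume c: "c \<in> J"
  then obtain y where y: "y \<in> J" "\<gamma> y = \<gamma> c - e" using none[OF None] im by (metis imageE imageI)
  have "0 <= (\<gamma> y - \<gamma> c) \<bullet> e" using inc[OF c y(1)] low[OF y(1)] s by (cases "y = c") (auto simp: less_le)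
  then show False using y(2) e by (simp add: norm_one_inner)
 qed
 then show ?thesis using None by simp
next
 case (Some a)
 then obtain y where y: "y \<in> J" "\<gamma> y = a" and a: "!!x. x \<in> J ==> 0 <= (\<gamma> x - \<gamma> y) \<bullet> e" using some[OF Some] im by auto
 have "y = c"
 proof (rule ccontr)
  assume "y ~= c"
  then have "s * c < s * y" using low[OF y(1)] s by (auto simp: less_le)
  then obtain z where z: "z \<in> J" "s * z < s * y" using dense[OF y(1)] by blast
  show False using inc[OF z(1) y(1) z(2)] a[OF z(1)] by (simp add: inner_diff_left)
 qed
 then show ?thesis using Some y by simp
qed

text \<open>A parametrization that advances strictly along the tangent visits the tail of a piece first and
its head last; hence the endpoints are exactly the values at those breakpoints that belong to
\<open>I\<close>.\<close>
lemma traverses_partition: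
 assumes t: "traverses I \<gamma> Ps" and I: "I \<in> {{0..1}, {0..<1}, {0<..<1}}"
 obtains s where "s 0 = 0" "s (length Ps) = 1" "!!j. j < length Ps ==> s j < s (Suc j)"
  "!!j. j < length Ps ==> valid_piece (Ps ! j)"
  "!!j. j < length Ps ==> \<gamma> ` (I \<inter> {s j..s (Suc j)}) = points (Ps ! j)"
  "!!j. j < length Ps ==> tail (Ps ! j) = (if s j \<in> I then Some (\<gamma> (s j)) else None)"
  "!!j. j < length Ps ==> head (Ps ! j) = (if s (Suc j) \<in> I then Some (\<gamma> (s (Suc j))) else None)"
  "!!i j. i < j ==> j <= length Ps ==> s i < s j"
  "!!j. j < length Ps ==> inj_on \<gamma> (I \<inter> {s j..s (Suc j)})"
proof -
 obtain s :: "nat => real" where s: "s 0 = 0" "s (length Ps) = 1"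
  and sj: "!!j. j < length Ps ==> s j < s (Suc j) \<and> valid_piece (Ps ! j) \<and>
    \<gamma> ` (I \<inter> {s j..s (Suc j)}) = points (Ps ! j) \<and>
    (\<forall>x\<in>I \<inter> {s j..s (Suc j)}. \<forall>y\<in>I \<inter> {s j..s (Suc j)}.
     x < y --> 0 < (\<gamma> y - \<gamma> x) \<bullet> tangent (Ps ! j))"
  using t unfolding traverses_def by blast
 have mono: "s i < s j" if "i < j" "j <= length Ps" for i j
  using that
 proof (induction j)
  case (Suc j)
  then have "s j < s (Suc j)" using sj by simp
  then show ?case using Suc by (cases "i = j") auto
 qed simp
 have nonneg: "0 <= s j" "s j <= 1" if "j <= length Ps" for j
  using mono[of 0 j] mono[of j "length Ps"] s that by (cases "j = 0"; cases "j = length Ps"; force)+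
 have sub: "{0<..<1} \<subseteq> I" "I \<subseteq> {0..1}" using I by auto
 have near: "\<exists>z\<in>I \<inter> {s j..s (Suc j)}. x < z \<and> z < y" if "j < length Ps" "s j <= x" "x < y" "y <= s (Suc j)" for j x y
 proof -
  have "(x + y) / 2 \<in> {0<..<1}" using that nonneg[of j] nonneg[of "Suc j"] by auto
  then show ?thesis using sub that by (intro bexI[of _ "(x + y) / 2"]) auto
 qed
 have tl: "tail (Ps ! j) = (if s j \<in> I then Some (\<gamma> (s j)) else None)" if j: "j < length Ps" for j
 proof -
  note S = sj[OF j]
  have v: "valid_piece (Ps ! j)" and im: "\<gamma> ` (I \<inter> {s j..s (Suc j)}) = points (Ps ! j)" using S by auto
  have "tail (Ps ! j) = (if s j \<in> I \<inter> {s j..s (Suc j)} then Some (\<gamma> (s j)) else None)"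
  proof (rule extreme_endpoint[where s = 1 and e = "tangent (Ps ! j)" and M = "points (Ps ! j)"])
   show "\<exists>z\<in>I \<inter> {s j..s (Suc j)}. 1 * z < 1 * y" if "y \<in> I \<inter> {s j..s (Suc j)}" "1 * s j < 1 * y" for y
    using near[OF j order_refl, of y] that by auto
   show "a \<in> points (Ps ! j) \<and> (\<forall>p\<in>points (Ps ! j). 0 <= (p - a) \<bullet> tangent (Ps ! j))" if "tail (Ps ! j) = Some a" for a
    using that points_tail_le[OF v] endpoints_subset_points[OF v] by (auto simp: endpoints_iff)
   show "\<forall>p\<in>points (Ps ! j). p - tangent (Ps ! j) \<in> points (Ps ! j)" if "tail (Ps ! j) = None" using points_no_tail that by blast
  qed (use S im tangent_norm[OF v] in auto)
  then show ?thesis using S by auto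
 qed
 have hd: "head (Ps ! j) = (if s (Suc j) \<in> I then Some (\<gamma> (s (Suc j))) else None)" if j: "j < length Ps" for j
 proof -
  note S = sj[OF j]
  have v: "valid_piece (Ps ! j)" and im: "\<gamma> ` (I \<inter> {s j..s (Suc j)}) = points (Ps ! j)" using S by auto
  have "head (Ps ! j) = (if s (Suc j) \<in> I \<inter> {s j..s (Suc j)} then Some (\<gamma> (s (Suc j))) else None)"
  proof (rule extreme_endpoint[where s = "-1" and e = "- tangent (Ps ! j)" and M = "points (Ps ! j)"])
   show "\<exists>z\<in>I \<inter> {s j..s (Suc j)}. -1 * z < -1 * y" if "y \<in> I \<inter> {s j..s (Suc j)}" "-1 * s (Suc j) < -1 * y" for y
    using near[OF j _ _ order_refl, of y] that by auto
   show "a \<in> points (Ps ! j) \<and> (\<forall>p\<in>points (Ps ! j). 0 <= (p - a) \<bullet> - tangent (Ps ! j))" if "head (Ps ! j) = Some a" for a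
    using that points_head_le[OF v] endpoints_subset_points[OF v] by (auto simp: endpoints_iff inner_diff_left)
   show "\<forall>p\<in>points (Ps ! j). p - - tangent (Ps ! j) \<in> points (Ps ! j)" if "head (Ps ! j) = None" using points_no_head that by simp
   show "0 < (\<gamma> y - \<gamma> x) \<bullet> - tangent (Ps ! j)" if "x \<in> I \<inter> {s j..s (Suc j)}" "y \<in> I \<inter> {s j..s (Suc j)}" "-1 * x < -1 * y" for x y
   proof -
    have "0 < (\<gamma> x - \<gamma> y) \<bullet> tangent (Ps ! j)" using S that by auto
    then show ?thesis by (simp add: inner_diff_left)
   qed
  qed (use S im tangent_norm[OF v] in auto)
  then show ?thesis using S by auto
 qed
 have inj: "inj_on \<gamma> (I \<inter> {s j..s (Suc j)})" if j: "j < length Ps" for j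
 proof (rule linorder_inj_onI')
  fix x y assume "x \<in> I \<inter> {s j..s (Suc j)}" "y \<in> I \<inter> {s j..s (Suc j)}" "x < y"
  then have "0 < (\<gamma> y - \<gamma> x) \<bullet> tangent (Ps ! j)" using sj[OF j] by blast
  then show "\<gamma> x ~= \<gamma> y" by auto
 qed
 show thesis
  using that[of s, OF s] sj tl hd mono inj by blast
qed

text \<open>The initial network is fixed from here on; all networks of a flow consist of translated and
stretched copies of its pieces.\<close>
locale simple_net =
 fixes S0 :: network
 assumes simple: "simple_network S0"
begin

abbreviation "Ix \<equiv> pieces S0"
abbreviation "P \<equiv> piece_at S0"
abbreviation "Vx \<equiv> vertices S0"
abbreviation "inc \<equiv> incident S0"
abbreviation "d i \<equiv> dir_from (P i)"
abbreviation "ends i \<equiv> endpoints (P i)"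
abbreviation "\<tau> i \<equiv> tangent (P i)"
abbreviation "\<nu> i \<equiv> normal (P i)"

definition parametrization :: "(nat => real set) => (nat => real => plane) => (nat => nat => real) => bool" where
 "parametrization I \<gamma> s \<longleftrightarrow> (\<forall>k<length S0. I k \<in> {{0..1}, {0..<1}, {0<..<1}} \<and> {0<..<1} \<subseteq> I k \<and> I k \<subseteq> {0..1} \<and>
  s k 0 = 0 \<and> s k (length (S0 ! k)) = 1 \<and> (\<forall>i j. i < j --> j <= length (S0 ! k) --> s k i < s k j) \<and>
  (\<forall>j<length (S0 ! k). valid_piece (S0 ! k ! j) \<and>
    \<gamma> k ` (I k \<inter> {s k j..s k (Suc j)}) = points (S0 ! k ! j) \<and>
    tail (S0 ! k ! j) = (if s k j \<in> I k then Some (\<gamma> k (s k j)) else None) \<and>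
    head (S0 ! k ! j) = (if s k (Suc j) \<in> I k then Some (\<gamma> k (s k (Suc j))) else None))) \<and>
  (\<forall>k<length S0. \<forall>l<length S0. \<forall>x\<in>{0<..<1}. \<forall>y\<in>{0<..<1}. \<gamma> k x = \<gamma> l y --> k = l \<and> x = y)"

lemma param_interval: "parametrization I \<gamma> s ==> k < length S0 ==> {0<..<1} \<subseteq> I k \<and> I k \<subseteq> {0..1}"
 and param_shape: "parametrization I \<gamma> s ==> k < length S0 ==> I k \<in> {{0..1}, {0..<1}, {0<..<1}}"
 and param_0: "parametrization I \<gamma> s ==> k < length S0 ==> s k 0 = 0"
 and param_1: "parametrization I \<gamma> s ==> k < length S0 ==> s k (length (S0 ! k)) = 1"
 and param_mono: "parametrization I \<gamma> s ==> k < length S0 ==> i < j ==> j <= length (S0 ! k) ==> s k i < s k j"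
 and param_valid: "parametrization I \<gamma> s ==> (k, j) \<in> Ix ==> valid_piece (P (k, j))"
 and param_image: "parametrization I \<gamma> s ==> (k, j) \<in> Ix ==> \<gamma> k ` (I k \<inter> {s k j..s k (Suc j)}) = points (P (k, j))"
 and param_tail: "parametrization I \<gamma> s ==> (k, j) \<in> Ix ==> tail (P (k, j)) = (if s k j \<in> I k then Some (\<gamma> k (s k j)) else None)"
 and param_head: "parametrization I \<gamma> s ==> (k, j) \<in> Ix ==> head (P (k, j)) = (if s k (Suc j) \<in> I k then Some (\<gamma> k (s k (Suc j))) else None)"
 and param_inj: "parametrization I \<gamma> s ==> k < length S0 ==> l < length S0 ==> x \<in> {0<..<1} ==> y \<in> {0<..<1} ==> \<gamma> k x = \<gamma> l y ==> k = l \<and> x = y"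
 unfolding parametrization_def pieces_def piece_at_def by (simp_all only: mem_Collect_eq case_prod_conv fst_conv snd_conv)

lemma parametrized: "\<exists>I \<gamma> s. parametrization I \<gamma> s"
proof -
 have "polygonal_network S0" using simple by (simp add: simple_network_def admissible_def)
 then have "\<exists>I \<gamma>. (\<forall>k<length S0. curve (I k) (\<gamma> k) \<and> traverses (I k) (\<gamma> k) (S0 ! k)) \<and>
   (\<forall>k<length S0. \<forall>l<length S0. k ~= l --> \<gamma> k ` {0<..<1} \<inter> \<gamma> l ` {0<..<1} = {})"
  unfolding polygonal_network_def by (rule conjunct1)
 then obtain I where "\<exists>\<gamma>. (\<forall>k<length S0. curve (I k) (\<gamma> k) \<and> traverses (I k) (\<gamma> k) (S0 ! k)) \<and>
   (\<forall>k<length S0. \<forall>l<length S0. k ~= l --> \<gamma> k ` {0<..<1} \<inter> \<gamma> l ` {0<..<1} = {})" ..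
 then obtain \<gamma> where cd: "(\<forall>k<length S0. curve (I k) (\<gamma> k) \<and> traverses (I k) (\<gamma> k) (S0 ! k)) \<and>
   (\<forall>k<length S0. \<forall>l<length S0. k ~= l --> \<gamma> k ` {0<..<1} \<inter> \<gamma> l ` {0<..<1} = {})" ..
 note c = conjunct1[OF cd] and dj = conjunct2[OF cd]
 have I: "I k \<in> {{0..1}, {0..<1}, {0<..<1}}" if "k < length S0" for k
  using c that by (simp add: curve_def)
 have "\<exists>s. s 0 = 0 \<and> s (length (S0!k)) = 1 \<and> (\<forall>i j. i < j --> j <= length (S0!k) --> s i < s j) \<and>
  (\<forall>j<length (S0!k). valid_piece (S0!k ! j) \<and>
  \<gamma> k ` (I k \<inter> {s j..s (Suc j)}) = points (S0!k ! j) \<and>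
  tail (S0!k ! j) = (if s j \<in> I k then Some (\<gamma> k (s j)) else None) \<and>
  head (S0!k ! j) = (if s (Suc j) \<in> I k then Some (\<gamma> k (s (Suc j))) else None))" if "k < length S0" for k
 proof -
  have t: "traverses (I k) (\<gamma> k) (S0 ! k)" using c that by simp
  from traverses_partition[OF t I[OF that]] show ?thesis by metis
 qed
 then obtain s where s: "!!k. k < length S0 ==> s k 0 = 0 \<and> s k (length (S0!k)) = 1 \<and> (\<forall>i j. i < j --> j <= length (S0!k) --> s k i < s k j) \<and>
  (\<forall>j<length (S0!k). valid_piece (S0!k ! j) \<and>
  \<gamma> k ` (I k \<inter> {s k j..s k (Suc j)}) = points (S0!k ! j) \<and>
  tail (S0!k ! j) = (if s k j \<in> I k then Some (\<gamma> k (s k j)) else None) \<and>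
  head (S0!k ! j) = (if s k (Suc j) \<in> I k then Some (\<gamma> k (s k (Suc j))) else None))" by metis
 have inj: "k = l \<and> x = y" if "k < length S0" "l < length S0" "x \<in> {0<..<1}" "y \<in> {0<..<1}" "\<gamma> k x = \<gamma> l y" for k l x y
 proof -
  have "k = l" using dj that by blast
  moreover have "inj_on (\<gamma> k) {0<..<1}" using c that by (simp add: curve_def)
  ultimately show ?thesis using that by (meson inj_onD)
 qed
 have sub: "{0<..<1} \<subseteq> I k \<and> I k \<subseteq> {0..1}" if "k < length S0" for k
  using I[OF that] by (elim insertE emptyE) (simp_all add: subset_eq)
 have "parametrization I \<gamma> s" unfolding parametrization_def
 proof (intro conjI allI impI)
  fix k assume k: "k < length S0"
  show "I k \<in> {{0..1}, {0..<1}, {0<..<1}}" by (rule I[OF k])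
  show "{0<..<1} \<subseteq> I k" "I k \<subseteq> {0..1}" using sub[OF k] by blast+
  show "s k 0 = 0" "s k (length (S0 ! k)) = 1" using s[OF k] by blast+
  show "s k i < s k j" if "i < j" "j <= length (S0 ! k)" for i j using s[OF k] that by blast
  fix j assume "j < length (S0 ! k)"
  with s[OF k] show "valid_piece (S0!k ! j)" "\<gamma> k ` (I k \<inter> {s k j..s k (Suc j)}) = points (S0!k ! j)"
   "tail (S0!k ! j) = (if s k j \<in> I k then Some (\<gamma> k (s k j)) else None)"
   "head (S0!k ! j) = (if s k (Suc j) \<in> I k then Some (\<gamma> k (s k (Suc j))) else None)" by blast+
 qed (intro ballI impI inj; assumption)
 then show ?thesis by blast
qed

lemma valid: "i \<in> Ix ==> valid_piece (P i)"
proof -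
 assume i: "i \<in> Ix"
 obtain I \<gamma> s where "parametrization I \<gamma> s" using parametrized by blast
 from param_valid[OF this, of "fst i" "snd i"] i show ?thesis by simp
qed

lemma tangent_hexdir: "i \<in> Ix ==> \<tau> i \<in> hexdir"
 using simple valid facet_parallel_direction unfolding simple_network_def admissible_def by blast

lemma d_hexdir: "i \<in> Ix ==> d i X \<in> hexdir"
 using tangent_hexdir hexdir_uminus dir_from_cases by metis

lemma d_norm: "i \<in> Ix ==> norm (d i X) = 1"
 using d_hexdir hexdir_norm by blast

lemma curve_nonempty:
 assumes k: "k < length S0"
 shows "S0 ! k ~= []"
proof -
 obtain I \<gamma> s where "parametrization I \<gamma> s" using parametrized by blast
 from param_0[OF this k] param_1[OF this k] show ?thesis by auto
qed

lemma consecutive: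
 assumes "(k, Suc j) \<in> Ix"
 shows "\<exists>X. head (P (k, j)) = Some X \<and> tail (P (k, Suc j)) = Some X"
proof -
 obtain I \<gamma> s where prm: "parametrization I \<gamma> s" using parametrized by blast
 note p = param_interval[OF prm] param_0[OF prm] param_1[OF prm] param_tail[OF prm] param_head[OF prm] param_mono[OF prm]
 have k: "k < length S0" "Suc j < length (S0 ! k)" using assms by (auto simp: pieces_def)
 have "0 < s k (Suc j)" "s k (Suc j) < 1" using p(6)[of k 0 "Suc j"] p(6)[of k "Suc j" "length (S0 ! k)"] p(2,3) k by auto
 then have "s k (Suc j) \<in> I k" using p(1)[OF k(1)] by auto
 moreover have "(k, j) \<in> Ix" using k by (auto simp: pieces_def)
 ultimately show ?thesis using p(4)[OF assms] p(5)[of k j] by auto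
qed

text \<open>A junction counts three curve ends and three incident pieces, so each of these pieces is the first
or the last one of its curve.\<close>
lemma junction_incident:
 assumes X: "X \<in> junctions S0"
 shows "inc X = (\<lambda>k. (k, 0)) ` {k. k < length S0 \<and> curve_start (S0 ! k) = Some X} \<union>
   (\<lambda>k. (k, length (S0 ! k) - 1)) ` {k. k < length S0 \<and> curve_end (S0 ! k) = Some X}" (is "_ = ?A \<union> ?B")
  and "((\<lambda>k. (k, 0)) ` {k. k < length S0 \<and> curve_start (S0 ! k) = Some X}) \<inter>
   ((\<lambda>k. (k, length (S0 ! k) - 1)) ` {k. k < length S0 \<and> curve_end (S0 ! k) = Some X}) = {}"
  and "card (inc X) = 3"
proof -
 have c: "junction_order S0 X = 3" "card (inc X) = 3" using simple X by (auto simp: simple_network_def)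
 then show "card (inc X) = 3" by simp
 have t: "tail (P (k, 0)) = Some X" "(k, 0) \<in> Ix" if "k < length S0" "curve_start (S0 ! k) = Some X" for k
  using that curve_nonempty[OF that(1)] by (auto simp: curve_start_def hd_conv_nth pieces_def)
 have h: "head (P (k, length (S0 ! k) - 1)) = Some X" "(k, length (S0 ! k) - 1) \<in> Ix" if "k < length S0" "curve_end (S0 ! k) = Some X" for k
  using that curve_nonempty[OF that(1)] by (auto simp: curve_end_def last_conv_nth pieces_def)
 have sub: "?A \<union> ?B \<subseteq> inc X" using t h by (auto simp: incident_def endpoints_iff)
 show dj: "?A \<inter> ?B = {}"
 proof (rule ccontr)
  assume ne: "?A \<inter> ?B ~= {}"
  then obtain z where "z \<in> ?A" "z \<in> ?B" by blast
  then obtain k l where kl: "k < length S0" "curve_start (S0 ! k) = Some X" "l < length S0" "curve_end (S0 ! l) = Some X" "(k, 0) = (l, length (S0 ! l) - 1)"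
   by (elim imageE) blast
  then show False using t[of k] h[of l] tail_neq_head[OF valid] by (metis (no_types, lifting))
 qed
 have "card ?A = card {k. k < length S0 \<and> curve_start (S0 ! k) = Some X}" "card ?B = card {k. k < length S0 \<and> curve_end (S0 ! k) = Some X}"
  by (intro card_image inj_onI; simp)+
 then have "card (?A \<union> ?B) = 3" using c(1) dj by (subst card_Un_disjoint) (auto simp: junction_order_def)
 then show "inc X = ?A \<union> ?B" using card_subset_eq[OF finite_incident sub] c(2) by simp
qed

text \<open>As the curves are injective and disjoint, a vertex that is not a junction is passed exactly
once.\<close>
lemma simple_vertex_incident:
 assumes X: "X \<in> Vx" "X \<notin> junctions S0"
 shows "\<exists>k j. (k, Suc j) \<in> Ix \<and> (k, j) \<in> Ix \<and> inc X = {(k, j), (k, Suc j)} \<and> head (P (k, j)) = Some X \<and> tail (P (k, Suc j)) = Some X"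
proof -
 obtain I \<gamma> s where prm: "parametrization I \<gamma> s" using parametrized by blast
 note p = param_interval[OF prm] param_0[OF prm] param_1[OF prm] param_tail[OF prm] param_head[OF prm] param_mono[OF prm] param_inj[OF prm]
 have visit: "\<exists>m. 0 < m \<and> m < length (S0 ! k) \<and> X = \<gamma> k (s k m) \<and> (j = m \<or> Suc j = m)" if "(k, j) \<in> inc X" for k j
 proof -
  have kj: "(k, j) \<in> Ix" and e: "tail (P (k, j)) = Some X \<or> head (P (k, j)) = Some X" using that by (auto simp: incident_def endpoints_iff)
  have k: "k < length S0" "j < length (S0 ! k)" using kj by (auto simp: pieces_def)
  from e show ?thesis
  proof
   assume t: "tail (P (k, j)) = Some X"
   have "j ~= 0"
   proof
    assume "j = 0"
    then have "curve_start (S0 ! k) = Some X" using t curve_nonempty[OF k(1)] by (simp add: curve_start_def hd_conv_nth)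
    then show False using X k by (auto simp: junctions_def curve_endpoints_def)
   qed
   then show ?thesis using t p(4)[OF kj] k by (intro exI[of _ j]) (auto split: if_splits)
  next
   assume h: "head (P (k, j)) = Some X"
   have "Suc j ~= length (S0 ! k)"
   proof
    assume "Suc j = length (S0 ! k)"
    then have "curve_end (S0 ! k) = Some X" using h curve_nonempty[OF k(1)] by (simp add: curve_end_def last_conv_nth flip: \<open>Suc j = length (S0 ! k)\<close>)
    then show False using X k by (auto simp: junctions_def curve_endpoints_def)
   qed
   then show ?thesis using h p(5)[OF kj] k by (intro exI[of _ "Suc j"]) (auto split: if_splits)
  qed
 qed
 have rng: "s k m \<in> {0<..<1}" if "k < length S0" "0 < m" "m < length (S0 ! k)" for k m
  using p(6)[of k 0 m] p(6)[of k m "length (S0 ! k)"] p(2,3) that by auto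
 obtain k0 j0 where "(k0, j0) \<in> inc X" using X by (auto simp: vertices_def incident_def)
 with visit obtain m where m: "0 < m" "m < length (S0 ! k0)" "X = \<gamma> k0 (s k0 m)" by blast
 have k0: "k0 < length S0" using \<open>(k0, j0) \<in> inc X\<close> by (auto simp: incident_def pieces_def)
 obtain j where j: "m = Suc j" using m by (cases m) auto
 have only: "k = k0 \<and> (i = m \<or> i = j)" if i: "(k, i) \<in> inc X" for k i
 proof -
  obtain m' where m': "0 < m'" "m' < length (S0 ! k)" "X = \<gamma> k (s k m')" "i = m' \<or> Suc i = m'" using visit[OF i] by blast
  have k: "k < length S0" using i by (auto simp: incident_def pieces_def)
  have "\<gamma> k (s k m') = \<gamma> k0 (s k0 m)" using m(3) m'(3) by simp
  then have "k = k0 \<and> s k m' = s k0 m" using p(7)[OF k k0 rng[OF k m'(1,2)] rng[OF k0 m(1,2)]] by blast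
  then have "m' = m" using p(6)[OF k0, of m m'] p(6)[OF k0, of m' m] m m' by (metis less_imp_le linorder_neqE_nat order_less_irrefl)
  then show ?thesis using m'(4) j \<open>k = k0 \<and> _\<close> by auto
 qed
 have kk: "(k0, Suc j) \<in> Ix" "(k0, j) \<in> Ix" using k0 m j by (auto simp: pieces_def)
 have "s k0 (Suc j) \<in> I k0" using rng[OF k0 m(1,2)] p(1)[OF k0] j by auto
 then have "head (P (k0, j)) = Some X" "tail (P (k0, Suc j)) = Some X" using p(4)[OF kk(1)] p(5)[OF kk(2)] m j by auto
 moreover from this have "inc X = {(k0, j), (k0, Suc j)}" using only kk j by (auto simp: incident_def endpoints_iff simp del: piece_at_pair)
 ultimately show ?thesis using kk by blast
qed

lemma junctions_subset_vertices: "junctions S0 \<subseteq> Vx"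
proof
 fix X assume X: "X \<in> junctions S0"
 then have "inc X ~= {}" using junction_incident(3)[OF X] by force
 then obtain i where "i \<in> inc X" by blast
 then show "X \<in> Vx" unfolding incident_def vertices_def by blast
qed

lemma incident_inner:
 assumes i: "i \<in> inc X" "j \<in> inc X" "i ~= j"
 shows "d i X \<bullet> d j X = - 1 / 2"
proof -
 have "X \<in> Vx" using i by (auto simp: incident_def vertices_def)
 then have "angles_120 S0 X" using simple unfolding simple_network_def admissible_def by blast
 then have "vec_angle (d i X) (d j X) = 2 * pi / 3" using i unfolding angles_120_def by blast
 then show ?thesis using i by (intro vec_angle_120 d_norm) (auto simp: incident_def)
qed

lemma star_cases:
 assumes X: "X \<in> Vx"
 obtains (two) i j where "i ~= j" "inc X = {i, j}" "X \<notin> junctions S0"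
 | (three) i j k where "i ~= j" "i ~= k" "j ~= k" "inc X = {i, j, k}" "d i X + d j X + d k X = 0" "X \<in> junctions S0"
proof (cases "X \<in> junctions S0")
 case True
 then obtain i j k where ijk: "inc X = {i, j, k}" "i ~= j" "i ~= k" "j ~= k" using junction_incident(3) by (metis card_3_iff)
 moreover have "d i X + d j X + d k X = 0"
 proof (rule three_at_120)
  have "i \<in> Ix" "j \<in> Ix" "k \<in> Ix" using ijk by (auto simp: incident_def)
  then show "norm (d i X) = 1" "norm (d j X) = 1" "norm (d k X) = 1" using d_norm by auto
 qed (use ijk incident_inner in auto)
 ultimately show thesis using three True by blast
next
 case False
 then obtain k j where "inc X = {(k, j), (k, Suc j)}" using simple_vertex_incident[OF X] by blast
 then show thesis using two[of "(k, j)" "(k, Suc j)"] False by simp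
qed

text \<open>If no edge at \<open>X\<close> were parallel to \<open>j\<close>, three unit vectors with sum zero
would all have inner product \<open>1/2\<close> or \<open>-1/2\<close> with its tangent, which is impossible
by parity. A parallel edge shares infinitely many points with \<open>j\<close>, and one of them is no
breakpoint, against injectivity.\<close>
lemma junction_not_inside:
 assumes X: "X \<in> junctions S0" and j: "j \<in> Ix" and p: "X \<in> points (P j)"
 shows "X \<in> ends j"
proof (rule ccontr)
 assume n: "X \<notin> ends j"
 obtain I \<gamma> s where prm: "parametrization I \<gamma> s" using parametrized by blast
 note pm = param_interval[OF prm] param_0[OF prm] param_1[OF prm] param_image[OF prm] param_mono[OF prm] param_inj[OF prm]
 have XV: "X \<in> Vx" using X junctions_subset_vertices by blast
 have "\<exists>m\<in>inc X. d m X = \<tau> j \<or> d m X = - \<tau> j"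
 proof (rule ccontr)
  assume c: "\<not> ?thesis"
  have half: "d m X \<bullet> \<tau> j = 1/2 \<or> d m X \<bullet> \<tau> j = -1/2" if m: "m \<in> inc X" for m
  proof -
   have mI: "m \<in> Ix" using m by (auto simp: incident_def)
   have "d m X \<bullet> \<tau> j \<in> {1, -1, 1/2, -1/2}" by (intro hexdir_inner d_hexdir tangent_hexdir mI j)
   moreover have "d m X \<bullet> \<tau> j ~= 1" "d m X \<bullet> \<tau> j ~= -1"
    using c m unit_inner_one[of "d m X" "\<tau> j"] d_norm[OF mI] hexdir_norm[OF tangent_hexdir[OF j]] by auto
   ultimately show ?thesis by auto
  qed
  from XV show False
  proof (cases rule: star_cases)
   case (two a b) then show ?thesis using X by simp
  next
   case (three a b c)
   have "d a X \<bullet> \<tau> j + d b X \<bullet> \<tau> j + d c X \<bullet> \<tau> j = 0" using three(5) by (metis inner_add_left inner_zero_left)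
   then show ?thesis using half[of a] half[of b] half[of c] three(4) by auto
  qed
 qed
 then obtain m where m: "m \<in> inc X" "d m X = \<tau> j \<or> d m X = - \<tau> j" by blast
 have mI: "m \<in> Ix" "X \<in> ends m" using m by (auto simp: incident_def)
 obtain r1 where r1: "0 < r1" "!!r. 0 <= r ==> r <= r1 ==> X + r *\<^sub>R d m X \<in> points (P m)"
  using near_endpoint_mem[OF valid[OF mI(1)] mI(2)] by blast
 obtain r2 where r2: "0 < r2" "!!r. \<bar>r\<bar> <= r2 ==> X + r *\<^sub>R \<tau> j \<in> points (P j)"
  using near_interior_mem[OF valid[OF j] p n] by blast
 define q where "q r = X + r *\<^sub>R d m X" for r
 define F where "F = (\<Union>k<length S0. \<gamma> k ` s k ` {..length (S0 ! k)})"
 have finF: "finite F" by (simp add: F_def)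
 have "d m X ~= 0" using d_norm[OF mI(1), of X] by auto
 then have "inj q" by (auto simp: inj_def q_def)
 moreover have "infinite {0<..min r1 r2}" using r1 r2 by (simp add: infinite_Ioc)
 ultimately have "infinite (q ` {0<..min r1 r2})" using finite_imageD inj_on_subset by blast
 \<comment> \<open>infinitely many common points, but only finitely many breakpoints\<close>
 then have "\<not> q ` {0<..min r1 r2} \<subseteq> F" using finF finite_subset by blast
 then obtain r where "r \<in> {0<..min r1 r2}" "q r \<notin> F" by blast
 then have r: "0 < r" "r <= r1" "r <= r2" "q r \<notin> F" by auto
 have qm: "q r \<in> points (P m)" using r1 r by (simp add: q_def)
 have qj: "q r \<in> points (P j)" using m(2) r2(2)[of r] r2(2)[of "- r"] r by (auto simp: q_def)
 have par: "\<exists>x. x \<in> {0<..<1} \<and> \<gamma> k x = q r \<and> s k i < x \<and> x < s k (Suc i)" if ki: "(k, i) \<in> Ix" "q r \<in> points (P (k, i))" for k i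
 proof -
  have k: "k < length S0" "i < length (S0 ! k)" using ki by (auto simp: pieces_def)
  obtain x where x: "x \<in> I k" "s k i <= x" "x <= s k (Suc i)" "\<gamma> k x = q r" using ki pm(4)[OF ki(1)] by force
  have "\<gamma> k (s k a) \<in> F" if "a <= length (S0 ! k)" for a unfolding F_def using that k by blast
  from this[of i] this[of "Suc i"] have "s k i ~= x" "s k (Suc i) ~= x" using x(4) r(4) k(2) by auto
  moreover have "0 <= s k i" using pm(5)[OF k(1), of 0 i] pm(2)[OF k(1)] k by (cases "i = 0") auto
  moreover have "s k (Suc i) <= 1" using pm(5)[OF k(1), of "Suc i" "length (S0 ! k)"] pm(3)[OF k(1)] k by (cases "Suc i = length (S0 ! k)") auto
  ultimately show ?thesis using x by (intro exI[of _ x]) auto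
 qed
 obtain k1 i1 k2 i2 where km: "m = (k1, i1)" "j = (k2, i2)" by (metis surj_pair)
 obtain x where x: "x \<in> {0<..<1}" "\<gamma> k1 x = q r" "s k1 i1 < x" "x < s k1 (Suc i1)" using par[of k1 i1] mI qm km by auto
 obtain y where y: "y \<in> {0<..<1}" "\<gamma> k2 y = q r" "s k2 i2 < y" "y < s k2 (Suc i2)" using par[of k2 i2] j qj km by auto
 have kl: "k1 < length S0" "i1 < length (S0 ! k1)" "k2 < length S0" "i2 < length (S0 ! k2)" using mI j km by (auto simp: pieces_def)
 have eq: "k1 = k2" "x = y" using pm(6)[OF kl(1,3) x(1) y(1)] x y by auto
 have mono: "s k1 a <= s k1 b" if "a <= b" "b <= length (S0 ! k1)" for a b
  using pm(5)[OF kl(1), of a b] that by (cases "a = b") auto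
 have "i1 = i2"
 proof (rule linorder_cases[of i1 i2])
  assume "i1 < i2" then show ?thesis using mono[of "Suc i1" i2] x y eq kl by auto
 next
  assume "i2 < i1" then show ?thesis using mono[of "Suc i2" i1] x y eq kl by auto
 qed
 then have "m = j" using km eq by simp
 then show False using n mI by simp
qed

text \<open>A common point would be visited twice by the parametrizations, unless it is a junction.\<close>
lemma separate:
 assumes ij: "i \<in> Ix" "j \<in> Ix" "i ~= j" and dj: "ends i \<inter> ends j = {}"
 shows "points (P i) \<inter> points (P j) = {}"
proof (rule ccontr)
 assume "points (P i) \<inter> points (P j) ~= {}"
 then obtain p where p: "p \<in> points (P i)" "p \<in> points (P j)" by blast
 obtain I \<gamma> s where prm: "parametrization I \<gamma> s" using parametrized by blast
 note pm = param_interval[OF prm] param_0[OF prm] param_1[OF prm] param_image[OF prm] param_tail[OF prm] param_head[OF prm] param_mono[OF prm] param_inj[OF prm]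
 have par: "p \<in> junctions S0 \<and> p \<in> ends (k, m) \<or> (\<exists>x. x \<in> {0<..<1} \<and> x \<in> I k \<and> \<gamma> k x = p \<and> s k m <= x \<and> x <= s k (Suc m))"
  if km: "(k, m) \<in> Ix" "p \<in> points (P (k, m))" for k m
 proof -
  have k: "k < length S0" "m < length (S0 ! k)" using km by (auto simp: pieces_def)
  obtain x where x: "x \<in> I k" "s k m <= x" "x <= s k (Suc m)" "\<gamma> k x = p" using km pm(4)[OF km(1)] by force
  have x01: "0 <= x" "x <= 1" using x(1) pm(1)[OF k(1)] by auto
  consider "x = 0" | "x = 1" | "x \<in> {0<..<1}" using x01 by force
  then show ?thesis
  proof cases
   case 1
   have "m = 0" using pm(7)[OF k(1), of 0 m] pm(2)[OF k(1)] x(2) 1 k by (cases "m = 0") auto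
   then have t: "tail (P (k, m)) = Some p" using pm(5)[OF km(1)] pm(2)[OF k(1)] x 1 by simp
   then have "curve_start (S0 ! k) = Some p" using \<open>m = 0\<close> curve_nonempty[OF k(1)] by (simp add: curve_start_def hd_conv_nth)
   then have "p \<in> junctions S0" using k by (auto simp: junctions_def curve_endpoints_def)
   then show ?thesis using t by (simp add: endpoints_iff)
  next
   case 2
   have "Suc m = length (S0 ! k)"
   proof (rule ccontr)
    assume "Suc m ~= length (S0 ! k)"
    then have "s k (Suc m) < 1" using pm(7)[OF k(1), of "Suc m" "length (S0 ! k)"] pm(3)[OF k(1)] k by simp
    then show False using x(3) 2 by simp
   qed
   then have h: "head (P (k, m)) = Some p" using pm(6)[OF km(1)] pm(3)[OF k(1)] x 2 by simp
   then have "curve_end (S0 ! k) = Some p" using curve_nonempty[OF k(1)] by (simp add: curve_end_def last_conv_nth flip: \<open>Suc m = length (S0 ! k)\<close>)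
   then have "p \<in> junctions S0" using k by (auto simp: junctions_def curve_endpoints_def)
   then show ?thesis using h by (simp add: endpoints_iff)
  next
   case 3 then show ?thesis using x by blast
  qed
 qed
 obtain k1 i1 k2 i2 where km: "i = (k1, i1)" "j = (k2, i2)" by (metis surj_pair)
 have nj: "p \<notin> junctions S0" if "p \<in> ends i \<or> p \<in> ends j"
  using junction_not_inside ij p dj that by blast
 obtain x where x: "x \<in> {0<..<1}" "x \<in> I k1" "\<gamma> k1 x = p" "s k1 i1 <= x" "x <= s k1 (Suc i1)" using par[of k1 i1] ij p km nj by blast
 obtain y where y: "y \<in> {0<..<1}" "y \<in> I k2" "\<gamma> k2 y = p" "s k2 i2 <= y" "y <= s k2 (Suc i2)" using par[of k2 i2] ij p km nj by blast
 have kl: "k1 < length S0" "i1 < length (S0 ! k1)" "k2 < length S0" "i2 < length (S0 ! k2)" using ij km by (auto simp: pieces_def)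
 have eq: "k1 = k2" "x = y" using pm(8)[OF kl(1,3) x(1) y(1)] x y by auto
 have mono: "s k1 a < s k1 b" if "a < b" "b <= length (S0 ! k1)" for a b
  using pm(7)[OF kl(1), of a b] that by auto
 have touch: "p \<in> ends (k1, a) \<inter> ends (k1, b)"
  if "a < b" "x <= s k1 (Suc a)" "s k1 b <= x" "b < length (S0 ! k1)" for a b
 proof -
  have "b = Suc a" using mono[of "Suc a" b] that by (cases "b = Suc a") auto
  then have "x = s k1 b" using that by simp
  moreover have "(k1, a) \<in> Ix" "(k1, b) \<in> Ix" using that kl by (auto simp: pieces_def)
  ultimately show ?thesis using pm(5)[of k1 b] pm(6)[of k1 a] x \<open>b = Suc a\<close> by (auto simp: endpoints_iff)
 qed
 have "i1 ~= i2" using ij km eq by auto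
 then have "p \<in> ends i \<inter> ends j"
  using touch[of i1 i2] touch[of i2 i1] x y eq kl km by (auto simp: neq_iff)
 then show False using dj by simp
qed

end

section \<open>Curves through given pieces\<close>

lemma ray_iff:
 assumes "norm (d :: plane) = 1"
 shows "(\<exists>s\<ge>0. p = X + s *\<^sub>R d) \<longleftrightarrow> 0 <= (p - X) \<bullet> d \<and> (p - X) \<bullet> rot90 d = 0"
proof
 assume "\<exists>s\<ge>0. p = X + s *\<^sub>R d"
 then show "0 <= (p - X) \<bullet> d \<and> (p - X) \<bullet> rot90 d = 0" using assms by (auto simp: norm_one_inner)
next
 assume a: "0 <= (p - X) \<bullet> d \<and> (p - X) \<bullet> rot90 d = 0"
 then have "p - X = ((p - X) \<bullet> d) *\<^sub>R d" using frame_decomp[OF assms, of "p - X"] by simp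
 then show "\<exists>s\<ge>0. p = X + s *\<^sub>R d" using a by (intro exI[of _ "(p - X) \<bullet> d"]) (simp add: algebra_simps)
qed

lemma closed_points:
 assumes "valid_piece P"
 shows "closed (points P)"
proof -
 have "points P = (\<Inter>X\<in>endpoints P. {p. 0 <= (p - X) \<bullet> dir_from P X \<and> (p - X) \<bullet> rot90 (dir_from P X) = 0})"
  using mem_points_iff[OF assms] ray_iff[OF dir_from_norm[OF assms]] by auto
 also have "closed ..."
  by (intro closed_INT ballI closed_Collect_conj closed_Collect_le closed_Collect_eq continuous_intros)
 finally show ?thesis .
qed

lemma connected_points: "connected (points P)"
proof -
 have "connected (arc_domain P)" by (cases P) auto
 moreover have "continuous_on (arc_domain P) (arc_point P)" by (cases P) (auto intro!: continuous_intros)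
 ultimately show ?thesis unfolding points_def by (rule connected_continuous_image[rotated])
qed

lemma lipschitz_imp_abs_continuous:
 assumes "!!a b. {a..b} \<subseteq> I ==> \<exists>L. L-lipschitz_on {a..b} \<gamma>"
 shows "abs_continuous_on I \<gamma>"
 unfolding abs_continuous_on_def
proof (intro allI impI)
 fix a b and \<epsilon> :: real assume ab: "{a..b} \<subseteq> I" and e: "0 < \<epsilon>"
 obtain L where L: "L-lipschitz_on {a..b} \<gamma>" using assms[OF ab] by blast
 have L0: "0 <= L" using lipschitz_on_nonneg[OF L] .
 show "\<exists>\<delta>>0. \<forall>n (u :: nat => real) v.
    (\<forall>i<n. a <= u i \<and> u i <= v i \<and> v i <= b) \<and>
    (\<forall>i<n. \<forall>j<n. i ~= j --> {u i<..<v i} \<inter> {u j<..<v j} = {}) \<and>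
    (\<Sum>i<n. v i - u i) < \<delta>
    --> (\<Sum>i<n. dist (\<gamma> (u i)) (\<gamma> (v i))) < \<epsilon>"
 proof (intro exI[of _ "\<epsilon> / (L + 1)"] conjI allI impI)
  show "0 < \<epsilon> / (L + 1)" using e L0 by simp
  fix n and u v :: "nat => real"
  assume h: "(\<forall>i<n. a <= u i \<and> u i <= v i \<and> v i <= b) \<and>
    (\<forall>i<n. \<forall>j<n. i ~= j --> {u i<..<v i} \<inter> {u j<..<v j} = {}) \<and>
    (\<Sum>i<n. v i - u i) < \<epsilon> / (L + 1)"
  have "(\<Sum>i<n. dist (\<gamma> (u i)) (\<gamma> (v i))) <= (\<Sum>i<n. L * (v i - u i))"
  proof (rule sum_mono)
   fix i assume i: "i \<in> {..<n}"
   have "dist (\<gamma> (u i)) (\<gamma> (v i)) <= L * dist (u i) (v i)"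
    using h i by (intro lipschitz_onD[OF L]) auto
   then show "dist (\<gamma> (u i)) (\<gamma> (v i)) <= L * (v i - u i)" using h i by (auto simp: dist_real_def)
  qed
  also have "... = L * (\<Sum>i<n. v i - u i)" by (simp add: sum_distrib_left)
  also have "... <= L * (\<epsilon> / (L + 1))" using h L0 by (intro mult_left_mono) auto
  also have "... < \<epsilon>" using L0 e by (simp add: field_simps)
  finally show "(\<Sum>i<n. dist (\<gamma> (u i)) (\<gamma> (v i))) < \<epsilon>" .
 qed
qed

lemma arc_point_line: "arc_point Q s = arc_point Q 0 + s *\<^sub>R tangent Q"
 by (cases Q) auto

lemma arc_point_dist: "valid_piece Q ==> dist (arc_point Q r) (arc_point Q s) = dist r s"
 unfolding arc_point_line[of Q r] arc_point_line[of Q s] by (simp add: dist_norm tangent_norm flip: scaleR_diff_left)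

lemma arc_point_mem: "s \<in> arc_domain Q ==> arc_point Q s \<in> points Q"
 by (simp add: points_def)

text \<open>Arclength as a function of a parameter in the unit interval; the infinite end of a half-line
corresponds to a missing end of that interval.\<close>
fun warp :: "piece => real => real" where
 "warp (Segment a b) y = y * dist a b"
| "warp (Outgoing a u) y = y / (1 - y)"
| "warp (Incoming b u) y = (y - 1) / y"

definition unit_domain :: "piece => real set" where
 "unit_domain P = {0..1} - (if tail P = None then {0} else {}) - (if head P = None then {1} else {})"

definition unit_param :: "piece => real => plane" where
 "unit_param P y = arc_point P (warp P y)"

lemma unit_domain_simps [simp]: "unit_domain (Segment a b) = {0..1}" "unit_domain (Outgoing a u) = {0..<1}" "unit_domain (Incoming a u) = {0<..1}"
 by (auto simp: unit_domain_def)

lemma unit_param_tail: "tail P = Some X ==> unit_param P 0 = X"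
 by (cases P) (auto simp: unit_param_def)

lemma unit_param_head: "head P = Some X ==> unit_param P 1 = X"
proof (cases P)
 case (Segment a b)
 assume "head P = Some X"
 moreover have "a + dist a b *\<^sub>R sgn (b - a) = b"
  using segment_tangent[of a b] by (cases "a = b") (simp_all flip: segment_tangent)
 ultimately show ?thesis using Segment by (simp add: unit_param_def)
qed (auto simp: unit_param_def)

lemma unit_param_image:
 assumes v: "valid_piece P"
 shows "unit_param P ` unit_domain P = points P"
proof -
 have "warp P ` unit_domain P = arc_domain P"
 proof (cases P)
  case (Segment a b)
  have "(\<lambda>y. y * dist a b) ` {0..1} = (*) (dist a b) ` {0..1}" by (simp add: mult.commute)
  then show ?thesis using Segment v image_mult_atLeastAtMost[of "dist a b" 0 1] by simp
 next
  case (Outgoing a u)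
  have "s \<in> (\<lambda>y. y / (1 - y)) ` {0..<1}" if "0 <= s" for s :: real
   using that by (intro image_eqI[of _ _ "s / (1 + s)"]) (auto simp: field_simps)
  then show ?thesis using Outgoing by auto
 next
  case (Incoming b u)
  have "s \<in> (\<lambda>y. (y - 1) / y) ` {0<..1}" if "s <= 0" for s :: real
   using that by (intro image_eqI[of _ _ "1 / (1 - s)"]) (auto simp: field_simps)
  then show ?thesis using Incoming by (auto simp: divide_le_0_iff)
 qed
 then show ?thesis unfolding points_def unit_param_def by (metis image_image)
qed

lemma unit_param_mono:
 assumes v: "valid_piece P" and xy: "x \<in> unit_domain P" "y \<in> unit_domain P" "x < y"
 shows "0 < (unit_param P y - unit_param P x) \<bullet> tangent P"
proof -
 have "warp P x < warp P y" using xy v by (cases P) (auto simp: field_simps)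
 moreover have "(unit_param P y - unit_param P x) \<bullet> tangent P = warp P y - warp P x"
  unfolding unit_param_def arc_point_line[of P "warp P y"] arc_point_line[of P "warp P x"]
  using tangent_norm[OF v] by (simp add: norm_one_inner inner_diff_left inner_add_left)
 ultimately show ?thesis by simp
qed

lemma unit_param_lipschitz:
 assumes v: "valid_piece P" and sub: "{c..d} \<subseteq> unit_domain P"
 shows "\<exists>L. L-lipschitz_on {c..d} (unit_param P)"
proof -
 have "\<exists>L\<ge>0. \<forall>x\<in>{c..d}. \<forall>y\<in>{c..d}. \<bar>warp P x - warp P y\<bar> <= L * \<bar>x - y\<bar>"
 proof (cases P)
  case (Segment a b)
  then show ?thesis by (intro exI[of _ "dist a b"]) (simp add: abs_mult flip: left_diff_distrib)
 next
  case (Outgoing a u)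
  show ?thesis
  proof (intro exI[of _ "1 / (1 - d)\<^sup>2"] conjI ballI)
   fix x y assume xy: "x \<in> {c..d}" "y \<in> {c..d}"
   then have "d \<in> unit_domain P" using sub by auto
   then have d: "d < 1" using Outgoing by simp
   have "x / (1 - x) - y / (1 - y) = (x - y) / ((1 - x) * (1 - y))" using xy d by (simp add: field_simps)
   then have "\<bar>warp P x - warp P y\<bar> = \<bar>x - y\<bar> / ((1 - x) * (1 - y))" using Outgoing xy d by (simp add: abs_mult)
   also have "... <= \<bar>x - y\<bar> / ((1 - d) * (1 - d))" using xy d by (intro divide_left_mono mult_mono) auto
   finally show "\<bar>warp P x - warp P y\<bar> <= 1 / (1 - d)\<^sup>2 * \<bar>x - y\<bar>" by (simp add: power2_eq_square)
  qed simp
 next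
  case (Incoming b u)
  show ?thesis
  proof (intro exI[of _ "1 / c\<^sup>2"] conjI ballI)
   fix x y assume xy: "x \<in> {c..d}" "y \<in> {c..d}"
   then have "c \<in> unit_domain P" using sub by auto
   then have c: "0 < c" using Incoming by simp
   have "(x - 1) / x - (y - 1) / y = (x - y) / (x * y)" using xy c by (simp add: field_simps)
   then have "\<bar>warp P x - warp P y\<bar> = \<bar>x - y\<bar> / (x * y)" using Incoming xy c by (simp add: abs_mult)
   also have "... <= \<bar>x - y\<bar> / (c * c)" using xy c by (intro divide_left_mono mult_mono) auto
   finally show "\<bar>warp P x - warp P y\<bar> <= 1 / c\<^sup>2 * \<bar>x - y\<bar>" by (simp add: power2_eq_square)
  qed simp
 qed
 then obtain L where "0 <= L" "\<forall>x\<in>{c..d}. \<forall>y\<in>{c..d}. \<bar>warp P x - warp P y\<bar> <= L * \<bar>x - y\<bar>" by blast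
 then have "L-lipschitz_on {c..d} (unit_param P)"
  by (intro lipschitz_onI) (simp_all add: unit_param_def arc_point_dist[OF v] dist_real_def)
 then show ?thesis by blast
qed

lemma breakpoints_cover:
 fixes s :: "nat => real"
 assumes "0 < n" "s 0 <= x" "x <= s n"
 shows "\<exists>j<n. s j <= x \<and> x <= s (Suc j)"
 using assms
proof (induction n)
 case (Suc n)
 then show ?case by (cases "n = 0"; cases "x <= s n") (auto intro: less_SucI)
qed simp

text \<open>Piece \<open>j\<close> of \<open>n\<close> is assigned the parameters between \<open>j / n\<close>
and \<open>(j + 1) / n\<close>.\<close>
lemma curve_through_pieces:
 assumes ne: "Ps ~= []" and val: "!!j. j < length Ps ==> valid_piece (Ps ! j)"
  and I: "I \<in> {{0..1}, {0..<1}, {0<..<1}}"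
  and cons: "!!j. Suc j < length Ps ==> \<exists>X. head (Ps ! j) = Some X \<and> tail (Ps ! Suc j) = Some X"
  and st: "tail (Ps ! 0) = None \<longleftrightarrow> 0 \<notin> I" and en: "head (Ps ! (length Ps - 1)) = None \<longleftrightarrow> 1 \<notin> I"
 shows "\<exists>\<gamma>. traverses I \<gamma> Ps \<and> abs_continuous_on I \<gamma> \<and> closed (\<gamma> ` I)"
proof -
 define n where "n = length Ps"
 have n0: "0 < n" using ne by (simp add: n_def)
 have sub: "{0<..<1} \<subseteq> I" "I \<subseteq> {0..1}" using I by (auto simp: subset_eq)
 define s where "s j = real j / real n" for j
 have s01: "s 0 = 0" "s n = 1" using n0 by (auto simp: s_def)
 have sS: "s (Suc j) - s j = 1 / real n" for j by (simp add: s_def diff_divide_distrib[symmetric])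
 have smono: "s i <= s j" if "i <= j" for i j using that by (simp add: s_def divide_right_mono)
 define idx where "idx x = (LEAST j. x <= s (Suc j))" for x
 define \<gamma> where "\<gamma> x = unit_param (Ps ! idx x) (real n * (x - s (idx x)))" for x
 have loc: "real n * (x - s j) \<in> unit_domain (Ps ! j) \<longleftrightarrow> x \<in> I \<inter> {s j..s (Suc j)}" if j: "j < n" for x j
 proof -
  let ?y = "real n * (x - s j)"
  have y: "0 <= ?y \<longleftrightarrow> s j <= x" "?y <= 1 \<longleftrightarrow> x <= s (Suc j)" "?y = 0 \<longleftrightarrow> x = s j" "?y = 1 \<longleftrightarrow> x = s (Suc j)"
  proof -
   have "?y = real n * x - real j" using n0 by (simp add: s_def right_diff_distrib)
   moreover have "s j <= x \<longleftrightarrow> real j <= real n * x" "x <= s (Suc j) \<longleftrightarrow> real n * x <= real j + 1"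
    "x = s j \<longleftrightarrow> real n * x = real j" "x = s (Suc j) \<longleftrightarrow> real n * x = real j + 1"
    using n0 by (auto simp: s_def field_simps)
   ultimately show "0 <= ?y \<longleftrightarrow> s j <= x" "?y <= 1 \<longleftrightarrow> x <= s (Suc j)" "?y = 0 \<longleftrightarrow> x = s j" "?y = 1 \<longleftrightarrow> x = s (Suc j)"
    by auto
  qed
  have t: "tail (Ps ! j) = None \<longleftrightarrow> s j \<notin> I"
  proof (cases j)
   case 0 then show ?thesis using st s01 by simp
  next
   case (Suc i)
   have "0 < s j" "s j < 1" using j n0 Suc by (auto simp: s_def)
   then have "s j \<in> I" using sub by auto
   moreover have "tail (Ps ! j) ~= None" using cons[of i] j Suc by (auto simp: n_def)
   ultimately show ?thesis by simp
  qed
  have h: "head (Ps ! j) = None \<longleftrightarrow> s (Suc j) \<notin> I"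
  proof (cases "Suc j = n")
   case True then show ?thesis using en s01 by (metis diff_Suc_1 n_def)
  next
   case False
   then have "0 < s (Suc j)" "s (Suc j) < 1" using j n0 by (auto simp: s_def)
   then have "s (Suc j) \<in> I" using sub by auto
   moreover have "head (Ps ! j) ~= None" using cons[of j] j False by (auto simp: n_def)
   ultimately show ?thesis by simp
  qed
  have "0 <= s j" "s (Suc j) <= 1" using smono[of 0 j] smono[of "Suc j" n] s01 j by auto
  moreover have "x \<in> I" if "s j < x" "x < s (Suc j)" using that calculation sub by auto
  moreover have "x \<in> I ==> s j <= x ==> s j \<notin> I ==> s j < x" "x \<in> I ==> x <= s (Suc j) ==> s (Suc j) \<notin> I ==> x < s (Suc j)"
   by (auto simp: less_le)
  moreover have dm: "?y \<in> unit_domain (Ps ! j) \<longleftrightarrow> 0 <= ?y \<and> ?y <= 1 \<and> (s j \<in> I \<or> ?y ~= 0) \<and> (s (Suc j) \<in> I \<or> ?y ~= 1)"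
   unfolding unit_domain_def t h by auto
  ultimately show ?thesis unfolding dm y by (auto simp: less_le)
 qed
 have gam: "\<gamma> x = unit_param (Ps ! j) (real n * (x - s j))" if j: "j < n" and x: "s j <= x" "x <= s (Suc j)" for x j
 proof (cases "s j < x \<or> j = 0")
  case True
  have "idx x = j" unfolding idx_def
  proof (rule Least_equality[where P = "\<lambda>j. x <= s (Suc j)", OF x(2)])
   fix i assume i: "x <= s (Suc i)"
   show "j <= i"
   proof (rule ccontr)
    assume "\<not> j <= i"
    then have "s (Suc i) <= s j" "j ~= 0" by (auto intro: smono)
    then show False using True i by auto
   qed
  qed
  then show ?thesis by (simp add: \<gamma>_def)
 next
  case False
  then obtain i where i: "j = Suc i" "x = s j" using x by (cases j) auto
  have "idx x = i" unfolding idx_def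
  proof (rule Least_equality[where P = "\<lambda>j. x <= s (Suc j)"])
   show "x <= s (Suc i)" using i by simp
   fix m assume m: "x <= s (Suc m)"
   show "i <= m" using m i n0 by (simp add: s_def divide_le_cancel)
  qed
  then have "\<gamma> x = unit_param (Ps ! i) 1" using i sS[of i] n0 by (simp add: \<gamma>_def)
  moreover obtain X where "head (Ps ! i) = Some X" "tail (Ps ! j) = Some X" using cons[of i] i j by (auto simp: n_def)
  ultimately show ?thesis using i by (simp add: unit_param_tail unit_param_head)
 qed
 have img: "\<gamma> ` (I \<inter> {s j..s (Suc j)}) = points (Ps ! j)" if j: "j < n" for j
 proof -
  have "\<gamma> ` (I \<inter> {s j..s (Suc j)}) = unit_param (Ps ! j) ` ((\<lambda>x. real n * (x - s j)) ` (I \<inter> {s j..s (Suc j)}))"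
   unfolding image_image using gam[OF j] by (intro image_cong) auto
  also have "(\<lambda>x. real n * (x - s j)) ` (I \<inter> {s j..s (Suc j)}) = unit_domain (Ps ! j)"
  proof (intro equalityI subsetI)
   fix y assume y: "y \<in> unit_domain (Ps ! j)"
   have yy: "real n * ((s j + y / real n) - s j) = y" using n0 by simp
   then have "s j + y / real n \<in> I \<inter> {s j..s (Suc j)}" using loc[OF j, of "s j + y / real n"] y by simp
   then show "y \<in> (\<lambda>x. real n * (x - s j)) ` (I \<inter> {s j..s (Suc j)})" using yy by (metis image_eqI)
  next
   fix y assume "y \<in> (\<lambda>x. real n * (x - s j)) ` (I \<inter> {s j..s (Suc j)})"
   then obtain x where "x \<in> I \<inter> {s j..s (Suc j)}" "y = real n * (x - s j)" by blast
   then show "y \<in> unit_domain (Ps ! j)" using loc[OF j, of x] by blast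
  qed
  finally show ?thesis using unit_param_image[OF val] j by (simp add: n_def)
 qed
 have tr: "traverses I \<gamma> Ps"
  unfolding traverses_def
 proof (intro conjI exI[of _ s] allI impI ballI)
  fix j assume j: "j < length Ps"
  then have jn: "j < n" by (simp add: n_def)
  show "s j < s (Suc j)" using n0 by (simp add: s_def divide_strict_right_mono)
  show "valid_piece (Ps ! j)" using val j by simp
  show "\<gamma> ` (I \<inter> {s j..s (Suc j)}) = points (Ps ! j)" by (rule img[OF jn])
  fix x y assume xy: "x \<in> I \<inter> {s j..s (Suc j)}" "y \<in> I \<inter> {s j..s (Suc j)}" "x < y"
  have "0 < (unit_param (Ps ! j) (real n * (y - s j)) - unit_param (Ps ! j) (real n * (x - s j))) \<bullet> tangent (Ps ! j)"
   using xy n0 loc[OF jn] by (intro unit_param_mono val j) auto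
  then show "0 < (\<gamma> y - \<gamma> x) \<bullet> tangent (Ps ! j)" using gam[OF jn] xy by simp
 qed (use ne s01 n_def in auto)
 have cover: "\<exists>j<n. x \<in> {s j..s (Suc j)}" if x: "x \<in> {0..1}" for x
  using breakpoints_cover[of n s x] n0 s01 x by auto
 have ac: "abs_continuous_on I \<gamma>"
 proof (rule lipschitz_imp_abs_continuous)
  fix a b assume ab: "{a..b} \<subseteq> I"
  have "\<exists>L. L-lipschitz_on ({a..b} \<inter> {s j..s (Suc j)}) \<gamma>" if j: "j < n" for j
  proof -
   let ?c = "real n * (max a (s j) - s j)" and ?d = "real n * (min b (s (Suc j)) - s j)"
   have eq: "{a..b} \<inter> {s j..s (Suc j)} = {max a (s j)..min b (s (Suc j))}" by auto
   have dom: "{?c..?d} \<subseteq> unit_domain (Ps ! j)"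
   proof
    fix y assume y: "y \<in> {?c..?d}"
    let ?x = "s j + y / real n"
    have e: "real n * (?x - s j) = y" using n0 by simp
    have "real n * (max a (s j) - s j) <= real n * (?x - s j)" "real n * (?x - s j) <= real n * (min b (s (Suc j)) - s j)"
     unfolding e using y by auto
    then have "max a (s j) - s j <= ?x - s j" "?x - s j <= min b (s (Suc j)) - s j"
     using n0 by (simp_all only: mult_le_cancel_left_pos of_nat_0_less_iff)
    then have "max a (s j) <= ?x" "?x <= min b (s (Suc j))" by linarith+
    then have "?x \<in> {max a (s j)..min b (s (Suc j))}" by simp
    then have "?x \<in> I \<inter> {s j..s (Suc j)}" using ab eq by blast
    then have "real n * (?x - s j) \<in> unit_domain (Ps ! j)" using loc[OF j, of ?x] by blast
    then show "y \<in> unit_domain (Ps ! j)" using n0 by simp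
   qed
   have "valid_piece (Ps ! j)" using val j by (simp add: n_def)
   then obtain L where L: "L-lipschitz_on {?c..?d} (unit_param (Ps ! j))" using unit_param_lipschitz[OF _ dom] by blast
   have "(L * real n)-lipschitz_on ({a..b} \<inter> {s j..s (Suc j)}) \<gamma>"
   proof (rule lipschitz_onI)
    fix x y assume xy: "x \<in> {a..b} \<inter> {s j..s (Suc j)}" "y \<in> {a..b} \<inter> {s j..s (Suc j)}"
    have "dist (\<gamma> x) (\<gamma> y) = dist (unit_param (Ps ! j) (real n * (x - s j))) (unit_param (Ps ! j) (real n * (y - s j)))"
     using xy gam[OF j] by simp
    also have "... <= L * dist (real n * (x - s j)) (real n * (y - s j))"
     using xy n0 by (intro lipschitz_onD[OF L]) (auto intro!: mult_left_mono)
    also have "dist (real n * (x - s j)) (real n * (y - s j)) = real n * dist x y"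
     by (simp add: dist_real_def abs_mult flip: right_diff_distrib)
    finally show "dist (\<gamma> x) (\<gamma> y) <= L * real n * dist x y" by (simp add: mult.assoc)
   qed (use lipschitz_on_nonneg[OF L] in simp)
   then show ?thesis by blast
  qed
  then obtain L where L: "!!j. j < n ==> (L j)-lipschitz_on ({a..b} \<inter> {s j..s (Suc j)}) \<gamma>" by metis
  define M where "M = (\<Sum>j<n. L j)"
  have "L j <= M" if "j < n" for j
   unfolding M_def using that L lipschitz_on_nonneg by (intro member_le_sum) auto
  then have "M-lipschitz_on {a..b} \<gamma>"
  proof (intro lipschitz_on_closed_Union[where I = "{..<n}" and U = "\<lambda>j. {a..b} \<inter> {s j..s (Suc j)}"])
   show "M-lipschitz_on ({a..b} \<inter> {s j..s (Suc j)}) \<gamma>" if "j \<in> {..<n}" for j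
    using that L[of j] \<open>!!j. j < n ==> L j <= M\<close>[of j] by (auto intro: lipschitz_on_le)
   show "0 <= M" unfolding M_def using L lipschitz_on_nonneg by (intro sum_nonneg) auto
   show "{a..b} \<subseteq> (\<Union>j<n. {a..b} \<inter> {s j..s (Suc j)})"
   proof
    fix x assume x: "x \<in> {a..b}"
    then have "x \<in> {0..1}" using ab sub by blast
    then obtain j where "j < n" "x \<in> {s j..s (Suc j)}" using cover by blast
    then show "x \<in> (\<Union>j<n. {a..b} \<inter> {s j..s (Suc j)})" using x by blast
   qed
  qed auto
  then show "\<exists>L. L-lipschitz_on {a..b} \<gamma>" by blast
 qed
 have "\<gamma> ` I = (\<Union>j<n. points (Ps ! j))"
 proof -
  have "I = (\<Union>j<n. I \<inter> {s j..s (Suc j)})" using cover sub by blast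
  then have "\<gamma> ` I = (\<Union>j<n. \<gamma> ` (I \<inter> {s j..s (Suc j)}))" by (metis image_UN)
  then show ?thesis using img by simp
 qed
 then have "closed (\<gamma> ` I)" using closed_points[OF val] by (auto simp: n_def)
 then show ?thesis using tr ac by blast
qed

section \<open>Networks parallel to a simple network\<close>

fun move_piece :: "(plane => plane) => piece => piece" where
 "move_piece V (Segment a b) = Segment (V a) (V b)"
| "move_piece V (Outgoing a u) = Outgoing (V a) u"
| "move_piece V (Incoming b u) = Incoming (V b) u"

lemma move_tail: "tail (move_piece V Q) = map_option V (tail Q)"
 and move_head: "head (move_piece V Q) = map_option V (head Q)"
 and move_endpoints: "endpoints (move_piece V Q) = V ` endpoints Q"
 and move_is_segment: "is_segment (move_piece V Q) = is_segment Q"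
 by (cases Q; simp)+

lemma parallel_pieces_iff:
 assumes "valid_piece P" "valid_piece Q"
 shows "parallel_pieces P Q \<longleftrightarrow> tangent P = tangent Q"
proof
 assume "parallel_pieces P Q" then show "tangent P = tangent Q" by (simp add: parallel_pieces_def normal_def)
next
 assume t: "tangent P = tangent Q"
 obtain X Y where XY: "X \<in> endpoints P" "Y \<in> endpoints Q" using endpoints_nonempty by blast
 have "affine hull points Q = (+) (Y - X) ` (affine hull points P)"
  unfolding affine_hull_points[OF assms(1) XY(1)] affine_hull_points[OF assms(2) XY(2)] t by (auto simp: image_iff)
 then show "parallel_pieces P Q" using t by (auto simp: parallel_pieces_def normal_def affine_parallel_def)
qed

lemma height_eq:
 assumes v: "valid_piece P" "valid_piece Q" and t: "tangent Q = tangent P"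
  and X: "X \<in> endpoints P" and Y: "Y \<in> endpoints Q"
 shows "height P Q = (Y - X) \<bullet> normal P"
proof -
 let ?t = "tangent P" and ?n = "normal P"
 have nt: "norm ?t = 1" by (rule tangent_norm[OF v(1)])
 define c where "c = (Y - X) \<bullet> ?n"
 have YX: "Y - X = ((Y - X) \<bullet> ?t) *\<^sub>R ?t + c *\<^sub>R ?n"
  using frame_decomp[OF nt, of "Y - X"] by (simp add: c_def normal_def)
 have hulls: "affine hull points P = range (\<lambda>s. X + s *\<^sub>R ?t)" "affine hull points Q = range (\<lambda>s. Y + s *\<^sub>R ?t)"
  using affine_hull_points[OF v(1) X] affine_hull_points[OF v(2) Y] t by auto
 have "distance_vector P Q = c *\<^sub>R ?n"
  unfolding distance_vector_def
 proof (rule the_equality)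
  have "affine hull points Q = (+) (c *\<^sub>R ?n) ` (affine hull points P)"
  proof -
   have "Y + s *\<^sub>R ?t = c *\<^sub>R ?n + (X + ((Y - X) \<bullet> ?t + s) *\<^sub>R ?t)" for s
   proof -
    have "Y = X + (Y - X)" by simp
    then have "Y = X + (((Y - X) \<bullet> ?t) *\<^sub>R ?t + c *\<^sub>R ?n)" using YX by argo
    then have "Y + s *\<^sub>R ?t = X + (((Y - X) \<bullet> ?t) *\<^sub>R ?t + c *\<^sub>R ?n) + s *\<^sub>R ?t" by (rule arg_cong)
    then show ?thesis unfolding scaleR_add_left by (simp only: ac_simps)
   qed
   then have A: "range (\<lambda>s. Y + s *\<^sub>R ?t) = range (\<lambda>s. c *\<^sub>R ?n + (X + ((Y - X) \<bullet> ?t + s) *\<^sub>R ?t))" by simp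
   have "range (\<lambda>s. c *\<^sub>R ?n + (X + ((Y - X) \<bullet> ?t + s) *\<^sub>R ?t)) = range (\<lambda>s. c *\<^sub>R ?n + (X + s *\<^sub>R ?t))"
   proof -
    have "surj (\<lambda>s. (Y - X) \<bullet> ?t + s)" by (rule surj_plus)
    then show ?thesis using image_image[of "\<lambda>s. c *\<^sub>R ?n + (X + s *\<^sub>R ?t)" "\<lambda>s. (Y - X) \<bullet> ?t + s" UNIV] by simp
   qed
   then show ?thesis unfolding hulls A by (simp add: image_image)
  qed
  then show "(c *\<^sub>R ?n) \<bullet> ?t = 0 \<and> affine hull points Q = (+) (c *\<^sub>R ?n) ` (affine hull points P)"
   by (simp add: normal_def)
 next
  fix H assume H: "H \<bullet> ?t = 0 \<and> affine hull points Q = (+) H ` (affine hull points P)"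
  have "Y \<in> affine hull points Q" unfolding hulls by (auto intro: range_eqI[of _ _ 0])
  then obtain s where s: "Y = H + (X + s *\<^sub>R ?t)" using H unfolding hulls by auto
  have "H \<bullet> rot90 ?t = c" using s nt by (simp add: c_def normal_def inner_add_left)
  then show "H = c *\<^sub>R ?n"
   using H nt by (intro frame_eqI[OF nt]) (auto simp: normal_def norm_one_inner)
 qed
 then show ?thesis using normal_norm[OF v(1)] by (simp add: height_def c_def norm_one_inner)
qed

context simple_net
begin

definition net :: "(plane => plane) => network" where
 "net V = map (map (move_piece V)) S0"

text \<open>\<open>V\<close> moves the vertices. Half-lines keep their lines, since otherwise the symmetric
difference with the original half-line would be unbounded.\<close>
definition placement :: "(plane => plane) => bool" where
 "placement V \<longleftrightarrow> (\<forall>i\<in>Ix. (\<forall>a b. P i = Segment a b --> (\<exists>l>0. V b - V a = l *\<^sub>R \<tau> i)) \<and>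
  (\<not> is_segment (P i) --> (\<forall>X\<in>ends i. (V X - X) \<bullet> \<nu> i = 0)))"

abbreviation moved :: "(plane => plane) => nat \<times> nat => plane set" where
 "moved V i \<equiv> points (move_piece V (P i))"

text \<open>Pieces with a common endpoint leave it at 120 degrees; only the other pairs can collide.\<close>
definition embedded :: "(plane => plane) => bool" where
 "embedded V \<longleftrightarrow> (\<forall>i\<in>Ix. \<forall>j\<in>Ix. i ~= j --> ends i \<inter> ends j = {} -->
  moved V i \<inter> moved V j = {})"

lemma pieces_net [simp]: "pieces (net V) = Ix"
 by (auto simp: pieces_def net_def)

lemma piece_at_net: "i \<in> Ix ==> piece_at (net V) i = move_piece V (P i)"
 by (auto simp: pieces_def net_def piece_at_def)

lemma length_net [simp]: "length (net V) = length S0"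
 by (simp add: net_def)

lemma length_net_nth [simp]: "k < length S0 ==> length (net V ! k) = length (S0 ! k)"
 by (simp add: net_def)

lemma curve_start_net: "k < length S0 ==> curve_start (net V ! k) = map_option V (curve_start (S0 ! k))"
 using curve_nonempty by (simp add: curve_start_def net_def hd_map move_tail)

lemma curve_end_net: "k < length S0 ==> curve_end (net V ! k) = map_option V (curve_end (S0 ! k))"
 using curve_nonempty by (simp add: curve_end_def net_def last_map move_head)

lemma curve_endpoints_net: "k < length S0 ==> curve_endpoints (net V ! k) = V ` curve_endpoints (S0 ! k)"
 by (auto simp: curve_endpoints_def curve_start_net curve_end_net option.set_map)

lemma junctions_net: "junctions (net V) = V ` junctions S0"
 by (auto simp: junctions_def curve_endpoints_net)

lemma placement_move:
 assumes V: "placement V" and i: "i \<in> Ix"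
 shows "valid_piece (move_piece V (P i))" "tangent (move_piece V (P i)) = \<tau> i" "inj_on V (ends i)"
proof -
 have "valid_piece (move_piece V (P i)) \<and> tangent (move_piece V (P i)) = \<tau> i \<and> inj_on V (ends i)"
 proof (cases "P i")
  case (Segment a b)
  obtain l where l: "0 < l" "V b - V a = l *\<^sub>R \<tau> i" using V i Segment unfolding placement_def by blast
  have n: "norm (\<tau> i) = 1" using tangent_norm valid i by blast
  have "V a ~= V b" using l n by auto
  moreover have "sgn (V b - V a) = \<tau> i" using l n by (simp add: sgn_div_norm)
  ultimately show ?thesis using Segment by (simp add: inj_on_def)
 next
  case (Outgoing a u) then show ?thesis using valid[OF i] by simp
 next
  case (Incoming a u) then show ?thesis using valid[OF i] by simp
 qed
 then show "valid_piece (move_piece V (P i))" "tangent (move_piece V (P i)) = \<tau> i" "inj_on V (ends i)" by auto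
qed

lemma normal_move: "placement V ==> i \<in> Ix ==> normal (move_piece V (P i)) = \<nu> i"
 by (simp add: normal_def placement_move)

lemma dir_from_move:
 assumes V: "placement V" and i: "i \<in> Ix" and X: "X \<in> ends i"
 shows "dir_from (move_piece V (P i)) (V X) = d i X"
proof -
 have "tail (move_piece V (P i)) = Some (V X) \<longleftrightarrow> tail (P i) = Some X"
 proof
  assume "tail (move_piece V (P i)) = Some (V X)"
  then obtain Y where Y: "tail (P i) = Some Y" "V Y = V X" by (auto simp: move_tail)
  then have "Y \<in> ends i" by (simp add: endpoints_iff)
  then have "Y = X" using placement_move(3)[OF V i] X Y(2) by (meson inj_onD)
  then show "tail (P i) = Some X" using Y by simp
 qed (simp add: move_tail)
 then show ?thesis by (simp add: dir_from_def placement_move[OF V i])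
qed

lemma mem_move_iff:
 assumes V: "placement V" and i: "i \<in> Ix"
 shows "p \<in> moved V i \<longleftrightarrow> (\<forall>X\<in>ends i. \<exists>s\<ge>0. p = V X + s *\<^sub>R d i X)"
 unfolding mem_points_iff[OF placement_move(1)[OF V i]] move_endpoints using dir_from_move[OF V i] by auto

lemma vertex_mem_move: "placement V ==> i \<in> Ix ==> X \<in> ends i ==> V X \<in> moved V i"
 using endpoints_subset_points[OF placement_move(1)] move_endpoints by blast

lemma incident_not_parallel:
 assumes "i \<in> inc X" "j \<in> inc X" "i ~= j" "s *\<^sub>R d i X = r *\<^sub>R d j X" "0 <= s" "0 <= r"
 shows "s = 0" "r = 0"
proof -
 have n: "d i X \<bullet> d i X = 1" "d j X \<bullet> d j X = 1" using assms d_norm by (auto simp: incident_def norm_one_inner)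
 have ip: "d i X \<bullet> d j X = -1/2" using incident_inner assms by blast
 have "(s *\<^sub>R d i X) \<bullet> d i X = (r *\<^sub>R d j X) \<bullet> d i X" using assms by simp
 then have "s = - r / 2" using n ip by (simp add: inner_commute)
 then show "s = 0" "r = 0" using assms by auto
qed

text \<open>Both pieces are rays seen from a common endpoint, and rays with different directions have only
their origin in common.\<close>
lemma embedded_meet:
 assumes V: "placement V" and E: "embedded V" and ij: "i \<in> Ix" "j \<in> Ix" "i ~= j"
  and p: "p \<in> moved V i" "p \<in> moved V j"
 shows "\<exists>Z\<in>ends i \<inter> ends j. p = V Z"
proof -
 have "ends i \<inter> ends j ~= {}" using E ij p unfolding embedded_def by blast
 then obtain Z where Z: "Z \<in> ends i" "Z \<in> ends j" by blast
 obtain s r where s: "0 <= s" "p = V Z + s *\<^sub>R d i Z" and r: "0 <= r" "p = V Z + r *\<^sub>R d j Z"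
  using p Z mem_move_iff[OF V ij(1)] mem_move_iff[OF V ij(2)] by blast
 have "s *\<^sub>R d i Z = r *\<^sub>R d j Z" using s(2) r(2) by simp
 then have "s = 0" using incident_not_parallel(1)[of i Z j s r] Z ij s r by (auto simp: incident_def)
 then show ?thesis using s Z by auto
qed

lemma embedded_inj:
 assumes V: "placement V" and E: "embedded V"
 shows "inj_on V Vx"
proof (rule inj_onI)
 fix X Y assume XY: "X \<in> Vx" "Y \<in> Vx" "V X = V Y"
 obtain i j where ij: "i \<in> Ix" "X \<in> ends i" "j \<in> Ix" "Y \<in> ends j"
  using XY by (auto simp: vertices_def)
 show "X = Y"
 proof (cases "i = j")
  case True then show ?thesis using placement_move(3)[OF V ij(1)] ij XY by (auto dest: inj_onD)
 next
  case False
  obtain Z where Z: "Z \<in> ends i" "Z \<in> ends j" "V X = V Z"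
   using embedded_meet[OF V E ij(1,3) False] vertex_mem_move[OF V] ij XY by (metis IntD1 IntD2)
  then show ?thesis using placement_move(3)[OF V ij(1)] placement_move(3)[OF V ij(3)] ij XY by (metis inj_onD)
 qed
qed

lemma embedded_id: "embedded (\<lambda>X. X)"
proof -
 have "move_piece (\<lambda>X. X) Q = Q" for Q by (cases Q) auto
 then show ?thesis using separate by (auto simp: embedded_def)
qed

lemma net_id: "net (\<lambda>X. X) = S0"
proof -
 have "move_piece (\<lambda>X. X) = (\<lambda>Q. Q)" by (rule ext, case_tac Q) auto
 then show ?thesis by (simp add: net_def map_idI)
qed

lemma half_line_ends:
 assumes "(k, j) \<in> Ix" and prm: "parametrization I \<gamma> s"
 shows "tail (P (k, j)) = None \<longleftrightarrow> j = 0 \<and> 0 \<notin> I k" "head (P (k, j)) = None \<longleftrightarrow> Suc j = length (S0 ! k) \<and> 1 \<notin> I k"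
proof -
 have k: "k < length S0" "j < length (S0 ! k)" using assms by (auto simp: pieces_def)
 have in01: "s k m \<in> I k" if "0 < m" "m < length (S0 ! k)" for m
  using param_mono[OF prm k(1), of 0 m] param_mono[OF prm k(1), of m "length (S0 ! k)"] param_0[OF prm k(1)] param_1[OF prm k(1)]
   param_interval[OF prm k(1)] that by auto
 show "tail (P (k, j)) = None \<longleftrightarrow> j = 0 \<and> 0 \<notin> I k"
  using param_tail[OF prm assms(1)] in01[of j] k param_0[OF prm k(1)] by (cases "j = 0") auto
 show "head (P (k, j)) = None \<longleftrightarrow> Suc j = length (S0 ! k) \<and> 1 \<notin> I k"
  using param_head[OF prm assms(1)] in01[of "Suc j"] k param_1[OF prm k(1)] by (cases "Suc j = length (S0 ! k)") auto
qed

text \<open>A parameter value at which two curves agree gives, by \<open>embedded_meet\<close>, a common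
vertex, and vertices were visited only once by the original curves. The moved network is connected because
pieces that meet in \<open>S0\<close> share a vertex and therefore still meet.\<close>
lemma polygonal_net:
 assumes V: "placement V" and E: "embedded V"
 shows "polygonal_network (net V)"
proof -
 obtain I \<gamma>0 s0 where prm: "parametrization I \<gamma>0 s0" using parametrized by blast
 have PQ: "net V ! k ! j = move_piece V (P (k, j))" if "(k, j) \<in> Ix" for k j
  using piece_at_net[OF that, of V] by simp
 have "\<exists>\<gamma>. traverses (I k) \<gamma> (net V ! k) \<and> abs_continuous_on (I k) \<gamma> \<and> closed (\<gamma> ` I k)" if k: "k < length S0" for k
 proof (rule curve_through_pieces)
  have ix: "(k, j) \<in> Ix \<longleftrightarrow> j < length (S0 ! k)" for j using k by (auto simp: pieces_def)
  have n0: "0 < length (S0 ! k)" using curve_nonempty[OF k] by simp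
  show "net V ! k ~= []" using n0 k by (metis length_greater_0_conv length_net_nth)
  show "valid_piece (net V ! k ! j)" if "j < length (net V ! k)" for j
  proof -
   have "(k, j) \<in> Ix" using that k ix by simp
   then show ?thesis using placement_move(1)[OF V, of "(k, j)"] PQ[of k j] by (simp del: piece_at_pair)
  qed
  show "I k \<in> {{0..1}, {0..<1}, {0<..<1}}" by (rule param_shape[OF prm k])
  show "\<exists>X. head (net V ! k ! j) = Some X \<and> tail (net V ! k ! Suc j) = Some X" if j: "Suc j < length (net V ! k)" for j
  proof -
   have i: "(k, Suc j) \<in> Ix" "(k, j) \<in> Ix" using j k ix by auto
   then obtain X where "head (P (k, j)) = Some X" "tail (P (k, Suc j)) = Some X" using consecutive by blast
   then show ?thesis using PQ[OF i(1)] PQ[OF i(2)] by (simp add: move_head move_tail)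
  qed
  show "tail (net V ! k ! 0) = None \<longleftrightarrow> 0 \<notin> I k"
   using half_line_ends(1)[OF _ prm, of k 0] PQ[of k 0] ix n0 by (simp add: move_tail)
  show "head (net V ! k ! (length (net V ! k) - 1)) = None \<longleftrightarrow> 1 \<notin> I k"
   using half_line_ends(2)[OF _ prm, of k "length (S0 ! k) - 1"] PQ[of k "length (S0 ! k) - 1"] ix n0 k by (simp add: move_head)
 qed
 then obtain \<gamma> where g: "!!k. k < length S0 ==> traverses (I k) (\<gamma> k) (net V ! k)"
  "!!k. k < length S0 ==> abs_continuous_on (I k) (\<gamma> k)" "!!k. k < length S0 ==> closed (\<gamma> k ` I k)" by metis
 have rng0: "s0 k m \<in> {0<..<1}" if "k < length S0" "0 < m" "m < length (S0 ! k)" for k m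
  using param_mono[OF prm that(1), of 0 m] param_mono[OF prm that(1), of m "length (S0 ! k)"] param_0[OF prm that(1)] param_1[OF prm that(1)] that by auto
 have "\<exists>s. s 0 = 0 \<and> s (length (S0 ! k)) = 1 \<and> (\<forall>j<length (S0 ! k).
  \<gamma> k ` (I k \<inter> {s j..s (Suc j)}) = moved V (k, j) \<and>
  tail (move_piece V (P (k, j))) = (if s j \<in> I k then Some (\<gamma> k (s j)) else None) \<and>
  head (move_piece V (P (k, j))) = (if s (Suc j) \<in> I k then Some (\<gamma> k (s (Suc j))) else None) \<and>
  inj_on (\<gamma> k) (I k \<inter> {s j..s (Suc j)}))" if k: "k < length S0" for k
 proof -
  obtain s where s: "s 0 = 0" "s (length (net V ! k)) = 1"
   "!!j. j < length (net V ! k) ==> \<gamma> k ` (I k \<inter> {s j..s (Suc j)}) = points (net V ! k ! j)"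
   "!!j. j < length (net V ! k) ==> tail (net V ! k ! j) = (if s j \<in> I k then Some (\<gamma> k (s j)) else None)"
   "!!j. j < length (net V ! k) ==> head (net V ! k ! j) = (if s (Suc j) \<in> I k then Some (\<gamma> k (s (Suc j))) else None)"
   "!!j. j < length (net V ! k) ==> inj_on (\<gamma> k) (I k \<inter> {s j..s (Suc j)})"
   by (rule traverses_partition[OF g(1)[OF k] param_shape[OF prm k]]) blast
  have "net V ! k ! j = move_piece V (P (k, j))" if "j < length (S0 ! k)" for j
   using PQ[of k j] that k by (simp add: pieces_def)
  then show ?thesis using s k by (intro exI[of _ s]) (simp del: piece_at_pair)
 qed
 then obtain s where "\<forall>k. k < length S0 --> s k 0 = 0 \<and> s k (length (S0 ! k)) = 1 \<and> (\<forall>j<length (S0 ! k).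
  \<gamma> k ` (I k \<inter> {s k j..s k (Suc j)}) = moved V (k, j) \<and>
  tail (move_piece V (P (k, j))) = (if s k j \<in> I k then Some (\<gamma> k (s k j)) else None) \<and>
  head (move_piece V (P (k, j))) = (if s k (Suc j) \<in> I k then Some (\<gamma> k (s k (Suc j))) else None) \<and>
  inj_on (\<gamma> k) (I k \<inter> {s k j..s k (Suc j)}))" by metis
 then have s: "s k 0 = 0" "s k (length (S0 ! k)) = 1"
  "j < length (S0 ! k) ==> \<gamma> k ` (I k \<inter> {s k j..s k (Suc j)}) = moved V (k, j)"
  "j < length (S0 ! k) ==> tail (move_piece V (P (k, j))) = (if s k j \<in> I k then Some (\<gamma> k (s k j)) else None)"
  "j < length (S0 ! k) ==> head (move_piece V (P (k, j))) = (if s k (Suc j) \<in> I k then Some (\<gamma> k (s k (Suc j))) else None)"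
  "j < length (S0 ! k) ==> inj_on (\<gamma> k) (I k \<inter> {s k j..s k (Suc j)})"
  if "k < length S0" for k j using that by blast+
 have locate: "\<exists>j<length (S0 ! k). x \<in> I k \<inter> {s k j..s k (Suc j)}" if k: "k < length S0" and x: "x \<in> {0<..<1}" for k x
 proof -
  have "\<exists>j<length (S0 ! k). s k j <= x \<and> x <= s k (Suc j)"
   by (rule breakpoints_cover) (use curve_nonempty[OF k] s(1,2)[OF k] x in auto)
  then show ?thesis using x param_interval[OF prm k] by auto
 qed
 have breakpoint: "\<exists>m. m \<in> {0<..<length (S0 ! k)} \<and> x = s k m \<and> Z = \<gamma>0 k (s0 k m)"
  if k: "k < length S0" "i < length (S0 ! k)" and x: "x \<in> {0<..<1}" "x \<in> I k \<inter> {s k i..s k (Suc i)}"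
   and Z: "Z \<in> ends (k, i)" "\<gamma> k x = V Z" for k i x Z
 proof -
  have ki: "(k, i) \<in> Ix" using k by (simp add: pieces_def)
  have le: "s k i <= s k (Suc i)" using x by simp
  from Z(1) consider "tail (P (k, i)) = Some Z" | "head (P (k, i)) = Some Z" by (auto simp: endpoints_iff)
  then show ?thesis
  proof cases
   case 1
   then have "s k i \<in> I k" "\<gamma> k (s k i) = V Z" using s(4)[OF k] by (auto simp: move_tail split: if_splits)
   then have xe: "x = s k i" using inj_onD[OF s(6)[OF k], of x "s k i"] x Z(2) le by simp
   have "i ~= 0" using xe s(1)[OF k(1)] x by (cases i) auto
   moreover have "Z = \<gamma>0 k (s0 k i)" using 1 param_tail[OF prm ki] by (auto split: if_splits)
   ultimately show ?thesis using xe k by (intro exI[of _ i]) auto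
  next
   case 2
   then have "s k (Suc i) \<in> I k" "\<gamma> k (s k (Suc i)) = V Z" using s(5)[OF k] by (auto simp: move_head split: if_splits)
   then have xe: "x = s k (Suc i)" using inj_onD[OF s(6)[OF k], of x "s k (Suc i)"] x Z(2) le by simp
   have "Suc i ~= length (S0 ! k)" using xe s(2)[OF k(1)] x by auto
   moreover have "Z = \<gamma>0 k (s0 k (Suc i))" using 2 param_head[OF prm ki] by (auto split: if_splits)
   ultimately show ?thesis using xe k by (intro exI[of _ "Suc i"]) auto
  qed
 qed
 have inj: "k = l \<and> x = y" if kl: "k < length S0" "l < length S0" and x: "x \<in> {0<..<1}" and y: "y \<in> {0<..<1}" and eq: "\<gamma> k x = \<gamma> l y" for k l x y
 proof -
  obtain i where i: "i < length (S0 ! k)" "x \<in> I k \<inter> {s k i..s k (Suc i)}" using locate[OF kl(1) x] by blast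
  obtain j where j: "j < length (S0 ! l)" "y \<in> I l \<inter> {s l j..s l (Suc j)}" using locate[OF kl(2) y] by blast
  have ix: "(k, i) \<in> Ix" "(l, j) \<in> Ix" using i j kl by (auto simp: pieces_def)
  have px: "\<gamma> k x \<in> moved V (k, i)" using s(3)[OF kl(1) i(1)] i(2) by blast
  have py: "\<gamma> k x \<in> moved V (l, j)" using s(3)[OF kl(2) j(1)] j(2) unfolding eq by blast
  show ?thesis
  proof (cases "(k, i) = (l, j)")
   case True
   then show ?thesis using inj_onD[OF s(6)[OF kl(1) i(1)] _ i(2), of y] j(2) eq by simp
  next
   case False
   obtain Z where Z: "Z \<in> ends (k, i)" "Z \<in> ends (l, j)" "\<gamma> k x = V Z"
    using embedded_meet[OF V E ix False px py] by blast
   have Z': "\<gamma> l y = V Z" using Z(3) eq by simp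
   obtain m where m: "m \<in> {0<..<length (S0 ! k)}" "x = s k m" "Z = \<gamma>0 k (s0 k m)" using breakpoint[OF kl(1) i(1) x i(2) Z(1) Z(3)] by blast
   obtain m' where m': "m' \<in> {0<..<length (S0 ! l)}" "y = s l m'" "Z = \<gamma>0 l (s0 l m')" using breakpoint[OF kl(2) j(1) y j(2) Z(2) Z'] by blast
   have "\<gamma>0 k (s0 k m) = \<gamma>0 l (s0 l m')" using m m' by simp
   moreover have "s0 k m \<in> {0<..<1}" "s0 l m' \<in> {0<..<1}" using rng0[OF kl(1), of m] rng0[OF kl(2), of m'] m(1) m'(1) by simp_all
   ultimately have kk: "k = l \<and> s0 k m = s0 l m'" using param_inj[OF prm kl, of "s0 k m" "s0 l m'"] by blast
   have "m = m'"
   proof (rule ccontr)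
    assume "m ~= m'"
    then have "m < m' \<or> m' < m" by linarith
    then show False using param_mono[OF prm kl(1), of m m'] param_mono[OF prm kl(1), of m' m] kk m m' by auto
   qed
   then show ?thesis using kk m m' by simp
  qed
 qed
 have curves: "curve (I k) (\<gamma> k)" if "k < length S0" for k
  unfolding curve_def using g[OF that] param_shape[OF prm that] inj[OF that that] by (auto simp: inj_on_def)
 have disj: "\<gamma> k ` {0<..<1} \<inter> \<gamma> l ` {0<..<1} = {}" if "k < length S0" "l < length S0" "k ~= l" for k l
  using inj[OF that(1,2)] that(3) by blast
 have poly: "polygonal_network S0" using simple by (simp add: simple_network_def admissible_def)
 have cards: "(if closed_curve (net V ! k) then 1 else 2)
    <= card {l. l < length (net V) \<and> l ~= k \<and> X \<in> curve_endpoints (net V ! l)}"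
  if k: "k < length S0" and X: "X \<in> curve_endpoints (net V ! k)" for k X
 proof -
  obtain Y where Y: "Y \<in> curve_endpoints (S0 ! k)" "X = V Y" using X curve_endpoints_net[OF k] by blast
  have "(if closed_curve (S0 ! k) then 1 else 2) <= card {l. l < length S0 \<and> l ~= k \<and> Y \<in> curve_endpoints (S0 ! l)}"
   using poly k Y unfolding polygonal_network_def by blast
  also have "... <= card {l. l < length (net V) \<and> l ~= k \<and> X \<in> curve_endpoints (net V ! l)}"
   by (intro card_mono) (auto simp: curve_endpoints_net Y)
  finally have "(if closed_curve (S0 ! k) then 1 else 2) <= card {l. l < length (net V) \<and> l ~= k \<and> X \<in> curve_endpoints (net V ! l)}" .
  moreover have "closed_curve (S0 ! k) ==> closed_curve (net V ! k)"
   unfolding closed_curve_def curve_start_net[OF k] curve_end_net[OF k] by (metis option.map_disc_iff)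
  ultimately show ?thesis by (auto split: if_splits)
 qed
 have supp: "support (net V) = (\<Union>i\<in>Ix. moved V i)" by (simp add: support_def piece_at_net)
 have cl: "closed (\<Union>i\<in>A. moved V i)" if "A \<subseteq> Ix" for A
  using that finite_subset[OF that] by (intro closed_UN ballI closed_points placement_move(1)[OF V]) auto
 have cl0: "closed (\<Union>i\<in>A. points (P i))" if "A \<subseteq> Ix" for A
  using that finite_subset[OF that] by (intro closed_UN ballI closed_points valid) auto
 have "connected (support (net V))"
 proof (rule ccontr)
  assume "\<not> ?thesis"
  then obtain A B where AB: "closed A" "closed B" "support (net V) \<subseteq> A \<union> B" "A \<inter> B \<inter> support (net V) = {}"
   "A \<inter> support (net V) ~= {}" "B \<inter> support (net V) ~= {}" unfolding connected_closed by blast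
  let ?Q = "\<lambda>i. moved V i"
  have sub: "?Q i \<subseteq> support (net V)" if "i \<in> Ix" for i using that supp by blast
  have either: "?Q i \<inter> A = {} \<or> ?Q i \<inter> B = {}" if i: "i \<in> Ix" for i
  proof (rule ccontr)
   assume c: "\<not> ?thesis"
   have "?Q i \<subseteq> A \<union> B" "A \<inter> B \<inter> ?Q i = {}" using sub[OF i] AB by blast+
   then show False using c AB(1,2) connected_points[of "move_piece V (P i)"] unfolding connected_closed by blast
  qed
  define IA where "IA = {i \<in> Ix. ?Q i \<inter> A ~= {}}"
  define IB where "IB = {i \<in> Ix. ?Q i \<inter> B ~= {}}"
  have ne: "IA ~= {}" "IB ~= {}" using AB(5,6) supp unfolding IA_def IB_def by blast+
  have cov: "IA \<union> IB = Ix"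
  proof -
   have "?Q i ~= {}" if "i \<in> Ix" for i using vertex_mem_move[OF V that] endpoints_nonempty[of "P i"] by blast
   then show ?thesis using sub AB(3) by (auto simp: IA_def IB_def) blast
  qed
  have adj: "points (P i) \<inter> points (P j) = {}" if i: "i \<in> IA" and j: "j \<in> IB" for i j
  proof (rule ccontr)
   assume c: "\<not> ?thesis"
   have ij: "i \<in> Ix" "j \<in> Ix" using i j by (auto simp: IA_def IB_def)
   have "i ~= j" using either[OF ij(1)] i j by (auto simp: IA_def IB_def)
   then obtain Z where Z: "Z \<in> ends i" "Z \<in> ends j" using separate[OF ij] c by blast
   then have "V Z \<in> ?Q i" "V Z \<in> ?Q j" using vertex_mem_move[OF V] ij by blast+
   moreover have "?Q i \<inter> B = {}" "?Q j \<inter> A = {}" using either[OF ij(1)] either[OF ij(2)] i j unfolding IA_def IB_def by blast+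
   ultimately show False using sub[OF ij(1)] AB(3) by blast
  qed
  let ?A = "\<Union>i\<in>IA. points (P i)" and ?B = "\<Union>i\<in>IB. points (P i)"
  have "support S0 = ?A \<union> ?B" using cov by (auto simp: support_def)
  moreover have "closed ?A" "closed ?B" by (intro cl0; simp add: IA_def IB_def)+
  moreover have "?A \<inter> ?B = {}" using adj by blast
  moreover have "points (P i) ~= {}" if "i \<in> Ix" for i using endpoints_subset_points[OF valid[OF that]] endpoints_nonempty[of "P i"] by blast
  then have "?A ~= {}" "?B ~= {}" using ne cov by blast+
  ultimately have "\<not> connected (support S0)" using connected_closedD[of "support S0" ?A ?B] by blast
  then show False using poly by (simp add: polygonal_network_def)
 qed
 moreover have "closed (support (net V))" unfolding supp by (rule cl) simp
 ultimately show ?thesis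
  unfolding polygonal_network_def length_net using curves g(1) disj cards by (intro conjI exI[of _ I] exI[of _ \<gamma>]) auto
qed

lemma parallel_net:
 assumes V: "placement V" and E: "embedded V"
 shows "parallel_network S0 (net V)"
 unfolding parallel_network_def
proof (intro conjI allI impI ballI polygonal_net[OF V E] length_net length_net_nth; (assumption)?)
 fix i assume i: "i \<in> Ix"
 note Q = piece_at_net[OF i, of V] and pv = placement_move[OF V i]
 show "parallel_pieces (P i) (piece_at (net V) i)"
  unfolding Q using parallel_pieces_iff[OF valid[OF i] pv(1)] pv(2) by simp
 show "is_segment (P i) ==> is_segment (piece_at (net V) i)" "\<not> is_segment (P i) ==> \<not> is_segment (piece_at (net V) i)"
  unfolding Q by (simp_all add: move_is_segment)
 assume n: "\<not> is_segment (P i)"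
 obtain X where X: "X \<in> ends i" using endpoints_nonempty by blast
 have eX: "ends i = {X}" using n X by (cases "P i") auto
 have d1: "norm (d i X) = 1" using d_norm[OF i] .
 have "(V X - X) \<bullet> \<nu> i = 0" using V i n X unfolding placement_def by blast
 then have "(V X - X) \<bullet> rot90 (d i X) = 0" using dir_from_cases[of "P i" X] by (auto simp: normal_def rot90_minus)
 then have VX: "V X = X + ((V X - X) \<bullet> d i X) *\<^sub>R d i X" using frame_decomp[OF d1, of "V X - X"] by (simp add: algebra_simps)
 define c where "c = (V X - X) \<bullet> d i X"
 have "sym_diff (points (P i)) (points (piece_at (net V) i)) \<subseteq> (\<lambda>s. X + s *\<^sub>R d i X) ` {-\<bar>c\<bar>..\<bar>c\<bar>}"
 proof
  fix p assume p: "p \<in> sym_diff (points (P i)) (points (piece_at (net V) i))"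
  have A: "p \<in> points (P i) \<longleftrightarrow> (\<exists>s\<ge>0. p = X + s *\<^sub>R d i X)" using mem_points_iff[OF valid[OF i]] eX by simp
  have "p \<in> points (piece_at (net V) i) \<longleftrightarrow> (\<exists>s\<ge>0. p = V X + s *\<^sub>R d i X)" unfolding Q using mem_move_iff[OF V i] eX by simp
  also have "... \<longleftrightarrow> (\<exists>s\<ge>c. p = X + s *\<^sub>R d i X)"
  proof
   assume "\<exists>s\<ge>0. p = V X + s *\<^sub>R d i X"
   then obtain s where s: "s \<ge> 0" "p = V X + s *\<^sub>R d i X" by blast
   have "p = X + c *\<^sub>R d i X + s *\<^sub>R d i X" using s(2) VX unfolding c_def by simp
   then have "p = X + (c + s) *\<^sub>R d i X" by (simp add: scaleR_add_left)
   then show "\<exists>s\<ge>c. p = X + s *\<^sub>R d i X" using s(1) by (intro exI[of _ "c + s"]) auto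
  next
   assume "\<exists>s\<ge>c. p = X + s *\<^sub>R d i X"
   then obtain s where s: "s \<ge> c" "p = X + s *\<^sub>R d i X" by blast
   have "V X + (s - c) *\<^sub>R d i X = X + c *\<^sub>R d i X + (s - c) *\<^sub>R d i X" using VX unfolding c_def by simp
   then have "p = V X + (s - c) *\<^sub>R d i X" using s(2) by (simp add: scaleR_diff_left)
   then show "\<exists>s\<ge>0. p = V X + s *\<^sub>R d i X" using s(1) by (intro exI[of _ "s - c"]) auto
  qed
  finally have B: "p \<in> points (piece_at (net V) i) \<longleftrightarrow> (\<exists>s\<ge>c. p = X + s *\<^sub>R d i X)" .
  from p consider "p \<in> points (P i)" "p \<notin> points (piece_at (net V) i)" | "p \<notin> points (P i)" "p \<in> points (piece_at (net V) i)" by blast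
  then show "p \<in> (\<lambda>s. X + s *\<^sub>R d i X) ` {-\<bar>c\<bar>..\<bar>c\<bar>}"
  proof cases
   case 1
   then obtain s where s: "s \<ge> 0" "p = X + s *\<^sub>R d i X" using A by blast
   then have "\<not> s \<ge> c" using 1(2) B by blast
   then show ?thesis using s by (intro image_eqI[of _ _ s]) auto
  next
   case 2
   then obtain s where s: "s \<ge> c" "p = X + s *\<^sub>R d i X" using B by blast
   then have "\<not> s \<ge> 0" using 2(1) A by blast
   then show ?thesis using s by (intro image_eqI[of _ _ s]) auto
  qed
 qed
 moreover have "bounded ((\<lambda>s. X + s *\<^sub>R d i X) ` {-\<bar>c\<bar>..\<bar>c\<bar>})"
  by (intro compact_imp_bounded compact_continuous_image continuous_intros compact_Icc)
 ultimately show "bounded (sym_diff (points (P i)) (points (piece_at (net V) i)))" by (rule bounded_subset[rotated])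
next
 fix i j e f assume "i \<in> Ix" "j \<in> Ix" "e \<in> {tail, head}" "f \<in> {tail, head}" "e (P i) ~= None \<and> e (P i) = f (P j)"
 then show "e (piece_at (net V) i) = f (piece_at (net V) j)"
  by (auto simp: piece_at_net move_tail move_head)
qed

lemma half_line_unbounded:
 assumes n: "norm (u :: plane) = 1" and A: "!!s. c <= s ==> a + s *\<^sub>R u \<in> A" and b: "bounded A"
 shows False
proof -
 obtain B where B: "!!p. p \<in> A ==> norm p <= B" using b by (auto simp: bounded_iff)
 define s where "s = max c (\<bar>B\<bar> + norm a + 1)"
 have "norm (a + s *\<^sub>R u) <= B" using A B by (simp add: s_def)
 moreover have "norm (s *\<^sub>R u) <= norm (a + s *\<^sub>R u) + norm a" by (metis add.commute add_diff_cancel_left' norm_triangle_ineq4)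
 moreover have "0 <= s" by (simp add: s_def le_max_iff_disj)
 then have "norm (s *\<^sub>R u) = s" using n by simp
 ultimately show False by (auto simp: s_def)
qed

text \<open>A half-line that leaves the other one, by its line or by its direction, leaves it along an
unbounded set.\<close>
lemma parallel_half_line:
 assumes v: "valid_piece A" "valid_piece B" and t: "tangent A = tangent B" and n: "\<not> is_segment A" "\<not> is_segment B"
  and b: "bounded (sym_diff (points A) (points B))"
 shows "(\<exists>a a' u. A = Outgoing a u \<and> B = Outgoing a' u \<and> (a' - a) \<bullet> rot90 u = 0) \<or>
  (\<exists>a a' u. A = Incoming a u \<and> B = Incoming a' u \<and> (a' - a) \<bullet> rot90 u = 0)"
proof -
 define d where "d = (\<lambda>P. case P of Outgoing a u => u | Incoming a u => - u | _ => 0)"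
 define x where "x = (\<lambda>P. case P of Outgoing a u => a | Incoming a u => a | _ => 0)"
 have pts: "p \<in> points Q \<longleftrightarrow> 0 <= (p - x Q) \<bullet> d Q \<and> (p - x Q) \<bullet> rot90 (d Q) = 0" "norm (d Q) = 1" "d Q = tangent Q \<or> d Q = - tangent Q"
  if "valid_piece Q" "\<not> is_segment Q" for p Q
 proof -
  have "norm (d Q) = 1" "endpoints Q = {x Q}" "dir_from Q (x Q) = d Q" "d Q = tangent Q \<or> d Q = - tangent Q" using that by (cases Q; auto simp: d_def x_def dir_from_def)+
  then show "p \<in> points Q \<longleftrightarrow> 0 <= (p - x Q) \<bullet> d Q \<and> (p - x Q) \<bullet> rot90 (d Q) = 0" "norm (d Q) = 1" "d Q = tangent Q \<or> d Q = - tangent Q"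
   using mem_points_iff[OF that(1)] ray_iff by auto
 qed
 note pA = pts[OF v(1) n(1)] and pB = pts[OF v(2) n(2)]
 have dd: "d A = d B \<or> d A = - d B" using pA(3) pB(3) t by auto
 have uA: "d A \<bullet> d A = 1" using pA(2) by (simp add: norm_one_inner)
 have inA: "x A + s *\<^sub>R d A \<in> points A" if "0 <= s" for s using that uA unfolding pA(1) by simp
 have onl: "(x A - x B) \<bullet> rot90 (d B) = 0"
 proof (rule ccontr)
  assume c: "(x A - x B) \<bullet> rot90 (d B) ~= 0"
  have "x A + s *\<^sub>R d A \<notin> points B" for s
  proof -
   have "(x A + s *\<^sub>R d A - x B) \<bullet> rot90 (d B) = (x A - x B) \<bullet> rot90 (d B)"
    using dd by (auto simp: inner_add_left inner_diff_left)
   then show ?thesis using c pB(1) by auto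
  qed
  then show False using half_line_unbounded[OF pA(2) _ b, of 0 "x A"] inA by blast
 qed
 have same: "d A = d B"
 proof (rule ccontr)
  assume "d A ~= d B"
  then have op: "d B = - d A" using dd by auto
  have "x A + s *\<^sub>R d A \<notin> points B" if "\<bar>(x A - x B) \<bullet> d A\<bar> + 1 <= s" for s
  proof -
   have "(x A + s *\<^sub>R d A - x B) \<bullet> d B = - ((x A - x B) \<bullet> d A) - s" using uA by (simp add: op inner_add_left inner_diff_left)
   then show ?thesis using that pB(1) by auto
  qed
  moreover have "x A + s *\<^sub>R d A \<in> points A" if "\<bar>(x A - x B) \<bullet> d A\<bar> + 1 <= s" for s using inA that by simp
  ultimately show False using half_line_unbounded[OF pA(2) _ b, of "\<bar>(x A - x B) \<bullet> d A\<bar> + 1" "x A"] by blast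
 qed
 have onl': "(x B - x A) \<bullet> rot90 (d B) = 0" using onl by (simp add: inner_diff_left)
 show ?thesis
 proof (cases A)
  case (Segment a b) then show ?thesis using n by simp
 next
  case A: (Outgoing a u)
  show ?thesis
  proof (cases B)
   case (Segment a b) then show ?thesis using n by simp
  next
   case (Outgoing a' u') then show ?thesis using A t onl' by (simp add: d_def x_def)
  next
   case (Incoming a' u')
   then have "u = - u" using A t same by (simp add: d_def)
   then have "2 *\<^sub>R u = 0" by (metis add.right_inverse scaleR_2)
   then show ?thesis using pA(2) A by (auto simp: d_def)
  qed
 next
  case A: (Incoming a u)
  show ?thesis
  proof (cases B)
   case (Segment a b) then show ?thesis using n by simp
  next
   case (Incoming a' u') then show ?thesis using A t onl' by (simp add: d_def x_def rot90_minus)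
  next
   case (Outgoing a' u')
   then have "u = - u" using A t same by (simp add: d_def)
   then have "2 *\<^sub>R u = 0" by (metis add.right_inverse scaleR_2)
   then show ?thesis using pA(2) A by (auto simp: d_def)
  qed
 qed
qed

lemma polygonal_valid:
 assumes "polygonal_network S" "i \<in> pieces S"
 shows "valid_piece (piece_at S i)"
proof -
 have "\<exists>I \<gamma>. (\<forall>k<length S. curve (I k) (\<gamma> k) \<and> traverses (I k) (\<gamma> k) (S ! k)) \<and>
   (\<forall>k<length S. \<forall>l<length S. k ~= l --> \<gamma> k ` {0<..<1} \<inter> \<gamma> l ` {0<..<1} = {})"
  using assms(1) unfolding polygonal_network_def by (rule conjunct1)
 then obtain I where "\<exists>\<gamma>. (\<forall>k<length S. curve (I k) (\<gamma> k) \<and> traverses (I k) (\<gamma> k) (S ! k)) \<and>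
   (\<forall>k<length S. \<forall>l<length S. k ~= l --> \<gamma> k ` {0<..<1} \<inter> \<gamma> l ` {0<..<1} = {})" ..
 then obtain \<gamma> where "(\<forall>k<length S. curve (I k) (\<gamma> k) \<and> traverses (I k) (\<gamma> k) (S ! k)) \<and>
   (\<forall>k<length S. \<forall>l<length S. k ~= l --> \<gamma> k ` {0<..<1} \<inter> \<gamma> l ` {0<..<1} = {})" ..
 moreover obtain k j where kj: "i = (k, j)" "k < length S" "j < length (S ! k)" using assms(2) by (auto simp: pieces_def)
 ultimately have "traverses (I k) (\<gamma> k) (S ! k)" by blast
 then show ?thesis using kj by (auto simp: traverses_def)
qed

text \<open>Ends that coincide keep coinciding, so the new position of an end depends only on the
vertex.\<close>
lemma parallel_network_placement:
 assumes par: "parallel_network S0 S'"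
 shows "\<exists>V. S' = net V \<and> placement V"
proof -
 have poly: "polygonal_network S'" and len: "length S' = length S0" "!!k. k < length S0 ==> length (S' ! k) = length (S0 ! k)"
  using par unfolding parallel_network_def by blast+
 have pieces: "pieces S' = Ix" using len by (auto simp: pieces_def)
 define Q where "Q = piece_at S'"
 have v: "valid_piece (Q i)" if "i \<in> Ix" for i using polygonal_valid[OF poly] that pieces by (simp add: Q_def)
 have t: "tangent (P i) = tangent (Q i)" if "i \<in> Ix" for i
  using par that parallel_pieces_iff[OF valid[OF that] v[OF that]] unfolding parallel_network_def Q_def by blast
 have seg: "is_segment (P i) ==> is_segment (Q i)" "\<not> is_segment (P i) ==> \<not> is_segment (Q i)"
  "\<not> is_segment (P i) ==> bounded (sym_diff (points (P i)) (points (Q i)))" if "i \<in> Ix" for i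
  using par that unfolding parallel_network_def Q_def by blast+
 have match: "e (Q i) = f (Q j)" if "i \<in> Ix" "j \<in> Ix" "e \<in> {tail, head}" "f \<in> {tail, head}" "e (P i) = Some X" "f (P j) = Some X" for i j e f X
 proof -
  have "e (P i) ~= None \<and> e (P i) = f (P j)" using that by simp
  then show ?thesis using par that(1-4) unfolding parallel_network_def Q_def by blast
 qed
 define V where "V X = (SOME Y. \<exists>i\<in>Ix. \<exists>e\<in>{tail, head}. e (P i) = Some X \<and> e (Q i) = Some Y)" for X
 have V: "V X = Y" if "i \<in> Ix" "e \<in> {tail, head}" "e (P i) = Some X" "e (Q i) = Some Y" for i e X Y
 proof -
  have "\<exists>j\<in>Ix. \<exists>f\<in>{tail, head}. f (P j) = Some X \<and> f (Q j) = Some (V X)"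
   unfolding V_def using that by (intro someI_ex[where P = "\<lambda>Y. \<exists>i\<in>Ix. \<exists>e\<in>{tail, head}. e (P i) = Some X \<and> e (Q i) = Some Y"]) blast
  then obtain j f where "j \<in> Ix" "f \<in> {tail, head}" "f (P j) = Some X" "f (Q j) = Some (V X)" by blast
  then show ?thesis using match[of i j e f X] that by simp
 qed
 have half: "(\<exists>a a' u. P i = Outgoing a u \<and> Q i = Outgoing a' u \<and> (a' - a) \<bullet> rot90 u = 0) \<or>
  (\<exists>a a' u. P i = Incoming a u \<and> Q i = Incoming a' u \<and> (a' - a) \<bullet> rot90 u = 0)" if "i \<in> Ix" "\<not> is_segment (P i)" for i
  using parallel_half_line[OF valid v t] seg that by blast
 have QV: "Q i = move_piece V (P i)" if i: "i \<in> Ix" for i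
 proof (cases "is_segment (P i)")
  case True
  then obtain a b a' b' where ab: "P i = Segment a b" "Q i = Segment a' b'" using seg(1)[OF i] by (metis is_segment.elims(2))
  then have "V a = a'" "V b = b'" using V[OF i, of tail a a'] V[OF i, of head b b'] by auto
  then show ?thesis using ab by simp
 next
  case False
  then show ?thesis using half[OF i] V[OF i, of tail] V[OF i, of head] by auto
 qed
 have "S' = net V"
 proof (rule nth_equalityI)
  fix k assume k: "k < length S'"
  show "S' ! k = net V ! k"
  proof (rule nth_equalityI)
   fix j assume j: "j < length (S' ! k)"
   then have "(k, j) \<in> Ix" using k len by (simp add: pieces_def)
   then show "S' ! k ! j = net V ! k ! j" using QV[of "(k, j)"] piece_at_net[of "(k, j)" V] by (simp add: Q_def)
  qed (use k len in simp)
 qed (use len in simp)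
 moreover have "placement V"
  unfolding placement_def
 proof (intro ballI conjI allI impI)
  fix i a b assume i: "i \<in> Ix" and ab: "P i = Segment a b"
  have q: "Q i = Segment (V a) (V b)" using QV[OF i] ab by simp
  then have ne: "V a ~= V b" using v[OF i] by simp
  then have "V b - V a = dist (V a) (V b) *\<^sub>R \<tau> i" using segment_tangent[OF ne] t[OF i] q by simp
  then show "\<exists>l>0. V b - V a = l *\<^sub>R \<tau> i" using ne by (intro exI[of _ "dist (V a) (V b)"]) auto
 next
  fix i X assume i: "i \<in> Ix" and n: "\<not> is_segment (P i)" and X: "X \<in> ends i"
  then show "(V X - X) \<bullet> \<nu> i = 0" using half[OF i n] QV[OF i] by (auto simp: normal_def)
 qed
 ultimately show ?thesis by blast
qed

lemma height_net:
 assumes V: "placement V" and i: "i \<in> Ix" and X: "X \<in> ends i"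
 shows "height (P i) (piece_at (net V) i) = (V X - X) \<bullet> \<nu> i"
 unfolding piece_at_net[OF i]
 by (rule height_eq[OF valid[OF i] placement_move(1)[OF V i] placement_move(2)[OF V i] X]) (use X in \<open>simp add: move_endpoints\<close>)

end

section \<open>Boundary values of Cahn--Hoffman fields\<close>

definition half_facet :: real where "half_facet = 1 / sqrt 3"

lemma half_facet: "0 < half_facet" "half_facet <= 1" "half_facet = sqrt 3 / 3"
proof -
 show "0 < half_facet" by (simp add: half_facet_def)
 show "half_facet <= 1" by (simp add: half_facet_def)
 show "half_facet = sqrt 3 / 3" by (simp add: half_facet_def real_div_sqrt field_simps)
qed

context simple_net
begin

definition segs :: "(nat \<times> nat) set" where "segs = {i \<in> Ix. is_segment (P i)}"
definition start :: "nat \<times> nat => plane" where "start i = the (tail (P i))"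
definition fin :: "nat \<times> nat => plane" where "fin i = the (head (P i))"
definition sg :: "nat \<times> nat => plane => real" where "sg i X = (if tail (P i) = Some X then 1 else -1)"

text \<open>The possible values \<open>g (i, X)\<close> of the tangential component at the end
\<open>X\<close> of piece \<open>i\<close>. Measured from the vertex, the field on a piece leaving in
direction \<open>d\<close> is \<open>rot90 d + g d\<close>; in this form continuity at simple vertices and
balance at junctions are one condition.\<close>
definition end_data :: "((nat \<times> nat) \<times> plane => real) set" where
 "end_data = {g. (\<forall>z. \<bar>g z\<bar> <= half_facet) \<and>
  (\<forall>X\<in>Vx. (\<Sum>i\<in>inc X. rot90 (d i X) + g (i, X) *\<^sub>R d i X) = 0)}"

definition jump :: "((nat \<times> nat) \<times> plane => real) => nat \<times> nat => real" where
 "jump g i = g (i, fin i) - g (i, start i)"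

definition jump_energy :: "(nat \<times> nat => real) => ((nat \<times> nat) \<times> plane => real) => real" where
 "jump_energy w g = (\<Sum>i\<in>segs. w i * (jump g i)\<^sup>2)"

definition minimizer :: "(nat \<times> nat => real) => ((nat \<times> nat) \<times> plane => real) => bool" where
 "minimizer w g \<longleftrightarrow> g \<in> end_data \<and> (\<forall>g'\<in>end_data. jump_energy w g <= jump_energy w g')"

lemma segs_Ix: "i \<in> segs ==> i \<in> Ix" by (simp add: segs_def)

lemma finite_segs [simp]: "finite segs" by (simp add: segs_def)

lemma seg_ends:
 assumes "i \<in> segs"
 shows "P i = Segment (start i) (fin i)" "tail (P i) = Some (start i)" "head (P i) = Some (fin i)"
  "ends i = {start i, fin i}" "start i ~= fin i"
proof -
 obtain a b where ab: "P i = Segment a b" using assms unfolding segs_def by (auto elim: is_segment.elims)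
 then show "P i = Segment (start i) (fin i)" by (simp add: start_def fin_def)
 then show "tail (P i) = Some (start i)" "head (P i) = Some (fin i)" "ends i = {start i, fin i}" by (simp_all only: tail.simps head.simps endpoints_simps)
 show "start i ~= fin i" using valid[OF segs_Ix[OF assms]] ab by (simp add: start_def fin_def)
qed

lemma d_sg: "d i X = sg i X *\<^sub>R \<tau> i"
 by (simp add: dir_from_def sg_def)

lemma sg_ends: "i \<in> segs ==> sg i (start i) = 1" "i \<in> segs ==> sg i (fin i) = -1"
 using seg_ends by (auto simp: sg_def)

lemma sg_sq: "sg i X * sg i X = 1" "sg i X = 1 \<or> sg i X = -1"
 by (auto simp: sg_def)

lemma endpoint_vertex: "i \<in> Ix ==> X \<in> ends i ==> X \<in> Vx"
 by (auto simp: vertices_def)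

lemma inc_iff: "i \<in> inc X \<longleftrightarrow> i \<in> Ix \<and> X \<in> ends i"
 by (auto simp: incident_def)

lemma end_data_bound: "g \<in> end_data ==> \<bar>g z\<bar> <= half_facet"
 unfolding end_data_def by blast

lemma end_data_balance: "g \<in> end_data ==> X \<in> Vx ==> (\<Sum>i\<in>inc X. rot90 (d i X) + g (i, X) *\<^sub>R d i X) = 0"
 unfolding end_data_def by blast

lemma end_dataI: "(!!z. \<bar>g z\<bar> <= half_facet) ==> (!!X. X \<in> Vx ==> (\<Sum>i\<in>inc X. rot90 (d i X) + g (i, X) *\<^sub>R d i X) = 0) ==> g \<in> end_data"
 unfolding end_data_def by blast

lemma inc_unit: "i \<in> inc X ==> norm (d i X) = 1" "i \<in> inc X ==> d i X \<bullet> d i X = 1"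
 using d_norm unfolding norm_one_inner inc_iff by blast+

text \<open>At a simple vertex the field must be the common vertex of two facets.\<close>
lemma end_data_two:
 assumes g: "g \<in> end_data" and X: "X \<in> Vx" and ij: "inc X = {i, j}" "i ~= j"
 shows "g (i, X) = (2/3) * (d j X \<bullet> rot90 (d i X))"
proof -
 have n: "d i X \<bullet> d i X = 1" "d j X \<bullet> d j X = 1" using ij by (auto intro: inc_unit)
 have ip: "d i X \<bullet> d j X = -1/2" using incident_inner ij by blast
 have eq: "rot90 (d i X) + g (i, X) *\<^sub>R d i X + (rot90 (d j X) + g (j, X) *\<^sub>R d j X) = 0"
  using end_data_balance[OF g X] ij by (simp add: add.assoc)
 define k where "k = d j X \<bullet> rot90 (d i X)"
 have k': "rot90 (d j X) \<bullet> d i X = - k" by (simp add: k_def inner_rot90_left)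
 have "(rot90 (d i X) + g (i, X) *\<^sub>R d i X + (rot90 (d j X) + g (j, X) *\<^sub>R d j X)) \<bullet> d i X = 0" using eq by simp
 then have 1: "g (i, X) - k - g (j, X) / 2 = 0" using n ip k' by (simp add: inner_add_left inner_commute[of "d j X" "d i X"])
 have "(rot90 (d i X) + g (i, X) *\<^sub>R d i X + (rot90 (d j X) + g (j, X) *\<^sub>R d j X)) \<bullet> d j X = 0" using eq by simp
 then have 2: "k - g (i, X) / 2 + g (j, X) = 0" using n ip by (simp add: inner_add_left k_def inner_commute[of "d j X" "rot90 (d i X)"])
 show ?thesis unfolding k_def[symmetric] using 1 2 by argo
qed

lemma three_rays_independent:
 assumes X: "inc X = {i, j, k}" "i ~= j" "i ~= k" "j ~= k" and s: "d i X + d j X + d k X = 0"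
  and 0: "a *\<^sub>R d i X + b *\<^sub>R d j X + c *\<^sub>R d k X = 0"
 shows "a = b" "b = c"
proof -
 have n: "d i X \<bullet> d i X = 1" "d j X \<bullet> d j X = 1" "d k X \<bullet> d k X = 1" using X by (auto intro: inc_unit)
 have ip: "d i X \<bullet> d j X = -1/2" "d i X \<bullet> d k X = -1/2" "d j X \<bullet> d k X = -1/2" using incident_inner X by blast+
 have "(a *\<^sub>R d i X + b *\<^sub>R d j X + c *\<^sub>R d k X) \<bullet> d i X = 0" "(a *\<^sub>R d i X + b *\<^sub>R d j X + c *\<^sub>R d k X) \<bullet> d j X = 0"
  using 0 by simp_all
 then have "a - b/2 - c/2 = 0" "- (a/2) + b - c/2 = 0"
  using n ip unfolding inner_add_left inner_scaleR_left inner_commute[of "d j X" "d i X"] inner_commute[of "d k X" "d i X"] inner_commute[of "d k X" "d j X"]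
  by simp_all
 then show "a = b" "b = c" by argo+
qed

text \<open>Three unit vectors at 120 degrees satisfy only one linear relation, so one free parameter
remains.\<close>
lemma end_data_three:
 assumes g: "g \<in> end_data" and X: "X \<in> Vx" "inc X = {i, j, k}" "i ~= j" "i ~= k" "j ~= k" and s: "d i X + d j X + d k X = 0"
 shows "g (i, X) = g (j, X)" "g (j, X) = g (k, X)"
proof -
 have "(\<Sum>i\<in>{i, j, k}. rot90 (d i X) + g (i, X) *\<^sub>R d i X) = 0"
  using end_data_balance[OF g X(1)] unfolding X(2) .
 then have "rot90 (d i X + d j X + d k X) + (g (i, X) *\<^sub>R d i X + g (j, X) *\<^sub>R d j X + g (k, X) *\<^sub>R d k X) = 0"
  using X(3-5) by (simp add: rot90_add algebra_simps)
 then have "g (i, X) *\<^sub>R d i X + g (j, X) *\<^sub>R d j X + g (k, X) *\<^sub>R d k X = 0" using s by (simp add: rot90_zero)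
 then show "g (i, X) = g (j, X)" "g (j, X) = g (k, X)" using three_rays_independent[OF X(2-5) s] by auto
qed

lemma incident_cross:
 assumes "i \<in> inc X" "j \<in> inc X" "i ~= j"
 shows "\<bar>d j X \<bullet> rot90 (d i X)\<bar> = sqrt 3 / 2"
proof -
 have n: "norm (d i X) = 1" "norm (d j X) = 1" using assms d_norm by (auto simp: inc_iff)
 have "\<bar>d j X \<bullet> d i X\<bar> = 1/2" using incident_inner[OF assms(2,1)] assms by simp
 from unit_inner_half[OF n(2,1) this] have "\<bar>d j X \<bullet> rot90 (d i X)\<bar> = \<bar>sqrt 3 / 2\<bar>" by (metis abs_minus_cancel)
 then show ?thesis by simp
qed

lemma end_data_nonempty: "end_data ~= {}"
proof -
 define g where "g = (\<lambda>(i, X). if X \<in> Vx \<and> i \<in> inc X then (2/3) * ((\<Sum>j\<in>inc X. d j X) \<bullet> rot90 (d i X)) else 0)"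
 have "\<bar>g (i, X)\<bar> <= half_facet \<and> (X \<in> Vx --> (\<Sum>i\<in>inc X. rot90 (d i X) + g (i, X) *\<^sub>R d i X) = 0)" for i X
 proof (cases "X \<in> Vx")
  case True
  then show ?thesis
  proof (cases rule: star_cases)
   case (two a b)
   have gg: "g (a, X) = (2/3) * (d b X \<bullet> rot90 (d a X))" "g (b, X) = (2/3) * (d a X \<bullet> rot90 (d b X))"
    using two True by (simp_all add: g_def inner_add_left)
   have bnd: "\<bar>g (a, X)\<bar> = half_facet" "\<bar>g (b, X)\<bar> = half_facet"
    using incident_cross[of a X b] incident_cross[of b X a] two by (simp_all add: gg abs_mult half_facet)
   have n: "d a X \<bullet> d a X = 1" "d b X \<bullet> d b X = 1" "norm (d a X) = 1" using two by (auto intro: inc_unit)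
   have ip: "d a X \<bullet> d b X = -1/2" using incident_inner two by blast
   define k where "k = d b X \<bullet> rot90 (d a X)"
   have k': "d a X \<bullet> rot90 (d b X) = - k" by (metis inner_commute inner_rot90_left k_def)
   have kk: "k * k = 3/4"
   proof -
    have "\<bar>k\<bar> = sqrt 3 / 2" using incident_cross[of a X b] two unfolding k_def by simp
    then have "k * k = (sqrt 3 / 2) * (sqrt 3 / 2)" by (metis abs_mult_self_eq)
    then show ?thesis by simp
   qed
   have db: "d b X = (-1/2) *\<^sub>R d a X + k *\<^sub>R rot90 (d a X)"
    using frame_decomp[OF n(3), of "d b X"] ip by (simp add: k_def inner_commute)
   have "rot90 (d a X) + g (a, X) *\<^sub>R d a X + (rot90 (d b X) + g (b, X) *\<^sub>R d b X) = 0"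
   proof (rule frame_eqI[OF n(3)])
    have dbr: "rot90 (d b X) \<bullet> d a X = - k" "rot90 (d b X) \<bullet> rot90 (d a X) = -1/2" "d b X \<bullet> d a X = -1/2" "d b X \<bullet> rot90 (d a X) = k"
    proof -
     show db1: "d b X \<bullet> d a X = -1/2" using ip by (simp only: inner_commute)
     show "rot90 (d b X) \<bullet> d a X = - k" using k' by (simp only: inner_commute)
     show "rot90 (d b X) \<bullet> rot90 (d a X) = -1/2" using db1 by (simp only: inner_rot90_rot90)
     show "d b X \<bullet> rot90 (d a X) = k" by (rule k_def[symmetric])
    qed
    show "(rot90 (d a X) + g (a, X) *\<^sub>R d a X + (rot90 (d b X) + g (b, X) *\<^sub>R d b X)) \<bullet> d a X = 0 \<bullet> d a X"
     unfolding gg k' k_def[symmetric] inner_add_left inner_scaleR_left dbr n(1) by simp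
    show "(rot90 (d a X) + g (a, X) *\<^sub>R d a X + (rot90 (d b X) + g (b, X) *\<^sub>R d b X)) \<bullet> rot90 (d a X) = 0 \<bullet> rot90 (d a X)"
     unfolding gg k' k_def[symmetric] inner_add_left inner_scaleR_left inner_rot90_rot90 dbr n(1) using kk by simp
   qed
   then have "(\<Sum>i\<in>inc X. rot90 (d i X) + g (i, X) *\<^sub>R d i X) = 0" using two by simp
   moreover have "\<bar>g (i, X)\<bar> <= half_facet"
   proof (cases "i \<in> inc X")
    case True then show ?thesis using bnd two(2) by auto
   next
    case False then show ?thesis using half_facet(1) by (simp add: g_def)
   qed
   ultimately show ?thesis by blast
  next
   case (three a b c)
   have s0: "(\<Sum>j\<in>inc X. d j X) = 0" using three by (simp add: add.assoc)
   then have "g (m, X) = 0" for m by (simp add: g_def)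
   moreover have "(\<Sum>i\<in>inc X. rot90 (d i X)) = rot90 (\<Sum>i\<in>inc X. d i X)" using three(1-4) by (simp add: rot90_add)
   ultimately show ?thesis using s0 half_facet(1) by (simp add: rot90_zero)
  qed
 qed (use half_facet(1) in \<open>simp add: g_def\<close>)
 then have "g \<in> end_data" by (intro end_dataI) (auto simp: split_paired_all)
 then show ?thesis by blast
qed

lemma minimizer_exists: "\<exists>g. minimizer w g"
proof -
 let ?B = "PiE UNIV (\<lambda>_. {- half_facet..half_facet}) :: ((nat \<times> nat) \<times> plane => real) set"
 have "compactin (product_topology (\<lambda>_. euclidean) UNIV) ?B"
  by (subst compactin_PiE) auto
 then have cB: "compact ?B" by (simp add: euclidean_product_topology)
 have cont: "continuous_on S (\<lambda>g. g z)" for S and z :: "(nat \<times> nat) \<times> plane" and S' :: "((nat \<times> nat) \<times> plane => real) set"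
  by (rule continuous_on_subset[OF continuous_on_product_coordinates]) simp
 have eq: "end_data = ?B \<inter> (\<Inter>X\<in>Vx. {g. (\<Sum>i\<in>inc X. rot90 (d i X) + g (i, X) *\<^sub>R d i X) = 0})"
  by (auto simp: end_data_def PiE_iff abs_le_iff minus_le_iff)
 have "closed (\<Inter>X\<in>Vx. {g. (\<Sum>i\<in>inc X. rot90 (d i X) + g (i, X) *\<^sub>R d i X) = 0})"
  by (intro closed_INT ballI closed_Collect_eq continuous_intros cont)
 then have "compact end_data" unfolding eq using cB by (rule compact_Int_closed[rotated])
 moreover have "continuous_on end_data (jump_energy w)"
  unfolding jump_energy_def[abs_def] jump_def by (intro continuous_intros cont)
 ultimately show ?thesis using continuous_attains_inf[OF _ end_data_nonempty] unfolding minimizer_def by blast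
qed

lemma end_data_convex:
 assumes "g \<in> end_data" "g' \<in> end_data" "0 <= t" "t <= 1"
 shows "(\<lambda>z. g z + t * (g' z - g z)) \<in> end_data"
proof (rule end_dataI)
 fix z
 have "g z + t * (g' z - g z) = (1 - t) * g z + t * g' z" by (simp add: algebra_simps)
 also have "\<bar>...\<bar> <= (1 - t) * half_facet + t * half_facet"
 proof -
  have "\<bar>(1 - t) * g z\<bar> <= (1 - t) * half_facet" "\<bar>t * g' z\<bar> <= t * half_facet"
   using assms end_data_bound[OF assms(1), of z] end_data_bound[OF assms(2), of z] unfolding abs_mult
   by (simp_all add: mult_left_mono)
  then show ?thesis by linarith
 qed
 finally show "\<bar>g z + t * (g' z - g z)\<bar> <= half_facet" by (simp add: algebra_simps)
next
 fix X assume X: "X \<in> Vx"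
 have "(\<Sum>i\<in>inc X. rot90 (d i X) + (g (i, X) + t * (g' (i, X) - g (i, X))) *\<^sub>R d i X)
  = (1 - t) *\<^sub>R (\<Sum>i\<in>inc X. rot90 (d i X) + g (i, X) *\<^sub>R d i X) + t *\<^sub>R (\<Sum>i\<in>inc X. rot90 (d i X) + g' (i, X) *\<^sub>R d i X)"
  unfolding scaleR_sum_right sum.distrib[symmetric] by (intro sum.cong) (auto simp: algebra_simps)
 then show "(\<Sum>i\<in>inc X. rot90 (d i X) + (g (i, X) + t * (g' (i, X) - g (i, X))) *\<^sub>R d i X) = 0"
  unfolding end_data_balance[OF assms(1) X] end_data_balance[OF assms(2) X] by simp
qed

lemma variational_inequality:
 assumes m: "minimizer w g" and g': "g' \<in> end_data"
 shows "0 <= (\<Sum>i\<in>segs. w i * jump g i * (jump g' i - jump g i))"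
proof (rule ccontr)
 define A where "A = (\<Sum>i\<in>segs. w i * jump g i * (jump g' i - jump g i))"
 define B where "B = (\<Sum>i\<in>segs. w i * (jump g' i - jump g i)\<^sup>2)"
 assume "\<not> ?thesis"
 then have A: "A < 0" by (simp add: A_def)
 define t where "t = min 1 (- A / (\<bar>B\<bar> + 1))"
 have t: "0 < t" "t <= 1"
 proof -
  have "0 < - A / (\<bar>B\<bar> + 1)" using A by (intro divide_pos_pos) auto
  then show "0 < t" "t <= 1" by (simp_all add: t_def)
 qed
 have "t * \<bar>B\<bar> <= - A / (\<bar>B\<bar> + 1) * \<bar>B\<bar>" by (intro mult_right_mono) (auto simp: t_def)
 also have "... <= - A" using A by (simp add: field_simps)
 finally have tB: "t * \<bar>B\<bar> <= - A" .
 define h where "h z = g z + t * (g' z - g z)" for z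
 have "h \<in> end_data" unfolding h_def[abs_def] using m g' t by (intro end_data_convex) (auto simp: minimizer_def)
 then have le: "jump_energy w g <= jump_energy w h" using m by (simp add: minimizer_def)
 have jh: "jump h i = jump g i + t * (jump g' i - jump g i)" for i by (simp add: jump_def h_def algebra_simps)
 have "jump_energy w h = (\<Sum>i\<in>segs. w i * (jump g i)\<^sup>2 + 2 * t * (w i * jump g i * (jump g' i - jump g i)) + t\<^sup>2 * (w i * (jump g' i - jump g i)\<^sup>2))"
  unfolding jump_energy_def jh by (intro sum.cong) (auto simp: power2_eq_square algebra_simps)
 also have "... = jump_energy w g + 2 * t * A + t\<^sup>2 * B"
  unfolding jump_energy_def A_def B_def by (simp add: sum.distrib sum_distrib_left)
 finally have "0 <= 2 * t * A + t\<^sup>2 * B" using le by simp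
 then have "0 <= t * (2 * A + t * B)" by (simp add: power2_eq_square algebra_simps)
 then have "0 <= 2 * A + t * B" using t by (simp add: zero_le_mult_iff)
 moreover have "t * B <= t * \<bar>B\<bar>" using t by (intro mult_left_mono) auto
 ultimately show False using tB A by linarith
qed

lemma jump_bound:
 assumes "g \<in> end_data"
 shows "\<bar>jump g i\<bar> <= 2"
proof -
 show ?thesis using end_data_bound[OF assms, of "(i, fin i)"] end_data_bound[OF assms, of "(i, start i)"] half_facet(2)
  unfolding jump_def by linarith
qed

text \<open>Minimizers need not be unique, but the energy is strictly convex in the jumps.\<close>
lemma minimizer_jump_unique:
 assumes m: "minimizer w g" "minimizer w g'" and w: "!!i. i \<in> segs ==> 0 < w i" and i: "i \<in> segs"
 shows "jump g i = jump g' i"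
proof -
 have "0 <= (\<Sum>i\<in>segs. w i * jump g i * (jump g' i - jump g i)) + (\<Sum>i\<in>segs. w i * jump g' i * (jump g i - jump g' i))"
  using variational_inequality[OF m(1)] variational_inequality[OF m(2)] m by (simp add: minimizer_def)
 also have "... = - (\<Sum>i\<in>segs. w i * (jump g i - jump g' i)\<^sup>2)"
  unfolding sum.distrib[symmetric] sum_negf[symmetric] by (intro sum.cong) (auto simp: power2_eq_square algebra_simps)
 finally have "(\<Sum>i\<in>segs. w i * (jump g i - jump g' i)\<^sup>2) <= 0" by simp
 moreover have nn: "0 <= w i * (jump g i - jump g' i)\<^sup>2" if "i \<in> segs" for i using w[OF that] by simp
 ultimately have "(\<Sum>i\<in>segs. w i * (jump g i - jump g' i)\<^sup>2) = 0" by (intro antisym sum_nonneg) auto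
 then have "w i * (jump g i - jump g' i)\<^sup>2 = 0" using sum_nonneg_eq_0_iff[of segs "\<lambda>i. w i * (jump g i - jump g' i)\<^sup>2"] nn i by simp
 then show ?thesis using w[OF i] by simp
qed

definition crystalline :: "(nat \<times> nat => real) => (nat \<times> nat) \<times> plane => real" where
 "crystalline L = (SOME g. minimizer (\<lambda>i. 1 / L i) g)"

definition curv :: "(nat \<times> nat => real) => nat \<times> nat => real" where
 "curv L i = (if i \<in> segs then jump (crystalline L) i / L i else 0)"

lemma crystalline_min: "minimizer (\<lambda>i. 1 / L i) (crystalline L)"
 unfolding crystalline_def by (rule someI_ex[OF minimizer_exists])

lemma crystalline_data: "crystalline L \<in> end_data"
 using crystalline_min by (simp add: minimizer_def)

lemma curv_minimizer:
 assumes "minimizer (\<lambda>i. 1 / L i) g" "!!i. i \<in> segs ==> 0 < L i" "i \<in> segs"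
 shows "curv L i = jump g i / L i"
 using minimizer_jump_unique[OF crystalline_min assms(1)] assms(2,3) by (simp add: curv_def)

lemma curv_cong:
 assumes "!!i. i \<in> segs ==> L i = L' i"
 shows "curv L = curv L'"
proof -
 have "jump_energy (\<lambda>i. 1 / L i) = jump_energy (\<lambda>i. 1 / L' i)"
  unfolding jump_energy_def using assms by (intro ext sum.cong) auto
 then have "crystalline L = crystalline L'" by (simp add: crystalline_def minimizer_def)
 then show ?thesis unfolding curv_def using assms by auto
qed

lemma curv_bound:
 assumes "0 < \<delta>" "!!i. i \<in> segs ==> \<delta> <= L i"
 shows "\<bar>curv L i\<bar> <= 2 / \<delta>"
proof (cases "i \<in> segs")
 case True
 have "\<bar>jump (crystalline L) i\<bar> / L i <= 2 / \<delta>"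
  using jump_bound[OF crystalline_data, of L i] assms(1) assms(2)[OF True] by (intro frac_le) auto
 then show ?thesis using True assms(1) assms(2)[OF True] by (simp add: curv_def abs_divide)
qed (use assms in \<open>simp add: curv_def\<close>)

text \<open>The two variational inequalities, each tested with the other minimizer, are added up.\<close>
lemma curv_lipschitz:
 assumes \<delta>: "0 < \<delta>" and L: "!!i. i \<in> segs ==> \<delta> <= L i" and L': "!!i. i \<in> segs ==> \<delta> <= L' i"
 shows "\<bar>curv L i - curv L' i\<bar> <= (2 * (real (card segs) + 1) / \<delta>\<^sup>2) * (\<Sum>j\<in>segs. \<bar>L j - L' j\<bar>)"
proof (cases "i \<in> segs")
 case False
 then show ?thesis using \<delta> by (auto simp: curv_def intro!: mult_nonneg_nonneg sum_nonneg divide_nonneg_nonneg)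
next
 case i: True
 define w where "w i = 1 / L i" for i
 define w' where "w' i = 1 / L' i" for i
 define p where "p = jump (crystalline L)"
 define p' where "p' = jump (crystalline L')"
 define S where "S = (\<Sum>j\<in>segs. \<bar>L j - L' j\<bar>)"
 define R where "R = (\<Sum>j\<in>segs. w j * \<bar>p j - p' j\<bar>)"
 define A where "A = (\<Sum>j\<in>segs. w j * (p j - p' j)\<^sup>2)"
 define n where "n = real (card segs)"
 have w: "0 < w j" "w j <= 1 / \<delta>" and w': "0 < w' j" "w' j <= 1 / \<delta>" if "j \<in> segs" for j
  using L[OF that] L'[OF that] \<delta> by (auto simp: w_def w'_def frac_le)
 have p': "\<bar>p' j\<bar> <= 2" for j unfolding p'_def by (rule jump_bound[OF crystalline_data])
 have dw: "\<bar>w' j - w j\<bar> <= S / \<delta> * w j" "\<bar>w' j - w j\<bar> <= S / \<delta>\<^sup>2" if j: "j \<in> segs" for j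
 proof -
  have pos: "0 < L j" "0 < L' j" using L[OF j] L'[OF j] \<delta> by auto
  have "w' j - w j = (L j - L' j) * (w' j * w j)" using pos by (simp add: w_def w'_def field_simps)
  then have "\<bar>w' j - w j\<bar> = \<bar>L j - L' j\<bar> * (w' j * w j)" using w[OF j] w'[OF j] by (simp add: abs_mult)
  also have "... <= S * (1 / \<delta> * w j)"
  proof (intro mult_mono)
   show "\<bar>L j - L' j\<bar> <= S" unfolding S_def using j by (intro member_le_sum) auto
  qed (use w[OF j] w'[OF j] \<delta> in \<open>auto simp: S_def intro!: sum_nonneg\<close>)
  finally show 1: "\<bar>w' j - w j\<bar> <= S / \<delta> * w j" by simp
  also have "... <= S / \<delta> * (1 / \<delta>)" using w[OF j] \<delta> by (intro mult_left_mono) (auto simp: S_def intro!: sum_nonneg divide_nonneg_nonneg)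
  finally show "\<bar>w' j - w j\<bar> <= S / \<delta>\<^sup>2" by (simp add: power2_eq_square)
 qed
 have S0: "0 <= S" by (simp add: S_def sum_nonneg)
 have R0: "0 <= R" unfolding R_def using w by (intro sum_nonneg mult_nonneg_nonneg) (auto intro: less_imp_le)
 have "0 <= (\<Sum>j\<in>segs. w j * p j * (p' j - p j)) + (\<Sum>j\<in>segs. w' j * p' j * (p j - p' j))"
  using variational_inequality[OF crystalline_min[of L] crystalline_data[of L']]
   variational_inequality[OF crystalline_min[of L'] crystalline_data[of L]]
  by (simp add: w_def w'_def p_def p'_def)
 also have "... = (\<Sum>j\<in>segs. (w' j - w j) * p' j * (p j - p' j)) - A"
  unfolding A_def sum.distrib[symmetric] sum_subtractf[symmetric] by (intro sum.cong) (auto simp: power2_eq_square algebra_simps)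
 finally have "A <= (\<Sum>j\<in>segs. (w' j - w j) * p' j * (p j - p' j))" by simp
 also have "... <= (\<Sum>j\<in>segs. (2 * S / \<delta>) * (w j * \<bar>p j - p' j\<bar>))"
 proof (rule sum_mono)
  fix j assume j: "j \<in> segs"
  have "(w' j - w j) * p' j * (p j - p' j) <= \<bar>w' j - w j\<bar> * \<bar>p' j\<bar> * \<bar>p j - p' j\<bar>" by (metis abs_ge_self abs_mult)
  also have "... <= (S / \<delta> * w j) * 2 * \<bar>p j - p' j\<bar>"
   using dw[OF j] p'[of j] w[OF j] \<delta> S0 by (intro mult_mono mult_nonneg_nonneg divide_nonneg_nonneg) auto
  finally show "(w' j - w j) * p' j * (p j - p' j) <= (2 * S / \<delta>) * (w j * \<bar>p j - p' j\<bar>)" by (simp add: algebra_simps)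
 qed
 also have "... = (2 * S / \<delta>) * R" by (simp add: R_def sum_distrib_left)
 finally have AR: "A <= (2 * S / \<delta>) * R" .
 have "R\<^sup>2 <= n * (\<Sum>j\<in>segs. (w j * \<bar>p j - p' j\<bar>)\<^sup>2)"
  using Cauchy_Schwarz_ineq_sum[of "\<lambda>_. 1" "\<lambda>j. w j * \<bar>p j - p' j\<bar>" segs] by (simp add: R_def n_def)
 also have "... <= n * (\<Sum>j\<in>segs. (1 / \<delta>) * (w j * (p j - p' j)\<^sup>2))"
 proof (intro mult_left_mono sum_mono)
  fix j assume j: "j \<in> segs"
  have "(w j * \<bar>p j - p' j\<bar>)\<^sup>2 = w j * (w j * (p j - p' j)\<^sup>2)" by (simp add: power2_eq_square algebra_simps flip: abs_mult)
  also have "... <= (1 / \<delta>) * (w j * (p j - p' j)\<^sup>2)" using w[OF j] by (intro mult_right_mono) auto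
  finally show "(w j * \<bar>p j - p' j\<bar>)\<^sup>2 <= (1 / \<delta>) * (w j * (p j - p' j)\<^sup>2)" .
 qed (simp add: n_def)
 also have "... = n / \<delta> * A" by (simp add: A_def sum_distrib_left sum_divide_distrib)
 also have "... <= n / \<delta> * ((2 * S / \<delta>) * R)" using AR \<delta> by (intro mult_left_mono) (auto simp: n_def)
 finally have "R * R <= (2 * n / \<delta>\<^sup>2 * S) * R" by (simp add: power2_eq_square algebra_simps)
 then have R: "R <= 2 * n / \<delta>\<^sup>2 * S"
 proof (cases "R = 0")
  case True then show ?thesis using S0 by (simp add: n_def)
 next
  case False
  then have "0 < R" using R0 by simp
  then show ?thesis using \<open>R * R <= (2 * n / \<delta>\<^sup>2 * S) * R\<close> by (simp only: mult_le_cancel_right_pos)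
 qed
 have "curv L i - curv L' i = w i * (p i - p' i) + (w i - w' i) * p' i"
  using i by (simp add: curv_def w_def w'_def p_def p'_def algebra_simps)
 also have "\<bar>...\<bar> <= w i * \<bar>p i - p' i\<bar> + \<bar>w' i - w i\<bar> * \<bar>p' i\<bar>"
  using w[OF i] by (intro order_trans[OF abs_triangle_ineq]) (simp add: abs_mult abs_minus_commute)
 also have "... <= R + S / \<delta>\<^sup>2 * 2"
 proof (intro add_mono mult_mono)
  show "w i * \<bar>p i - p' i\<bar> <= R" unfolding R_def
   by (rule member_le_sum[OF i, of "\<lambda>j. w j * \<bar>p j - p' j\<bar>"]) (use w(1) in \<open>auto intro!: mult_nonneg_nonneg intro: less_imp_le\<close>)
 qed (use dw(2)[OF i] p' S0 in auto)
 also have "... <= 2 * n / \<delta>\<^sup>2 * S + S / \<delta>\<^sup>2 * 2" using R by simp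
 also have "... = (2 * (n + 1) / \<delta>\<^sup>2) * S" by (simp add: add_divide_distrib algebra_simps)
 finally show ?thesis by (simp add: S_def n_def)
qed

text \<open>If the common value at a junction is inside \<open>{- 1 / sqrt 3..1 / sqrt 3}\<close>, it can be
varied freely and the sum is the derivative of the energy. If it is at an end, all neighbouring values lie on
one side of it; this gives a sign, and moving the common value inwards gives the opposite sign.\<close>
lemma curv_junction:
 assumes X: "X \<in> junctions S0" and L: "!!i. i \<in> segs ==> 0 < L i"
 shows "(\<Sum>i\<in>inc X. sg i X * curv L i) = 0"
proof -
 define g where "g = crystalline L"
 have m: "minimizer (\<lambda>i. 1 / L i) g" and gd: "g \<in> end_data" unfolding g_def by (rule crystalline_min crystalline_data)+
 have XV: "X \<in> Vx" using X junctions_subset_vertices by blast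
 from XV obtain a b c where abc: "a ~= b" "a ~= c" "b ~= c" "inc X = {a, b, c}" "d a X + d b X + d c X = 0"
  using X by (cases rule: star_cases) auto
 define x where "x = g (a, X)"
 have gx: "g (i, X) = x" if "i \<in> inc X" for i
  using end_data_three[OF gd XV abc(4,1,2,3,5)] that abc(4) by (auto simp: x_def)
 have bx: "\<bar>x\<bar> <= half_facet" unfolding x_def by (rule end_data_bound[OF gd])
 let ?s = "\<Sum>i\<in>inc X \<inter> segs. sg i X * (jump g i / L i)"
 have key: "0 <= - \<eta> * ?s" if \<eta>: "\<bar>x + \<eta>\<bar> <= half_facet" for \<eta>
 proof -
  define g' where "g' = (\<lambda>(i, Y). g (i, Y) + (if Y = X \<and> i \<in> inc X then \<eta> else 0))"
  have "g' \<in> end_data"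
  proof (rule end_dataI)
   fix z show "\<bar>g' z\<bar> <= half_facet" using end_data_bound[OF gd, of z] gx \<eta> by (cases z) (auto simp: g'_def)
  next
   fix Y assume Y: "Y \<in> Vx"
   have b: "(\<Sum>i\<in>inc Y. rot90 (d i Y) + g (i, Y) *\<^sub>R d i Y) = 0" by (rule end_data_balance[OF gd Y])
   show "(\<Sum>i\<in>inc Y. rot90 (d i Y) + g' (i, Y) *\<^sub>R d i Y) = 0"
   proof (cases "Y = X")
    case True
    have "(\<Sum>i\<in>inc X. rot90 (d i X) + g' (i, X) *\<^sub>R d i X) = (\<Sum>i\<in>inc X. rot90 (d i X) + g (i, X) *\<^sub>R d i X) + \<eta> *\<^sub>R (\<Sum>i\<in>inc X. d i X)"
     unfolding scaleR_sum_right sum.distrib[symmetric] by (intro sum.cong) (auto simp: g'_def algebra_simps)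
    moreover have "(\<Sum>i\<in>inc X. d i X) = 0" using abc by (simp add: add.assoc)
    ultimately show ?thesis using b True by simp
   next
    case False then show ?thesis using b by (simp add: g'_def)
   qed
  qed
  from variational_inequality[OF m this]
  have "0 <= (\<Sum>i\<in>segs. 1 / L i * jump g i * (jump g' i - jump g i))" .
  also have "... = (\<Sum>i\<in>segs. if i \<in> inc X then - \<eta> * (sg i X * (jump g i / L i)) else 0)"
  proof (rule sum.cong[OF refl])
   fix i assume i: "i \<in> segs"
   note e = seg_ends[OF i]
   show "1 / L i * jump g i * (jump g' i - jump g i) = (if i \<in> inc X then - \<eta> * (sg i X * (jump g i / L i)) else 0)"
   proof (cases "i \<in> inc X")
    case True
    then have "X = start i \<or> X = fin i" using e(4) by (auto simp: inc_iff)
    then have "jump g' i - jump g i = - \<eta> * sg i X" using True e(5) sg_ends[OF i] by (auto simp: jump_def g'_def)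
    then show ?thesis using True by simp
   next
    case False
    then show ?thesis by (simp add: jump_def g'_def)
   qed
  qed
  also have "... = (\<Sum>i\<in>segs \<inter> inc X. - \<eta> * (sg i X * (jump g i / L i)))" by (rule sum.inter_restrict[OF finite_segs, symmetric])
  also have "... = - \<eta> * ?s" by (simp add: sum_distrib_left Int_commute)
  finally show ?thesis .
 qed
 have other: "sg i X * jump g i = g (i, Y) - x" if "i \<in> inc X \<inter> segs" "Y = (if X = start i then fin i else start i)" for i Y
 proof -
  have i: "i \<in> segs" "i \<in> inc X" using that by auto
  then have "X = start i \<or> X = fin i" using seg_ends(4)[OF i(1)] by (auto simp: inc_iff)
  then show ?thesis using sg_ends[OF i(1)] seg_ends(5)[OF i(1)] gx[OF i(2)] that(2) by (auto simp: jump_def)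
 qed
 have gb: "\<bar>g z\<bar> <= half_facet" for z by (rule end_data_bound[OF gd])
 have "?s = 0"
 proof (cases "x = half_facet \<or> x = - half_facet")
  case False
  define \<eta> where "\<eta> = half_facet - \<bar>x\<bar>"
  have "0 < \<eta>" using False bx by (auto simp: \<eta>_def abs_if split: if_splits)
  moreover have "\<bar>x + \<eta>\<bar> <= half_facet" "\<bar>x - \<eta>\<bar> <= half_facet" using bx by (auto simp: \<eta>_def)
  ultimately show ?thesis using key[of \<eta>] key[of "- \<eta>"] by (simp add: mult_le_0_iff zero_le_mult_iff)
 next
  case True
  note h0 = half_facet(1)
  from True show ?thesis
  proof
   assume x: "x = half_facet"
   have "0 <= ?s" using key[of "- half_facet"] x h0 by (simp add: zero_le_mult_iff)
   moreover have "?s <= 0"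
   proof (rule sum_nonpos)
    fix i assume i: "i \<in> inc X \<inter> segs"
    have "sg i X * jump g i <= 0" using other[OF i refl] gb[of "(i, if X = start i then fin i else start i)"] x by simp
    then show "sg i X * (jump g i / L i) <= 0" using L[of i] i using divide_nonpos_pos by fastforce
   qed
   ultimately show ?thesis by simp
  next
   assume x: "x = - half_facet"
   have "?s <= 0" using key[of half_facet] x h0 by (simp add: mult_le_0_iff)
   moreover have "0 <= ?s"
   proof (rule sum_nonneg)
    fix i assume i: "i \<in> inc X \<inter> segs"
    have "0 <= sg i X * jump g i" using other[OF i refl] gb[of "(i, if X = start i then fin i else start i)"] x by simp
    then show "0 <= sg i X * (jump g i / L i)" using L[of i] i using divide_nonneg_pos by fastforce
   qed
   ultimately show ?thesis by simp
  qed
 qed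
 moreover have "(\<Sum>i\<in>inc X. sg i X * curv L i) = ?s"
  unfolding curv_def g_def by (simp add: sum.inter_restrict if_distrib cong: if_cong)
 ultimately show ?thesis by simp
qed

end

section \<open>Minimal Cahn--Hoffman fields\<close>

lemma AE_lebesgue_interval:
 assumes ae: "AE s in lebesgue. s \<in> D --> \<Phi> s" and sub: "{c<..<e} \<subseteq> D" and ce: "c < (e::real)"
 shows "\<exists>s\<in>{c<..<e}. \<Phi> s"
proof (rule ccontr)
 assume "\<not> ?thesis"
 then have n: "\<not> \<Phi> s" if "s \<in> {c<..<e}" for s using that by blast
 have "AE s in lebesgue. s \<notin> {c<..<e}" using ae
 proof eventually_elim
  case (elim s) then show ?case using sub n by blast
 qed
 then have "emeasure lebesgue {c<..<e} = 0"
  by (subst (asm) AE_iff_measurable[of "{c<..<e}"]) auto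
 then show False using ce by simp
qed

lemma arc_domain_interval:
 assumes v: "valid_piece Q" and s: "s \<in> arc_domain Q" and d: "0 < \<delta>"
 shows "\<exists>c e. c < e \<and> {c<..<e} \<subseteq> arc_domain Q \<and> {c<..<e} \<subseteq> {s - \<delta><..<s + \<delta>}"
proof (cases Q)
 case (Segment a b)
 then have l: "0 < dist a b" "0 <= s" "s <= dist a b" using v s by auto
 show ?thesis
 proof (cases "s < dist a b")
  case True
  then show ?thesis using l d Segment by (intro exI[of _ s] exI[of _ "min (dist a b) (s + \<delta>)"]) auto
 next
  case False
  then show ?thesis using l d Segment by (intro exI[of _ "max 0 (s - \<delta>)"] exI[of _ s]) auto
 qed
next
 case (Outgoing a u)
 then show ?thesis using s d by (intro exI[of _ s] exI[of _ "s + \<delta>"]) auto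
next
 case (Incoming a u)
 then show ?thesis using s d by (intro exI[of _ "s - \<delta>"] exI[of _ s]) auto
qed

text \<open>A field along a single piece, as it is seen by the definition of a Cahn--Hoffman field.\<close>
locale field_on_piece =
 fixes Q :: piece and N :: "plane => plane" and C :: real
 assumes v: "valid_piece Q" and hex: "tangent Q \<in> hexdir"
  and lip: "C-lipschitz_on (points Q) N"
  and fr: "N ` points Q \<subseteq> frontier wulff"
  and ae: "AE s in lebesgue. s \<in> arc_domain Q --> N (arc_point Q s) \<bullet> normal Q = phi_dual (normal Q)"
begin

abbreviation "e \<equiv> tangent Q"
definition g :: "real => real" where "g s = N (arc_point Q s) \<bullet> e"
text \<open>The tangential divergence, whose value is unspecified where the field is not
differentiable.\<close>
definition vd :: "real => real" where "vd s = vector_derivative (\<lambda>r. N (arc_point Q r)) (at s) \<bullet> e"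

lemma ne: "norm e = 1" using hexdir_norm[OF hex] .

lemma lip_arc: "C-lipschitz_on (arc_domain Q) (\<lambda>s. N (arc_point Q s))"
proof (rule lipschitz_onI)
 fix r s assume "r \<in> arc_domain Q" "s \<in> arc_domain Q"
 then have "dist (N (arc_point Q r)) (N (arc_point Q s)) <= C * dist (arc_point Q r) (arc_point Q s)"
  by (intro lipschitz_onD[OF lip] arc_point_mem)
 then show "dist (N (arc_point Q r)) (N (arc_point Q s)) <= C * dist r s" by (simp add: arc_point_dist[OF v])
qed (rule lipschitz_on_nonneg[OF lip])

lemma lip_g: "C-lipschitz_on (arc_domain Q) g"
proof (rule lipschitz_onI)
 fix r s assume rs: "r \<in> arc_domain Q" "s \<in> arc_domain Q"
 have "dist (g r) (g s) = \<bar>(N (arc_point Q r) - N (arc_point Q s)) \<bullet> e\<bar>" by (simp add: g_def dist_real_def inner_diff_left)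
 also have "... <= norm (N (arc_point Q r) - N (arc_point Q s)) * norm e" by (rule Cauchy_Schwarz_ineq2)
 also have "... <= C * dist r s" using lipschitz_onD[OF lip_arc rs] ne by (simp add: dist_norm)
 finally show "dist (g r) (g s) <= C * dist r s" .
qed (rule lipschitz_on_nonneg[OF lip])

lemma normal_one:
 assumes s: "s \<in> arc_domain Q"
 shows "N (arc_point Q s) \<bullet> rot90 e = 1"
proof (rule ccontr)
 assume ne1: "\<not> ?thesis"
 let ?F = "\<lambda>s. N (arc_point Q s) \<bullet> rot90 e"
 have "continuous_on (arc_domain Q) ?F"
  using lipschitz_on_continuous_on[OF lip_arc] by (intro continuous_intros)
 moreover have "0 < \<bar>?F s - 1\<bar>" using ne1 by simp
 ultimately obtain \<delta> where \<delta>: "0 < \<delta>" "!!r. r \<in> arc_domain Q ==> dist r s < \<delta> ==> dist (?F r) (?F s) < \<bar>?F s - 1\<bar>"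
  using s unfolding continuous_on_iff by blast
 obtain c e' where ce: "c < e'" "{c<..<e'} \<subseteq> arc_domain Q" "{c<..<e'} \<subseteq> {s - \<delta><..<s + \<delta>}"
  using arc_domain_interval[OF v s \<delta>(1)] by blast
 obtain r where r: "r \<in> {c<..<e'}" "N (arc_point Q r) \<bullet> normal Q = phi_dual (normal Q)"
  using AE_lebesgue_interval[OF ae ce(2,1)] by blast
 have "?F r = 1" using r(2) phi_dual_rot90[OF hex] by (simp add: normal_def)
 moreover have "r \<in> arc_domain Q" "r \<in> {s - \<delta><..<s + \<delta>}" using r(1) ce by blast+
 moreover from this(2) have "dist r s < \<delta>" by (auto simp: dist_real_def)
 ultimately show False using \<delta>(2)[of r] by (simp add: dist_real_def abs_minus_commute)
qed

lemma field_eq: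
 assumes s: "s \<in> arc_domain Q"
 shows "N (arc_point Q s) = rot90 e + g s *\<^sub>R e" "\<bar>g s\<bar> <= half_facet"
 using facet_point_eq[OF hex _ normal_one[OF s]] fr arc_point_mem[OF s] unfolding g_def half_facet_def by blast+

lemma vd_eq_deriv:
 assumes s: "s \<in> interior (arc_domain Q)" and d: "g differentiable (at s)"
 shows "vd s = deriv g s"
proof -
 have "(g has_vector_derivative deriv g s) (at s)"
  using d by (simp add: DERIV_deriv_iff_real_differentiable flip: has_real_derivative_iff_has_vector_derivative)
 then have "((\<lambda>r. rot90 e + g r *\<^sub>R e) has_vector_derivative deriv g s *\<^sub>R e) (at s)"
  by (auto intro!: derivative_eq_intros simp flip: has_real_derivative_iff_has_vector_derivative)
 then have "((\<lambda>r. N (arc_point Q r)) has_vector_derivative deriv g s *\<^sub>R e) (at s)"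
  by (rule has_vector_derivative_transform_within_open[OF _ open_interior s]) (use field_eq interior_subset in \<open>metis subsetD\<close>)
 then show ?thesis using ne by (simp add: vd_def vector_derivative_at norm_one_inner)
qed

lemma energy_interval:
 assumes ab: "a < b" "{a..b} \<subseteq> arc_domain Q"
 shows "ennreal (((g b - g a) / (b - a))\<^sup>2 * (b - a)) <= (\<integral>\<^sup>+s. ennreal ((vd s)\<^sup>2) * indicator {a..b} s \<partial>lebesgue)"
  and "(\<integral>\<^sup>+s. ennreal ((vd s)\<^sup>2) * indicator {a..b} s \<partial>lebesgue) <= ennreal (((g b - g a) / (b - a))\<^sup>2 * (b - a)) ==>
   AE s in lebesgue. s \<in> {a..b} --> vd s = (g b - g a) / (b - a)"
proof -
 have L: "C-lipschitz_on {a..b} g" using lip_g ab(2) by (rule lipschitz_on_subset)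
 have D: "vd s = deriv g s" if "a < s" "s < b" "g differentiable (at s)" for s
 proof -
  have "s \<in> {a<..<b}" using that by simp
  moreover have "{a<..<b} \<subseteq> arc_domain Q" using ab(2) by (meson greaterThanLessThan_subseteq_atLeastAtMost_iff order_refl subset_trans)
  ultimately have "s \<in> interior (arc_domain Q)" by (meson interior_maximal open_greaterThanLessThan subsetD)
  then show ?thesis using vd_eq_deriv that by blast
 qed
 note E = lipschitz_energy[OF L ab(1), of vd]
 show "ennreal (((g b - g a) / (b - a))\<^sup>2 * (b - a)) <= (\<integral>\<^sup>+s. ennreal ((vd s)\<^sup>2) * indicator {a..b} s \<partial>lebesgue)"
  by (rule E(1)) (rule D)
 assume "(\<integral>\<^sup>+s. ennreal ((vd s)\<^sup>2) * indicator {a..b} s \<partial>lebesgue) <= ennreal (((g b - g a) / (b - a))\<^sup>2 * (b - a))"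
 then show "AE s in lebesgue. s \<in> {a..b} --> vd s = (g b - g a) / (b - a)"
  by (intro E(2)) (use D in auto)
qed

lemma zero_energy:
 assumes z: "(\<integral>\<^sup>+s. ennreal ((vd s)\<^sup>2) * indicator (arc_domain Q) s \<partial>lebesgue) <= 0"
 shows "AE s in lebesgue. s \<in> arc_domain Q --> vd s = 0"
proof -
 have part: "AE s in lebesgue. s \<in> {a..b} --> vd s = 0" if ab: "a < b" "{a..b} \<subseteq> arc_domain Q" for a b
 proof -
  have "(\<integral>\<^sup>+s. ennreal ((vd s)\<^sup>2) * indicator {a..b} s \<partial>lebesgue) <= (\<integral>\<^sup>+s. ennreal ((vd s)\<^sup>2) * indicator (arc_domain Q) s \<partial>lebesgue)"
   using ab(2) by (intro nn_integral_mono mult_left_mono) (auto simp: indicator_def)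
  then have le: "(\<integral>\<^sup>+s. ennreal ((vd s)\<^sup>2) * indicator {a..b} s \<partial>lebesgue) <= 0" using z by simp
  then have "ennreal (((g b - g a) / (b - a))\<^sup>2 * (b - a)) <= 0" using energy_interval(1)[OF ab] by simp
  moreover have "0 <= ((g b - g a) / (b - a))\<^sup>2 * (b - a)" using ab(1) by simp
  ultimately have "((g b - g a) / (b - a))\<^sup>2 * (b - a) = 0" using ennreal_eq_0_iff by simp
  then have c: "(g b - g a) / (b - a) = 0" using ab(1) by simp
  have "AE s in lebesgue. s \<in> {a..b} --> vd s = (g b - g a) / (b - a)"
   by (rule energy_interval(2)[OF ab]) (use le c in simp)
  then show ?thesis using c by simp
 qed
 define J where "J n = (case Q of Segment a b => {0..dist a b} | Outgoing a u => {0..real (Suc n)} | Incoming a u => {- real (Suc n)..0})" for n :: nat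
 have "AE s in lebesgue. s \<in> J n --> vd s = 0" for n
 proof (cases Q)
  case (Segment a b) then show ?thesis using v part[of 0 "dist a b"] by (simp add: J_def)
 next
  case (Outgoing a u) then show ?thesis using part[of 0 "real (Suc n)"] by (simp add: J_def)
 next
  case (Incoming a u) then show ?thesis using part[of "- real (Suc n)" 0] by (simp add: J_def)
 qed
 then have "AE s in lebesgue. \<forall>n. s \<in> J n --> vd s = 0" by (subst AE_all_countable) blast
 moreover have ex: "\<exists>n. s \<in> J n" if s: "s \<in> arc_domain Q" for s
 proof -
  obtain n where "\<bar>s\<bar> <= real n" using real_arch_simple by blast
  then show ?thesis using s by (cases Q) (auto simp: J_def intro!: exI[of _ n])
 qed
 ultimately show ?thesis by (auto elim!: eventually_mono dest!: ex)
qed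

end

text \<open>If lower bounds add up to the total, each of them is attained.\<close>
lemma ennreal_sum_tight:
 fixes E :: "'a => ennreal" and c :: "'a => real"
 assumes fin: "finite A" and c: "!!i. i \<in> A ==> 0 <= c i" and le: "!!i. i \<in> A ==> ennreal (c i) <= E i"
  and sum: "(\<Sum>i\<in>A. E i) <= ennreal (\<Sum>i\<in>A. c i)" and i: "i \<in> A"
 shows "E i <= ennreal (c i)"
proof -
 have "E i + ennreal (\<Sum>j\<in>A - {i}. c j) <= E i + (\<Sum>j\<in>A - {i}. E j)"
  using le c by (intro add_left_mono) (subst sum_ennreal[symmetric], auto intro!: sum_mono)
 also have "... = (\<Sum>j\<in>A. E j)" using fin i by (simp add: sum.remove)
 also have "... <= ennreal (\<Sum>j\<in>A. c j)" by (rule sum)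
 also have "... = ennreal (c i) + ennreal (\<Sum>j\<in>A - {i}. c j)"
  unfolding sum.remove[OF fin i] using c i by (intro ennreal_plus sum_nonneg) auto
 finally show ?thesis by (simp add: ennreal_add_left_cancel_le add.commute)
qed

context simple_net
begin

definition len :: "(plane => plane) => nat \<times> nat => real" where
 "len V i = (V (fin i) - V (start i)) \<bullet> \<tau> i"

lemma len_pos:
 assumes V: "placement V" and i: "i \<in> segs"
 shows "0 < len V i" "V (fin i) = V (start i) + len V i *\<^sub>R \<tau> i" "dist (V (start i)) (V (fin i)) = len V i"
proof -
 obtain l where l: "0 < l" "V (fin i) - V (start i) = l *\<^sub>R \<tau> i" using V seg_ends(1)[OF i] segs_Ix[OF i] unfolding placement_def by blast
 have n: "\<tau> i \<bullet> \<tau> i = 1" "norm (\<tau> i) = 1" using tangent_norm[OF valid[OF segs_Ix[OF i]]] by (auto simp: norm_one_inner)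
 have ll: "len V i = l" using l n by (simp add: len_def)
 then show "0 < len V i" using l by simp
 show VV: "V (fin i) = V (start i) + len V i *\<^sub>R \<tau> i" using l ll by (simp add: algebra_simps)
 then show "dist (V (start i)) (V (fin i)) = len V i" using n l ll by (simp add: dist_norm)
qed

lemma half_line_end:
 assumes "i \<in> Ix" "i \<notin> segs"
 obtains X where "ends i = {X}" "X \<in> Vx"
proof -
 have "\<not> is_segment (P i)" using assms by (simp add: segs_def)
 then obtain X where X: "ends i = {X}" by (cases "P i") auto
 then have "X \<in> Vx" using assms(1) endpoint_vertex by blast
 then show thesis using X that by blast
qed

context
 fixes V
 assumes V: "placement V" and E: "embedded V"
begin

definition Q :: "nat \<times> nat => piece" where "Q i = move_piece V (P i)"

lemma Q_net: "i \<in> Ix ==> piece_at (net V) i = Q i"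
 by (simp add: Q_def piece_at_net)

lemma Q_valid: "i \<in> Ix ==> valid_piece (Q i)" and Q_tangent: "i \<in> Ix ==> tangent (Q i) = \<tau> i"
 and Q_normal: "i \<in> Ix ==> normal (Q i) = \<nu> i"
 using placement_move[OF V] by (auto simp: Q_def normal_def)

lemma Q_segment: "i \<in> segs ==> Q i = Segment (V (start i)) (V (fin i))"
proof -
 assume i: "i \<in> segs"
 show ?thesis using arg_cong[OF seg_ends(1)[OF i], of "move_piece V"] by (simp add: Q_def)
qed

lemma Q_arc_segment:
 assumes i: "i \<in> segs"
 shows "arc_domain (Q i) = {0..len V i}" "arc_point (Q i) 0 = V (start i)" "arc_point (Q i) (len V i) = V (fin i)"
proof -
 show "arc_domain (Q i) = {0..len V i}" "arc_point (Q i) 0 = V (start i)"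
  using Q_segment[OF i] len_pos(3)[OF V i] by auto
 then show "arc_point (Q i) (len V i) = V (fin i)"
  unfolding arc_point_line[of "Q i" "len V i"] using len_pos(2)[OF V i] Q_tangent[OF segs_Ix[OF i]] by simp
qed

lemma CH_field_on_piece:
 assumes N: "CH_field (net V) N" and i: "i \<in> Ix"
 shows "\<exists>C. field_on_piece (Q i) (N i) C"
proof -
 have "N i ` points (Q i) \<subseteq> frontier wulff \<and> (\<exists>C. C-lipschitz_on (points (Q i)) (N i)) \<and>
   (AE s in lebesgue. s \<in> arc_domain (Q i) --> N i (arc_point (Q i) s) \<bullet> normal (Q i) = phi_dual (normal (Q i)))"
  using bspec[OF conjunct1[OF N[unfolded CH_field_def pieces_net]] i] unfolding Q_net[OF i] .
 then show ?thesis using Q_valid[OF i] Q_tangent[OF i] tangent_hexdir[OF i] by (auto simp: field_on_piece_def)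
qed

lemma vertex_arc:
 assumes i: "i \<in> Ix" and X: "X \<in> ends i"
 shows "\<exists>s\<in>arc_domain (Q i). V X = arc_point (Q i) s"
 using vertex_mem_move[OF V i X] by (auto simp: points_def Q_def)

definition edge_values :: "field => (nat \<times> nat) \<times> plane => real" where
 "edge_values N = (\<lambda>(i, X). if i \<in> Ix \<and> X \<in> ends i then N i (V X) \<bullet> \<tau> i else 0)"

lemma CH_value:
 assumes N: "CH_field (net V) N" and i: "i \<in> Ix" and X: "X \<in> ends i"
 shows "N i (V X) = \<nu> i + edge_values N (i, X) *\<^sub>R \<tau> i" "\<bar>edge_values N (i, X)\<bar> <= half_facet"
proof -
 obtain C where "field_on_piece (Q i) (N i) C" using CH_field_on_piece[OF N i] by blast
 then interpret field_on_piece "Q i" "N i" C .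
 obtain s where s: "s \<in> arc_domain (Q i)" "V X = arc_point (Q i) s" using vertex_arc[OF i X] by blast
 have "g s = edge_values N (i, X)" using i X s Q_tangent[OF i] by (simp add: g_def edge_values_def)
 then show "N i (V X) = \<nu> i + edge_values N (i, X) *\<^sub>R \<tau> i" "\<bar>edge_values N (i, X)\<bar> <= half_facet"
  using field_eq[OF s(1)] s(2) Q_tangent[OF i] by (simp_all add: normal_def)
qed

text \<open>At a simple vertex the incoming piece has sign \<open>-1\<close> and the outgoing one
\<open>1\<close>, so the signed sum is zero exactly when the field is continuous there.\<close>
lemma CH_field_vertex_iff:
 fixes N :: field
 shows "((\<forall>k j X. (k, Suc j) \<in> Ix --> head (piece_at (net V) (k, j)) = Some X --> N (k, j) X = N (k, Suc j) X) \<and>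
  (\<forall>X\<in>junctions (net V).
   (\<Sum>k | k < length (net V) \<and> curve_start (net V ! k) = Some X. N (k, 0) X) -
   (\<Sum>k | k < length (net V) \<and> curve_end (net V ! k) = Some X. N (k, length (net V ! k) - 1) X) = 0)) \<longleftrightarrow>
  (\<forall>X\<in>Vx. (\<Sum>i\<in>inc X. sg i X *\<^sub>R N i (V X)) = 0)" (is "?S \<and> ?J \<longleftrightarrow> ?R")
proof -
 have inj: "V X = V Y \<longleftrightarrow> X = Y" if "X \<in> Vx" "Y \<in> Vx" for X Y
  using embedded_inj[OF V E] that by (meson inj_onD)
 have junc: "(\<Sum>k | k < length (net V) \<and> curve_start (net V ! k) = Some (V X). N (k, 0) (V X)) -
   (\<Sum>k | k < length (net V) \<and> curve_end (net V ! k) = Some (V X). N (k, length (net V ! k) - 1) (V X))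
   = (\<Sum>i\<in>inc X. sg i X *\<^sub>R N i (V X))" if X: "X \<in> junctions S0" for X
 proof -
  have XV: "X \<in> Vx" using X junctions_subset_vertices by blast
  have ends: "Y \<in> Vx" if "k < length S0" "curve_start (S0 ! k) = Some Y \<or> curve_end (S0 ! k) = Some Y" for k Y
   using that junctions_subset_vertices by (auto simp: junctions_def curve_endpoints_def)
  have A: "{k. k < length (net V) \<and> curve_start (net V ! k) = Some (V X)} = {k. k < length S0 \<and> curve_start (S0 ! k) = Some X}"
   using inj[OF _ XV] ends by (auto simp: curve_start_net)
  have B: "{k. k < length (net V) \<and> curve_end (net V ! k) = Some (V X)} = {k. k < length S0 \<and> curve_end (S0 ! k) = Some X}"
   using inj[OF _ XV] ends by (auto simp: curve_end_net)
  let ?A = "{k. k < length S0 \<and> curve_start (S0 ! k) = Some X}" and ?B = "{k. k < length S0 \<and> curve_end (S0 ! k) = Some X}"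
  have sA: "sg (k, 0) X = 1" if "k \<in> ?A" for k
   using that curve_nonempty[of k] by (auto simp: sg_def curve_start_def hd_conv_nth)
  have sB: "sg (k, length (S0 ! k) - 1) X = -1" if "k \<in> ?B" for k
  proof -
   have "(k, length (S0 ! k) - 1) \<in> Ix" "head (P (k, length (S0 ! k) - 1)) = Some X"
    using that curve_nonempty[of k] by (auto simp: pieces_def curve_end_def last_conv_nth)
   then show ?thesis using tail_neq_head[OF valid] unfolding sg_def by metis
  qed
  have "(\<Sum>i\<in>inc X. sg i X *\<^sub>R N i (V X)) = (\<Sum>i\<in>(\<lambda>k. (k, 0)) ` ?A. sg i X *\<^sub>R N i (V X)) + (\<Sum>i\<in>(\<lambda>k. (k, length (S0 ! k) - 1)) ` ?B. sg i X *\<^sub>R N i (V X))"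
   unfolding junction_incident(1)[OF X] by (rule sum.union_disjoint) (use junction_incident(2)[OF X] in auto)
  also have "(\<Sum>i\<in>(\<lambda>k. (k, 0)) ` ?A. sg i X *\<^sub>R N i (V X)) = (\<Sum>k\<in>?A. sg (k, 0) X *\<^sub>R N (k, 0) (V X))"
   by (subst sum.reindex) (auto simp: inj_on_def)
  also have "... = (\<Sum>k\<in>?A. N (k, 0) (V X))" by (rule sum.cong[OF refl]) (simp only: sA scaleR_one)
  also have "(\<Sum>i\<in>(\<lambda>k. (k, length (S0 ! k) - 1)) ` ?B. sg i X *\<^sub>R N i (V X)) = (\<Sum>k\<in>?B. sg (k, length (S0 ! k) - 1) X *\<^sub>R N (k, length (S0 ! k) - 1) (V X))"
   by (subst sum.reindex) (auto simp: inj_on_def)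
  also have "... = (\<Sum>k\<in>?B. - N (k, length (S0 ! k) - 1) (V X))" by (rule sum.cong[OF refl]) (simp only: sB scaleR_minus1_left)
  also have "... = - (\<Sum>k\<in>?B. N (k, length (net V ! k) - 1) (V X))" by (simp add: sum_negf)
  finally show ?thesis unfolding A B by simp
 qed
 have vert: "(\<Sum>i\<in>inc X. sg i X *\<^sub>R N i (V X)) = N (k, Suc j) (V X) - N (k, j) (V X)"
  if kj: "(k, Suc j) \<in> Ix" "(k, j) \<in> Ix" "inc X = {(k, j), (k, Suc j)}" "head (P (k, j)) = Some X" "tail (P (k, Suc j)) = Some X" for X k j
 proof -
  have "sg (k, Suc j) X = 1" using kj(5) by (simp add: sg_def)
  moreover have "sg (k, j) X = -1" using tail_neq_head[OF valid[OF kj(2)]] kj(4) unfolding sg_def by metis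
  ultimately show ?thesis unfolding kj(3) by simp
 qed
 show ?thesis
 proof
  assume SJ: "?S \<and> ?J"
  show ?R
  proof
   fix X assume X: "X \<in> Vx"
   show "(\<Sum>i\<in>inc X. sg i X *\<^sub>R N i (V X)) = 0"
   proof (cases "X \<in> junctions S0")
    case True
    then have "V X \<in> junctions (net V)" by (simp add: junctions_net)
    then show ?thesis using junc[OF True] SJ by simp
   next
    case False
    obtain k j where kj: "(k, Suc j) \<in> Ix" "(k, j) \<in> Ix" "inc X = {(k, j), (k, Suc j)}" "head (P (k, j)) = Some X" "tail (P (k, Suc j)) = Some X"
     using simple_vertex_incident[OF X False] by blast
    have "head (piece_at (net V) (k, j)) = Some (V X)" using kj(4) by (simp add: piece_at_net[OF kj(2)] move_head del: piece_at_pair)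
    then have "N (k, j) (V X) = N (k, Suc j) (V X)" using SJ kj(1) by blast
    then show ?thesis using vert[OF kj] by simp
   qed
  qed
 next
  assume R: ?R
  have ?S
  proof (intro allI impI)
   fix k j Y assume kj: "(k, Suc j) \<in> Ix" and h: "head (piece_at (net V) (k, j)) = Some Y"
   have kj': "(k, j) \<in> Ix" using kj by (auto simp: pieces_def)
   obtain X where X: "head (P (k, j)) = Some X" "tail (P (k, Suc j)) = Some X" using consecutive[OF kj] by blast
   have Y: "Y = V X" using h X by (simp add: piece_at_net[OF kj'] move_head del: piece_at_pair)
   have XV: "X \<in> Vx" using X(1) kj' endpoint_vertex[of "(k, j)" X] by (simp add: endpoints_iff del: piece_at_pair)
   have "X \<notin> junctions S0"
   proof
    assume XJ: "X \<in> junctions S0"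
    have "(k, Suc j) \<in> inc X" "(k, j) \<in> inc X" using kj kj' X by (auto simp: inc_iff endpoints_iff simp del: piece_at_pair)
    then have "(k, Suc j) \<in> (\<lambda>k. (k, length (S0 ! k) - 1)) ` {k. k < length S0 \<and> curve_end (S0 ! k) = Some X}"
     using junction_incident(1)[OF XJ] by auto
    then have "Suc j = length (S0 ! k) - 1" "k < length S0" "curve_end (S0 ! k) = Some X" by auto
    then have "head (P (k, Suc j)) = Some X" using curve_nonempty[of k] by (simp add: curve_end_def last_conv_nth)
    then show False using tail_neq_head[OF valid[OF kj]] X(2) by metis
   qed
   then obtain k' j' where k': "(k', Suc j') \<in> Ix" "(k', j') \<in> Ix" "inc X = {(k', j'), (k', Suc j')}" "head (P (k', j')) = Some X" "tail (P (k', Suc j')) = Some X"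
    using simple_vertex_incident[OF XV] by blast
   have "(k, Suc j) \<in> inc X" "(k, j) \<in> inc X" using kj kj' X by (auto simp: inc_iff endpoints_iff simp del: piece_at_pair)
   then have "k' = k \<and> (j' = Suc j \<or> j' = j)" "j' = j \<or> Suc j' = j" unfolding k'(3) by auto
   then have "k' = k" "j' = j" by auto
   then have "N (k, Suc j) (V X) - N (k, j) (V X) = 0" using vert[OF k'] R XV by simp
   then show "N (k, j) Y = N (k, Suc j) Y" using Y by simp
  qed
  moreover have ?J
  proof
   fix Y assume "Y \<in> junctions (net V)"
   then obtain X where X: "X \<in> junctions S0" "Y = V X" by (auto simp: junctions_net)
   then show "(\<Sum>k | k < length (net V) \<and> curve_start (net V ! k) = Some Y. N (k, 0) Y) -
   (\<Sum>k | k < length (net V) \<and> curve_end (net V ! k) = Some Y. N (k, length (net V ! k) - 1) Y) = 0"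
    using junc[OF X(1)] R junctions_subset_vertices by auto
  qed
  ultimately show "?S \<and> ?J" by blast
 qed
qed

lemma balance_conv:
 assumes X: "X \<in> Vx" and N: "!!i. i \<in> inc X ==> N i (V X) = \<nu> i + t (i, X) *\<^sub>R \<tau> i"
 shows "(\<Sum>i\<in>inc X. sg i X *\<^sub>R N i (V X)) = (\<Sum>i\<in>inc X. rot90 (d i X) + t (i, X) *\<^sub>R d i X)"
proof (rule sum.cong[OF refl])
 fix i assume i: "i \<in> inc X"
 show "sg i X *\<^sub>R N i (V X) = rot90 (d i X) + t (i, X) *\<^sub>R d i X"
  unfolding N[OF i] d_sg by (simp add: rot90_scaleR normal_def scaleR_add_right)
qed

lemma edge_values_end_data:
 assumes N: "CH_field (net V) N"
 shows "edge_values N \<in> end_data"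
proof (rule end_dataI)
 fix z
 show "\<bar>edge_values N z\<bar> <= half_facet"
  using CH_value(2)[OF N] half_facet(1) by (cases z; cases "fst z \<in> Ix \<and> snd z \<in> endpoints (P (fst z))") (auto simp: edge_values_def)
next
 fix X assume X: "X \<in> Vx"
 have "(\<forall>X\<in>Vx. (\<Sum>i\<in>inc X. sg i X *\<^sub>R N i (V X)) = 0)"
  using N CH_field_vertex_iff[of N] unfolding CH_field_def pieces_net by blast
 then have "(\<Sum>i\<in>inc X. sg i X *\<^sub>R N i (V X)) = 0" using X by blast
 then show "(\<Sum>i\<in>inc X. rot90 (d i X) + edge_values N (i, X) *\<^sub>R d i X) = 0"
  using balance_conv[OF X, of N "edge_values N"] CH_value(1)[OF N] by (auto simp: inc_iff)
qed

definition piece_energy :: "field => nat \<times> nat => ennreal" where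
 "piece_energy N i = (\<integral>\<^sup>+s. ennreal ((tangential_div (net V) N i s)\<^sup>2) * indicator (arc_domain (Q i)) s \<partial>lebesgue)"

lemma CH_energy_eq: "CH_energy (net V) N = (\<Sum>i\<in>Ix. piece_energy N i)"
proof -
 have "phi_dual (normal (Q i)) = 1" if "i \<in> Ix" for i
  using phi_dual_rot90[OF tangent_hexdir[OF that]] Q_tangent[OF that] by (simp add: normal_def)
 then show ?thesis unfolding CH_energy_def piece_energy_def pieces_net by (intro sum.cong) (auto simp: Q_net)
qed

definition bound :: "((nat \<times> nat) \<times> plane => real) => nat \<times> nat => real" where
 "bound t i = (if i \<in> segs then 1 / len V i * (jump t i)\<^sup>2 else 0)"

lemma bound_sum: "(\<Sum>i\<in>Ix. bound t i) = jump_energy (\<lambda>i. 1 / len V i) t"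
proof -
 have "segs \<subseteq> Ix" by (auto simp: segs_def)
 then have "Ix \<inter> segs = segs" by blast
 then show ?thesis unfolding bound_def jump_energy_def by (simp add: sum.inter_restrict[symmetric])
qed

lemma bound_nonneg: "0 <= bound t i"
 using len_pos(1)[OF V, of i] unfolding bound_def by (cases "i \<in> segs") (simp_all add: less_imp_le)

lemma piece_energy_bound:
 assumes N: "CH_field (net V) N" and i: "i \<in> Ix"
 shows "ennreal (bound (edge_values N) i) <= piece_energy N i"
  and "piece_energy N i <= ennreal (bound (edge_values N) i) ==>
   AE s in lebesgue. s \<in> arc_domain (Q i) --> tangential_div (net V) N i s = (if i \<in> segs then jump (edge_values N) i / len V i else 0)"
proof -
 obtain C where "field_on_piece (Q i) (N i) C" using CH_field_on_piece[OF N i] by blast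
 then interpret field_on_piece "Q i" "N i" C .
 have vd: "tangential_div (net V) N i s = vd s" for s
  by (simp add: tangential_div_def vd_def Q_net[OF i])
 have bseg: "bound (edge_values N) i = ((g (len V i) - g 0) / (len V i - 0))\<^sup>2 * (len V i - 0)" and jseg: "jump (edge_values N) i / len V i = (g (len V i) - g 0) / (len V i - 0)" if s: "i \<in> segs"
 proof -
  have "g 0 = edge_values N (i, start i)" "g (len V i) = edge_values N (i, fin i)"
   using Q_arc_segment[OF s] i Q_tangent[OF i] seg_ends(4)[OF s] by (simp_all add: g_def edge_values_def)
  then have j: "jump (edge_values N) i = g (len V i) - g 0" by (simp add: jump_def)
  then show "jump (edge_values N) i / len V i = (g (len V i) - g 0) / (len V i - 0)" by simp
  show "bound (edge_values N) i = ((g (len V i) - g 0) / (len V i - 0))\<^sup>2 * (len V i - 0)"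
   using s len_pos(1)[OF V s] unfolding j[symmetric] by (simp add: bound_def power_divide power2_eq_square[of "len V i"])
 qed
 show "ennreal (bound (edge_values N) i) <= piece_energy N i"
 proof (cases "i \<in> segs")
  case True
  then show ?thesis using energy_interval(1)[OF len_pos(1)[OF V True]] Q_arc_segment(1)[OF True]
   unfolding piece_energy_def vd bseg[OF True] by simp
 qed (simp add: bound_def)
 assume le: "piece_energy N i <= ennreal (bound (edge_values N) i)"
 show "AE s in lebesgue. s \<in> arc_domain (Q i) --> tangential_div (net V) N i s = (if i \<in> segs then jump (edge_values N) i / len V i else 0)"
 proof (cases "i \<in> segs")
  case True
  have "AE s in lebesgue. s \<in> {0..len V i} --> vd s = (g (len V i) - g 0) / (len V i - 0)"
  proof (rule energy_interval(2)[OF len_pos(1)[OF V True]])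
   show "{0..len V i} \<subseteq> arc_domain (Q i)" using Q_arc_segment(1)[OF True] by simp
   show "(\<integral>\<^sup>+s. ennreal ((vd s)\<^sup>2) * indicator {0..len V i} s \<partial>lebesgue) <= ennreal (((g (len V i) - g 0) / (len V i - 0))\<^sup>2 * (len V i - 0))"
    using le unfolding piece_energy_def vd bseg[OF True] Q_arc_segment(1)[OF True] .
  qed
  then show ?thesis unfolding vd Q_arc_segment(1)[OF True] jseg[OF True] using True by simp
 next
  case False
  then show ?thesis using zero_energy le unfolding piece_energy_def vd by (simp add: bound_def)
 qed
qed

text \<open>On a half-line the affine interpolation of a single end value is constant.\<close>
definition affine_field :: "((nat \<times> nat) \<times> plane => real) => field" where
 "affine_field t i p = \<nu> i + (if i \<in> segs then t (i, start i) + jump t i / len V i * ((p - V (start i)) \<bullet> \<tau> i)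
  else t (i, SOME X. X \<in> ends i)) *\<^sub>R \<tau> i"

lemma affine_field_vertex:
 assumes i: "i \<in> Ix" and X: "X \<in> ends i"
 shows "affine_field t i (V X) = \<nu> i + t (i, X) *\<^sub>R \<tau> i"
proof (cases "i \<in> segs")
 case True
 have n: "\<tau> i \<bullet> \<tau> i = 1" using tangent_norm[OF valid[OF i]] by (simp add: norm_one_inner)
 have "X = start i \<or> X = fin i" using X seg_ends(4)[OF True] by auto
 then show ?thesis using True len_pos[OF V True] n by (auto simp: affine_field_def jump_def)
next
 case False
 then obtain Y where Y: "ends i = {Y}" using half_line_end[OF i] by blast
 then have "(SOME X. X \<in> ends i) = X" using X by simp
 then show ?thesis using False by (simp add: affine_field_def)
qed

lemma affine_field_range:
 assumes t: "t \<in> end_data" and i: "i \<in> Ix" and p: "p \<in> points (Q i)"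
 shows "\<exists>c. \<bar>c\<bar> <= half_facet \<and> affine_field t i p = \<nu> i + c *\<^sub>R \<tau> i"
proof (cases "i \<in> segs")
 case True
 have n: "\<tau> i \<bullet> \<tau> i = 1" using tangent_norm[OF valid[OF i]] by (simp add: norm_one_inner)
 obtain s where s: "s \<in> {0..len V i}" "p = arc_point (Q i) s" using p Q_arc_segment(1)[OF True] by (auto simp: points_def)
 have ps: "(p - V (start i)) \<bullet> \<tau> i = s"
  using s(2) arc_point_line[of "Q i" s] Q_arc_segment(2)[OF True] Q_tangent[OF i] n by simp
 define r where "r = s / len V i"
 have r: "0 <= r" "r <= 1" using s(1) len_pos(1)[OF V True] by (auto simp: r_def)
 have "t (i, start i) + jump t i / len V i * s = (1 - r) * t (i, start i) + r * t (i, fin i)"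
  by (simp add: r_def jump_def algebra_simps diff_divide_distrib)
 also have "\<bar>...\<bar> <= (1 - r) * half_facet + r * half_facet"
 proof -
  have "\<bar>(1 - r) * t (i, start i)\<bar> <= (1 - r) * half_facet" "\<bar>r * t (i, fin i)\<bar> <= r * half_facet"
   using r end_data_bound[OF t] unfolding abs_mult by (simp_all add: mult_left_mono)
  then show ?thesis by linarith
 qed
 also have "... = half_facet" by (simp add: algebra_simps)
 finally have "\<bar>t (i, start i) + jump t i / len V i * s\<bar> <= half_facet" .
 then show ?thesis using True ps unfolding affine_field_def by auto
next
 case False
 then show ?thesis using end_data_bound[OF t]
  by (intro exI[of _ "t (i, SOME X. X \<in> ends i)"]) (simp add: affine_field_def)
qed

lemma affine_field_CH:
 assumes t: "t \<in> end_data"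
 shows "CH_field (net V) (affine_field t)"
proof -
 have "(\<forall>i\<in>Ix. affine_field t i ` points (piece_at (net V) i) \<subseteq> frontier wulff \<and>
   (\<exists>C. C-lipschitz_on (points (piece_at (net V) i)) (affine_field t i)) \<and>
   (AE s in lebesgue. s \<in> arc_domain (piece_at (net V) i) -->
    affine_field t i (arc_point (piece_at (net V) i) s) \<bullet> normal (piece_at (net V) i) = phi_dual (normal (piece_at (net V) i))))"
 proof (intro ballI conjI)
  fix i assume i: "i \<in> Ix"
  have n: "\<tau> i \<bullet> \<tau> i = 1" "norm (\<tau> i) = 1" using tangent_norm[OF valid[OF i]] by (auto simp: norm_one_inner)
  show "affine_field t i ` points (piece_at (net V) i) \<subseteq> frontier wulff"
  proof
   fix q assume "q \<in> affine_field t i ` points (piece_at (net V) i)"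
   then obtain p where p: "p \<in> points (Q i)" "q = affine_field t i p" using Q_net[OF i] by auto
   then obtain c where "\<bar>c\<bar> <= half_facet" "q = \<nu> i + c *\<^sub>R \<tau> i" using affine_field_range[OF t i p(1)] by auto
   then show "q \<in> frontier wulff" using facet_frontier[OF tangent_hexdir[OF i]] by (simp add: normal_def half_facet_def)
  qed
  have lin: "norm (affine_field t i p - affine_field t i q) <= \<bar>jump t i / len V i\<bar> * norm (p - q)" for p q
  proof (cases "i \<in> segs")
   case True
   have "affine_field t i p - affine_field t i q = (jump t i / len V i * ((p - q) \<bullet> \<tau> i)) *\<^sub>R \<tau> i"
    using True by (simp add: affine_field_def inner_diff_left algebra_simps)
   then have "norm (affine_field t i p - affine_field t i q) = \<bar>jump t i / len V i\<bar> * \<bar>(p - q) \<bullet> \<tau> i\<bar>" using n by (simp add: abs_mult)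
   also have "... <= \<bar>jump t i / len V i\<bar> * norm (p - q)" using Cauchy_Schwarz_ineq2[of "p - q" "\<tau> i"] n by (intro mult_left_mono) auto
   finally show ?thesis .
  qed (simp add: affine_field_def)
  show "\<exists>C. C-lipschitz_on (points (piece_at (net V) i)) (affine_field t i)"
   using lin by (intro exI[of _ "\<bar>jump t i / len V i\<bar>"] lipschitz_onI) (auto simp: dist_norm)
  show "AE s in lebesgue. s \<in> arc_domain (piece_at (net V) i) -->
    affine_field t i (arc_point (piece_at (net V) i) s) \<bullet> normal (piece_at (net V) i) = phi_dual (normal (piece_at (net V) i))"
  proof (rule AE_I2, rule impI)
   fix s assume "s \<in> arc_domain (piece_at (net V) i)"
   then have "arc_point (Q i) s \<in> points (Q i)" using arc_point_mem Q_net[OF i] by simp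
   then obtain c where "affine_field t i (arc_point (Q i) s) = \<nu> i + c *\<^sub>R \<tau> i" using affine_field_range[OF t i] by blast
   then show "affine_field t i (arc_point (piece_at (net V) i) s) \<bullet> normal (piece_at (net V) i) = phi_dual (normal (piece_at (net V) i))"
    using n phi_dual_rot90[OF tangent_hexdir[OF i]] Q_net[OF i] Q_normal[OF i] by (simp add: normal_def inner_add_left)
  qed
 qed
 moreover have "\<forall>X\<in>Vx. (\<Sum>i\<in>inc X. sg i X *\<^sub>R affine_field t i (V X)) = 0"
 proof
  fix X assume X: "X \<in> Vx"
  show "(\<Sum>i\<in>inc X. sg i X *\<^sub>R affine_field t i (V X)) = 0"
   using balance_conv[OF X, of "affine_field t" t] affine_field_vertex end_data_balance[OF t X] by (auto simp: inc_iff)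
 qed
 ultimately show ?thesis using CH_field_vertex_iff[of "affine_field t"] unfolding CH_field_def pieces_net by blast
qed

lemma affine_field_div:
 assumes i: "i \<in> Ix"
 shows "tangential_div (net V) (affine_field t) i s = (if i \<in> segs then jump t i / len V i else 0)"
proof -
 have n: "\<tau> i \<bullet> \<tau> i = 1" using tangent_norm[OF valid[OF i]] by (simp add: norm_one_inner)
 define c where "c = (if i \<in> segs then jump t i / len V i else 0)"
 have "affine_field t i (arc_point (Q i) r) = affine_field t i (arc_point (Q i) 0) + (r * c) *\<^sub>R \<tau> i" for r
  unfolding arc_point_line[of "Q i" r] Q_tangent[OF i] using n
  by (simp add: affine_field_def c_def inner_diff_left inner_add_left algebra_simps)
 then have eq: "(\<lambda>r. affine_field t i (arc_point (Q i) r)) = (\<lambda>r. affine_field t i (arc_point (Q i) 0) + (r * c) *\<^sub>R \<tau> i)"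
  by (rule ext)
 have "((\<lambda>r. affine_field t i (arc_point (Q i) r)) has_vector_derivative c *\<^sub>R \<tau> i) (at s)"
  unfolding eq by (auto intro!: derivative_eq_intros)
 then show ?thesis using n by (simp add: tangential_div_def Q_net[OF i] vector_derivative_at Q_tangent[OF i] c_def)
qed

lemma affine_field_energy:
 assumes t: "t \<in> end_data"
 shows "CH_energy (net V) (affine_field t) = ennreal (jump_energy (\<lambda>i. 1 / len V i) t)"
proof -
 have "piece_energy (affine_field t) i = ennreal (bound t i)" if i: "i \<in> Ix" for i
 proof (cases "i \<in> segs")
  case True
  have l: "0 < len V i" by (rule len_pos(1)[OF V True])
  have "piece_energy (affine_field t) i = (\<integral>\<^sup>+s. ennreal ((jump t i / len V i)\<^sup>2) * indicator {0..len V i} s \<partial>lebesgue)"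
   unfolding piece_energy_def affine_field_div[OF i] Q_arc_segment(1)[OF True] using True by simp
  also have "... = ennreal ((jump t i / len V i)\<^sup>2) * emeasure lebesgue {0..len V i}"
   by (rule nn_integral_cmult_indicator) simp
  also have "... = ennreal ((jump t i / len V i)\<^sup>2 * len V i)" using l by (simp add: ennreal_mult)
  also have "(jump t i / len V i)\<^sup>2 * len V i = bound t i" using True l by (simp add: bound_def power2_eq_square field_simps)
  finally show ?thesis .
 next
  case False
  then show ?thesis unfolding piece_energy_def affine_field_div[OF i] by (simp add: bound_def)
 qed
 then have "CH_energy (net V) (affine_field t) = (\<Sum>i\<in>Ix. ennreal (bound t i))" unfolding CH_energy_eq by (intro sum.cong) auto
 also have "... = ennreal (\<Sum>i\<in>Ix. bound t i)" by (rule sum_ennreal) (rule bound_nonneg)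
 finally show ?thesis by (simp add: bound_sum)
qed

lemma CH_energy_lower:
 assumes N: "CH_field (net V) N"
 shows "ennreal (jump_energy (\<lambda>i. 1 / len V i) (edge_values N)) <= CH_energy (net V) N"
proof -
 have "ennreal (jump_energy (\<lambda>i. 1 / len V i) (edge_values N)) = (\<Sum>i\<in>Ix. ennreal (bound (edge_values N) i))"
  unfolding bound_sum[symmetric] by (rule sum_ennreal[symmetric]) (rule bound_nonneg)
 also have "... <= (\<Sum>i\<in>Ix. piece_energy N i)" by (intro sum_mono piece_energy_bound(1)[OF N])
 finally show ?thesis by (simp add: CH_energy_eq)
qed

lemma jump_energy_nonneg: "0 <= jump_energy (\<lambda>i. 1 / len V i) t"
 unfolding bound_sum[symmetric] by (intro sum_nonneg bound_nonneg)

lemma minimal_affine_field: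
 assumes m: "minimizer (\<lambda>i. 1 / len V i) t"
 shows "minimal_CH_field (net V) (affine_field t)"
proof -
 have t: "t \<in> end_data" using m by (simp add: minimizer_def)
 have "CH_energy (net V) (affine_field t) <= CH_energy (net V) M" if M: "CH_field (net V) M" for M
 proof -
  have "jump_energy (\<lambda>i. 1 / len V i) t <= jump_energy (\<lambda>i. 1 / len V i) (edge_values M)" using m edge_values_end_data[OF M] by (simp add: minimizer_def)
  then show ?thesis unfolding affine_field_energy[OF t] using CH_energy_lower[OF M] by (meson ennreal_leI order_trans)
 qed
 then show ?thesis using affine_field_CH[OF t] by (simp add: minimal_CH_field_def)
qed

lemma minimal_div:
 assumes N: "minimal_CH_field (net V) N" and i: "i \<in> Ix"
 shows "AE s in lebesgue. s \<in> arc_domain (Q i) --> tangential_div (net V) N i s = curv (len V) i"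
proof -
 let ?w = "\<lambda>i. 1 / len V i"
 have NC: "CH_field (net V) N" using N by (simp add: minimal_CH_field_def)
 define t where "t = crystalline (len V)"
 have m: "minimizer ?w t" unfolding t_def by (rule crystalline_min)
 have t: "t \<in> end_data" unfolding t_def by (rule crystalline_data)
 have "CH_energy (net V) N <= CH_energy (net V) (affine_field t)" using N affine_field_CH[OF t] by (simp add: minimal_CH_field_def)
 then have EN: "CH_energy (net V) N <= ennreal (jump_energy ?w t)" by (simp add: affine_field_energy[OF t])
 have "ennreal (jump_energy ?w (edge_values N)) <= ennreal (jump_energy ?w t)" using CH_energy_lower[OF NC] EN by (rule order_trans)
 then have le: "jump_energy ?w (edge_values N) <= jump_energy ?w t" using jump_energy_nonneg by (simp add: ennreal_le_iff)
 have mN: "minimizer ?w (edge_values N)" unfolding minimizer_def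
  using edge_values_end_data[OF NC] m le by (auto simp: minimizer_def intro: order_trans)
 have "jump_energy ?w t <= jump_energy ?w (edge_values N)" using m edge_values_end_data[OF NC] by (simp add: minimizer_def)
 then have "ennreal (jump_energy ?w t) <= ennreal (jump_energy ?w (edge_values N))" by (rule ennreal_leI)
 then have "(\<Sum>i\<in>Ix. piece_energy N i) <= ennreal (\<Sum>i\<in>Ix. bound (edge_values N) i)"
  using EN unfolding CH_energy_eq bound_sum by (rule order_trans[rotated])
 then have "piece_energy N i <= ennreal (bound (edge_values N) i)"
  by (intro ennreal_sum_tight[OF finite_pieces bound_nonneg piece_energy_bound(1)[OF NC] _ i]) auto
 from piece_energy_bound(2)[OF NC i this]
 have "AE s in lebesgue. s \<in> arc_domain (Q i) --> tangential_div (net V) N i s = (if i \<in> segs then jump (edge_values N) i / len V i else 0)" .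
 moreover have "(if i \<in> segs then jump (edge_values N) i / len V i else 0) = curv (len V) i"
 proof (cases "i \<in> segs")
  case True
  have "!!i. i \<in> segs ==> 0 < len V i" by (rule len_pos(1)[OF V])
  then show ?thesis using curv_minimizer[OF mN _ True] True by simp
 qed (simp add: curv_def)
 ultimately show ?thesis by simp
qed

end

text \<open>The energy of a field is at least that of the affine field with the same end values, with equality
only for constant divergence.\<close>
theorem phi_curvature_net:
 assumes V: "placement V" and E: "embedded V" and i: "i \<in> Ix"
 shows "has_phi_curvature (net V) i \<kappa> \<longleftrightarrow> \<kappa> = curv (len V) i"
proof -
 have Qi: "piece_at (net V) i = Q V i" by (rule Q_net[OF V E i])
 have ex: "\<exists>N. minimal_CH_field (net V) N"
  using minimal_affine_field[OF V E crystalline_min] by blast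
 have ae: "AE s in lebesgue. s \<in> arc_domain (piece_at (net V) i) --> tangential_div (net V) N i s = curv (len V) i"
  if "minimal_CH_field (net V) N" for N
  using minimal_div[OF V E that i] by (simp only: Qi)
 show ?thesis
 proof
  assume h: "has_phi_curvature (net V) i \<kappa>"
  obtain N where N: "minimal_CH_field (net V) N" using ex by blast
  have "AE s in lebesgue. s \<in> arc_domain (piece_at (net V) i) --> tangential_div (net V) N i s = \<kappa>"
   using h N by (simp add: has_phi_curvature_def)
  with ae[OF N] have both: "AE s in lebesgue. s \<in> arc_domain (piece_at (net V) i) --> \<kappa> = curv (len V) i"
   by eventually_elim auto
  obtain X where "X \<in> ends i" using endpoints_nonempty by blast
  then obtain s where s: "s \<in> arc_domain (Q V i)" using vertex_arc[OF V E i] by blast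
  obtain c e where "c < e" "{c<..<e} \<subseteq> arc_domain (Q V i)" using arc_domain_interval[OF Q_valid[OF V E i] s, of 1] by auto
  then show "\<kappa> = curv (len V) i" using AE_lebesgue_interval[OF both, of c e] by (simp add: Qi)
 next
  assume "\<kappa> = curv (len V) i"
  then show "has_phi_curvature (net V) i \<kappa>" using ex ae by (simp add: has_phi_curvature_def)
 qed
qed

lemma net_phi_regular: "placement V ==> embedded V ==> phi_regular (net V)"
 unfolding phi_regular_def using affine_field_CH crystalline_data by blast

end

section \<open>Heights as coordinates\<close>

context simple_net
begin

text \<open>The displacement of \<open>X\<close> that realizes the heights. Unit vectors \<open>n\<close> at
120 degrees satisfy \<open>\<Sum> n \<otimes> n = (3/2) id\<close> if there are three of them, and their sum
is then zero; for two of them the second term supplies the contribution of the missing third vector.\<close>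
definition disp :: "(nat \<times> nat => real) => plane => plane" where
 "disp h X = (2/3) *\<^sub>R ((\<Sum>i\<in>inc X. (sg i X * h i) *\<^sub>R rot90 (d i X)) + (\<Sum>i\<in>inc X. sg i X * h i) *\<^sub>R (\<Sum>i\<in>inc X. rot90 (d i X)))"

definition pos :: "(nat \<times> nat => real) => plane => plane" where
 "pos h X = X + disp h X"

text \<open>Three lines through one point: the signed heights at a triple junction add up to zero.\<close>
definition compatible :: "(nat \<times> nat => real) => bool" where
 "compatible h \<longleftrightarrow> (\<forall>X\<in>junctions S0. (\<Sum>i\<in>inc X. sg i X * h i) = 0) \<and> (\<forall>i\<in>Ix. i \<notin> segs --> h i = 0)"

lemma rot90_d: "rot90 (d i X) = sg i X *\<^sub>R \<nu> i"
 by (simp add: d_sg rot90_scaleR normal_def)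

lemma normal_sg: "\<nu> i = sg i X *\<^sub>R rot90 (d i X)"
 using sg_sq(1)[of i X] by (simp add: rot90_d)

lemma disp_inner:
 assumes h: "compatible h" and i: "i \<in> inc X"
 shows "disp h X \<bullet> \<nu> i = h i"
proof -
 have X: "X \<in> Vx" using i endpoint_vertex[of i X] by (simp add: inc_iff)
 define c where "c i = sg i X * h i" for i
 have nn: "rot90 (d a X) \<bullet> rot90 (d a X) = 1" if "a \<in> inc X" for a using inc_unit(2)[OF that] by simp
 have nm: "rot90 (d a X) \<bullet> rot90 (d b X) = -1/2" if "a \<in> inc X" "b \<in> inc X" "a ~= b" for a b
  using incident_inner[OF that] by simp
 have key: "disp h X \<bullet> rot90 (d i X) = c i" if i: "i \<in> inc X" for i
  using X
 proof (cases rule: star_cases)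
  case (two a b)
  have ab: "a \<in> inc X" "b \<in> inc X" using two by auto
  have D: "disp h X = (2/3) *\<^sub>R ((c a *\<^sub>R rot90 (d a X) + c b *\<^sub>R rot90 (d b X)) + (c a + c b) *\<^sub>R (rot90 (d a X) + rot90 (d b X)))"
   unfolding disp_def two(2) using two(1) by (simp add: c_def)
  have "i = a \<or> i = b" using i two by auto
  then show ?thesis
  proof
   assume ia: "i = a"
   show ?thesis unfolding D inner_scaleR_left inner_add_left ia
    using nn[OF ab(1)] nm[OF ab(2,1)] two(1) by (simp add: field_simps)
  next
   assume ib: "i = b"
   show ?thesis unfolding D inner_scaleR_left inner_add_left ib
    using nn[OF ab(2)] nm[OF ab(1,2)] two(1) by (simp add: field_simps)
  qed
 next
  case (three a b k)
  have ab: "a \<in> inc X" "b \<in> inc X" "k \<in> inc X" using three by auto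
  have s0: "c a + c b + c k = 0" using h three unfolding compatible_def by (auto simp: c_def)
  have n0: "rot90 (d a X) + rot90 (d b X) + rot90 (d k X) = 0" using three(5) by (metis rot90_add rot90_zero)
  have D: "disp h X = (2/3) *\<^sub>R (c a *\<^sub>R rot90 (d a X) + c b *\<^sub>R rot90 (d b X) + c k *\<^sub>R rot90 (d k X))"
  proof -
   have "(\<Sum>i\<in>inc X. rot90 (d i X)) = 0" unfolding three(4) using three(1-3) n0 by (simp add: add.assoc)
   moreover have "(\<Sum>i\<in>inc X. (sg i X * h i) *\<^sub>R rot90 (d i X)) = c a *\<^sub>R rot90 (d a X) + c b *\<^sub>R rot90 (d b X) + c k *\<^sub>R rot90 (d k X)"
    unfolding three(4) using three(1-3) by (simp add: c_def add.assoc)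
   ultimately show ?thesis by (simp only: disp_def scaleR_zero_right add_0_right)
  qed
  have ck: "c k = - c a - c b" using s0 by linarith
  have "i = a \<or> i = b \<or> i = k" using i three by auto
  then show ?thesis
  proof (elim disjE)
   assume e: "i = a"
   show ?thesis unfolding D inner_scaleR_left inner_add_left e
    using nn[OF ab(1)] nm[OF ab(2,1)] nm[OF ab(3,1)] three(1-3) by (simp add: field_simps ck)
  next
   assume e: "i = b"
   show ?thesis unfolding D inner_scaleR_left inner_add_left e
    using nn[OF ab(2)] nm[OF ab(1,2)] nm[OF ab(3,2)] three(1-3) by (simp add: field_simps ck)
  next
   assume e: "i = k"
   show ?thesis unfolding D inner_scaleR_left inner_add_left e
    using nn[OF ab(3)] nm[OF ab(1,3)] nm[OF ab(2,3)] three(1-3) by (simp add: field_simps ck)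
  qed
 qed
 have "disp h X \<bullet> \<nu> i = sg i X * c i" using key[OF i] unfolding normal_sg[of i X] by simp
 then show ?thesis using sg_sq(1)[of i X] by (simp add: c_def flip: mult.assoc)
qed

lemma two_incident:
 assumes "X \<in> Vx"
 obtains i j where "i \<in> inc X" "j \<in> inc X" "i ~= j"
 using assms by (cases rule: star_cases) auto

lemma disp_unique:
 assumes h: "compatible h" and X: "X \<in> Vx" and w: "!!i. i \<in> inc X ==> w \<bullet> \<nu> i = h i"
 shows "w = disp h X"
proof -
 obtain i j where ij: "i \<in> inc X" "j \<in> inc X" "i ~= j" using two_incident[OF X] .
 define v where "v = w - disp h X"
 have "v \<bullet> \<nu> i = 0" "v \<bullet> \<nu> j = 0" using w disp_inner[OF h] ij by (auto simp: v_def inner_diff_left)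
 then have v: "v \<bullet> rot90 (d i X) = 0" "v \<bullet> rot90 (d j X) = 0" unfolding rot90_d by simp_all
 have vi: "v = (v \<bullet> d i X) *\<^sub>R d i X" using frame_decomp[OF inc_unit(1)[OF ij(1)], of v] v(1) by simp
 have "(v \<bullet> d i X) * (d i X \<bullet> rot90 (d j X)) = 0" using v(2) vi by (metis inner_scaleR_left)
 moreover have "d i X \<bullet> rot90 (d j X) ~= 0" using incident_cross[OF ij(2,1)] ij(3) by auto
 ultimately have "v = 0" using vi by simp
 then show ?thesis by (simp add: v_def)
qed

lemma pos_inner: "compatible h ==> i \<in> inc X ==> (pos h X - X) \<bullet> \<nu> i = h i"
 by (simp add: pos_def disp_inner)

lemma pos_zero [simp]: "pos (\<lambda>_. 0) X = X"
 by (simp add: pos_def disp_def)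

lemma pos_cong:
 assumes "!!i. i \<in> Ix ==> h i = h' i"
 shows "pos h = pos h'"
proof -
 have "(\<Sum>i\<in>inc X. (sg i X * h i) *\<^sub>R rot90 (d i X)) = (\<Sum>i\<in>inc X. (sg i X * h' i) *\<^sub>R rot90 (d i X))"
  "(\<Sum>i\<in>inc X. sg i X * h i) = (\<Sum>i\<in>inc X. sg i X * h' i)" for X
  using assms by (auto intro!: sum.cong simp: inc_iff)
 then show ?thesis by (intro ext) (simp only: pos_def disp_def)
qed

lemma pos_line:
 assumes h: "compatible h" and i: "i \<in> segs"
 shows "pos h (fin i) - pos h (start i) = len (pos h) i *\<^sub>R \<tau> i"
proof -
 note e = seg_ends[OF i]
 have n: "norm (\<tau> i) = 1" using tangent_norm[OF valid[OF segs_Ix[OF i]]] .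
 have "fin i - start i = dist (start i) (fin i) *\<^sub>R \<tau> i" using segment_tangent[OF e(5)] e(1) by (metis tangent.simps(1))
 then have 0: "(fin i - start i) \<bullet> \<nu> i = 0" by (simp add: normal_def)
 have inc: "i \<in> inc (fin i)" "i \<in> inc (start i)" using e segs_Ix[OF i] by (auto simp: inc_iff)
 have "(pos h (fin i) - pos h (start i)) \<bullet> \<nu> i = 0"
  using 0 disp_inner[OF h inc(1)] disp_inner[OF h inc(2)] by (simp add: pos_def inner_diff_left inner_add_left)
 then show ?thesis using frame_decomp[OF n, of "pos h (fin i) - pos h (start i)"] by (simp add: len_def normal_def)
qed

lemma placement_pos:
 assumes h: "compatible h" and l: "!!i. i \<in> segs ==> 0 < len (pos h) i"
 shows "placement (pos h)"
 unfolding placement_def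
proof (intro ballI conjI allI impI)
 fix i a b assume i: "i \<in> Ix" and ab: "P i = Segment a b"
 have s: "i \<in> segs" using i ab by (simp add: segs_def)
 have "a = start i" "b = fin i" using ab by (simp_all add: start_def fin_def)
 then show "\<exists>l>0. pos h b - pos h a = l *\<^sub>R \<tau> i" using pos_line[OF h s] l[OF s] by blast
next
 fix i X assume i: "i \<in> Ix" and n: "\<not> is_segment (P i)" and X: "X \<in> ends i"
 have "h i = 0" using h i n unfolding compatible_def segs_def by blast
 then show "(pos h X - X) \<bullet> \<nu> i = 0" using pos_inner[OF h, of i X] i X by (simp add: inc_iff)
qed

lemma net_cong: "(!!X. X \<in> Vx ==> V X = W X) ==> net V = net W"
proof -
 assume a: "!!X. X \<in> Vx ==> V X = W X"
 have m: "move_piece V (P i) = move_piece W (P i)" if i: "i \<in> Ix" for i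
  using endpoint_vertex[OF i] a by (cases "P i") auto
 show "net V = net W"
 proof (rule nth_equalityI)
  fix k assume k: "k < length (net V)"
  show "net V ! k = net W ! k"
  proof (rule nth_equalityI)
   fix j assume "j < length (net V ! k)"
   then have "(k, j) \<in> Ix" using k by (simp add: pieces_def)
   then show "net V ! k ! j = net W ! k ! j" using m[of "(k, j)"] piece_at_net[of "(k, j)"] by simp
  qed (use k in simp)
 qed simp
qed

lemma parallel_network_heights:
 assumes par: "parallel_network S0 S'"
 defines "h \<equiv> \<lambda>i. height (P i) (piece_at S' i)"
 shows "S' = net (pos h)" "compatible h" "!!i. i \<in> segs ==> 0 < len (pos h) i" "placement (pos h)"
proof -
 obtain V where V: "S' = net V" "placement V" using parallel_network_placement[OF par] by blast
 have hV: "(V X - X) \<bullet> \<nu> i = h i" if "i \<in> inc X" for i X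
  using height_net[OF V(2), of i X] that unfolding h_def V(1) by (simp add: inc_iff)
 show c: "compatible h"
  unfolding compatible_def
 proof (intro conjI ballI impI)
  fix X assume X: "X \<in> junctions S0"
  then have XV: "X \<in> Vx" using junctions_subset_vertices by blast
  from XV obtain a b k where abk: "a ~= b" "a ~= k" "b ~= k" "inc X = {a, b, k}" "d a X + d b X + d k X = 0"
   using X by (cases rule: star_cases) auto
  have "(\<Sum>i\<in>inc X. sg i X * h i) = (\<Sum>i\<in>inc X. (V X - X) \<bullet> rot90 (d i X))"
   by (intro sum.cong) (auto simp: rot90_d hV)
  also have "... = (V X - X) \<bullet> rot90 (d a X + d b X + d k X)"
   unfolding abk(4) using abk(1-3) by (simp add: rot90_add inner_add_right)
  finally show "(\<Sum>i\<in>inc X. sg i X * h i) = 0" using abk(5) by (simp add: rot90_zero)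
 next
  fix i assume i: "i \<in> Ix" "i \<notin> segs"
  obtain X where X: "ends i = {X}" using half_line_end[OF i] .
  have "(V X - X) \<bullet> \<nu> i = 0" using V(2) i X unfolding placement_def segs_def by auto
  then show "h i = 0" using hV[of i X] i X by (simp add: inc_iff)
 qed
 have VX: "V X = pos h X" if X: "X \<in> Vx" for X
 proof -
  have "V X - X = disp h X" by (rule disp_unique[OF c X]) (rule hV)
  then show ?thesis by (simp add: pos_def algebra_simps)
 qed
 show "S' = net (pos h)" unfolding V(1) by (rule net_cong) (rule VX)
 show l: "0 < len (pos h) i" if i: "i \<in> segs" for i
 proof -
  have "start i \<in> Vx" "fin i \<in> Vx" using seg_ends(4)[OF i] segs_Ix[OF i] endpoint_vertex by auto
  then show ?thesis using len_pos(1)[OF V(2) i] VX by (simp add: len_def)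
 qed
 show "placement (pos h)" by (rule placement_pos[OF c l])
qed

lemma disp_diff: "disp h X - disp h' X = disp (\<lambda>i. h i - h' i) X"
proof -
 have A: "(\<Sum>i\<in>inc X. (sg i X * (h i - h' i)) *\<^sub>R rot90 (d i X)) = (\<Sum>i\<in>inc X. (sg i X * h i) *\<^sub>R rot90 (d i X)) - (\<Sum>i\<in>inc X. (sg i X * h' i) *\<^sub>R rot90 (d i X))"
  unfolding sum_subtractf[symmetric] by (intro sum.cong) (auto simp: algebra_simps)
 have B: "(\<Sum>i\<in>inc X. sg i X * (h i - h' i)) = (\<Sum>i\<in>inc X. sg i X * h i) - (\<Sum>i\<in>inc X. sg i X * h' i)"
  unfolding sum_subtractf[symmetric] by (intro sum.cong) (auto simp: algebra_simps)
 show ?thesis unfolding disp_def A B by (simp add: algebra_simps)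
qed

lemma disp_bound: "norm (disp h X) <= (1 + real (card Ix)) * (\<Sum>i\<in>Ix. \<bar>h i\<bar>)"
proof -
 have sub: "inc X \<subseteq> Ix" by (auto simp: inc_iff)
 have s: "(\<Sum>i\<in>inc X. \<bar>h i\<bar>) <= (\<Sum>i\<in>Ix. \<bar>h i\<bar>)" by (intro sum_mono2 sub) auto
 have n1: "norm (rot90 (d i X)) = 1" if "i \<in> inc X" for i using inc_unit(1)[OF that] by simp
 have a: "\<bar>sg i X\<bar> = 1" for i using sg_sq(2)[of i X] by auto
 have 1: "norm (\<Sum>i\<in>inc X. (sg i X * h i) *\<^sub>R rot90 (d i X)) <= (\<Sum>i\<in>inc X. \<bar>h i\<bar>)"
 proof (rule order_trans[OF norm_sum], rule sum_mono)
  fix i assume "i \<in> inc X"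
  then show "norm ((sg i X * h i) *\<^sub>R rot90 (d i X)) <= \<bar>h i\<bar>" using n1[of i] a[of i] by (simp add: abs_mult)
 qed
 have 2: "\<bar>\<Sum>i\<in>inc X. sg i X * h i\<bar> <= (\<Sum>i\<in>inc X. \<bar>h i\<bar>)"
  by (rule order_trans[OF sum_abs]) (auto intro!: sum_mono simp: a abs_mult)
 have "norm (\<Sum>i\<in>inc X. rot90 (d i X)) <= (\<Sum>i\<in>inc X. 1)"
  by (rule order_trans[OF norm_sum], rule sum_mono) (simp only: n1 order_refl)
 also have "... <= real (card Ix)" using card_mono[OF finite_pieces sub] by simp
 finally have 3: "norm (\<Sum>i\<in>inc X. rot90 (d i X)) <= real (card Ix)" .
 have "norm (disp h X) <= (2/3) * (norm (\<Sum>i\<in>inc X. (sg i X * h i) *\<^sub>R rot90 (d i X)) + \<bar>\<Sum>i\<in>inc X. sg i X * h i\<bar> * norm (\<Sum>i\<in>inc X. rot90 (d i X)))"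
  unfolding disp_def norm_scaleR by (intro mult_mono order_trans[OF norm_triangle_ineq]) (simp_all add: norm_scaleR)
 also have "... <= 1 * ((\<Sum>i\<in>Ix. \<bar>h i\<bar>) + (\<Sum>i\<in>Ix. \<bar>h i\<bar>) * real (card Ix))"
  using 1 2 3 s by (intro mult_mono add_mono) (auto intro!: add_nonneg_nonneg sum_nonneg)
 finally show ?thesis by (simp add: algebra_simps)
qed

lemma len_pos_lipschitz:
 assumes i: "i \<in> segs"
 shows "\<bar>len (pos h) i - len (pos h') i\<bar> <= 2 * (1 + real (card Ix)) * (\<Sum>j\<in>Ix. \<bar>h j - h' j\<bar>)"
proof -
 have n: "norm (\<tau> i) = 1" using tangent_norm[OF valid[OF segs_Ix[OF i]]] .
 have "len (pos h) i - len (pos h') i = (disp (\<lambda>j. h j - h' j) (fin i) - disp (\<lambda>j. h j - h' j) (start i)) \<bullet> \<tau> i"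
  unfolding disp_diff[symmetric] by (simp add: len_def pos_def inner_diff_left inner_add_left)
 also have "\<bar>...\<bar> <= norm (disp (\<lambda>j. h j - h' j) (fin i) - disp (\<lambda>j. h j - h' j) (start i))"
  using Cauchy_Schwarz_ineq2[of "disp (\<lambda>j. h j - h' j) (fin i) - disp (\<lambda>j. h j - h' j) (start i)" "\<tau> i"] unfolding n by simp
 also have "... <= norm (disp (\<lambda>j. h j - h' j) (fin i)) + norm (disp (\<lambda>j. h j - h' j) (start i))" by (rule norm_triangle_ineq4)
 also have "... <= 2 * (1 + real (card Ix)) * (\<Sum>j\<in>Ix. \<bar>h j - h' j\<bar>)"
  using disp_bound[of "\<lambda>j. h j - h' j" "fin i"] disp_bound[of "\<lambda>j. h j - h' j" "start i"] by linarith
 finally show ?thesis .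
qed

lemma continuous_pos:
 assumes "!!i. i \<in> Ix ==> continuous_on A (\<lambda>t. h t i)"
 shows "continuous_on A (\<lambda>t. pos (h t) X)"
 unfolding pos_def disp_def by (intro continuous_intros assms) (auto simp: inc_iff)

lemma continuous_len:
 assumes "!!i. i \<in> Ix ==> continuous_on A (\<lambda>t. h t i)"
 shows "continuous_on A (\<lambda>t. len (pos (h t)) i)"
 unfolding len_def by (intro continuous_intros continuous_pos assms)

section \<open>Configurations that force an intersection\<close>

lemma mem_moved_frame:
 assumes V: "placement V" and i: "i \<in> Ix"
 shows "p \<in> moved V i \<longleftrightarrow> (\<forall>X\<in>ends i. 0 <= (p - V X) \<bullet> d i X \<and> (p - V X) \<bullet> rot90 (d i X) = 0)"
 unfolding mem_move_iff[OF V i] using ray_iff[OF d_norm[OF i]] by simp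

lemma seg_other:
 assumes V: "placement V" and i: "i \<in> Ix" and XY: "X \<in> ends i" "Y \<in> ends i" "X ~= Y"
 shows "i \<in> segs" "V Y = V X + len V i *\<^sub>R d i X" "d i Y = - d i X" "dist (V X) (V Y) = len V i"
proof -
 show s: "i \<in> segs"
 proof (rule ccontr)
  assume "i \<notin> segs"
  then obtain Z where "ends i = {Z}" by (metis half_line_end[OF i])
  then show False using XY by simp
 qed
 have cases: "X = start i \<and> Y = fin i \<or> X = fin i \<and> Y = start i" using seg_ends(4)[OF s] XY by auto
 then have "V Y = V X + len V i *\<^sub>R d i X \<and> d i Y = - d i X"
 proof (elim disjE conjE)
  assume a: "X = start i" "Y = fin i"
  show ?thesis unfolding a d_sg sg_ends(1)[OF s] sg_ends(2)[OF s] using len_pos(2)[OF V s] by simp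
 next
  assume a: "X = fin i" "Y = start i"
  show ?thesis unfolding a d_sg sg_ends(1)[OF s] sg_ends(2)[OF s] using len_pos(2)[OF V s] by simp
 qed
 then show "V Y = V X + len V i *\<^sub>R d i X" "d i Y = - d i X" by simp_all
 show "dist (V X) (V Y) = len V i" using cases len_pos(3)[OF V s] by (auto simp: dist_commute)
qed

lemma mem_near:
 assumes V: "placement V" and i: "i \<in> inc X" and s: "0 <= s" and l: "i \<in> segs ==> s <= len V i"
 shows "V X + s *\<^sub>R d i X \<in> moved V i"
proof -
 have iX: "i \<in> Ix" "X \<in> ends i" using i by (auto simp: inc_iff)
 have "\<exists>r\<ge>0. V X + s *\<^sub>R d i X = V Y + r *\<^sub>R d i Y" if Y: "Y \<in> ends i" for Y
 proof (cases "X = Y")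
  case True then show ?thesis using s by blast
 next
  case False
  note o = seg_other[OF V iX(1) iX(2) Y False]
  have "V X + s *\<^sub>R d i X = V Y + (len V i - s) *\<^sub>R d i Y" unfolding o(2,3) by (simp add: algebra_simps)
  then show ?thesis using l[OF o(1)] by (intro exI[of _ "len V i - s"]) auto
 qed
 then show ?thesis using mem_move_iff[OF V iX(1)] by blast
qed

lemma parallel_not_adjacent:
 assumes "i \<in> inc X" "j \<in> inc X" "i ~= j"
 shows "d i Y ~= d j Z" "d i Y ~= - d j Z"
proof -
 have "d i X \<bullet> d j X = -1/2" using incident_inner[OF assms] .
 then have "\<bar>\<tau> i \<bullet> \<tau> j\<bar> = 1/2" using sg_sq(2)[of i X] sg_sq(2)[of j X] by (auto simp: d_sg)
 moreover have "\<tau> j \<bullet> \<tau> j = 1" using assms tangent_norm[OF valid] by (auto simp: inc_iff norm_one_inner)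
 ultimately have "\<tau> i ~= \<tau> j" "\<tau> i ~= - \<tau> j" by auto
 then show "d i Y ~= d j Z" "d i Y ~= - d j Z" using dir_from_cases[of "P i" Y] dir_from_cases[of "P j" Z]
  by (metis minus_minus)+
qed

context
 fixes V \<delta>
 assumes V: "placement V" and E: "embedded V" and \<delta>: "!!i. i \<in> segs ==> \<delta> <= len V i"
begin

text \<open>Close to \<open>X\<close> the edge \<open>m\<close> has no other vertex, so an intersection with
\<open>j\<close> can only be \<open>X\<close> itself.\<close>
lemma near_meet:
 assumes m: "m \<in> inc X" and j: "j \<in> Ix" "m ~= j" and s: "0 <= s" "s < \<delta>"
  and p: "V X + s *\<^sub>R d m X \<in> moved V j"
 shows "X \<in> ends j"
proof -
 have mX: "m \<in> Ix" "X \<in> ends m" using m by (auto simp: inc_iff)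
 have "V X + s *\<^sub>R d m X \<in> moved V m" by (rule mem_near[OF V m s(1)]) (use \<delta>[of m] s(2) in simp)
 from embedded_meet[OF V E mX(1) j(1,2) this p]
 obtain Z where Z: "Z \<in> ends m" "Z \<in> ends j" "V X + s *\<^sub>R d m X = V Z" by blast
 have "Z = X"
 proof (rule ccontr)
  assume "Z ~= X"
  note o = seg_other[OF V mX(1) mX(2) Z(1) \<open>Z ~= X\<close>[symmetric]]
  have "s *\<^sub>R d m X = len V m *\<^sub>R d m X" using Z(3) o(2) by simp
  then have "s = len V m" using inc_unit[OF m] by (metis norm_zero scaleR_cancel_right zero_neq_one)
  then show False using \<delta>[OF o(1)] s by simp
 qed
 then show ?thesis using Z by simp
qed

lemma no_cross:
 assumes m: "m \<in> inc X" and k: "k \<in> inc Y" and XY: "X ~= Y"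
  and u: "0 <= u" "u < \<delta>" and v: "0 <= v" "v < \<delta>" and eq: "V X + u *\<^sub>R d m X = V Y + v *\<^sub>R d k Y" and D: "dist (V X) (V Y) < \<delta>"
 shows False
proof -
 have far: False if "i \<in> Ix" "X \<in> ends i" "Y \<in> ends i" for i
  using seg_other[OF V that XY] \<delta>[of i] D by simp
 have kk: "k \<in> Ix" "Y \<in> ends k" using k by (auto simp: inc_iff)
 have mm: "m \<in> Ix" "X \<in> ends m" using m by (auto simp: inc_iff)
 have "m ~= k" using far[of m] mm kk by auto
 moreover have "V X + u *\<^sub>R d m X \<in> moved V k" unfolding eq by (rule mem_near[OF V k v(1)]) (use \<delta>[of k] v(2) in simp)
 ultimately have "X \<in> ends k" using near_meet[OF m kk(1) _ u] by blast
 then show False using far kk by blast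
qed

text \<open>The directions of the two wedges alternate, so wherever \<open>Y\<close> lies relative to
\<open>X\<close>, some edge at \<open>X\<close> crosses some edge at \<open>Y\<close>; four cases according to
the coordinates of \<open>Y\<close> relative to the wedge at \<open>X\<close>.\<close>
lemma interleaved_cross:
 assumes m: "m \<in> inc X" "m' \<in> inc X" "m ~= m'" and k: "k \<in> inc Y" "k' \<in> inc Y" and XY: "X ~= Y"
  and dk: "d k Y = d m X + d m' X" "d k' Y = - d m X" and D: "V Y - V X = r *\<^sub>R d m X + s *\<^sub>R d m' X" and rs: "\<bar>r\<bar> + \<bar>s\<bar> < \<delta>"
 shows False
proof -
 have "dist (V X) (V Y) <= \<bar>r\<bar> + \<bar>s\<bar>"
 proof -
  have "dist (V X) (V Y) = norm (r *\<^sub>R d m X + s *\<^sub>R d m' X)" using D by (metis dist_commute dist_norm)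
  also have "... <= \<bar>r\<bar> + \<bar>s\<bar>" by (rule order_trans[OF norm_triangle_ineq]) (simp add: inc_unit m)
  finally show ?thesis .
 qed
 then have dist: "dist (V X) (V Y) < \<delta>" using rs by simp
 have VY: "V Y = V X + (r *\<^sub>R d m X + s *\<^sub>R d m' X)" using D by (simp add: algebra_simps)
 consider "0 <= s" "0 <= r" | "0 <= s" "r < 0" | "s < 0" "0 <= r - s" | "s < 0" "r < s" by linarith
 then show False
 proof cases
  case 1
  have "V X + s *\<^sub>R d m' X = V Y + r *\<^sub>R d k' Y" unfolding VY dk by (simp add: algebra_simps)
  then show False using no_cross[OF m(2) k(2) XY, of s r] 1 rs dist by simp
 next
  case 2
  have "V X + (s - r) *\<^sub>R d m' X = V Y + (- r) *\<^sub>R d k Y" unfolding VY dk by (simp add: algebra_simps)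
  then show False using no_cross[OF m(2) k(1) XY, of "s - r" "- r"] 2 rs dist by simp
 next
  case 3
  have "V X + (r - s) *\<^sub>R d m X = V Y + (- s) *\<^sub>R d k Y" unfolding VY dk by (simp add: algebra_simps)
  then show False using no_cross[OF m(1) k(1) XY _ _ _ _ _ dist, of "r - s" "- s"] 3 rs by linarith
 next
  case 4
  have "V X + (s - r) *\<^sub>R d m' X = V Y + (- r) *\<^sub>R d k Y" unfolding VY dk by (simp add: algebra_simps)
  then show False using no_cross[OF m(2) k(1) XY, of "s - r" "- r"] 4 rs dist by simp
 qed
qed

text \<open>For opposite wedges there is a crossing if \<open>X\<close> lies in the cone spanned by the edges
at \<open>Y\<close>.\<close>
lemma opposite_cross:
 assumes m: "m \<in> inc X" "m' \<in> inc X" and k: "k \<in> inc Y" and XY: "X ~= Y"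
  and dk: "d k Y = - d m X" and D: "V X - V Y = r *\<^sub>R d m X + s *\<^sub>R d m' X" and rs: "\<bar>r\<bar> + \<bar>s\<bar> < \<delta>" "r <= 0" "s <= 0"
 shows False
proof -
 have "dist (V X) (V Y) = norm (r *\<^sub>R d m X + s *\<^sub>R d m' X)" using D by (metis dist_norm)
 also have "... <= \<bar>r\<bar> + \<bar>s\<bar>" by (rule order_trans[OF norm_triangle_ineq]) (simp add: inc_unit m)
 finally have dist: "dist (V X) (V Y) < \<delta>" using rs by simp
 have VX: "V X = V Y + (r *\<^sub>R d m X + s *\<^sub>R d m' X)" using D by (simp add: algebra_simps)
 have "V X + (- s) *\<^sub>R d m' X = V Y + (- r) *\<^sub>R d k Y" unfolding VX dk by (simp add: algebra_simps)
 then show False using no_cross[OF m(2) k XY, of "- s" "- r"] rs dist by simp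
qed

text \<open>One of the two edges points towards the line of \<open>j\<close> and reaches it inside
\<open>j\<close>.\<close>
lemma wedge_line_cross:
 assumes j: "j \<in> Ix" and X: "X \<notin> ends j" and m: "m1 \<in> inc X" "m2 \<in> inc X"
  and side: "d m1 X \<bullet> rot90 (\<tau> j) = sqrt 3 / 2" "d m2 X \<bullet> rot90 (\<tau> j) = - (sqrt 3 / 2)"
  and Z0: "Z0 \<in> ends j" and y: "\<bar>(V X - V Z0) \<bullet> rot90 (\<tau> j)\<bar> < min \<delta> \<eta> / 2"
  and inside: "!!Z. Z \<in> ends j ==> \<eta> <= (V X - V Z) \<bullet> d j Z"
 shows False
proof -
 define y where "y = (V X - V Z0) \<bullet> rot90 (\<tau> j)"
 have yZ: "(V X - V Z) \<bullet> rot90 (\<tau> j) = y" if Z: "Z \<in> ends j" for Z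
 proof (cases "Z = Z0")
  case False
  have "V Z0 = V Z + len V j *\<^sub>R d j Z" using seg_other(2)[OF V j Z Z0 False] .
  then show ?thesis by (simp add: y_def inner_diff_left d_sg inner_add_left)
 qed (simp add: y_def)
 have main: False if m: "m \<in> inc X" and dm: "d m X \<bullet> rot90 (\<tau> j) = c * (sqrt 3 / 2)" "c = 1 \<or> c = -1" and cy: "c * y <= 0" for m c
 proof -
  define s where "s = \<bar>y\<bar> / (sqrt 3 / 2)"
  have s32: "1 <= sqrt 3" by simp
  have "s <= 2 * \<bar>y\<bar>" unfolding s_def using s32 by (simp add: field_simps mult_le_cancel_left1)
  then have s: "0 <= s" "s < \<delta>" "s < \<eta>" using y by (auto simp: s_def y_def)
  have "m ~= j" using m X by (auto simp: inc_iff)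
  have "V X + s *\<^sub>R d m X \<in> moved V j"
   unfolding mem_moved_frame[OF V j]
  proof (intro ballI conjI)
   fix Z assume Z: "Z \<in> ends j"
   have "\<bar>d m X \<bullet> d j Z\<bar> <= 1" using Cauchy_Schwarz_ineq2[of "d m X" "d j Z"] inc_unit(1)[OF m] d_norm[OF j] by simp
   then have "s * (d m X \<bullet> d j Z) \<ge> - s" using s(1) by (metis abs_le_D2 minus_le_iff mult.right_neutral mult_left_mono mult_minus_right)
   then show "0 <= (V X + s *\<^sub>R d m X - V Z) \<bullet> d j Z" using inside[OF Z] s by (simp add: inner_diff_left inner_add_left)
   have "s * (c * (sqrt 3 / 2)) = c * \<bar>y\<bar>" by (simp add: s_def)
   also have "... = - y" using dm(2) cy by (auto simp: abs_if)
   finally have "s * (d m X \<bullet> rot90 (\<tau> j)) = - y" unfolding dm(1) .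
   then have "(V X + s *\<^sub>R d m X - V Z) \<bullet> rot90 (\<tau> j) = 0" using yZ[OF Z] by (simp add: inner_diff_left inner_add_left)
   then show "(V X + s *\<^sub>R d m X - V Z) \<bullet> rot90 (d j Z) = 0" by (simp add: d_sg rot90_scaleR)
  qed
  then show False using near_meet[OF m j \<open>m ~= j\<close> s(1,2)] X by blast
 qed
 show False
 proof (cases "0 <= y")
  case True then show ?thesis using main[OF m(2), of "-1"] side(2) by simp
 next
  case False then show ?thesis using main[OF m(1), of 1] side(1) by simp
 qed
qed

end

end

section \<open>Two parallel pieces facing each other across a narrow gap\<close>

context simple_net
begin

text \<open>The tangential component of the minimal field on piece \<open>i\<close>, extended to an affine
function on the plane. An arbitrary end serves as base point; by \<open>field_along_vertex\<close> the other
one gives the same function.\<close>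
definition field_along :: "(plane => plane) => nat \<times> nat => plane => real" where
 "field_along V i w = crystalline (len V) (i, SOME X. X \<in> ends i) +
  curv (len V) i * ((w - V (SOME X. X \<in> ends i)) \<bullet> \<tau> i)"

lemma field_along_add: "field_along V i (w + v) = field_along V i w + curv (len V) i * (v \<bullet> \<tau> i)"
 by (simp add: field_along_def inner_diff_left inner_add_left algebra_simps)

lemma curv_half_line [simp]: "i \<notin> segs ==> curv L i = 0"
 by (simp add: curv_def)

lemma field_along_vertex:
 assumes V: "placement V" and i: "i \<in> Ix" and X: "X \<in> ends i"
 shows "field_along V i (V X) = crystalline (len V) (i, X)"
proof -
 define X0 where "X0 = (SOME X. X \<in> ends i)"
 have X0: "X0 \<in> ends i" unfolding X0_def using X by (rule someI)
 show ?thesis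
 proof (cases "X = X0")
  case True then show ?thesis unfolding field_along_def X0_def[symmetric] by simp
 next
  case False
  note o = seg_other[OF V i X0 X False[symmetric]]
  have s: "i \<in> segs" by (rule o(1))
  have L: "0 < len V i" using len_pos(1)[OF V s] .
  have tt: "\<tau> i \<bullet> \<tau> i = 1" using tangent_norm[OF valid[OF i]] by (simp add: norm_one_inner)
  have e: "V X - V X0 = len V i *\<^sub>R (sg i X0 *\<^sub>R \<tau> i)" using o(2) by (simp add: d_sg)
  have "field_along V i (V X) = crystalline (len V) (i, X0) + curv (len V) i * (len V i * sg i X0)"
   unfolding field_along_def X0_def[symmetric] e by (simp add: tt)
  also have "... = crystalline (len V) (i, X0) + jump (crystalline (len V)) i * sg i X0"
   using L s by (simp add: curv_def)
  finally have f: "field_along V i (V X) = crystalline (len V) (i, X0) + jump (crystalline (len V)) i * sg i X0" .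
  have "X0 = start i \<and> X = fin i \<or> X0 = fin i \<and> X = start i" using X X0 False unfolding seg_ends(4)[OF s] by blast
  then show ?thesis
  proof (elim disjE conjE)
   assume a: "X0 = start i" "X = fin i"
   show ?thesis unfolding f unfolding a sg_ends(1)[OF s] jump_def by simp
  next
   assume a: "X0 = fin i" "X = start i"
   show ?thesis unfolding f unfolding a sg_ends(2)[OF s] jump_def by simp
  qed
 qed
qed

lemma segment_end_exists:
 assumes s: "i \<in> segs" and e: "\<tau> i = e \<or> \<tau> i = - e"
 shows "\<exists>X\<in>ends i. d i X = e"
 using e
proof
 assume "\<tau> i = e"
 then have "d i (start i) = e" unfolding d_sg sg_ends(1)[OF s] by simp
 then show ?thesis using seg_ends(4)[OF s] by blast
next
 assume "\<tau> i = - e"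
 then have "d i (fin i) = e" unfolding d_sg sg_ends(2)[OF s] by simp
 then show ?thesis using seg_ends(4)[OF s] by blast
qed

lemma end_unique:
 assumes V: "placement V" and i: "i \<in> Ix" "X \<in> ends i" "Y \<in> ends i" "d i X = d i Y"
 shows "X = Y"
proof (rule ccontr)
 assume "X ~= Y"
 then have "d i Y = - d i X" using seg_other(3)[OF V i(1-3)] by blast
 then have "d i X = - d i X" using i(4) by simp
 then have "d i X \<bullet> d i X = - (d i X \<bullet> d i X)" by (metis inner_minus_left)
 then show False using d_norm[OF i(1), of X] by simp
qed

lemma field_along_bound:
 assumes V: "placement V" and i: "i \<in> Ix" and \<theta>: "0 <= \<theta>"
  and w: "!!X. X \<in> ends i ==> - \<theta> <= (w - V X) \<bullet> d i X"
 shows "\<bar>field_along V i w\<bar> <= half_facet + \<bar>curv (len V) i\<bar> * \<theta>"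
proof (cases "i \<in> segs")
 case False
 then show ?thesis using end_data_bound[OF crystalline_data] by (simp add: field_along_def)
next
 case s: True
 define g where "g = crystalline (len V)"
 define \<kappa> where "\<kappa> = curv (len V) i"
 define a where "a = (w - V (start i)) \<bullet> \<tau> i"
 define L where "L = len V i"
 have L: "0 < L" using len_pos(1)[OF V s] by (simp add: L_def)
 note e = seg_ends(4)[OF s]
 have tt: "\<tau> i \<bullet> \<tau> i = 1" using tangent_norm[OF valid[OF i]] by (simp add: norm_one_inner)
 have gs: "field_along V i (V (start i)) = g (i, start i)" "field_along V i (V (fin i)) = g (i, fin i)"
  using field_along_vertex[OF V i] e by (auto simp: g_def)
 have f: "field_along V i w = g (i, start i) + \<kappa> * a"
  using field_along_add[of V i "V (start i)" "w - V (start i)"] gs by (simp add: a_def \<kappa>_def)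
 have \<kappa>L: "\<kappa> * L = g (i, fin i) - g (i, start i)"
  using field_along_add[of V i "V (start i)" "len V i *\<^sub>R \<tau> i"] gs len_pos(2)[OF V s] tt by (simp add: \<kappa>_def L_def)
 have b: "\<bar>g (i, start i)\<bar> <= half_facet" "\<bar>g (i, fin i)\<bar> <= half_facet"
  using end_data_bound[OF crystalline_data] by (auto simp: g_def)
 have a1: "- \<theta> <= a" using w[of "start i"] e by (simp add: a_def d_sg sg_ends(1)[OF s])
 have "(w - V (fin i)) \<bullet> \<tau> i = a - L"
  using len_pos(2)[OF V s] tt by (simp add: a_def L_def inner_diff_left inner_add_left)
 then have a2: "a - L <= \<theta>" using w[of "fin i"] e by (simp add: d_sg sg_ends(2)[OF s])
 have m: "\<bar>\<kappa> * x\<bar> <= \<bar>\<kappa>\<bar> * \<theta>" if "\<bar>x\<bar> <= \<theta>" for x using that by (simp add: abs_mult mult_left_mono)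
 consider "a < 0" | "0 <= a" "a <= L" | "L < a" by linarith
 then show ?thesis
 proof cases
  case 1
  then have "\<bar>\<kappa> * a\<bar> <= \<bar>\<kappa>\<bar> * \<theta>" using a1 by (intro m) simp
  then show ?thesis using b f by (simp add: \<kappa>_def)
 next
  case 3
  then have "\<bar>\<kappa> * (a - L)\<bar> <= \<bar>\<kappa>\<bar> * \<theta>" using a2 by (intro m) simp
  moreover have "field_along V i w = g (i, fin i) + \<kappa> * (a - L)" using f \<kappa>L by (simp add: algebra_simps)
  ultimately show ?thesis using b by (simp add: \<kappa>_def)
 next
  case 2
  have "L * field_along V i w = (L - a) * g (i, start i) + a * g (i, fin i)"
  proof -
   have "L * field_along V i w = L * g (i, start i) + a * (\<kappa> * L)" using f by (simp add: algebra_simps)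
   then show ?thesis unfolding \<kappa>L by (simp add: algebra_simps)
  qed
  also have "\<bar>...\<bar> <= (L - a) * half_facet + a * half_facet"
   by (rule order_trans[OF abs_triangle_ineq]) (use b 2 in \<open>simp add: abs_mult add_mono mult_left_mono\<close>)
  finally have "L * \<bar>field_along V i w\<bar> <= L * half_facet" using L by (simp add: abs_mult algebra_simps)
  then have "\<bar>field_along V i w\<bar> <= half_facet" using L by simp
  moreover have "0 <= \<bar>\<kappa>\<bar> * \<theta>" using \<theta> by simp
  ultimately show ?thesis unfolding \<kappa>_def by linarith
 qed
qed

text \<open>Only one direction is left for a second edge, so \<open>X\<close> is a simple vertex, where the
field is known.\<close>
lemma end_sign:
 assumes g: "g \<in> end_data" and F: "F \<in> inc X" "d F X = - e" and e: "norm e = 1" and \<sigma>: "\<sigma> = 1 \<or> \<sigma> = -1"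
  and no: "!!k. k \<in> inc X ==> d k X ~= (1/2) *\<^sub>R e - (sqrt 3 / 2) *\<^sub>R (\<sigma> *\<^sub>R rot90 e)"
 shows "\<sigma> * g (F, X) = - half_facet"
proof -
 have X: "X \<in> Vx" using F endpoint_vertex[of F X] by (simp add: inc_iff)
 define n where "n = \<sigma> *\<^sub>R rot90 e"
 have \<sigma>2: "\<sigma> * \<sigma> = 1" using \<sigma> by auto
 have ee: "e \<bullet> e = 1" "n \<bullet> n = 1" "e \<bullet> n = 0" "n \<bullet> e = 0" and re: "rot90 e = \<sigma> *\<^sub>R n"
  using e \<sigma>2 by (simp_all add: n_def norm_one_inner)
 have nb: "d k X = (1/2) *\<^sub>R e + (sqrt 3 / 2) *\<^sub>R n" if k: "k \<in> inc X" "k ~= F" for k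
 proof -
  define x where "x = d k X \<bullet> rot90 e"
  have "d k X \<bullet> d F X = -1/2" using incident_inner[OF k(1) F(1) k(2)] .
  then have 1: "d k X \<bullet> e = 1/2" using F(2) by simp
  have dec: "d k X = (d k X \<bullet> e) *\<^sub>R e + x *\<^sub>R rot90 e" using frame_decomp[OF e] by (simp add: x_def)
  have "\<bar>x\<bar> = sqrt 3 / 2" using incident_cross[OF F(1) k(1)] k(2) F(2) by (simp add: x_def rot90_minus abs_minus_commute)
  then have "x = \<sigma> * (sqrt 3 / 2) \<or> x = - \<sigma> * (sqrt 3 / 2)" using \<sigma> by (auto simp: abs_if split: if_splits)
  then show ?thesis
  proof
   assume "x = \<sigma> * (sqrt 3 / 2)"
   then show ?thesis using dec 1 by (simp add: n_def mult.commute)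
  next
   assume "x = - \<sigma> * (sqrt 3 / 2)"
   then have "d k X = (1/2) *\<^sub>R e - (sqrt 3 / 2) *\<^sub>R (\<sigma> *\<^sub>R rot90 e)" using dec 1 by (simp add: mult.commute)
   then show ?thesis using no[OF k(1)] by simp
  qed
 qed
 have one: "k = k'" if k: "k \<in> inc X" "k ~= F" "k' \<in> inc X" "k' ~= F" for k k'
 proof (rule ccontr)
  assume "k ~= k'"
  then have "d k X \<bullet> d k' X = -1/2" using incident_inner k by blast
  moreover have "d k X = d k' X" using nb k by simp
  ultimately show False using inc_unit(2)[OF k(1)] by simp
 qed
 obtain k where k: "k \<in> inc X" "k ~= F" using two_incident[OF X] by metis
 have "inc X = {F, k}" using one[OF _ _ k] k F(1) by blast
 from end_data_two[OF g X this k(2)[symmetric]] have "g (F, X) = (2/3) * (d k X \<bullet> rot90 (d F X))" .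
 also have "... = - \<sigma> * half_facet" unfolding nb[OF k] F(2) by (simp add: rot90_minus re ee inner_add_left half_facet(3))
 finally show ?thesis using \<sigma>2 by (simp add: mult.assoc[symmetric])
qed

text \<open>\<open>F\<close> lies at height \<open>y\<close> above \<open>G\<close> in direction
\<open>\<sigma> *\<^sub>R rot90 e\<close>, and both extend by at least \<open>l\<close> to either side of
\<open>z\<close>. The parameters \<open>e\<close> and \<open>\<sigma>\<close> are kept apart so that the roles
of the two pieces and of the two sides can be exchanged by \<open>facing_flip\<close> and
\<open>facing_swap\<close>.\<close>
definition facing :: "(plane => plane) => real => real => plane => real => plane => nat \<times> nat => nat \<times> nat => bool" where
 "facing V l y e \<sigma> z F G \<longleftrightarrow> F \<in> Ix \<and> G \<in> Ix \<and> norm e = 1 \<and> (\<sigma> = 1 \<or> \<sigma> = -1) \<and>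
  (\<tau> F = e \<or> \<tau> F = - e) \<and> (\<tau> G = e \<or> \<tau> G = - e) \<and>
  (\<forall>X\<in>ends F. \<forall>Y\<in>ends G. (V X - V Y) \<bullet> (\<sigma> *\<^sub>R rot90 e) = y) \<and>
  (\<forall>X\<in>ends F. l <= (z - V X) \<bullet> d F X) \<and> (\<forall>Y\<in>ends G. l <= (z - V Y) \<bullet> d G Y)"

lemma facing_flip: "facing V l y e \<sigma> z F G ==> facing V l y (- e) (- \<sigma>) z F G"
 unfolding facing_def by (auto simp: rot90_minus)

lemma facing_swap: "facing V l y e \<sigma> z F G ==> facing V l y e (- \<sigma>) z G F"
 unfolding facing_def by (auto simp: inner_diff_left)

lemma facing_dir: "facing V l y e \<sigma> z F G ==> d F X = e \<or> d F X = - e" "facing V l y e \<sigma> z F G ==> d G X = e \<or> d G X = - e"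
 unfolding facing_def using dir_from_cases[of "P F" X] dir_from_cases[of "P G" X] by (metis minus_minus)+

context
 fixes V \<delta>
 assumes V: "placement V" and E: "embedded V" and \<delta>: "!!i. i \<in> segs ==> \<delta> <= len V i" and \<delta>0: "0 < \<delta>"
begin

text \<open>An edge that leaves the end of \<open>G\<close> outwards and towards \<open>F\<close> would cross
\<open>F\<close>, unless \<open>F\<close> ends before.\<close>
lemma ray_hits:
 assumes f: "facing V l y e \<sigma> z F G" and y: "0 < y" "y < l" "2 * y < \<delta>"
  and Y: "Y \<in> ends G" "d G Y = - e" and m: "m \<in> inc Y" "d m Y = (1/2) *\<^sub>R e + (sqrt 3 / 2) *\<^sub>R (\<sigma> *\<^sub>R rot90 e)"
 shows "\<exists>X\<in>ends F. d F X = - e \<and> V X \<bullet> e <= V Y \<bullet> e + y / sqrt 3"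
proof (rule ccontr)
 assume none: "\<not> ?thesis"
 define n where "n = \<sigma> *\<^sub>R rot90 e"
 have fF: "F \<in> Ix" "norm e = 1" "\<sigma> = 1 \<or> \<sigma> = -1" using f by (simp_all add: facing_def)
 have \<sigma>2: "\<sigma> * \<sigma> = 1" using fF by auto
 have ee: "e \<bullet> e = 1" "n \<bullet> n = 1" "e \<bullet> n = 0" "n \<bullet> e = 0" and re: "rot90 e = \<sigma> *\<^sub>R n"
  using fF \<sigma>2 by (simp_all add: n_def norm_one_inner)
 have gap: "(V X - V Y) \<bullet> n = y" if "X \<in> ends F" for X using f that Y by (simp add: facing_def n_def)
 have zX: "l <= (z - V X) \<bullet> d F X" if "X \<in> ends F" for X using f that by (simp add: facing_def)
 have zY: "l <= (z - V Y) \<bullet> d G Y" using f Y(1) by (simp add: facing_def)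
 have nF: "Y \<notin> ends F" using gap[of Y] y by auto
 then have mF: "m ~= F" using m by (auto simp: inc_iff)
 \<comment> \<open>the edge climbs at 60 degrees and reaches height \<open>y\<close> after length \<open>2 * y / sqrt 3\<close>\<close>
 define s where "s = 2 * (y / sqrt 3)"
 define u where "u = y / sqrt 3"
 have s3: "1 <= sqrt 3" by simp
 have u: "0 < u" "u <= y" using y s3 by (simp_all add: u_def field_simps mult_le_cancel_left1)
 have su: "s = 2 * u" by (simp add: s_def u_def)
 have uy: "u * sqrt 3 = y" by (simp add: u_def)
 have p: "V Y + s *\<^sub>R d m Y = V Y + u *\<^sub>R e + y *\<^sub>R n"
  unfolding m(2) n_def[symmetric] su uy[symmetric] by (simp add: scaleR_add_right mult.commute)
 have "V Y + s *\<^sub>R d m Y \<in> moved V F"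
  unfolding mem_moved_frame[OF V fF(1)] p
 proof (intro ballI conjI)
  fix X assume X: "X \<in> ends F"
  from facing_dir(1)[OF f, of X] show "0 <= (V Y + u *\<^sub>R e + y *\<^sub>R n - V X) \<bullet> d F X"
  proof
   assume dX: "d F X = e"
   have "l <= z \<bullet> e - V X \<bullet> e" "l <= V Y \<bullet> e - z \<bullet> e" using zX[OF X] zY dX Y by (simp_all add: inner_diff_left)
   then show ?thesis using u y unfolding dX by (simp add: inner_diff_left inner_add_left ee)
  next
   assume dX: "d F X = - e"
   have "\<not> V X \<bullet> e <= V Y \<bullet> e + u" using none X dX by (auto simp: u_def)
   then show ?thesis unfolding dX by (simp add: inner_diff_left inner_add_left ee)
  qed
  have "(V Y + u *\<^sub>R e + y *\<^sub>R n - V X) \<bullet> n = 0" using gap[OF X] by (simp add: inner_diff_left inner_add_left ee)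
  then show "(V Y + u *\<^sub>R e + y *\<^sub>R n - V X) \<bullet> rot90 (d F X) = 0"
   using facing_dir(1)[OF f, of X] by (elim disjE) (simp_all only: re rot90_minus inner_minus_right inner_scaleR_right mult_zero_right minus_zero)
 qed
 then show False using near_meet[OF V E \<delta> m(1) fF(1) mF, of s] nF u y su by auto
qed

text \<open>By \<open>ray_hits\<close> in both directions the two ends are nearly opposite, and then the edge
from \<open>Y\<close> upwards and the one from \<open>X\<close> downwards would cross each other inside the
strip.\<close>
lemma facing_edges:
 assumes f: "facing V l y e \<sigma> z F G" and y: "0 < y" "y < l" "2 * y < \<delta>"
  and Y: "Y \<in> ends G" "d G Y = - e" and m: "m \<in> inc Y" "d m Y = (1/2) *\<^sub>R e + (sqrt 3 / 2) *\<^sub>R (\<sigma> *\<^sub>R rot90 e)"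
  and X: "X \<in> ends F" "d F X = - e" "V X \<bullet> e <= V Y \<bullet> e + y / sqrt 3"
  and k: "k \<in> inc X"
 shows "d k X ~= (1/2) *\<^sub>R e - (sqrt 3 / 2) *\<^sub>R (\<sigma> *\<^sub>R rot90 e)"
proof
 assume dk: "d k X = (1/2) *\<^sub>R e - (sqrt 3 / 2) *\<^sub>R (\<sigma> *\<^sub>R rot90 e)"
 define n where "n = \<sigma> *\<^sub>R rot90 e"
 have fF: "F \<in> Ix" "G \<in> Ix" "norm e = 1" "\<sigma> = 1 \<or> \<sigma> = -1" using f by (simp_all add: facing_def)
 have \<sigma>2: "\<sigma> * \<sigma> = 1" using fF by auto
 have ee: "e \<bullet> e = 1" "n \<bullet> n = 1" "e \<bullet> n = 0" "n \<bullet> e = 0" and re: "rot90 e = \<sigma> *\<^sub>R n"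
  using fF \<sigma>2 by (simp_all add: n_def norm_one_inner)
 have gap: "(V X - V Y) \<bullet> n = y" using f X Y by (simp add: facing_def n_def)
 have XY: "X ~= Y" using gap y by auto
 obtain Y' where Y': "Y' \<in> ends G" "d G Y' = - e" "V Y' \<bullet> e <= V X \<bullet> e + y / sqrt 3"
  using ray_hits[OF facing_swap[OF f] y X(1,2) k] dk by auto
 have "Y' = Y" using end_unique[OF V fF(2) Y'(1) Y(1)] Y'(2) Y(2) by simp
 then have le: "V Y \<bullet> e <= V X \<bullet> e + y / sqrt 3" using Y' by simp
 define u where "u = y / sqrt 3"
 have s3: "1 <= sqrt 3" by simp
 have u: "0 < u" "u <= y" using y s3 by (simp_all add: u_def field_simps mult_le_cancel_left1)
 have uy: "u * sqrt 3 = y" by (simp add: u_def)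
 define D where "D = V X \<bullet> e - V Y \<bullet> e"
 have D: "- u <= D" "D <= u" using le X(3) by (simp_all add: D_def u_def)
 have XYd: "V X - V Y = D *\<^sub>R e + y *\<^sub>R n"
 proof -
  have "(V X - V Y) \<bullet> rot90 e = \<sigma> * y" using gap by (simp add: re)
  then have "V X - V Y = D *\<^sub>R e + (\<sigma> * y) *\<^sub>R rot90 e"
   using frame_decomp[OF fF(3), of "V X - V Y"] by (simp add: D_def inner_diff_left)
  then show ?thesis by (simp add: n_def mult.commute)
 qed
 then have VX: "V X = V Y + D *\<^sub>R e + y *\<^sub>R n" by (simp add: algebra_simps)
 \<comment> \<open>\<open>D\<close> is the horizontal offset of the two ends, and the two edges meet at distances \<open>u + D\<close> and \<open>u - D\<close>\<close>
 have "V Y + (u + D) *\<^sub>R d m Y = V X + (u - D) *\<^sub>R d k X"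
 proof -
  have "V Y + (u + D) *\<^sub>R d m Y = V Y + ((u + D) / 2) *\<^sub>R e + ((u + D) * (sqrt 3 / 2)) *\<^sub>R n"
   unfolding m(2) n_def[symmetric] by (simp add: scaleR_add_right)
  moreover have "V X + (u - D) *\<^sub>R d k X = V Y + (D + (u - D) / 2) *\<^sub>R e + (y - (u - D) * (sqrt 3 / 2)) *\<^sub>R n"
   unfolding VX dk n_def[symmetric] by (simp add: scaleR_diff_right scaleR_add_left scaleR_diff_left)
  moreover have "D + (u - D) / 2 = (u + D) / 2" "y - (u - D) * (sqrt 3 / 2) = (u + D) * (sqrt 3 / 2)"
   unfolding uy[symmetric] by (simp_all add: field_simps)
  ultimately show ?thesis by simp
 qed
 moreover have "dist (V Y) (V X) < \<delta>"
 proof -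
  have "dist (V Y) (V X) = norm (D *\<^sub>R e + y *\<^sub>R n)" using XYd by (metis dist_commute dist_norm)
  also have "... <= \<bar>D\<bar> + \<bar>y\<bar>" by (rule order_trans[OF norm_triangle_ineq]) (simp add: fF(3) n_def, use fF(4) in auto)
  finally show ?thesis using D u y by simp
 qed
 ultimately show False using no_cross[OF V E \<delta> m(1) k XY[symmetric], of "u + D" "u - D"] D u y by simp
qed

definition gap_bound :: "real => plane => real => plane => real => nat \<times> nat => nat \<times> nat => bool" where
 "gap_bound l e \<sigma> z y F G \<longleftrightarrow> (\<exists>w. l <= (w - z) \<bullet> e \<and> \<sigma> * (field_along V F w - field_along V G w) <= (2 / \<delta>) * y)"

lemma gap_bound_swap: "gap_bound l e (- \<sigma>) z y G F = gap_bound l e \<sigma> z y F G"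
proof -
 have "- \<sigma> * (field_along V G w - field_along V F w) = \<sigma> * (field_along V F w - field_along V G w)" for w
  by (simp add: algebra_simps)
 then show ?thesis unfolding gap_bound_def by simp
qed

text \<open>At \<open>X\<close> the field on \<open>F\<close> is extremal, and the one on \<open>G\<close> is
almost admissible because \<open>G\<close> extends at least to distance \<open>y\<close> from there.\<close>
lemma gap_bound_end:
 assumes f: "facing V l y e \<sigma> z F G" and y: "0 < y" "y < l" "2 * y < \<delta>"
  and X: "X \<in> ends F" "d F X = - e" and s: "\<sigma> * crystalline (len V) (F, X) = - half_facet"
  and le: "!!Y. Y \<in> ends G ==> d G Y = - e ==> V X \<bullet> e <= V Y \<bullet> e + y"
 shows "gap_bound l e \<sigma> z y F G"
 unfolding gap_bound_def
proof (intro exI conjI)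
 have fF: "F \<in> Ix" "G \<in> Ix" "\<sigma> = 1 \<or> \<sigma> = -1" using f by (simp_all add: facing_def)
 have zX: "l <= (z - V X) \<bullet> d F X" using f X(1) by (simp add: facing_def)
 show zX': "l <= (V X - z) \<bullet> e" using zX X(2) by (simp add: inner_diff_left)
 have "\<bar>field_along V G (V X)\<bar> <= half_facet + \<bar>curv (len V) G\<bar> * y"
 proof (rule field_along_bound[OF V fF(2)])
  fix Y assume Y: "Y \<in> ends G"
  have zY: "l <= (z - V Y) \<bullet> d G Y" using f Y by (simp add: facing_def)
  from facing_dir(2)[OF f, of Y] show "- y <= (V X - V Y) \<bullet> d G Y"
  proof
   assume dY: "d G Y = e"
   then show ?thesis using zX' zY y by (simp add: inner_diff_left)
  next
   assume dY: "d G Y = - e"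
   then show ?thesis using le[OF Y dY] by (simp add: inner_diff_left)
  qed
 qed (use y in simp)
 also have "\<bar>curv (len V) G\<bar> * y <= (2 / \<delta>) * y" using curv_bound[where L = "len V" and i = G, OF \<delta>0 \<delta>] y by (intro mult_right_mono) auto
 finally have "\<bar>\<sigma> * field_along V G (V X)\<bar> <= half_facet + (2 / \<delta>) * y" using fF(3) by (auto simp: abs_mult)
 then show "\<sigma> * (field_along V F (V X) - field_along V G (V X)) <= (2 / \<delta>) * y"
  using s unfolding field_along_vertex[OF V fF(1) X(1)] right_diff_distrib by linarith
qed

lemma gap_bound_up:
 assumes f: "facing V l y e \<sigma> z F G" and y: "0 < y" "y < l" "2 * y < \<delta>"
  and Y: "Y \<in> ends G" "d G Y = - e" and m: "m \<in> inc Y" "d m Y = (1/2) *\<^sub>R e + (sqrt 3 / 2) *\<^sub>R (\<sigma> *\<^sub>R rot90 e)"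
 shows "gap_bound l e \<sigma> z y F G"
proof -
 have fF: "F \<in> Ix" "G \<in> Ix" "norm e = 1" "\<sigma> = 1 \<or> \<sigma> = -1" using f by (simp_all add: facing_def)
 obtain X where X: "X \<in> ends F" "d F X = - e" "V X \<bullet> e <= V Y \<bullet> e + y / sqrt 3"
  using ray_hits[OF f y Y m] by blast
 have FX: "F \<in> inc X" using X fF by (simp add: inc_iff)
 have sX: "\<sigma> * crystalline (len V) (F, X) = - half_facet"
  by (rule end_sign[OF crystalline_data FX X(2) fF(3,4)]) (rule facing_edges[OF f y Y m X])
 have "1 <= sqrt 3" by simp
 then have u: "y / sqrt 3 <= y" using y by (simp add: field_simps mult_le_cancel_left1)
 show ?thesis
 proof (rule gap_bound_end[OF f y X(1,2) sX])
  fix Y' assume "Y' \<in> ends G" "d G Y' = - e"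
  then have "Y' = Y" using end_unique[OF V fF(2) _ Y(1)] Y(2) by simp
  then show "V X \<bullet> e <= V Y' \<bullet> e + y" using X(3) u by simp
 qed
qed

text \<open>If one of the free ends has an edge into the strip, \<open>gap_bound_up\<close> applies to it.
Otherwise both ends bend away, and the one that lies further inside can be used.\<close>
lemma gap_bound_side:
 assumes f: "facing V l y e \<sigma> z F G" and y: "0 < y" "y < l" "2 * y < \<delta>"
  and ex: "(\<exists>X\<in>ends F. d F X = - e) \<or> (\<exists>Y\<in>ends G. d G Y = - e)"
 shows "gap_bound l e \<sigma> z y F G"
proof (rule ccontr)
 assume no: "\<not> gap_bound l e \<sigma> z y F G"
 have fF: "F \<in> Ix" "G \<in> Ix" "norm e = 1" "\<sigma> = 1 \<or> \<sigma> = -1" "- \<sigma> = 1 \<or> - \<sigma> = -1" using f by (auto simp: facing_def)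
 have f': "facing V l y e (- \<sigma>) z G F" using facing_swap[OF f] .
 have no': "\<not> gap_bound l e (- \<sigma>) z y G F" using no by (metis gap_bound_swap)
 have up: "- \<sigma> * crystalline (len V) (G, Y) = - half_facet" if Y: "Y \<in> ends G" "d G Y = - e" for Y
 proof (rule end_sign[OF crystalline_data _ Y(2) fF(3,5)])
  show "G \<in> inc Y" using Y fF by (simp add: inc_iff)
  show "d k Y ~= (1/2) *\<^sub>R e - (sqrt 3 / 2) *\<^sub>R (- \<sigma> *\<^sub>R rot90 e)" if "k \<in> inc Y" for k
   using gap_bound_up[OF f y Y that] no by auto
 qed
 have down: "\<sigma> * crystalline (len V) (F, X) = - half_facet" if X: "X \<in> ends F" "d F X = - e" for X
 proof (rule end_sign[OF crystalline_data _ X(2) fF(3,4)])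
  show "F \<in> inc X" using X fF by (simp add: inc_iff)
  show "d k X ~= (1/2) *\<^sub>R e - (sqrt 3 / 2) *\<^sub>R (\<sigma> *\<^sub>R rot90 e)" if "k \<in> inc X" for k
   using gap_bound_up[OF f' y X that] no' by auto
 qed
 have 1: "\<exists>Y\<in>ends G. d G Y = - e \<and> V Y \<bullet> e + y < V X \<bullet> e" if X: "X \<in> ends F" "d F X = - e" for X
  using gap_bound_end[OF f y X down[OF X]] no by (meson not_le)
 have 2: "\<exists>X\<in>ends F. d F X = - e \<and> V X \<bullet> e + y < V Y \<bullet> e" if Y: "Y \<in> ends G" "d G Y = - e" for Y
  using gap_bound_end[OF f' y Y up[OF Y]] no' by (meson not_le)
 have "\<exists>X\<in>ends F. d F X = - e" using ex 2 by blast
 then obtain X where X: "X \<in> ends F" "d F X = - e" by blast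
 obtain Y where Y: "Y \<in> ends G" "d G Y = - e" "V Y \<bullet> e + y < V X \<bullet> e" using 1[OF X] by blast
 obtain X' where X': "X' \<in> ends F" "d F X' = - e" "V X' \<bullet> e + y < V Y \<bullet> e" using 2[OF Y(1,2)] by blast
 have "X' = X" using end_unique[OF V fF(1) X'(1) X(1)] X'(2) X(2) by simp
 then show False using X' Y y by simp
qed

text \<open>The difference of the two affine fields is small from above at one side and from below at the
other; divided by the distance of at least \<open>2 * l\<close> this bounds the difference of their
slopes.\<close>
lemma facing_slopes:
 assumes f: "facing V l y e 1 z F G" and y: "0 < y" "y < l" "2 * y < \<delta>"
 shows "(curv (len V) F * (\<tau> F \<bullet> e) - curv (len V) G * (\<tau> G \<bullet> e)) * l <= (2 / \<delta>) * y"
proof -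
 define D where "D = curv (len V) F * (\<tau> F \<bullet> e) - curv (len V) G * (\<tau> G \<bullet> e)"
 have fF: "F \<in> Ix" "G \<in> Ix" "norm e = 1" "\<tau> F = e \<or> \<tau> F = - e" "\<tau> G = e \<or> \<tau> G = - e" using f by (auto simp: facing_def)
 have K: "0 <= (2 / \<delta>) * y" using \<delta>0 y by simp
 have seg: "\<exists>X\<in>ends F. d F X = e'" if "F \<in> segs" "e' = e \<or> e' = - e" for e'
  by (rule segment_end_exists[OF that(1)]) (use fF(4) that(2) in auto)
 have seg': "\<exists>X\<in>ends G. d G X = e'" if "G \<in> segs" "e' = e \<or> e' = - e" for e'
  by (rule segment_end_exists[OF that(1)]) (use fF(5) that(2) in auto)
 show ?thesis
 proof (cases "F \<notin> segs \<and> G \<notin> segs")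
  case True then show ?thesis using K by simp
 next
  case False
  then have "gap_bound l e 1 z y F G" by (intro gap_bound_side[OF f y]) (use seg[of "- e"] seg'[of "- e"] in blast)
  then obtain w where w: "l <= (w - z) \<bullet> e" "field_along V F w - field_along V G w <= (2 / \<delta>) * y" unfolding gap_bound_def by auto
  have "gap_bound l (- e) (- 1) z y F G"
   by (rule gap_bound_side[OF facing_flip[OF f] y]) (use False seg[of e] seg'[of e] in auto)
  then obtain v where v: "l <= (v - z) \<bullet> (- e)" "- 1 * (field_along V F v - field_along V G v) <= (2 / \<delta>) * y" unfolding gap_bound_def by blast
  define x where "x = (w - v) \<bullet> e"
  have x: "2 * l <= x" using w(1) v(1) by (simp add: x_def inner_diff_left)
  have wt: "(w - v) \<bullet> \<tau> i = x * (\<tau> i \<bullet> e)" if "\<tau> i = e \<or> \<tau> i = - e" for i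
   using that fF(3) by (auto simp: x_def norm_one_inner)
  have "field_along V F w = field_along V F v + curv (len V) F * ((w - v) \<bullet> \<tau> F)"
   "field_along V G w = field_along V G v + curv (len V) G * ((w - v) \<bullet> \<tau> G)"
   using field_along_add[of V F v "w - v"] field_along_add[of V G v "w - v"] by simp_all
  then have "D * x = (field_along V F w - field_along V G w) - (field_along V F v - field_along V G v)"
   unfolding wt[OF fF(4)] wt[OF fF(5)] D_def by (simp add: algebra_simps)
  moreover have "- (field_along V F v - field_along V G v) <= (2 / \<delta>) * y" using v(2) by (simp only: mult_minus1)
  ultimately have Dx: "D * x <= 2 * ((2 / \<delta>) * y)" using w(2) by linarith
  have "D * l <= (2 / \<delta>) * y"
  proof (cases "0 <= D")
   case True
   have "D * (2 * l) <= D * x" using True x by (intro mult_left_mono)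
   then show ?thesis using Dx by linarith
  next
   case False
   then have "D * l <= 0" using y by (simp add: mult_nonpos_nonneg)
   then show ?thesis using K by linarith
  qed
  then show ?thesis by (simp add: D_def)
 qed
qed

end

end

section \<open>Intersections and time\<close>

lemma hexdir_six:
 assumes "x \<in> hexdir" "e \<in> hexdir" "f \<in> hexdir" "e \<bullet> f = -1/2"
 shows "x \<in> {e, f, - e, - f, e + f, - (e + f)}"
proof -
 have n: "norm e = 1" "norm f = 1" using assms hexdir_norm by auto
 have "f \<bullet> rot90 e = sqrt 3 / 2 \<or> f \<bullet> rot90 e = - (sqrt 3 / 2)"
  by (rule unit_inner_half[OF n(2,1)]) (use assms(4) in \<open>simp add: inner_commute\<close>)
 then obtain t where t: "t = 1 \<or> t = -1" "f \<bullet> rot90 e = t * (sqrt 3 / 2)" by (metis mult_1 mult_minus1)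
 have f: "f = (-1/2) *\<^sub>R e + (t * (sqrt 3 / 2)) *\<^sub>R rot90 e"
  using frame_decomp[OF n(1), of f] t(2) assms(4) by (simp add: inner_commute)
 from assms(1,2) show ?thesis
 proof (cases rule: hexdir_cases)
  case (half s c)
  have h: "x = (c/2) *\<^sub>R e + (s * (sqrt 3 / 2)) *\<^sub>R rot90 e" using half(3) by simp
  have ef: "e + f = (1/2) *\<^sub>R e + (t * (sqrt 3 / 2)) *\<^sub>R rot90 e"
   proof -
   have "e + (-1/2) *\<^sub>R e = (1/2) *\<^sub>R e" using scaleR_add_left[of 1 "-1/2" e] by simp
   then show ?thesis unfolding f by (simp only: add.assoc[symmetric])
  qed
  consider "c = 1" "s = t" | "c = 1" "s = - t" | "c = -1" "s = t" | "c = -1" "s = -t" using half(1,2) t(1) by auto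
  then show ?thesis
  proof cases
   case 1 then show ?thesis using h ef by simp
  next
   case 2 then have "x = - f" unfolding h f by simp
   then show ?thesis by simp
  next
   case 3 then have "x = f" unfolding h f by simp
   then show ?thesis by simp
  next
   case 4 then have "x = - (e + f)" unfolding h ef by simp
   then show ?thesis by simp
  qed
 qed simp_all
qed

lemma constant_sign:
 fixes f :: "real => real"
 assumes c: "continuous_on {a<..<b} f" and n: "!!t. a < t ==> t < b ==> f t ~= 0"
 shows "(\<forall>t. a < t \<and> t < b --> 0 < f t) \<or> (\<forall>t. a < t \<and> t < b --> f t < 0)"
proof (rule ccontr)
 assume "\<not> ?thesis"
 then obtain s t where st: "a < s" "s < b" "f s <= 0" "a < t" "t < b" "0 <= f t" by (meson not_less)
 have "connected (f ` {a<..<b})" by (rule connected_continuous_image[OF c]) simp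
 then have "0 \<in> f ` {a<..<b}" by (rule connectedD_interval[of _ "f s" "f t"]) (use st in auto)
 then show False using n by auto
qed

lemma closed_nonneg:
 fixes f :: "real => real"
 assumes "closed A" "continuous_on A f"
 shows "closed {t \<in> A. 0 <= f t}"
proof -
 have "{t \<in> A. 0 <= f t} = A \<inter> f -` {0..}" by auto
 then show ?thesis using continuous_closed_preimage[OF assms(2,1) closed_atLeast] by simp
qed

lemma closed_zero:
 fixes f :: "real => real"
 assumes "closed A" "continuous_on A f"
 shows "closed {t \<in> A. f t = 0}"
proof -
 have "{t \<in> A. f t = 0} = A \<inter> f -` {0}" by auto
 then show ?thesis using continuous_closed_preimage[OF assms(2,1) closed_singleton] by simp
qed

lemma closed_ball_all:
 assumes "finite B" "closed A" "!!x. x \<in> B ==> closed {t \<in> A. R x t}"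
 shows "closed {t \<in> A. \<forall>x\<in>B. R x t}"
proof -
 have "{t \<in> A. \<forall>x\<in>B. R x t} = A \<inter> (\<Inter>x\<in>B. {t \<in> A. R x t})" by auto
 moreover have "closed (A \<inter> (\<Inter>x\<in>B. {t \<in> A. R x t}))" by (intro closed_Int closed_INT assms ballI)
 ultimately show ?thesis by simp
qed

lemma closed_ball_ex:
 assumes "finite B" "!!x. x \<in> B ==> closed {t \<in> A. R x t}"
 shows "closed {t \<in> A. \<exists>x\<in>B. R x t}"
proof -
 have "{t \<in> A. \<exists>x\<in>B. R x t} = (\<Union>x\<in>B. {t \<in> A. R x t})" by auto
 moreover have "closed (\<Union>x\<in>B. {t \<in> A. R x t})" by (intro closed_UN assms ballI)
 ultimately show ?thesis by simp
qed

context simple_net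
begin

lemma not_parallel_cross:
 assumes i: "i \<in> Ix" "j \<in> Ix" and np: "\<tau> i ~= \<tau> j" "\<tau> i ~= - \<tau> j"
 shows "\<tau> i \<bullet> rot90 (\<tau> j) ~= 0"
 using tangent_hexdir[OF i(1)] tangent_hexdir[OF i(2)]
proof (cases rule: hexdir_cases)
 case (half s c)
 have "\<tau> j \<bullet> \<tau> j = 1" using tangent_norm[OF valid[OF i(2)]] by (simp add: norm_one_inner)
 then show ?thesis using half(1) unfolding half(3) by (auto simp: inner_add_left)
qed (use np in simp_all)

lemma same_line:
 assumes V: "placement V" and i: "i \<in> Ix" and X: "X \<in> ends i" "Y \<in> ends i"
 shows "(V X - V Y) \<bullet> rot90 (\<tau> i) = 0"
proof (cases "X = Y")
 case False
 then have "V Y = V X + len V i *\<^sub>R d i X" using seg_other(2)[OF V i X] by blast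
 then show ?thesis by (simp add: d_sg inner_diff_left inner_add_left)
qed simp

lemma rot90_d_zero: "v \<bullet> rot90 (d i X) = 0 \<longleftrightarrow> v \<bullet> rot90 (\<tau> i) = 0"
 using sg_sq(2)[of i X] by (auto simp: d_sg rot90_scaleR)

text \<open>The intersection point of the lines through two pieces that are not parallel.\<close>
definition meet :: "(plane => plane) => nat \<times> nat => nat \<times> nat => plane" where
 "meet V i j = V (SOME X. X \<in> ends i) +
  (((V (SOME Y. Y \<in> ends j) - V (SOME X. X \<in> ends i)) \<bullet> rot90 (\<tau> j)) / (\<tau> i \<bullet> rot90 (\<tau> j))) *\<^sub>R \<tau> i"

lemma some_endpoint: "(SOME X. X \<in> ends i) \<in> ends i"
 unfolding some_in_eq by simp

lemma meet_line:
 assumes V: "placement V" and i: "i \<in> Ix" "j \<in> Ix" and np: "\<tau> i \<bullet> rot90 (\<tau> j) ~= 0"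
 shows "X \<in> ends i ==> (meet V i j - V X) \<bullet> rot90 (d i X) = 0"
  and "Y \<in> ends j ==> (meet V i j - V Y) \<bullet> rot90 (d j Y) = 0"
proof -
 define X0 where "X0 = (SOME X. X \<in> ends i)"
 define Y0 where "Y0 = (SOME X. X \<in> ends j)"
 have ends: "X0 \<in> ends i" "Y0 \<in> ends j" by (simp_all add: X0_def Y0_def some_endpoint)
 have m: "meet V i j = V X0 + (((V Y0 - V X0) \<bullet> rot90 (\<tau> j)) / (\<tau> i \<bullet> rot90 (\<tau> j))) *\<^sub>R \<tau> i"
  by (simp add: meet_def X0_def Y0_def)
 show "(meet V i j - V X) \<bullet> rot90 (d i X) = 0" if X: "X \<in> ends i"
  using same_line[OF V i(1) ends(1) X] unfolding rot90_d_zero m by (simp add: inner_diff_left inner_add_left)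
 show "(meet V i j - V Y) \<bullet> rot90 (d j Y) = 0" if Y: "Y \<in> ends j"
  using same_line[OF V i(2) ends(2) Y] np unfolding rot90_d_zero m by (simp add: inner_diff_left inner_add_left)
qed

lemma meet_unique:
 assumes V: "placement V" and i: "i \<in> Ix" "j \<in> Ix" and np: "\<tau> i \<bullet> rot90 (\<tau> j) ~= 0"
  and p: "p \<in> moved V i" "p \<in> moved V j"
 shows "p = meet V i j"
proof -
 obtain X Y where XY: "X \<in> ends i" "Y \<in> ends j" using some_endpoint by blast
 define v where "v = p - meet V i j"
 have "(p - V X) \<bullet> rot90 (d i X) = 0" "(p - V Y) \<bullet> rot90 (d j Y) = 0"
  using p XY unfolding mem_moved_frame[OF V i(1)] mem_moved_frame[OF V i(2)] by blast+
 then have "v \<bullet> rot90 (d i X) = 0" "v \<bullet> rot90 (d j Y) = 0"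
  using meet_line[OF V i np] XY by (auto simp: v_def inner_diff_left)
 then have v: "v \<bullet> rot90 (\<tau> i) = 0" "v \<bullet> rot90 (\<tau> j) = 0" unfolding rot90_d_zero .
 have "v = (v \<bullet> \<tau> i) *\<^sub>R \<tau> i" using frame_decomp[OF tangent_norm[OF valid[OF i(1)]], of v] v(1) by simp
 moreover from this have "(v \<bullet> \<tau> i) * (\<tau> i \<bullet> rot90 (\<tau> j)) = 0" using v(2) by (metis inner_scaleR_left)
 ultimately show ?thesis using np by (simp add: v_def)
qed

lemma meet_iff:
 assumes V: "placement V" and i: "i \<in> Ix" "j \<in> Ix" and np: "\<tau> i \<bullet> rot90 (\<tau> j) ~= 0"
 shows "moved V i \<inter> moved V j ~= {} \<longleftrightarrow>
  (\<forall>X\<in>ends i. 0 <= (meet V i j - V X) \<bullet> d i X) \<and> (\<forall>Y\<in>ends j. 0 <= (meet V i j - V Y) \<bullet> d j Y)"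
proof
 assume "moved V i \<inter> moved V j ~= {}"
 then obtain p where "p \<in> moved V i" "p \<in> moved V j" by blast
 then show "(\<forall>X\<in>ends i. 0 <= (meet V i j - V X) \<bullet> d i X) \<and> (\<forall>Y\<in>ends j. 0 <= (meet V i j - V Y) \<bullet> d j Y)"
  using meet_unique[OF V i np] mem_moved_frame[OF V] i by metis
next
 assume "(\<forall>X\<in>ends i. 0 <= (meet V i j - V X) \<bullet> d i X) \<and> (\<forall>Y\<in>ends j. 0 <= (meet V i j - V Y) \<bullet> d j Y)"
 then have "meet V i j \<in> moved V i" "meet V i j \<in> moved V j"
  using meet_line[OF V i np] unfolding mem_moved_frame[OF V i(1)] mem_moved_frame[OF V i(2)] by blast+
 then show "moved V i \<inter> moved V j ~= {}" by blast
qed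

lemma continuous_meet:
 assumes "!!X. continuous_on A (\<lambda>t. W t X)"
 shows "continuous_on A (\<lambda>t. meet (W t) i j)"
 unfolding meet_def divide_inverse by (intro continuous_intros assms)

text \<open>Moving from a common point towards an end of \<open>i\<close>, one meets that end or leaves
\<open>j\<close> through an end of \<open>j\<close>.\<close>
lemma parallel_meet:
 assumes V: "placement V" and i: "i \<in> Ix" "j \<in> Ix" and par: "\<tau> i = \<tau> j \<or> \<tau> i = - \<tau> j"
  and p: "p \<in> moved V i" "p \<in> moved V j"
 shows "(\<exists>X\<in>ends i. V X \<in> moved V j) \<or> (\<exists>Y\<in>ends j. V Y \<in> moved V i)"
proof -
 obtain X where X: "X \<in> ends i" using some_endpoint by blast
 define a where "a = (p - V X) \<bullet> d i X"
 have pi: "0 <= (p - V Z) \<bullet> d i Z" "(p - V Z) \<bullet> rot90 (d i Z) = 0" if "Z \<in> ends i" for Z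
  using p(1) that unfolding mem_moved_frame[OF V i(1)] by blast+
 have pj: "0 <= (p - V Z) \<bullet> d j Z" "(p - V Z) \<bullet> rot90 (d j Z) = 0" if "Z \<in> ends j" for Z
  using p(2) that unfolding mem_moved_frame[OF V i(2)] by blast+
 have n: "norm (d i X) = 1" using d_norm[OF i(1)] .
 have nn: "d i X \<bullet> d i X = 1" using n by (simp add: norm_one_inner)
 have pX: "p = V X + a *\<^sub>R d i X" using frame_decomp[OF n, of "p - V X"] pi(2)[OF X] by (simp add: a_def algebra_simps)
 have a0: "0 <= a" using pi(1)[OF X] by (simp add: a_def)
 have dij: "d j Z = d i X \<or> d j Z = - d i X" for Z
  using par dir_from_cases[of "P i" X] dir_from_cases[of "P j" Z] by (metis minus_minus)
 have dii: "d i Z = d i X \<or> d i Z = - d i X" for Z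
  using dir_from_cases[of "P i" X] dir_from_cases[of "P i" Z] by (metis minus_minus)
 show ?thesis
 proof (cases "V X \<in> moved V j")
  case True then show ?thesis using X by blast
 next
  case False
  have VXn: "(V X - V Z) \<bullet> rot90 (d j Z) = 0" if "Z \<in> ends j" for Z
   using pj(2)[OF that] dij[of Z] unfolding pX by (auto simp: inner_add_left inner_diff_left rot90_minus)
  obtain Z where Z: "Z \<in> ends j" "(V X - V Z) \<bullet> d j Z < 0"
   using False VXn unfolding mem_moved_frame[OF V i(2)] by (meson not_less)
  have "d j Z = d i X"
  proof (rule ccontr)
   assume "d j Z ~= d i X"
   then have "d j Z = - d i X" using dij by blast
   then show False using Z(2) pj(1)[OF Z(1)] a0 unfolding pX by (simp add: inner_add_left inner_diff_left nn)
  qed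
  define r where "r = (p - V Z) \<bullet> d i X"
  have r: "0 <= r" "r < a" using pj(1)[OF Z(1)] Z(2) \<open>d j Z = d i X\<close> unfolding r_def pX by (simp_all add: inner_add_left inner_diff_left nn)
  have pZ: "V Z = p - r *\<^sub>R d i X"
   using frame_decomp[OF n, of "p - V Z"] pj(2)[OF Z(1)] \<open>d j Z = d i X\<close> by (simp add: r_def algebra_simps)
  have "V Z \<in> moved V i"
   unfolding mem_moved_frame[OF V i(1)]
  proof (intro ballI conjI)
   fix X' assume X': "X' \<in> ends i"
   show "(V Z - V X') \<bullet> rot90 (d i X') = 0" using pi(2)[OF X'] dii[of X'] unfolding pZ
    by (auto simp: inner_diff_left rot90_minus)
   show "0 <= (V Z - V X') \<bullet> d i X'"
   proof (cases "X' = X")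
    case True
    have "(V Z - V X) \<bullet> d i X = a - r" unfolding pZ pX by (simp add: inner_diff_left inner_add_left nn)
    then show ?thesis using r True by simp
   next
    case False
    have dX': "d i X' = - d i X" using seg_other(3)[OF V i(1) X X'] False by blast
    have "(V Z - V X') \<bullet> d i X' = (p - V X') \<bullet> d i X' + r" unfolding pZ dX' by (simp add: inner_diff_left nn)
    then show ?thesis using pi(1)[OF X'] r by simp
   qed
  qed
  then show ?thesis using Z(1) by blast
 qed
qed

lemma closed_mem_moved:
 fixes A :: "real set" and W :: "real => plane => plane"
 assumes A: "closed A" and V: "!!t. t \<in> A ==> placement (W t)" and c: "!!X. continuous_on A (\<lambda>t. W t X)" and i: "i \<in> Ix"
 shows "closed {t \<in> A. W t X \<in> moved (W t) i}"
proof -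
 have "{t \<in> A. W t X \<in> moved (W t) i} = {t \<in> A. \<forall>Z\<in>ends i. 0 <= (W t X - W t Z) \<bullet> d i Z \<and> (W t X - W t Z) \<bullet> rot90 (d i Z) = 0}"
  using mem_moved_frame[OF V i] by blast
 also have "closed ..."
 proof (rule closed_ball_all[OF _ A])
  fix Z assume "Z \<in> ends i"
  have "{t \<in> A. 0 <= (W t X - W t Z) \<bullet> d i Z \<and> (W t X - W t Z) \<bullet> rot90 (d i Z) = 0} =
   {t \<in> A. 0 <= (W t X - W t Z) \<bullet> d i Z} \<inter> {t \<in> A. (W t X - W t Z) \<bullet> rot90 (d i Z) = 0}" by blast
  also have "closed ..." by (rule closed_Int[OF closed_nonneg[OF A] closed_zero[OF A]]) (intro continuous_intros c)+
  finally show "closed {t \<in> A. 0 <= (W t X - W t Z) \<bullet> d i Z \<and> (W t X - W t Z) \<bullet> rot90 (d i Z) = 0}" .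
 qed simp
 finally show ?thesis .
qed

lemma closed_intersecting:
 fixes A :: "real set" and W :: "real => plane => plane"
 assumes A: "closed A" and V: "!!t. t \<in> A ==> placement (W t)" and c: "!!X. continuous_on A (\<lambda>t. W t X)"
  and i: "i \<in> Ix" "j \<in> Ix"
 shows "closed {t \<in> A. moved (W t) i \<inter> moved (W t) j ~= {}}"
proof (cases "\<tau> i = \<tau> j \<or> \<tau> i = - \<tau> j")
 case True
 have "moved (W t) i \<inter> moved (W t) j ~= {} \<longleftrightarrow>
  (\<exists>X\<in>ends i. W t X \<in> moved (W t) j) \<or> (\<exists>Y\<in>ends j. W t Y \<in> moved (W t) i)" if t: "t \<in> A" for t
 proof
  assume "moved (W t) i \<inter> moved (W t) j ~= {}"
  then obtain p where "p \<in> moved (W t) i" "p \<in> moved (W t) j" by blast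
  then show "(\<exists>X\<in>ends i. W t X \<in> moved (W t) j) \<or> (\<exists>Y\<in>ends j. W t Y \<in> moved (W t) i)"
   by (rule parallel_meet[OF V[OF t] i True])
 next
  assume "(\<exists>X\<in>ends i. W t X \<in> moved (W t) j) \<or> (\<exists>Y\<in>ends j. W t Y \<in> moved (W t) i)"
  then show "moved (W t) i \<inter> moved (W t) j ~= {}" using vertex_mem_move[OF V[OF t]] i by blast
 qed
 then have "{t \<in> A. moved (W t) i \<inter> moved (W t) j ~= {}} =
  {t \<in> A. \<exists>X\<in>ends i. W t X \<in> moved (W t) j} \<union> {t \<in> A. \<exists>Y\<in>ends j. W t Y \<in> moved (W t) i}" by blast
 also have "closed ..." by (intro closed_Un closed_ball_ex closed_mem_moved A V c i) simp_all
 finally show ?thesis .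
next
 case False
 then have np: "\<tau> i \<bullet> rot90 (\<tau> j) ~= 0" using not_parallel_cross[OF i] by blast
 have "{t \<in> A. moved (W t) i \<inter> moved (W t) j ~= {}} =
  {t \<in> A. \<forall>X\<in>ends i. 0 <= (meet (W t) i j - W t X) \<bullet> d i X} \<inter> {t \<in> A. \<forall>Y\<in>ends j. 0 <= (meet (W t) i j - W t Y) \<bullet> d j Y}"
  using meet_iff[OF V i np] by blast
 also have "closed ..."
  by (rule closed_Int) (rule closed_ball_all[OF _ A], simp, rule closed_nonneg[OF A], intro continuous_intros continuous_meet c)+
 finally show ?thesis .
qed

text \<open>Half-lines are not compact. Closedness is nevertheless elementary, since every intersection can be
detected at an explicit point that moves continuously: an endpoint, or the point \<open>meet\<close>.\<close>
lemma closed_not_embedded: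
 fixes A :: "real set" and W :: "real => plane => plane"
 assumes A: "closed A" and V: "!!t. t \<in> A ==> placement (W t)" and c: "!!X. continuous_on A (\<lambda>t. W t X)"
 shows "closed {t \<in> A. \<not> embedded (W t)}"
proof -
 let ?B = "{(i, j). (i, j) \<in> Ix \<times> Ix \<and> i ~= j \<and> ends i \<inter> ends j = {}}"
 have fin: "finite ?B" by (rule finite_subset[of _ "Ix \<times> Ix"]) auto
 have eq: "\<not> embedded U \<longleftrightarrow> (\<exists>z\<in>?B. moved U (fst z) \<inter> moved U (snd z) ~= {})" for U
 proof
  assume "\<not> embedded U"
  then obtain i j where "i \<in> Ix" "j \<in> Ix" "i ~= j" "ends i \<inter> ends j = {}" "moved U i \<inter> moved U j ~= {}"
   unfolding embedded_def by blast
  then show "\<exists>z\<in>?B. moved U (fst z) \<inter> moved U (snd z) ~= {}" by (intro bexI[of _ "(i, j)"]) simp_all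
 next
  assume "\<exists>z\<in>?B. moved U (fst z) \<inter> moved U (snd z) ~= {}"
  then show "\<not> embedded U" unfolding embedded_def by fastforce
 qed
 have "{t \<in> A. \<not> embedded (W t)} = {t \<in> A. \<exists>z\<in>?B. moved (W t) (fst z) \<inter> moved (W t) (snd z) ~= {}}"
  unfolding eq ..
 also have "closed ..." by (rule closed_ball_ex[OF fin]) (rule closed_intersecting[OF A V c], auto)
 finally show ?thesis .
qed

text \<open>The dual basis of two directions at 120 degrees.\<close>
lemma inner_decomp:
 assumes m: "m \<in> inc X" "m' \<in> inc X" "m ~= m'"
 shows "v = ((v \<bullet> rot90 (d m' X)) / (d m X \<bullet> rot90 (d m' X))) *\<^sub>R d m X + ((v \<bullet> rot90 (d m X)) / (d m' X \<bullet> rot90 (d m X))) *\<^sub>R d m' X"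
proof -
 define e where "e = d m X"
 define f where "f = d m' X"
 define c where "c = f \<bullet> rot90 e"
 define x where "x = v \<bullet> e"
 define y where "y = v \<bullet> rot90 e"
 have e: "norm e = 1" "e \<bullet> e = 1" using inc_unit[OF m(1)] by (simp_all add: e_def)
 have c0: "c ~= 0" using incident_cross[OF m(1,2)] m(3) by (auto simp: c_def e_def f_def)
 have fe: "f \<bullet> e = -1/2" using incident_inner[OF m(2,1)] m(3) by (simp add: e_def f_def)
 have f: "f = (-1/2) *\<^sub>R e + c *\<^sub>R rot90 e" using frame_decomp[OF e(1), of f] fe by (simp add: c_def)
 have v: "v = x *\<^sub>R e + y *\<^sub>R rot90 e" using frame_decomp[OF e(1), of v] by (simp add: x_def y_def)
 have rf: "rot90 f = (-1/2) *\<^sub>R rot90 e - c *\<^sub>R e" unfolding f by (simp only: rot90_add rot90_scaleR rot90_rot90 scaleR_minus_right diff_conv_add_uminus)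
 have vf: "v \<bullet> rot90 f = - y / 2 - c * x" unfolding rf by (simp add: inner_diff_right x_def y_def)
 have ef: "e \<bullet> rot90 f = - c" unfolding rf by (simp add: inner_diff_right e)
 have "a *\<^sub>R e + b *\<^sub>R f = (a - b / 2) *\<^sub>R e + (b * c) *\<^sub>R rot90 e" for a b
 proof -
  have "b *\<^sub>R f = (b * (-1/2)) *\<^sub>R e + (b * c) *\<^sub>R rot90 e" unfolding f by (simp only: scaleR_add_right scaleR_scaleR)
  moreover have "(a - b / 2) *\<^sub>R e = a *\<^sub>R e + (b * (-1/2)) *\<^sub>R e" unfolding scaleR_add_left[symmetric] by simp
  ultimately show ?thesis by (simp only: add.assoc)
 qed
 then have "((v \<bullet> rot90 f) / (e \<bullet> rot90 f)) *\<^sub>R e + (y / c) *\<^sub>R f = ((v \<bullet> rot90 f) / (e \<bullet> rot90 f) - (y / c) / 2) *\<^sub>R e + ((y / c) * c) *\<^sub>R rot90 e" .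
 also have "(v \<bullet> rot90 f) / (e \<bullet> rot90 f) - (y / c) / 2 = x" unfolding vf ef using c0 by (simp add: field_simps)
 also have "(y / c) * c = y" using c0 by simp
 finally have "v = ((v \<bullet> rot90 f) / (e \<bullet> rot90 f)) *\<^sub>R e + (y / c) *\<^sub>R f" using v by metis
 then show ?thesis unfolding e_def f_def c_def y_def .
qed

lemma star_two_or_three:
 assumes m: "m \<in> inc X" "m' \<in> inc X" "m ~= m'"
 obtains "inc X = {m, m'}" | m'' where "m'' \<in> inc X" "m ~= m''" "m' ~= m''" "d m'' X = - (d m X + d m' X)"
proof -
 have X: "X \<in> Vx" using m endpoint_vertex[of m X] by (simp add: inc_iff)
 from X show thesis
 proof (cases rule: star_cases)
  case (two i j)
  then have "inc X = {m, m'}" using m by auto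
  then show ?thesis by (rule that(1))
 next
  case (three i j k)
  have s: "d i X + d j X + d k X = 0" by (rule three(5))
  have "\<exists>m''\<in>inc X. m ~= m'' \<and> m' ~= m'' \<and> d m X + d m' X + d m'' X = 0"
   using m three(1-4) s by (auto simp: algebra_simps)
  then obtain m'' where "m'' \<in> inc X" "m ~= m''" "m' ~= m''" "d m X + d m' X + d m'' X = 0" by blast
  then show ?thesis using that(2)[of m''] minus_unique[of "d m X + d m' X" "d m'' X"] by simp
 qed
qed

end

section \<open>No collision while the lengths stay positive\<close>

context simple_net
begin

text \<open>A maximal value at \<open>X\<close> can only decrease along the piece.\<close>
lemma curv_sign:
 assumes V: "i \<in> inc X" and L: "!!i. i \<in> segs ==> 0 < L i" and \<epsilon>: "\<bar>\<epsilon>\<bar> = 1" and g: "\<epsilon> * crystalline L (i, X) = half_facet"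
 shows "\<epsilon> * (sg i X * curv L i) <= 0"
proof (cases "i \<in> segs")
 case s: True
 define g where "g = crystalline L"
 have le: "\<epsilon> * g z <= half_facet" for z
  using end_data_bound[OF crystalline_data, of L z] \<epsilon> unfolding g_def by (metis abs_ge_self abs_mult mult_1 order_trans)
 have eq: "\<epsilon> * g (i, X) = half_facet" using g by (simp add: g_def)
 have "X = start i \<or> X = fin i" using V seg_ends(4)[OF s] by (auto simp: inc_iff)
 then have "\<epsilon> * (sg i X * jump g i) <= 0"
 proof
  assume X: "X = start i"
  have "\<epsilon> * (sg i X * jump g i) = \<epsilon> * g (i, fin i) - \<epsilon> * g (i, X)" unfolding X sg_ends(1)[OF s] jump_def by (simp add: algebra_simps)
  then show ?thesis using eq le by simp
 next
  assume X: "X = fin i"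
  have "\<epsilon> * (sg i X * jump g i) = \<epsilon> * g (i, start i) - \<epsilon> * g (i, X)" unfolding X sg_ends(2)[OF s] jump_def by (simp add: algebra_simps)
  then show ?thesis using eq le by simp
 qed
 moreover have "\<epsilon> * (sg i X * curv L i) = \<epsilon> * (sg i X * jump g i) / L i" using s by (simp add: curv_def g_def)
 ultimately show ?thesis using L[OF s] by (simp add: divide_nonpos_pos)
qed simp

lemma alternating_pairs:
 fixes e f x x' :: plane
 assumes "e \<bullet> e = 1" "f \<bullet> f = 1" "e \<bullet> f = -1/2" "f \<bullet> e = -1/2"
  and "x \<in> {- e, - f, e + f, - (e + f)}" "x' \<in> {- e, - f, e + f, - (e + f)}" "x \<bullet> x' = -1/2"
 shows "(x = - e \<and> x' = - f) \<or> (x = - f \<and> x' = - e) \<or> (x = e + f \<and> (x' = - e \<or> x' = - f)) \<or> (x' = e + f \<and> (x = - e \<or> x = - f))"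
 using assms(5,6)
 by (elim insertE emptyE) (use assms(1-4,7) in \<open>simp_all add: inner_add_left inner_add_right inner_diff_left inner_diff_right\<close>)

lemma positive_min:
 assumes "finite A" "!!x. x \<in> A ==> 0 < (f x :: real)"
 obtains \<eta> where "0 < \<eta>" "!!x. x \<in> A ==> \<eta> <= f x"
proof (cases "A = {}")
 case True then show ?thesis using that[of 1] by simp
next
 case False
 have "0 < Min (f ` A)" using assms False by simp
 moreover have "Min (f ` A) <= f x" if "x \<in> A" for x using assms(1) that by simp
 ultimately show ?thesis by (rule that)
qed

context
 fixes h :: "real => nat \<times> nat => real" and b \<delta>
 assumes b0: "0 < b" and \<delta>0: "0 < \<delta>"
  and hc: "!!i. i \<in> Ix ==> continuous_on {0..b} (\<lambda>t. h t i)"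
  and co: "!!t. 0 <= t ==> t <= b ==> compatible (h t)"
  and ln: "!!t i. 0 <= t ==> t <= b ==> i \<in> segs ==> \<delta> <= len (pos (h t)) i"
  and der: "!!t i. 0 < t ==> t < b ==> i \<in> Ix ==> ((\<lambda>t. h t i) has_real_derivative - curv (len (pos (h t))) i) (at t)"
  and emb: "!!t. 0 < t ==> t < b ==> embedded (pos (h t))"
begin

abbreviation "W t \<equiv> pos (h t)"

lemma placement_W: "0 <= t ==> t <= b ==> placement (W t)"
 by (rule placement_pos[OF co]) (use ln[of t] \<delta>0 in \<open>auto intro: less_le_trans\<close>)

lemma placement_end: "placement (W b)"
 using placement_W b0 by simp

lemma continuous_W: "continuous_on {0..b} (\<lambda>t. W t X)"
 by (rule continuous_pos[OF hc])

lemma left_limit: "continuous_on {0..b} f ==> (f \<longlongrightarrow> f b) (at_left b)"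
 by (rule continuous_on_Icc_at_leftD[OF _ b0])

lemma near_gt: "continuous_on {0..b} f ==> (c :: real) < f b ==> eventually (\<lambda>t. c < f t) (at_left b)"
 using left_limit order_tendstoD(1) by blast

lemma near_lt: "continuous_on {0..b} f ==> f b < (c :: real) ==> eventually (\<lambda>t. f t < c) (at_left b)"
 using left_limit order_tendstoD(2) by blast

lemma near_time: "eventually (\<lambda>t. 0 < t \<and> t < b) (at_left b)"
 unfolding eventually_at_left_field using b0 by blast

text \<open>Normal to an incident piece, a vertex moves with the speed of that piece.\<close>
lemma vertex_derivative:
 assumes i: "i \<in> inc X" and t: "0 < t" "t < b"
 shows "((\<lambda>t. W t X \<bullet> \<nu> i) has_real_derivative - curv (len (W t)) i) (at t)"
proof (rule has_field_derivative_transform_within_open[of "\<lambda>t. X \<bullet> \<nu> i + h t i" _ _ "{0<..<b}"])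
 have iI: "i \<in> Ix" using i by (simp add: inc_iff)
 show "((\<lambda>t. X \<bullet> \<nu> i + h t i) has_real_derivative - curv (len (W t)) i) (at t)"
  using DERIV_add[OF DERIV_const der[OF t iI], of "X \<bullet> \<nu> i"] by simp
 show "X \<bullet> \<nu> i + h s i = W s X \<bullet> \<nu> i" if "s \<in> {0<..<b}" for s
  using pos_inner[OF co i, of s] that by (simp add: inner_diff_left)
qed (use t in auto)

text \<open>The width \<open>y\<close> of the strip satisfies \<open>y' \<ge> - C * y\<close> by
\<open>facing_slopes\<close>, so \<open>y * exp (C * t)\<close> does not decrease and cannot reach
zero.\<close>
lemma no_squeeze:
 assumes F: "F \<in> Ix" "G \<in> Ix" and e: "norm e = 1" "\<tau> F = e \<or> \<tau> F = - e" "\<tau> G = e \<or> \<tau> G = - e"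
  and XY: "X0 \<in> ends F" "Y0 \<in> ends G"
  and gap: "(W b X0 - W b Y0) \<bullet> rot90 e = 0" "eventually (\<lambda>t. 0 < (W t X0 - W t Y0) \<bullet> rot90 e) (at_left b)"
  and l: "0 < l" "!!X. X \<in> ends F ==> l < (z - W b X) \<bullet> d F X" "!!Y. Y \<in> ends G ==> l < (z - W b Y) \<bullet> d G Y"
 shows False
proof -
 define y where "y t = (W t X0 - W t Y0) \<bullet> rot90 e" for t
 have cy: "continuous_on {0..b} y" unfolding y_def by (intro continuous_intros continuous_W)
 have yb: "y b = 0" using gap(1) by (simp add: y_def)
 define D where "D t = curv (len (W t)) F * (\<tau> F \<bullet> e) - curv (len (W t)) G * (\<tau> G \<bullet> e)" for t
 define C where "C = 2 / (\<delta> * l)"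
 have ee: "e \<bullet> e = 1" using e(1) by (simp add: norm_one_inner)
 have "\<forall>\<^sub>F t in at_left b. \<forall>X\<in>ends F. l < (z - W t X) \<bullet> d F X"
  by (intro eventually_ball_finite ballI near_gt continuous_intros continuous_W l(2)) simp_all
 moreover have "\<forall>\<^sub>F t in at_left b. \<forall>Y\<in>ends G. l < (z - W t Y) \<bullet> d G Y"
  by (intro eventually_ball_finite ballI near_gt continuous_intros continuous_W l(3)) simp_all
 moreover have "\<forall>\<^sub>F t in at_left b. y t < min l (\<delta> / 2)" by (rule near_lt[OF cy]) (use yb l \<delta>0 in simp)
 ultimately have "\<forall>\<^sub>F t in at_left b. 0 < y t \<and> D t <= C * y t"
  using gap(2) near_time
 proof eventually_elim
  case (elim t)
  have V: "placement (W t)" using elim by (intro placement_W) auto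
  have E: "embedded (W t)" using elim emb by auto
  have dl: "!!i. i \<in> segs ==> \<delta> <= len (W t) i" using elim by (intro ln) auto
  have yt: "0 < y t" "y t < l" "2 * y t < \<delta>" using elim by (auto simp: y_def)
  have "facing (W t) l (y t) e 1 z F G"
   unfolding facing_def
  proof (intro conjI ballI)
   fix X Y assume X: "X \<in> ends F" and Y: "Y \<in> ends G"
   have "(W t X - W t X0) \<bullet> rot90 e = 0" using same_line[OF V F(1) X XY(1)] e(2) by (auto simp: rot90_minus)
   moreover have "(W t Y - W t Y0) \<bullet> rot90 e = 0" using same_line[OF V F(2) Y XY(2)] e(3) by (auto simp: rot90_minus)
   ultimately show "(W t X - W t Y) \<bullet> (1 *\<^sub>R rot90 e) = y t" by (simp add: y_def inner_diff_left)
  qed (use F e elim in auto)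
  from facing_slopes[OF V E dl \<delta>0 this yt] have "D t * l <= (2 / \<delta>) * y t" by (simp add: D_def)
  then have "D t <= C * y t" using l(1) \<delta>0 by (simp add: C_def field_simps)
  then show ?case using yt by simp
 qed
 then have "\<forall>\<^sub>F t in at_left b. 0 < y t \<and> D t <= C * y t \<and> 0 < t \<and> t < b"
  using near_time by eventually_elim simp
 then obtain a where a: "a < b" "!!t. a < t ==> t < b ==> 0 < y t \<and> D t <= C * y t \<and> 0 < t \<and> t < b"
  unfolding eventually_at_left_field by blast
 define c where "c = (a + b) / 2"
 have c: "a < c" "c < b" using a(1) by (simp_all add: c_def)
 have c0: "0 < c" "0 < y c" using a(2)[OF c] by auto
 have yd: "(y has_real_derivative - D t) (at t)" if t: "0 < t" "t < b" for t
 proof -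
  have iF: "F \<in> inc X0" "G \<in> inc Y0" using F XY by (simp_all add: inc_iff)
  have r: "rot90 e = (\<tau> F \<bullet> e) *\<^sub>R \<nu> F" "rot90 e = (\<tau> G \<bullet> e) *\<^sub>R \<nu> G" using e ee by (auto simp: normal_def rot90_minus)
  have y: "y = (\<lambda>t. (\<tau> F \<bullet> e) * (W t X0 \<bullet> \<nu> F) - (\<tau> G \<bullet> e) * (W t Y0 \<bullet> \<nu> G))"
  proof
   fix t
   have "y t = W t X0 \<bullet> rot90 e - W t Y0 \<bullet> rot90 e" by (simp add: y_def inner_diff_left)
   also have "W t X0 \<bullet> rot90 e = (\<tau> F \<bullet> e) * (W t X0 \<bullet> \<nu> F)" by (subst r(1)) simp
   also have "W t Y0 \<bullet> rot90 e = (\<tau> G \<bullet> e) * (W t Y0 \<bullet> \<nu> G)" by (subst r(2)) simp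
   finally show "y t = (\<tau> F \<bullet> e) * (W t X0 \<bullet> \<nu> F) - (\<tau> G \<bullet> e) * (W t Y0 \<bullet> \<nu> G)" .
  qed
  have "(y has_real_derivative (\<tau> F \<bullet> e) * (- curv (len (W t)) F) - (\<tau> G \<bullet> e) * (- curv (len (W t)) G)) (at t)"
   unfolding y by (intro DERIV_diff DERIV_cmult vertex_derivative iF t)
  then show ?thesis by (simp add: D_def mult.commute)
 qed
 have "y c * exp (C * c) <= y b * exp (C * b)"
 proof (rule DERIV_nonneg_imp_increasing_open[where f = "\<lambda>t. y t * exp (C * t)"])
  fix t assume t: "c < t" "t < b"
  have at: "0 < y t" "D t <= C * y t" "0 < t" using a(2)[of t] t c by auto
  have "((\<lambda>t. y t * exp (C * t)) has_real_derivative (- D t) * exp (C * t) + (exp (C * t) * C) * y t) (at t)"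
   by (rule DERIV_mult[OF yd[OF at(3) t(2)]]) (auto intro!: derivative_eq_intros)
  moreover have "0 <= (- D t) * exp (C * t) + (exp (C * t) * C) * y t"
  proof -
   have "0 <= exp (C * t) * (C * y t - D t)" using at by simp
   then show ?thesis by (simp add: algebra_simps)
  qed
  ultimately show "\<exists>y'. ((\<lambda>t. y t * exp (C * t)) has_real_derivative y') (at t) \<and> 0 <= y'" by blast
 next
  have "continuous_on {c..b} y" by (rule continuous_on_subset[OF cy]) (use c0 in auto)
  then show "continuous_on {c..b} (\<lambda>t. y t * exp (C * t))" by (intro continuous_intros)
 qed (use c in simp)
 then show False using c0 yb by (simp add: mult_le_0_iff not_le)
qed

text \<open>Before time \<open>b\<close> the width of the strip does not vanish, as the pieces would overlap;
it has constant sign, and \<open>no_squeeze\<close> applies to the pair in one of the two orders.\<close>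
lemma no_overlap:
 assumes F: "F \<in> Ix" "G \<in> Ix" "F ~= G" and par: "\<tau> G = \<tau> F \<or> \<tau> G = - \<tau> F"
  and p: "p \<in> moved (W b) F" "p \<in> moved (W b) G" and q: "q \<in> moved (W b) F" "q \<in> moved (W b) G" and pq: "p ~= q"
 shows False
proof -
 define e where "e = \<tau> F"
 have e: "norm e = 1" "e \<bullet> e = 1" using tangent_norm[OF valid[OF F(1)]] by (simp_all add: e_def norm_one_inner)
 have eF: "\<tau> F = e \<or> \<tau> F = - e" and eG: "\<tau> G = e \<or> \<tau> G = - e" using par by (simp_all add: e_def)
 have eGr: "\<tau> F = \<tau> G \<or> \<tau> F = - \<tau> G" using par by auto
 obtain X0 Y0 where XY: "X0 \<in> ends F" "Y0 \<in> ends G" using some_endpoint by blast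
 have disj: "ends F \<inter> ends G = {}"
 proof (rule ccontr)
  assume "ends F \<inter> ends G ~= {}"
  then obtain Z where Z: "F \<in> inc Z" "G \<in> inc Z" using F by (auto simp: inc_iff)
  have "d F Z ~= d G Z" "d F Z ~= - d G Z" using parallel_not_adjacent[OF Z F(3)] by blast+
  then show False using par dir_from_cases[of "P F" Z] dir_from_cases[of "P G" Z] by (metis minus_minus)
 qed
 have zero: "v \<bullet> rot90 (d i X) = 0 \<longleftrightarrow> v \<bullet> rot90 e = 0" if "i = F \<or> i = G" for i X v
  unfolding rot90_d_zero using that par by (auto simp: e_def rot90_minus)
 have m: "0 <= (r - W b X) \<bullet> d i X \<and> (r - W b X) \<bullet> rot90 e = 0" if "i = F \<or> i = G" "r = p \<or> r = q" "X \<in> ends i" for i X r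
 proof -
  have "i \<in> Ix" "r \<in> moved (W b) i" using that F p q by auto
  then have "0 <= (r - W b X) \<bullet> d i X \<and> (r - W b X) \<bullet> rot90 (d i X) = 0" using mem_moved_frame[OF placement_end, of i r] that(3) by blast
  then show ?thesis using zero[OF that(1)] by blast
 qed
 have gap0: "(W b X0 - W b Y0) \<bullet> rot90 e = 0"
  using m[of F p X0] m[of G p Y0] XY by (simp add: inner_diff_left)
 \<comment> \<open>both pieces extend by \<open>2 * l\<close> to either side of the midpoint, hence by \<open>l\<close> shortly before\<close>
 define z where "z = (1/2) *\<^sub>R (p + q)"
 define l where "l = \<bar>(p - q) \<bullet> e\<bar> / 4"
 have "(p - q) \<bullet> rot90 e = 0" using m[of F p X0] m[of F q X0] XY by (simp add: inner_diff_left)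
 then have "p - q = ((p - q) \<bullet> e) *\<^sub>R e" using frame_decomp[OF e(1), of "p - q"] by simp
 then have "(p - q) \<bullet> e ~= 0" using pq by (metis right_minus_eq scaleR_zero_left)
 then have l0: "0 < l" by (simp add: l_def)
 have lX: "l < (z - W b X) \<bullet> d i X" if i: "i = F \<or> i = G" "X \<in> ends i" for i X
 proof -
  define A where "A = (p - W b X) \<bullet> d i X"
  define B where "B = (q - W b X) \<bullet> d i X"
  have AB: "0 <= A" "0 <= B" using m[OF i(1) _ i(2)] by (auto simp: A_def B_def)
  have "(z - W b X) = (1/2) *\<^sub>R (p - W b X) + (1/2) *\<^sub>R (q - W b X)"
   unfolding z_def scaleR_diff_right scaleR_add_right using scaleR_half_double[of "W b X"] by (simp add: algebra_simps)
  then have z: "(z - W b X) \<bullet> d i X = (A + B) / 2" by (simp add: A_def B_def inner_add_left)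
  have "d i X = e \<or> d i X = - e" using i(1) par dir_from_cases[of "P i" X] by (auto simp: e_def)
  then have "\<bar>(p - q) \<bullet> e\<bar> = \<bar>(p - q) \<bullet> d i X\<bar>" by auto
  also have "(p - q) \<bullet> d i X = A - B" by (simp add: A_def B_def inner_diff_left)
  finally have "4 * l = \<bar>A - B\<bar>" by (simp add: l_def)
  moreover have "\<bar>A - B\<bar> <= A + B" using AB by (simp add: abs_le_iff)
  ultimately have "4 * l <= A + B" by simp
  then have "l < (A + B) / 2" using l0 by simp
  then show ?thesis unfolding z .
 qed
 have l0X: "0 < (z - W b X) \<bullet> d i X" if i: "i = F \<or> i = G" "X \<in> ends i" for i X
  using lX[OF i] l0 by linarith
 define y where "y t = (W t X0 - W t Y0) \<bullet> rot90 e" for t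
 have cy: "continuous_on {0..b} y" unfolding y_def by (intro continuous_intros continuous_W)
 have "\<forall>\<^sub>F t in at_left b. \<forall>X\<in>ends F. 0 < (z - W t X) \<bullet> d F X"
  by (intro eventually_ball_finite finite_endpoints ballI near_gt continuous_intros continuous_W l0X disjI1 refl)
 moreover have "\<forall>\<^sub>F t in at_left b. \<forall>Y\<in>ends G. 0 < (z - W t Y) \<bullet> d G Y"
  by (intro eventually_ball_finite finite_endpoints ballI near_gt continuous_intros continuous_W l0X disjI2 refl)
 ultimately have "\<forall>\<^sub>F t in at_left b. y t ~= 0 \<and> 0 < t \<and> t < b"
  using near_time
 proof eventually_elim
  case (elim t)
  have V: "placement (W t)" using elim by (intro placement_W) auto
  have "y t ~= 0"
  proof
   assume y0: "y t = 0"
   \<comment> \<open>the projection of \<open>z\<close> to the common line belongs to both pieces\<close>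
   define w where "w = z - ((z - W t X0) \<bullet> rot90 e) *\<^sub>R rot90 e"
   have we: "(w - W t X) \<bullet> d i X = (z - W t X) \<bullet> d i X" if "i = F \<or> i = G" for i X
   proof -
    have "d i X = e \<or> d i X = - e" using that par dir_from_cases[of "P i" X] by (auto simp: e_def)
    then show ?thesis by (auto simp: w_def inner_diff_left)
   qed
   have w0: "(w - W t X0) \<bullet> rot90 e = 0" using e(2) by (simp add: w_def inner_diff_left)
   have wn: "(w - W t X) \<bullet> rot90 (d i X) = 0" if i: "i = F \<or> i = G" "X \<in> ends i" for i X
    unfolding zero[OF i(1)]
    using i(1)
   proof
    assume iF: "i = F"
    have "(W t X - W t X0) \<bullet> rot90 e = 0" using same_line[OF V F(1) _ XY(1), of X] i(2) iF by (simp add: e_def)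
    then show "(w - W t X) \<bullet> rot90 e = 0" using w0 by (simp add: inner_diff_left)
   next
    assume iG: "i = G"
    have "(W t X - W t Y0) \<bullet> rot90 (\<tau> G) = 0" using same_line[OF V F(2) _ XY(2), of X] i(2) iG by simp
    then have "(W t X - W t Y0) \<bullet> rot90 e = 0" using par by (auto simp: e_def rot90_minus)
    then show "(w - W t X) \<bullet> rot90 e = 0" using w0 y0 by (simp add: inner_diff_left y_def)
   qed
   have "w \<in> moved (W t) F" unfolding mem_moved_frame[OF V F(1)] using we wn elim(1) by (auto intro: less_imp_le)
   moreover have "w \<in> moved (W t) G" unfolding mem_moved_frame[OF V F(2)] using we wn elim(2) by (auto intro: less_imp_le)
   moreover have "embedded (W t)" using elim(3) emb by blast
   ultimately show False using F disj unfolding embedded_def by blast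
  qed
  then show ?case using elim(3) by blast
 qed
 then obtain a where a: "a < b" "!!t. a < t ==> t < b ==> y t ~= 0 \<and> 0 < t \<and> t < b"
  unfolding eventually_at_left_field by blast
 have "continuous_on {a<..<b} y" by (rule continuous_on_subset[OF cy]) (use a(2) in force)
 from constant_sign[OF this] a(2) consider "\<forall>t. a < t \<and> t < b --> 0 < y t" | "\<forall>t. a < t \<and> t < b --> y t < 0" by blast
 then show False
 proof cases
  case 1
  then have "\<forall>\<^sub>F t in at_left b. 0 < (W t X0 - W t Y0) \<bullet> rot90 e" unfolding eventually_at_left_field y_def using a(1) by blast
  then show False using no_squeeze[OF F(1,2) e(1) eF eG XY gap0 _ l0] lX by blast
 next
  case 2
  have sw: "(W t Y0 - W t X0) \<bullet> rot90 e = - y t" for t by (simp add: y_def inner_diff_left)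
  have "\<forall>\<^sub>F t in at_left b. 0 < (W t Y0 - W t X0) \<bullet> rot90 e" unfolding eventually_at_left_field sw using 2 a(1) by auto
  moreover have "(W b Y0 - W b X0) \<bullet> rot90 e = 0" using gap0 by (simp add: inner_diff_left)
  ultimately show False using no_squeeze[OF F(2,1) e(1) eG eF XY(2,1) _ _ l0] lX by blast
 qed
qed

lemma extend_common:
 assumes m: "m \<in> inc X" and j: "j \<in> Ix" "m ~= j" and par: "d m X = \<tau> j \<or> d m X = - \<tau> j"
  and ins: "!!Z. Z \<in> ends j ==> 0 < (W b X - W b Z) \<bullet> d j Z" and on: "W b X \<in> moved (W b) j"
 shows False
proof -
 obtain \<eta> where \<eta>: "0 < \<eta>" "!!Z. Z \<in> ends j ==> \<eta> <= (W b X - W b Z) \<bullet> d j Z"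
  using positive_min[OF finite_endpoints, of "P j" "\<lambda>Z. (W b X - W b Z) \<bullet> d j Z"] ins by blast
 have mI: "m \<in> Ix" "X \<in> ends m" using m by (simp_all add: inc_iff)
 define r where "r = min \<eta> \<delta>"
 have r: "0 < r" "r <= \<eta>" "r <= \<delta>" using \<eta> \<delta>0 by (simp_all add: r_def)
 define q where "q = W b X + r *\<^sub>R d m X"
 have "q \<in> moved (W b) m" unfolding q_def using r ln[of b m] b0 by (intro mem_near[OF placement_end m]) auto
 moreover have "q \<in> moved (W b) j"
  unfolding mem_moved_frame[OF placement_end j(1)]
 proof (intro ballI conjI)
  fix Z assume Z: "Z \<in> ends j"
  have dd: "d m X = d j Z \<or> d m X = - d j Z" using par dir_from_cases[of "P j" Z] by (metis minus_minus)
  have "d j Z \<bullet> d j Z = 1" using d_norm[OF j(1), of Z] by (simp add: norm_one_inner)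
  then show "0 <= (q - W b Z) \<bullet> d j Z" using dd \<eta>(2)[OF Z] r by (auto simp: q_def inner_diff_left inner_add_left)
  have "(W b X - W b Z) \<bullet> rot90 (d j Z) = 0" using on Z unfolding mem_moved_frame[OF placement_end j(1)] by blast
  then show "(q - W b Z) \<bullet> rot90 (d j Z) = 0" using dd by (auto simp: q_def inner_diff_left inner_add_left)
 qed
 moreover have "W b X ~= q" using r inc_unit(1)[OF m] by (auto simp: q_def)
 moreover have "\<tau> j = \<tau> m \<or> \<tau> j = - \<tau> m" using par dir_from_cases[of "P m" X] by (metis minus_minus)
 ultimately show False using no_overlap[OF mI(1) j _ vertex_mem_move[OF placement_end mI] on] by blast
qed

text \<open>Either an edge at \<open>X\<close> comes to overlap with \<open>j\<close>, or the edges at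
\<open>X\<close> lie on both sides of \<open>j\<close>, as two of them differ by 120 degrees, and have crossed
\<open>j\<close> before.\<close>
lemma vertex_not_inside:
 assumes X: "X \<in> Vx" and j: "j \<in> Ix" and on: "W b X \<in> moved (W b) j"
  and ins: "!!Z. Z \<in> ends j ==> 0 < (W b X - W b Z) \<bullet> d j Z"
 shows False
proof -
 have Xj: "X \<notin> ends j" using ins[of X] by auto
 obtain m1 m2 where m: "m1 \<in> inc X" "m2 \<in> inc X" "m1 ~= m2" using two_incident[OF X] .
 have nj: "m ~= j" if "m \<in> inc X" for m using that Xj by (auto simp: inc_iff)
 have par: False if "m \<in> inc X" "d m X = \<tau> j \<or> d m X = - \<tau> j" for m
  using extend_common[OF that(1) j nj[OF that(1)] that(2) ins on] .
 have tj: "\<tau> j \<in> hexdir" "norm (\<tau> j) = 1" "\<tau> j \<bullet> \<tau> j = 1" using tangent_hexdir[OF j] tangent_norm[OF valid[OF j]] by (simp_all add: norm_one_inner)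
 have side: "\<exists>s c. (s = 1 \<or> s = -1) \<and> (c = 1 \<or> c = -1) \<and> d m X = (c/2) *\<^sub>R \<tau> j + (s * sqrt 3 / 2) *\<^sub>R rot90 (\<tau> j)"
  if mm: "m \<in> inc X" for m
 proof -
  have "d m X \<in> hexdir" using mm d_hexdir by (simp add: inc_iff)
  then show ?thesis
   using tj(1)
  proof (cases rule: hexdir_cases)
   case same then show ?thesis using par[OF mm] by simp
  next
   case opp then show ?thesis using par[OF mm] by simp
  next
   case (half s c) then show ?thesis by blast
  qed
 qed
 obtain s1 c1 where 1: "s1 = 1 \<or> s1 = -1" "c1 = 1 \<or> c1 = -1" "d m1 X = (c1/2) *\<^sub>R \<tau> j + (s1 * sqrt 3 / 2) *\<^sub>R rot90 (\<tau> j)"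
  using side[OF m(1)] by blast
 obtain s2 c2 where 2: "s2 = 1 \<or> s2 = -1" "c2 = 1 \<or> c2 = -1" "d m2 X = (c2/2) *\<^sub>R \<tau> j + (s2 * sqrt 3 / 2) *\<^sub>R rot90 (\<tau> j)"
  using side[OF m(2)] by blast
 have "c1 / 2 * (c2 / 2) + s1 * sqrt 3 / 2 * (s2 * sqrt 3 / 2) = -1/2"
 proof -
  have r: "\<tau> j \<bullet> rot90 (\<tau> j) = 0" "rot90 (\<tau> j) \<bullet> \<tau> j = 0" "rot90 (\<tau> j) \<bullet> rot90 (\<tau> j) = 1" using tj by simp_all
  have "d m1 X \<bullet> d m2 X = c1 / 2 * (c2 / 2) + s1 * sqrt 3 / 2 * (s2 * sqrt 3 / 2)"
   unfolding 1(3) 2(3) inner_add_left inner_add_right inner_scaleR_left inner_scaleR_right r tj(3) by (simp add: field_simps)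
  then show ?thesis using incident_inner[OF m] by simp
 qed
 then have "c1 * c2 / 4 + s1 * s2 * (sqrt 3 * sqrt 3) / 4 = -1/2" by (simp add: algebra_simps)
 then have "c1 * c2 + 3 * (s1 * s2) = -2" by simp
 then have s: "s1 = 1 \<and> s2 = -1 \<or> s1 = -1 \<and> s2 = 1" using 1(1,2) 2(1,2) by auto
 have i1: "d m1 X \<bullet> rot90 (\<tau> j) = s1 * (sqrt 3 / 2)" unfolding 1(3) by (simp add: inner_add_left tj)
 have i2: "d m2 X \<bullet> rot90 (\<tau> j) = s2 * (sqrt 3 / 2)" unfolding 2(3) by (simp add: inner_add_left tj)
 obtain a b' where ab: "a \<in> inc X" "b' \<in> inc X" "d a X \<bullet> rot90 (\<tau> j) = sqrt 3 / 2" "d b' X \<bullet> rot90 (\<tau> j) = - (sqrt 3 / 2)"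
  using s
 proof
  assume "s1 = 1 \<and> s2 = -1" then show thesis using that[OF m(1,2)] i1 i2 by simp
 next
  assume "s1 = -1 \<and> s2 = 1" then show thesis using that[OF m(2,1)] i1 i2 by simp
 qed
 obtain \<eta> where \<eta>: "0 < \<eta>" "!!Z. Z \<in> ends j ==> \<eta> <= (W b X - W b Z) \<bullet> d j Z"
  using positive_min[OF finite_endpoints, of "P j" "\<lambda>Z. (W b X - W b Z) \<bullet> d j Z"] ins by blast
 obtain Z0 where Z0: "Z0 \<in> ends j" using some_endpoint by blast
 have y0: "(W b X - W b Z0) \<bullet> rot90 (\<tau> j) = 0"
  using on Z0 rot90_d_zero unfolding mem_moved_frame[OF placement_end j] by blast
 have half: "\<eta> / 2 < (W b X - W b Z) \<bullet> d j Z" if "Z \<in> ends j" for Z using \<eta>(2)[OF that] \<eta>(1) by linarith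
 have "\<forall>\<^sub>F t in at_left b. \<forall>Z\<in>ends j. \<eta> / 2 < (W t X - W t Z) \<bullet> d j Z"
  by (intro eventually_ball_finite finite_endpoints ballI near_gt continuous_intros continuous_W half)
 moreover have "\<forall>\<^sub>F t in at_left b. \<bar>(W t X - W t Z0) \<bullet> rot90 (\<tau> j)\<bar> < min \<delta> (\<eta>/2) / 2"
  by (intro near_lt continuous_intros continuous_W) (use y0 \<eta> \<delta>0 in simp)
 ultimately have "\<forall>\<^sub>F t in at_left b. False"
  using near_time
 proof eventually_elim
  case (elim t)
  show False
  proof (rule wedge_line_cross[where V = "W t" and \<delta> = \<delta> and \<eta> = "\<eta> / 2", OF _ _ _ j Xj ab Z0 elim(2)])
   show "placement (W t)" "embedded (W t)" using elim(3) emb by (auto intro: placement_W)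
   show "\<delta> <= len (W t) i" if "i \<in> segs" for i using elim(3) that by (auto intro: ln)
   show "\<eta> / 2 <= (W t X - W t Z) \<bullet> d j Z" if "Z \<in> ends j" for Z using elim(1) that by (auto intro: less_imp_le)
  qed
 qed
 then show False by simp
qed

lemma no_shared_ray:
 assumes XY: "X ~= Y" "W b X = W b Y" and m: "m \<in> inc X" "k \<in> inc Y"
 shows "d m X ~= d k Y"
proof
 assume dd: "d m X = d k Y"
 have mI: "m \<in> Ix" "X \<in> ends m" and kI: "k \<in> Ix" "Y \<in> ends k" using m by (simp_all add: inc_iff)
 have mk: "m ~= k"
 proof
  assume "m = k"
  then have "X = Y" using end_unique[OF placement_end mI, of Y] kI dd by simp
  then show False using XY by simp
 qed
 define q where "q = W b X + \<delta> *\<^sub>R d m X"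
 have "q \<in> moved (W b) m" unfolding q_def using \<delta>0 ln[of b m] b0 by (intro mem_near[OF placement_end m(1)]) auto
 moreover have "q \<in> moved (W b) k" unfolding q_def dd XY(2) using \<delta>0 ln[of b k] b0 by (intro mem_near[OF placement_end m(2)]) auto
 moreover have "W b X ~= q" using \<delta>0 inc_unit(1)[OF m(1)] by (auto simp: q_def)
 moreover have "\<tau> k = \<tau> m \<or> \<tau> k = - \<tau> m" using dd dir_from_cases[of "P m" X] dir_from_cases[of "P k" Y] by (metis minus_minus)
 moreover have "W b X \<in> moved (W b) k" unfolding XY(2) by (rule vertex_mem_move[OF placement_end kI])
 ultimately show False using no_overlap[OF mI(1) kI(1) mk _ vertex_mem_move[OF placement_end mI]] by blast
qed

lemma coordinate_small:
 assumes XY: "W b X = W b Y" and e: "0 < \<epsilon>"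
 shows "\<forall>\<^sub>F t in at_left b. \<bar>((W t X - W t Y) \<bullet> v) / c\<bar> + \<bar>((W t X - W t Y) \<bullet> v') / c'\<bar> < \<epsilon>"
 unfolding divide_inverse by (intro near_lt continuous_intros continuous_W) (use XY e in simp)

lemma no_interleaved:
 assumes XY: "X ~= Y" "W b X = W b Y" and m: "m \<in> inc X" "m' \<in> inc X" "m ~= m'" and k: "k \<in> inc Y" "k' \<in> inc Y"
  and dk: "d k Y = d m X + d m' X" "d k' Y = - d m X"
 shows False
proof -
 have "\<forall>\<^sub>F t in at_left b. False"
  using coordinate_small[OF XY(2)[symmetric] \<delta>0, of "rot90 (d m' X)" "d m X \<bullet> rot90 (d m' X)" "rot90 (d m X)" "d m' X \<bullet> rot90 (d m X)"] near_time
 proof eventually_elim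
  case (elim t)
  show False
  proof (rule interleaved_cross[where V = "W t" and \<delta> = \<delta>, OF _ _ _ m k XY(1) dk inner_decomp[OF m] elim(1)])
   show "placement (W t)" "embedded (W t)" using elim(2) emb by (auto intro: placement_W)
   show "\<delta> <= len (W t) i" if "i \<in> segs" for i using elim(2) that by (auto intro: ln)
  qed
 qed
 then show False by simp
qed

text \<open>At both vertices the field is at the same end of its facet, so both wedges recede along each of
the two normals. The coordinate does not decrease and vanishes at time \<open>b\<close>.\<close>
lemma wedge_coordinate:
 assumes XY: "W b X = W b Y" and X: "inc X = {m, m'}" "m ~= m'" and Y: "inc Y = {k, k'}" "k ~= k'"
  and dk: "d k Y = - d m X" "d k' Y = - d m' X" and t: "0 < t" "t < b"
 shows "((W t X - W t Y) \<bullet> rot90 (d m X)) / (d m' X \<bullet> rot90 (d m X)) <= 0"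
proof -
 define c where "c = d m' X \<bullet> rot90 (d m X)"
 have m: "m \<in> inc X" "m' \<in> inc X" and k: "k \<in> inc Y" "k' \<in> inc Y" using X Y by auto
 have V: "X \<in> Vx" "Y \<in> Vx" using endpoint_vertex[of m X] endpoint_vertex[of k Y] m k by (simp_all add: inc_iff)
 have c: "\<bar>c\<bar> = sqrt 3 / 2" using incident_cross[OF m X(2)] by (simp add: c_def)
 define \<epsilon> where "\<epsilon> = sgn c"
 have c0: "c ~= 0" using c by auto
 have \<epsilon>: "\<bar>\<epsilon>\<bar> = 1" "\<epsilon> * c = sqrt 3 / 2" using c c0 by (auto simp: \<epsilon>_def sgn_if)
 have ec: "x / c = \<epsilon> * x / (sqrt 3 / 2)" for x
 proof -
  have "\<epsilon> * x / (sqrt 3 / 2) = (\<epsilon> * x) / (\<epsilon> * c)" by (simp only: \<epsilon>(2))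
  also have "... = x / c" using \<epsilon>(1) by (intro mult_divide_mult_cancel_left) auto
  finally show ?thesis by simp
 qed
 define f where "f t = ((W t X - W t Y) \<bullet> rot90 (d m X)) / c" for t
 have g1: "\<epsilon> * crystalline L (m, X) = half_facet" for L
 proof -
  have "\<epsilon> * crystalline L (m, X) = 2/3 * (\<epsilon> * c)" unfolding end_data_two[OF crystalline_data V(1) X] c_def by simp
  then show ?thesis using \<epsilon>(2) half_facet(3) by simp
 qed
 have g2: "\<epsilon> * crystalline L (k, Y) = half_facet" for L
 proof -
  have "\<epsilon> * crystalline L (k, Y) = 2/3 * (\<epsilon> * c)" unfolding end_data_two[OF crystalline_data V(2) Y] dk c_def by (simp add: rot90_minus)
  then show ?thesis using \<epsilon>(2) half_facet(3) by simp
 qed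
 have "f t <= f b"
 proof (rule DERIV_nonneg_imp_increasing_open[where f = f])
  fix u assume u: "t < u" "u < b"
  have u0: "0 < u" using u t by simp
  have L: "!!i. i \<in> segs ==> 0 < len (W u) i" using ln[of u] \<delta>0 u u0 by (auto intro: less_le_trans)
  have fe: "f = (\<lambda>u. (sg m X * (W u X \<bullet> \<nu> m) + sg k Y * (W u Y \<bullet> \<nu> k)) / c)"
  proof
   fix u
   have r1: "rot90 (d m X) = sg m X *\<^sub>R \<nu> m" by (rule rot90_d)
   have r2: "rot90 (d m X) = - (sg k Y *\<^sub>R \<nu> k)" using rot90_d[of k Y] unfolding dk(1) rot90_minus by (metis minus_minus)
   have "(W u X - W u Y) \<bullet> rot90 (d m X) = W u X \<bullet> rot90 (d m X) - W u Y \<bullet> rot90 (d m X)" by (simp add: inner_diff_left)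
   also have "W u X \<bullet> rot90 (d m X) = sg m X * (W u X \<bullet> \<nu> m)" by (subst r1) simp
   also have "W u Y \<bullet> rot90 (d m X) = - (sg k Y * (W u Y \<bullet> \<nu> k))" by (subst r2) simp
   finally show "f u = (sg m X * (W u X \<bullet> \<nu> m) + sg k Y * (W u Y \<bullet> \<nu> k)) / c" by (simp add: f_def)
  qed
  have "(f has_real_derivative (sg m X * (- curv (len (W u)) m) + sg k Y * (- curv (len (W u)) k)) / c) (at u)"
   unfolding fe by (intro DERIV_cdivide DERIV_add DERIV_cmult vertex_derivative m k u u0)
  moreover have "0 <= (sg m X * (- curv (len (W u)) m) + sg k Y * (- curv (len (W u)) k)) / c"
  proof -
   have "\<epsilon> * (sg m X * curv (len (W u)) m) <= 0" by (rule curv_sign[OF m(1) L \<epsilon>(1) g1])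
   moreover have "\<epsilon> * (sg k Y * curv (len (W u)) k) <= 0" by (rule curv_sign[OF k(1) L \<epsilon>(1) g2])
   ultimately have "0 <= \<epsilon> * (sg m X * (- curv (len (W u)) m) + sg k Y * (- curv (len (W u)) k))" by (simp add: algebra_simps)
   then show ?thesis unfolding ec by simp
  qed
  ultimately show "\<exists>y'. (f has_real_derivative y') (at u) \<and> 0 <= y'" by blast
 next
  have "continuous_on {0..b} f" unfolding f_def divide_inverse by (intro continuous_intros continuous_W)
  then show "continuous_on {t..b} f" by (rule continuous_on_subset) (use t in auto)
 qed (use t in simp)
 also have "f b = 0" using XY by (simp add: f_def)
 finally show ?thesis by (simp add: f_def c_def)
qed

lemma no_opposite:
 assumes XY: "X ~= Y" "W b X = W b Y" and X: "inc X = {m, m'}" "m ~= m'" and Y: "inc Y = {k, k'}" "k ~= k'"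
  and dk: "d k Y = - d m X" "d k' Y = - d m' X"
 shows False
proof -
 have m: "m \<in> inc X" "m' \<in> inc X" and k: "k \<in> inc Y" using X Y by auto
 have "\<forall>\<^sub>F t in at_left b. False"
  using coordinate_small[OF XY(2) \<delta>0, of "rot90 (d m' X)" "d m X \<bullet> rot90 (d m' X)" "rot90 (d m X)" "d m' X \<bullet> rot90 (d m X)"] near_time
 proof eventually_elim
  case (elim t)
  have t: "0 < t" "t < b" using elim by auto
  have r: "((W t X - W t Y) \<bullet> rot90 (d m' X)) / (d m X \<bullet> rot90 (d m' X)) <= 0"
   by (rule wedge_coordinate[OF XY(2) _ X(2)[symmetric] _ Y(2)[symmetric] dk(2,1) t]) (use X Y in auto)
  have s: "((W t X - W t Y) \<bullet> rot90 (d m X)) / (d m' X \<bullet> rot90 (d m X)) <= 0"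
   by (rule wedge_coordinate[OF XY(2) X Y dk t])
  show False
  proof (rule opposite_cross[where V = "W t" and \<delta> = \<delta>, OF _ _ _ m k XY(1) dk(1) inner_decomp[OF m X(2)] elim(1) r s])
   show "placement (W t)" "embedded (W t)" using t emb by (auto intro: placement_W)
   show "\<delta> <= len (W t) i" if "i \<in> segs" for i using t that by (auto intro: ln)
  qed
 qed
 then show False by simp
qed

text \<open>Without a common direction the edges at \<open>Y\<close> are opposite to directions of the star at
\<open>X\<close>, completed to three. If one of the vertices is a junction, or the two wedges are not exactly
opposite, the directions interleave.\<close>
lemma vertices_stay_apart:
 assumes X: "X \<in> Vx" "Y \<in> Vx" "X ~= Y"
 shows "W b X ~= W b Y"
proof
 assume XY: "W b X = W b Y"
 note no_inter = no_interleaved[OF X(3) XY]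
 obtain m m' where m: "m \<in> inc X" "m' \<in> inc X" "m ~= m'" using two_incident[OF X(1)] .
 obtain k k' where k: "k \<in> inc Y" "k' \<in> inc Y" "k ~= k'" using two_incident[OF X(2)] .
 define e where "e = d m X"
 define f where "f = d m' X"
 have ef: "e \<in> hexdir" "f \<in> hexdir" "e \<bullet> f = -1/2" "f \<bullet> e = -1/2" "e \<bullet> e = 1" "f \<bullet> f = 1"
  using m d_hexdir incident_inner[OF m] inc_unit(2)[OF m(1)] inc_unit(2)[OF m(2)]
  by (auto simp: e_def f_def inc_iff inner_commute)
 have four: "d n Y \<in> {- e, - f, e + f, - (e + f)}" if n: "n \<in> inc Y" for n
 proof -
  have "d n Y \<in> hexdir" using n d_hexdir by (simp add: inc_iff)
  from hexdir_six[OF this ef(1-3)] show ?thesis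
   using no_shared_ray[OF X(3) XY m(1) n] no_shared_ray[OF X(3) XY m(2) n] by (auto simp: e_def f_def)
 qed

 have bad: False if n: "n \<in> inc Y" "n' \<in> inc Y" "d n Y = e + f" "d n' Y = - e \<or> d n' Y = - f" for n n'
  using n(4)
 proof
  assume "d n' Y = - e"
  then show False using no_inter[OF m n(1,2)] n(3) by (simp add: e_def f_def)
 next
  assume "d n' Y = - f"
  then show False using no_inter[OF m(2,1) m(3)[symmetric] n(1,2)] n(3) by (simp add: e_def f_def add.commute)
 qed
 have "d k Y = - e \<and> d k' Y = - f \<or> d k Y = - f \<and> d k' Y = - e"
  using alternating_pairs[OF ef(5,6,3,4) four[OF k(1)] four[OF k(2)] incident_inner[OF k]] bad[OF k(1,2)] bad[OF k(2,1)] by blast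
 then obtain n n' where n: "n \<in> inc Y" "n' \<in> inc Y" "n ~= n'" "d n Y = - e" "d n' Y = - f"
  using k by metis
 show False
 proof (rule star_two_or_three[OF m])
  fix m'' assume a: "m'' \<in> inc X" "m ~= m''" "d m'' X = - (d m X + d m' X)"
  have "d n' Y = d m X + d m'' X" "d n Y = - d m X" using n a by (simp_all add: e_def f_def)
  then show False using no_inter[OF m(1) a(1,2) n(2,1)] by simp
 next
  assume X2: "inc X = {m, m'}"
  show False
  proof (rule star_two_or_three[OF n(1-3)])
   fix n'' assume a: "n'' \<in> inc Y" "d n'' Y = - (d n Y + d n' Y)"
   then show False using bad[OF a(1) n(1)] n by simp
  next
   assume "inc Y = {n, n'}"
   then show False using no_opposite[OF X(3) XY X2 m(3) _ n(3)] n(4,5) by (simp add: e_def f_def)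
  qed
 qed
qed

text \<open>A collision at time \<open>b\<close> takes place at vertices of both pieces, at a vertex of one of
them, or in the interior of both. In the last case the pieces overlap or have crossed transversally
before.\<close>
theorem embedded_at_end: "embedded (W b)"
 unfolding embedded_def
proof (intro ballI impI)
 fix i j assume ij: "i \<in> Ix" "j \<in> Ix" "i ~= j" and disj: "ends i \<inter> ends j = {}"
 have inside: "(\<exists>X\<in>ends i. p = W b X) \<or> (\<forall>Z\<in>ends i. 0 < (p - W b Z) \<bullet> d i Z)" if p: "p \<in> moved (W b) i" and i: "i \<in> Ix" for p i
 proof (rule ccontr)
  assume no: "\<not> ?thesis"
  then obtain Z where Z: "Z \<in> ends i" "\<not> 0 < (p - W b Z) \<bullet> d i Z" by blast
  have "0 <= (p - W b Z) \<bullet> d i Z" "(p - W b Z) \<bullet> rot90 (d i Z) = 0" using p Z(1) unfolding mem_moved_frame[OF placement_end i] by blast+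
  then have "p - W b Z = 0" using frame_decomp[OF d_norm[OF i], of "p - W b Z" Z] Z(2) by simp
  then show False using no Z(1) by auto
 qed
 have vi: False if "X \<in> ends i" "p = W b X" "\<forall>Z\<in>ends j. 0 < (p - W b Z) \<bullet> d j Z" "p \<in> moved (W b) j" "i \<in> Ix" "j \<in> Ix" for i j X p
  using vertex_not_inside[of X j] endpoint_vertex[OF that(5,1)] that by blast
 show "moved (W b) i \<inter> moved (W b) j = {}"
 proof (rule ccontr)
  assume "moved (W b) i \<inter> moved (W b) j ~= {}"
  then obtain p where p: "p \<in> moved (W b) i" "p \<in> moved (W b) j" by blast
  consider X Y where "X \<in> ends i" "p = W b X" "Y \<in> ends j" "p = W b Y"
   | X where "X \<in> ends i" "p = W b X" "\<forall>Z\<in>ends j. 0 < (p - W b Z) \<bullet> d j Z"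
   | Y where "Y \<in> ends j" "p = W b Y" "\<forall>Z\<in>ends i. 0 < (p - W b Z) \<bullet> d i Z"
   | "\<forall>Z\<in>ends i. 0 < (p - W b Z) \<bullet> d i Z" "\<forall>Z\<in>ends j. 0 < (p - W b Z) \<bullet> d j Z"
   using inside[OF p(1) ij(1)] inside[OF p(2) ij(2)] by blast
  then show False
  proof cases
   case (1 X Y)
   then have "X ~= Y" using disj by blast
   then show False using vertices_stay_apart[of X Y] endpoint_vertex[OF ij(1) 1(1)] endpoint_vertex[OF ij(2) 1(3)] 1(2,4) by simp
  next
   case (2 X) then show False using vi p(2) ij by blast
  next
   case (3 Y) then show False using vi p(1) ij by blast
  next
   case 4
   show False
   proof (cases "\<tau> i = \<tau> j \<or> \<tau> i = - \<tau> j")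
    case par: True
    obtain \<eta> where \<eta>: "0 < \<eta>" "!!Z. Z \<in> ends i ==> \<eta> <= (p - W b Z) \<bullet> d i Z"
     using positive_min[OF finite_endpoints, of "P i" "\<lambda>Z. (p - W b Z) \<bullet> d i Z"] 4(1) by blast
    obtain \<eta>' where \<eta>': "0 < \<eta>'" "!!Z. Z \<in> ends j ==> \<eta>' <= (p - W b Z) \<bullet> d j Z"
     using positive_min[OF finite_endpoints, of "P j" "\<lambda>Z. (p - W b Z) \<bullet> d j Z"] 4(2) by blast
    define r where "r = min \<eta> \<eta>'"
    have r: "0 < r" "r <= \<eta>" "r <= \<eta>'" using \<eta> \<eta>' by (simp_all add: r_def)
    define q where "q = p + r *\<^sub>R \<tau> i"
    have mem: "q \<in> moved (W b) n" if n: "n \<in> Ix" "\<tau> i = \<tau> n \<or> \<tau> i = - \<tau> n" "p \<in> moved (W b) n" "!!Z. Z \<in> ends n ==> r <= (p - W b Z) \<bullet> d n Z" for n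
     unfolding mem_moved_frame[OF placement_end n(1)]
    proof (intro ballI conjI)
     fix Z assume Z: "Z \<in> ends n"
     have dd: "\<tau> i = d n Z \<or> \<tau> i = - d n Z" using n(2) dir_from_cases[of "P n" Z] by (metis minus_minus)
     have "d n Z \<bullet> d n Z = 1" using d_norm[OF n(1), of Z] by (simp add: norm_one_inner)
     then show "0 <= (q - W b Z) \<bullet> d n Z" using dd n(4)[OF Z] r by (auto simp: q_def inner_diff_left inner_add_left)
     have "(p - W b Z) \<bullet> rot90 (d n Z) = 0" using n(3) Z unfolding mem_moved_frame[OF placement_end n(1)] by blast
     then show "(q - W b Z) \<bullet> rot90 (d n Z) = 0" using dd by (auto simp: q_def inner_diff_left inner_add_left)
    qed
    have qi: "q \<in> moved (W b) i" by (rule mem[OF ij(1) _ p(1)]) (use \<eta>(2) r in \<open>auto intro: order_trans\<close>)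
    have qj: "q \<in> moved (W b) j" by (rule mem[OF ij(2) par p(2)]) (use \<eta>'(2) r in \<open>auto intro: order_trans\<close>)
    have "p ~= q" using r tangent_norm[OF valid[OF ij(1)]] by (auto simp: q_def)
    then show False using no_overlap[OF ij _ p qi qj] par by auto
   next
    case False
    then have np: "\<tau> i \<bullet> rot90 (\<tau> j) ~= 0" using not_parallel_cross[OF ij(1,2)] by blast
    have pm: "p = meet (W b) i j" using meet_unique[OF placement_end ij(1,2) np p] .
    have "\<forall>\<^sub>F t in at_left b. \<forall>X\<in>ends i. 0 < (meet (W t) i j - W t X) \<bullet> d i X"
     by (intro eventually_ball_finite ballI near_gt continuous_intros continuous_meet continuous_W) (use 4(1) pm in auto)
    moreover have "\<forall>\<^sub>F t in at_left b. \<forall>X\<in>ends j. 0 < (meet (W t) i j - W t X) \<bullet> d j X"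
     by (intro eventually_ball_finite ballI near_gt continuous_intros continuous_meet continuous_W) (use 4(2) pm in auto)
    ultimately have "\<forall>\<^sub>F t in at_left b. False"
     using near_time
    proof eventually_elim
     case (elim t)
     have "placement (W t)" using elim(3) by (intro placement_W) auto
     from meet_iff[OF this ij(1,2) np] have "moved (W t) i \<inter> moved (W t) j ~= {}" using elim(1,2) by (auto intro: less_imp_le)
     moreover have "embedded (W t)" using elim(3) emb by blast
     ultimately show False using ij disj unfolding embedded_def by blast
    qed
    then show False by simp
   qed
  qed
 qed
qed

end

end

section \<open>The evolution of the heights\<close>

context simple_net
begin

definition evolves :: "real => (real => nat \<times> nat => real) => bool" where
 "evolves b h \<longleftrightarrow> (\<forall>i\<in>Ix. continuous_on {0..b} (\<lambda>t. h t i)) \<and> (\<forall>i\<in>Ix. h 0 i = 0) \<and>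
  (\<forall>t. 0 <= t \<and> t <= b --> compatible (h t) \<and> (\<forall>i\<in>segs. 0 < len (pos (h t)) i)) \<and>
  (\<forall>t. 0 < t \<and> t < b --> (\<forall>i\<in>Ix. ((\<lambda>t. h t i) has_real_derivative - curv (len (pos (h t))) i) (at t)))"

lemma pos_initial: "(!!i. i \<in> Ix ==> h i = 0) ==> pos h = (\<lambda>X. X)"
 using pos_cong[of h "\<lambda>_. 0"] by auto

lemma length_lower_bound:
 fixes h :: "real => nat \<times> nat => real" and b :: real
 assumes hc: "!!i. i \<in> Ix ==> continuous_on {0..b} (\<lambda>t. h t i)"
  and ln: "!!t i. 0 <= t ==> t <= b ==> i \<in> segs ==> 0 < len (pos (h t)) i"
 obtains \<delta> where "0 < \<delta>" "!!t i. 0 <= t ==> t <= b ==> i \<in> segs ==> \<delta> <= len (pos (h t)) i"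
proof (cases "0 <= b")
 case False
 show ?thesis
 proof (rule that[of 1])
  fix t i assume "0 <= t" "t <= b"
  then show "1 <= len (pos (h t)) i" using False by linarith
 qed simp
next
 case True
 have ex: "\<exists>m>0. \<forall>t\<in>{0..b}. m <= len (pos (h t)) i" if i: "i \<in> segs" for i
 proof -
  have "\<exists>s\<in>{0..b}. \<forall>t\<in>{0..b}. len (pos (h s)) i <= len (pos (h t)) i"
  proof (rule continuous_attains_inf[OF compact_Icc])
   show "continuous_on {0..b} (\<lambda>t. len (pos (h t)) i)" by (rule continuous_len) (rule hc)
  qed (use True in simp)
  then obtain s where s: "s \<in> {0..b}" "\<forall>t\<in>{0..b}. len (pos (h s)) i <= len (pos (h t)) i" ..
  then show ?thesis using ln[of s i] i by (intro exI[of _ "len (pos (h s)) i"]) auto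
 qed
 then obtain m where m: "!!i. i \<in> segs ==> 0 < m i \<and> (\<forall>t\<in>{0..b}. m i <= len (pos (h t)) i)" by metis
 then obtain \<delta> where \<delta>: "0 < \<delta>" "!!i. i \<in> segs ==> \<delta> <= m i" using positive_min[OF finite_segs, of m] by blast
 show ?thesis
 proof (rule that[OF \<delta>(1)])
  fix t i assume "0 <= t" "t <= b" "i \<in> segs"
  then show "\<delta> <= len (pos (h t)) i" using m[of i] \<delta>(2)[of i] by force
 qed
qed

text \<open>The times at which the network is not embedded form a closed set, so there would be a first one.
The equation is assumed only at embedded times; for a given flow nothing more is known at first.\<close>
lemma embedded_throughout:
 assumes hc: "!!i. i \<in> Ix ==> continuous_on {0..b} (\<lambda>t. h t i)" and h0: "!!i. i \<in> Ix ==> h 0 i = 0"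
  and co: "!!t. 0 <= t ==> t <= b ==> compatible (h t)"
  and ln: "!!t i. 0 <= t ==> t <= b ==> i \<in> segs ==> 0 < len (pos (h t)) i"
  and der: "!!t i. 0 < t ==> t < b ==> i \<in> Ix ==> embedded (pos (h t)) ==>
   ((\<lambda>t. h t i) has_real_derivative - curv (len (pos (h t))) i) (at t)"
  and t: "0 <= t" "t <= b"
 shows "embedded (pos (h t))"
proof (rule ccontr)
 assume bad: "\<not> embedded (pos (h t))"
 define B where "B = {t \<in> {0..b}. \<not> embedded (pos (h t))}"
 have tB: "t \<in> B" using bad t by (simp add: B_def)
 have "closed B" unfolding B_def
  by (rule closed_not_embedded[OF closed_atLeastAtMost]) (auto intro!: placement_pos co ln continuous_pos hc)
 moreover have bdd: "bdd_below B" by (rule bdd_belowI[of _ 0]) (simp add: B_def)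
 ultimately have TB: "Inf B \<in> B" using tB by (intro closed_contains_Inf) auto
 define T where "T = Inf B"
 have T: "0 <= T" "T <= b" "\<not> embedded (pos (h T))" using TB by (simp_all add: B_def T_def)
 have good: "embedded (pos (h s))" if "0 <= s" "s < T" for s
 proof (rule ccontr)
  assume "\<not> embedded (pos (h s))"
  then have "s \<in> B" using that T by (simp add: B_def)
  then have "T <= s" unfolding T_def by (rule cInf_lower[OF _ bdd])
  then show False using that by simp
 qed
 have "T ~= 0" using T(3) embedded_id pos_initial[of "h 0", OF h0] by metis
 then have T0: "0 < T" using T(1) by simp
 obtain \<delta> where \<delta>: "0 < \<delta>" "!!t i. 0 <= t ==> t <= b ==> i \<in> segs ==> \<delta> <= len (pos (h t)) i"
  using length_lower_bound[OF hc ln] by blast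
 have "embedded (pos (h T))"
 proof (rule embedded_at_end[OF T0 \<delta>(1)])
  show "continuous_on {0..T} (\<lambda>t. h t i)" if "i \<in> Ix" for i
   by (rule continuous_on_subset[OF hc[OF that]]) (use T in auto)
 qed (use T co \<delta>(2) der good in auto)
 then show False using T(3) by simp
qed

lemma evolves_embedded:
 assumes "evolves b h" "0 <= t" "t <= b"
 shows "embedded (pos (h t))"
 by (rule embedded_throughout[of b h]) (use assms in \<open>auto simp: evolves_def\<close>)

lemma evolves_placement: "evolves b h ==> 0 <= t ==> t <= b ==> placement (pos (h t))"
 unfolding evolves_def by (blast intro: placement_pos)

lemma evolves_lower_bound:
 assumes h: "evolves b h"
 obtains \<delta> where "0 < \<delta>" "!!t i. 0 <= t ==> t <= b ==> i \<in> segs ==> \<delta> <= len (pos (h t)) i"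
proof -
 have c: "continuous_on {0..b} (\<lambda>t. h t i)" if "i \<in> Ix" for i using h that by (simp add: evolves_def)
 have l: "0 < len (pos (h t)) i" if "0 <= t" "t <= b" "i \<in> segs" for t i using h that by (simp add: evolves_def)
 show ?thesis using length_lower_bound[of b h, OF c l] that by blast
qed

lemma evolves_mono:
 assumes h: "evolves b h" and b: "b' <= b"
 shows "evolves b' h"
 unfolding evolves_def
proof (intro conjI ballI)
 show "continuous_on {0..b'} (\<lambda>t. h t i)" if "i \<in> Ix" for i
  by (rule continuous_on_subset[of "{0..b}"]) (use h that b in \<open>auto simp: evolves_def\<close>)
qed (use h b in \<open>auto simp: evolves_def\<close>)

text \<open>The curvatures become globally Lipschitz once the lengths are cut off from below.\<close>
definition truncated :: "real => (nat \<times> nat => real) => nat \<times> nat => real" where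
 "truncated \<delta> u i = - curv (\<lambda>j. max \<delta> (len (pos u) j)) i"

lemma truncated_lipschitz:
 assumes \<delta>: "0 < \<delta>"
 shows "\<exists>C\<ge>0. \<forall>u v i. \<bar>truncated \<delta> u i - truncated \<delta> v i\<bar> <= C * (\<Sum>j\<in>Ix. \<bar>u j - v j\<bar>)"
proof (intro exI conjI allI)
 let ?K = "2 * (real (card segs) + 1) / \<delta>\<^sup>2"
 let ?M = "2 * (1 + real (card Ix))"
 let ?C = "?K * (real (card segs) * ?M)"
 show "0 <= ?C" by simp
 fix u v i
 have K: "0 <= ?K" by simp
 have "\<bar>truncated \<delta> u i - truncated \<delta> v i\<bar> = \<bar>curv (\<lambda>j. max \<delta> (len (pos u) j)) i - curv (\<lambda>j. max \<delta> (len (pos v) j)) i\<bar>"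
  by (simp add: truncated_def abs_minus_commute)
 also have "... <= ?K * (\<Sum>j\<in>segs. \<bar>max \<delta> (len (pos u) j) - max \<delta> (len (pos v) j)\<bar>)"
  by (rule curv_lipschitz[OF \<delta>]) simp_all
 also have "... <= ?K * (\<Sum>j\<in>segs. ?M * (\<Sum>j\<in>Ix. \<bar>u j - v j\<bar>))"
 proof (intro mult_left_mono sum_mono K)
  fix j assume "j \<in> segs"
  from len_pos_lipschitz[OF this, of u v]
  show "\<bar>max \<delta> (len (pos u) j) - max \<delta> (len (pos v) j)\<bar> <= ?M * (\<Sum>j\<in>Ix. \<bar>u j - v j\<bar>)" by linarith
 qed
 also have "... = ?C * (\<Sum>j\<in>Ix. \<bar>u j - v j\<bar>)" by (simp add: mult.assoc)
 finally show "\<bar>truncated \<delta> u i - truncated \<delta> v i\<bar> <= ?C * (\<Sum>j\<in>Ix. \<bar>u j - v j\<bar>)" .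
qed

lemma truncated_eq:
 assumes "!!j. j \<in> segs ==> \<delta> <= len (pos u) j"
 shows "truncated \<delta> u i = - curv (len (pos u)) i"
proof -
 have "curv (\<lambda>j. max \<delta> (len (pos u) j)) = curv (len (pos u))" by (rule curv_cong) (use assms in \<open>simp add: max_absorb2\<close>)
 then show ?thesis by (simp add: truncated_def)
qed

definition truncated_solution :: "real => (real => nat \<times> nat => real) => bool" where
 "truncated_solution \<delta> g \<longleftrightarrow> (\<forall>i\<in>Ix. continuous_on {0..} (\<lambda>t. g t i)) \<and> (\<forall>i\<in>Ix. g 0 i = 0) \<and> (\<forall>t\<ge>0. compatible (g t)) \<and>
  (\<forall>i\<in>Ix. \<forall>t>0. ((\<lambda>t. g t i) has_real_derivative truncated \<delta> (g t) i) (at t))"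

text \<open>The signed sums at junctions have derivative zero by \<open>curv_junction\<close>, which holds for
any positive weights and thus also for the truncated lengths.\<close>
lemma truncated_solution_exists:
 assumes \<delta>: "0 < \<delta>"
 obtains g where "truncated_solution \<delta> g"
proof -
 obtain C where C: "0 <= C" "!!u v i. \<bar>truncated \<delta> u i - truncated \<delta> v i\<bar> <= C * (\<Sum>j\<in>Ix. \<bar>u j - v j\<bar>)"
  using truncated_lipschitz[OF \<delta>] by blast
 have M: "0 <= 2 / \<delta>" using \<delta> by simp
 have bd: "\<bar>truncated \<delta> u i\<bar> <= 2 / \<delta>" for u i
  using curv_bound[OF \<delta>, of "\<lambda>j. max \<delta> (len (pos u) j)" i] by (simp add: truncated_def)
 obtain w where w: "\<forall>i\<in>Ix. continuous_on {0..} (w i)" "\<forall>i\<in>Ix. w i 0 = 0"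
  "\<forall>i\<in>Ix. \<forall>t>0. (w i has_real_derivative truncated \<delta> (\<lambda>j. w j t) i) (at t)"
  using ode_global_existence[where A = Ix and f = "truncated \<delta>" and C = C and M = "2 / \<delta>", OF finite_pieces C(2,1) bd M] by blast
 define g where "g t i = w i t" for t i
 have gc: "!!i. i \<in> Ix ==> continuous_on {0..} (\<lambda>t. g t i)" and g0: "!!i. i \<in> Ix ==> g 0 i = 0"
  and gd: "!!i t. i \<in> Ix ==> 0 < t ==> ((\<lambda>t. g t i) has_real_derivative truncated \<delta> (g t) i) (at t)"
  using w unfolding g_def by auto
 have zero: "f t = 0" if t: "0 <= t" and c: "continuous_on {0..} f" and f0: "f 0 = 0"
  and d: "!!s. 0 < s ==> (f has_real_derivative 0) (at s)" for f :: "real => real" and t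
 proof (cases "t = 0")
  case False
  then have "f t = f 0" using t d by (intro DERIV_isconst_end continuous_on_subset[OF c]) auto
  then show ?thesis using f0 by simp
 qed (use f0 in simp)
 have "compatible (g t)" if t: "0 <= t" for t
  unfolding compatible_def
 proof (intro conjI ballI impI)
  fix X assume X: "X \<in> junctions S0"
  have iI: "i \<in> Ix" if "i \<in> inc X" for i using that by (simp add: inc_iff)
  show "(\<Sum>i\<in>inc X. sg i X * g t i) = 0"
  proof (rule zero[OF t, of "\<lambda>t. \<Sum>i\<in>inc X. sg i X * g t i"])
   show "continuous_on {0..} (\<lambda>t. \<Sum>i\<in>inc X. sg i X * g t i)" by (intro continuous_intros gc iI)
   show "(\<Sum>i\<in>inc X. sg i X * g 0 i) = 0" using g0 iI by simp
   fix s :: real assume s: "0 < s"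
   have "((\<lambda>t. \<Sum>i\<in>inc X. sg i X * g t i) has_real_derivative (\<Sum>i\<in>inc X. sg i X * truncated \<delta> (g s) i)) (at s)"
    by (intro DERIV_sum DERIV_cmult gd iI s)
   moreover have "(\<Sum>i\<in>inc X. sg i X * truncated \<delta> (g s) i) = 0"
    using curv_junction[OF X, of "\<lambda>j. max \<delta> (len (pos (g s)) j)"] \<delta> by (simp add: truncated_def sum_negf)
   ultimately show "((\<lambda>t. \<Sum>i\<in>inc X. sg i X * g t i) has_real_derivative 0) (at s)" by simp
  qed
 next
  fix i assume i: "i \<in> Ix" "i \<notin> segs"
  show "g t i = 0"
   by (rule zero[OF t gc[OF i(1)] g0[OF i(1)]]) (use gd[OF i(1)] i(2) in \<open>simp add: truncated_def\<close>)
 qed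
 then have "truncated_solution \<delta> g" using gc g0 gd unfolding truncated_solution_def by blast
 then show ?thesis by (rule that)
qed

lemma truncated_solution_evolves:
 assumes g: "truncated_solution \<delta> g" and \<delta>: "0 < \<delta>" and l: "!!t i. 0 <= t ==> t <= b ==> i \<in> segs ==> \<delta> <= len (pos (g t)) i"
 shows "evolves b g"
 unfolding evolves_def
proof (intro conjI ballI allI impI)
 fix i assume i: "i \<in> Ix"
 show "continuous_on {0..b} (\<lambda>t. g t i)"
  by (rule continuous_on_subset[of "{0..}"]) (use g i in \<open>auto simp: truncated_solution_def\<close>)
 show "g 0 i = 0" using g i by (simp add: truncated_solution_def)
next
 fix t assume t: "0 <= t \<and> t <= b"
 show "compatible (g t)" using g t by (simp add: truncated_solution_def)
 show "0 < len (pos (g t)) i" if "i \<in> segs" for i using l[of t i] t that \<delta> by simp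
next
 fix t i assume t: "0 < t \<and> t < b" and i: "i \<in> Ix"
 have "truncated \<delta> (g t) i = - curv (len (pos (g t))) i" by (rule truncated_eq) (use l t in simp)
 moreover have "((\<lambda>t. g t i) has_real_derivative truncated \<delta> (g t) i) (at t)" using g t i by (simp add: truncated_solution_def)
 ultimately show "((\<lambda>t. g t i) has_real_derivative - curv (len (pos (g t))) i) (at t)" by simp
qed

lemma solutions_agree:
 assumes \<delta>: "0 < \<delta>"
  and c: "!!i. i \<in> Ix ==> continuous_on {0..b} (\<lambda>t. g t i)" "!!i. i \<in> Ix ==> continuous_on {0..b} (\<lambda>t. h t i)"
  and d: "!!i t. i \<in> Ix ==> 0 < t ==> t < b ==> ((\<lambda>t. g t i) has_real_derivative truncated \<delta> (g t) i) (at t)"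
   "!!i t. i \<in> Ix ==> 0 < t ==> t < b ==> ((\<lambda>t. h t i) has_real_derivative truncated \<delta> (h t) i) (at t)"
  and 0: "!!i. i \<in> Ix ==> g 0 i = 0" "!!i. i \<in> Ix ==> h 0 i = 0"
  and t: "0 <= t" "t <= b" and i: "i \<in> Ix"
 shows "g t i = h t i"
proof -
 obtain C where C: "0 <= C" "!!u v i. \<bar>truncated \<delta> u i - truncated \<delta> v i\<bar> <= C * (\<Sum>j\<in>Ix. \<bar>u j - v j\<bar>)"
  using truncated_lipschitz[OF \<delta>] by blast
 show ?thesis
  by (rule ode_uniqueness[where A = Ix and f = "truncated \<delta>" and C = C and a = 0 and b = b and u = "\<lambda>i t. g t i" and v = "\<lambda>i t. h t i"])
   (use C c d 0 t i in auto)
qed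

lemma evolves_truncated:
 assumes h: "evolves b h" and l: "!!t j. 0 <= t ==> t <= b ==> j \<in> segs ==> \<delta> <= len (pos (h t)) j" and i: "i \<in> Ix" and t: "0 < t" "t < b"
 shows "((\<lambda>t. h t i) has_real_derivative truncated \<delta> (h t) i) (at t)"
proof -
 have "truncated \<delta> (h t) i = - curv (len (pos (h t))) i" by (rule truncated_eq) (use l t in simp)
 then show ?thesis using h i t by (simp add: evolves_def)
qed

lemma evolves_unique:
 assumes g: "evolves b g" and h: "evolves b h" and t: "0 <= t" "t <= b" and i: "i \<in> Ix"
 shows "g t i = h t i"
proof -
 obtain \<delta>1 where 1: "0 < \<delta>1" "!!t i. 0 <= t ==> t <= b ==> i \<in> segs ==> \<delta>1 <= len (pos (g t)) i"
  using evolves_lower_bound[OF g] by blast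
 obtain \<delta>2 where 2: "0 < \<delta>2" "!!t i. 0 <= t ==> t <= b ==> i \<in> segs ==> \<delta>2 <= len (pos (h t)) i"
  using evolves_lower_bound[OF h] by blast
 define \<delta> where "\<delta> = min \<delta>1 \<delta>2"
 have \<delta>: "0 < \<delta>" "\<delta> <= \<delta>1" "\<delta> <= \<delta>2" using 1 2 by (simp_all add: \<delta>_def)
 have lg: "\<delta> <= len (pos (g t)) i" if "0 <= t" "t <= b" "i \<in> segs" for t i using 1(2)[OF that] \<delta> by simp
 have lh: "\<delta> <= len (pos (h t)) i" if "0 <= t" "t <= b" "i \<in> segs" for t i using 2(2)[OF that] \<delta> by simp
 show ?thesis
 proof (rule solutions_agree[OF \<delta>(1) _ _ _ _ _ _ t i])
  show "((\<lambda>t. g t i) has_real_derivative truncated \<delta> (g t) i) (at t)" if "i \<in> Ix" "0 < t" "t < b" for i t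
   by (rule evolves_truncated[OF g lg that])
  show "((\<lambda>t. h t i) has_real_derivative truncated \<delta> (h t) i) (at t)" if "i \<in> Ix" "0 < t" "t < b" for i t
   by (rule evolves_truncated[OF h lh that])
 qed (use g h in \<open>auto simp: evolves_def\<close>)
qed

lemma initial_length:
 assumes i: "i \<in> segs"
 shows "0 < len (\<lambda>X. X) i"
proof -
 note e = seg_ends[OF i]
 have n: "\<tau> i \<bullet> \<tau> i = 1" using tangent_norm[OF valid[OF segs_Ix[OF i]]] by (simp add: norm_one_inner)
 have "fin i - start i = dist (start i) (fin i) *\<^sub>R \<tau> i" using segment_tangent[OF e(5)] e(1) by (metis tangent.simps(1))
 then have "len (\<lambda>X. X) i = dist (start i) (fin i)" using n by (metis inner_scaleR_left len_def mult.right_neutral)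
 then show ?thesis using e(5) by simp
qed

text \<open>The solution truncated at \<open>\<delta>\<close> agrees with the given ones before
\<open>T\<close>. Its lengths are at least \<open>2 * \<delta>\<close> up to \<open>T\<close>, hence larger
than \<open>\<delta>\<close> for a while after \<open>T\<close>.\<close>
lemma extension:
 assumes T: "0 <= T" and \<delta>: "0 < \<delta>" and l0: "!!i. i \<in> segs ==> 2 * \<delta> <= len (\<lambda>X. X) i"
  and ev: "!!b. 0 <= b ==> b < T ==> \<exists>h. evolves b h \<and> (\<forall>t i. 0 <= t \<and> t <= b \<and> i \<in> segs --> 2 * \<delta> <= len (pos (h t)) i)"
 obtains b h where "T < b" "evolves b h"
proof -
 obtain g where g: "truncated_solution \<delta> g" using truncated_solution_exists[OF \<delta>] .
 have gc: "continuous_on {0..} (\<lambda>t. g t i)" and gd: "0 < t ==> ((\<lambda>t. g t i) has_real_derivative truncated \<delta> (g t) i) (at t)"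
  and g0: "g 0 i = 0" if "i \<in> Ix" for i t
  using g that by (auto simp: truncated_solution_def)
 have below: "2 * \<delta> <= len (pos (g t)) i" if t: "0 <= t" "t < T" and i: "i \<in> segs" for t i
 proof -
  obtain h where h: "evolves t h" "\<forall>s i. 0 <= s \<and> s <= t \<and> i \<in> segs --> 2 * \<delta> <= len (pos (h s)) i"
   using ev[OF t] by blast
  have eq: "g t j = h t j" if j: "j \<in> Ix" for j
  proof (rule solutions_agree[OF \<delta> _ _ _ _ _ _ t(1) order_refl j])
   show "continuous_on {0..t} (\<lambda>t. g t i)" if "i \<in> Ix" for i by (rule continuous_on_subset[OF gc[OF that]]) auto
   show "((\<lambda>t. h t i) has_real_derivative truncated \<delta> (h s) i) (at s)" if "i \<in> Ix" "0 < s" "s < t" for i s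
    by (rule evolves_truncated[OF h(1) _ that]) (use h(2) \<delta> in force)
  qed (use h(1) gd g0 in \<open>auto simp: evolves_def\<close>)
  have ph: "pos (g t) = pos (h t)" by (rule pos_cong) (rule eq)
  have "2 * \<delta> <= len (pos (h t)) i" using h(2)[rule_format, of t i] t i by simp
  then show ?thesis unfolding ph .
 qed
 have lc: "continuous_on {0..} (\<lambda>t. len (pos (g t)) i)" for i by (rule continuous_len) (rule gc)
 have at_T: "2 * \<delta> <= len (pos (g T)) i" if i: "i \<in> segs" for i
 proof (cases "T = 0")
  case True
  have "pos (g 0) = (\<lambda>X. X)" by (rule pos_initial) (rule g0)
  then show ?thesis using l0[OF i] True by simp
 next
  case False
  then have T0: "0 < T" using T by simp
  have "continuous_on {0..T} (\<lambda>t. len (pos (g t)) i)" by (rule continuous_on_subset[OF lc]) auto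
  from continuous_on_Icc_at_leftD[OF this T0] show ?thesis
  proof (rule tendsto_lowerbound)
   show "\<forall>\<^sub>F t in at_left T. 2 * \<delta> <= len (pos (g t)) i" unfolding eventually_at_left_field
    by (rule exI[of _ 0]) (use T0 below i in auto)
  qed simp
 qed
 have "\<forall>\<^sub>F t in at_right T. \<forall>i\<in>segs. \<delta> < len (pos (g t)) i"
 proof (intro eventually_ball_finite ballI finite_segs)
  fix i assume i: "i \<in> segs"
  have "continuous_on {T..T + 1} (\<lambda>t. len (pos (g t)) i)" by (rule continuous_on_subset[OF lc]) (use T in auto)
  from continuous_on_Icc_at_rightD[OF this] have "((\<lambda>t. len (pos (g t)) i) \<longlongrightarrow> len (pos (g T)) i) (at_right T)" by simp
  moreover have "\<delta> < len (pos (g T)) i" using at_T[OF i] \<delta> by simp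
  ultimately show "\<forall>\<^sub>F t in at_right T. \<delta> < len (pos (g t)) i" by (rule order_tendstoD(1))
 qed
 then obtain c where c: "T < c" "!!t. T < t ==> t < c ==> \<forall>i\<in>segs. \<delta> < len (pos (g t)) i"
  unfolding eventually_at_right_field by blast
 define b where "b = (T + c) / 2"
 have b: "T < b" "b < c" using c(1) by (simp_all add: b_def)
 have "evolves b g"
 proof (rule truncated_solution_evolves[OF g \<delta>])
  fix t i assume t: "0 <= t" "t <= b" and i: "i \<in> segs"
  consider "t < T" | "t = T" | "T < t" by linarith
  then show "\<delta> <= len (pos (g t)) i"
  proof cases
   case 1 then show ?thesis using below[OF t(1) 1 i] \<delta> by simp
  next
   case 2 then show ?thesis using at_T[OF i] \<delta> by simp
  next
   case 3 then show ?thesis using c(2)[of t] t b i by force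
  qed
 qed
 then show ?thesis using that b by blast
qed

end

section \<open>The maximal flow\<close>

context simple_net
begin

definition lifetime :: ereal where
 "lifetime = (SUP b\<in>{b. 0 <= b \<and> (\<exists>h. evolves b h)}. ereal b)"

text \<open>By uniqueness any solution that reaches \<open>t\<close> gives the same value.\<close>
definition heights :: "real => nat \<times> nat => real" where
 "heights t = (SOME h. evolves t h) t"

definition flow :: "real => network" where
 "flow t = net (pos (heights t))"

lemma heights_eq:
 assumes h: "evolves b h" and t: "0 <= t" "t <= b" and i: "i \<in> Ix"
 shows "heights t i = h t i"
proof -
 have ht: "evolves t h" using evolves_mono[OF h t(2)] .
 then have "evolves t (SOME h. evolves t h)" by (rule someI[where P = "evolves t"])
 from evolves_unique[OF this ht t(1) order_refl i] show ?thesis by (simp add: heights_def)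
qed

lemma pos_heights: "evolves b h ==> 0 <= t ==> t <= b ==> pos (heights t) = pos (h t)"
 by (rule pos_cong) (rule heights_eq)

lemma below_lifetime:
 assumes "ereal t < lifetime"
 obtains b h where "t < b" "0 <= b" "evolves b h"
 using assms unfolding lifetime_def less_SUP_iff by auto

lemma le_lifetime: "0 <= b ==> evolves b h ==> ereal b <= lifetime"
 unfolding lifetime_def by (rule SUP_upper) blast

lemma lifetime_pos: "0 < lifetime"
proof -
 obtain \<eta> where \<eta>: "0 < \<eta>" "!!i. i \<in> segs ==> \<eta> <= len (\<lambda>X. X) i"
  using positive_min[OF finite_segs, of "len (\<lambda>X. X)"] initial_length by blast
 obtain b h where "0 < b" "evolves b h"
 proof (rule extension[of 0 "\<eta> / 2"])
  show "2 * (\<eta> / 2) <= len (\<lambda>X. X) i" if "i \<in> segs" for i using \<eta>(2)[OF that] by simp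
 qed (use \<eta>(1) in auto)
 then have "ereal b <= lifetime" by (intro le_lifetime) auto
 then show ?thesis using \<open>0 < b\<close> by (metis ereal_less(2) less_le_trans)
qed

lemma continuous_on_local:
 fixes f :: "real => real"
 assumes "!!t. t \<in> A ==> \<exists>U. open U \<and> t \<in> U \<and> continuous_on (A \<inter> U) f"
 shows "continuous_on A f"
 unfolding continuous_on_def
proof
 fix t assume t: "t \<in> A"
 then obtain U where U: "open U" "t \<in> U" "continuous_on (A \<inter> U) f" using assms by blast
 have "(f \<longlongrightarrow> f t) (at t within (A \<inter> U))" using U(2,3) t unfolding continuous_on_def by blast
 moreover have "at t within (A \<inter> U) = at t within A" by (rule at_within_nhd[OF U(2,1)]) auto
 ultimately show "(f \<longlongrightarrow> f t) (at t within A)" by simp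
qed

lemma heights_continuous:
 assumes i: "i \<in> Ix"
 shows "continuous_on {t. 0 <= t \<and> ereal t < lifetime} (\<lambda>t. heights t i)"
proof (rule continuous_on_local)
 fix t assume "t \<in> {t. 0 <= t \<and> ereal t < lifetime}"
 then obtain b h where b: "t < b" "0 <= b" "evolves b h" using below_lifetime by blast
 have "continuous_on ({t. 0 <= t \<and> ereal t < lifetime} \<inter> {..<b}) (\<lambda>t. h t i)"
  by (rule continuous_on_subset[of "{0..b}"]) (use b i in \<open>auto simp: evolves_def\<close>)
 then have "continuous_on ({t. 0 <= t \<and> ereal t < lifetime} \<inter> {..<b}) (\<lambda>t. heights t i)"
  by (rule continuous_on_eq) (use heights_eq[OF b(3) _ _ i] in auto)
 then show "\<exists>U. open U \<and> t \<in> U \<and> continuous_on ({t. 0 <= t \<and> ereal t < lifetime} \<inter> U) (\<lambda>t. heights t i)"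
  using b(1) by (intro exI[of _ "{..<b}"]) auto
qed

lemma heights_derivative:
 assumes t: "0 < t" "ereal t < lifetime" and i: "i \<in> Ix"
 shows "((\<lambda>t. heights t i) has_real_derivative - curv (len (pos (heights t))) i) (at t)"
proof -
 obtain b h where b: "t < b" "0 <= b" "evolves b h" using below_lifetime[OF t(2)] .
 have "((\<lambda>t. h t i) has_real_derivative - curv (len (pos (h t))) i) (at t)" using b t i by (simp add: evolves_def)
 then have "((\<lambda>t. heights t i) has_real_derivative - curv (len (pos (h t))) i) (at t)"
  by (rule has_field_derivative_transform_within_open[where S = "{0<..<b}"]) (use t b heights_eq[OF b(3) _ _ i] in auto)
 then show ?thesis using pos_heights[OF b(3), of t] t b by simp
qed

lemma curvature_continuous:
 assumes i: "i \<in> Ix"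
 shows "continuous_on {t. 0 < t \<and> ereal t < lifetime} (\<lambda>t. curv (len (pos (heights t))) i)"
proof (rule continuous_on_local)
 fix t assume t: "t \<in> {t. 0 < t \<and> ereal t < lifetime}"
 then obtain b h where b: "t < b" "0 <= b" "evolves b h" using below_lifetime by blast
 obtain \<delta> where \<delta>: "0 < \<delta>" "!!t i. 0 <= t ==> t <= b ==> i \<in> segs ==> \<delta> <= len (pos (h t)) i"
  using evolves_lower_bound[OF b(3)] by blast
 obtain C where C: "0 <= C" "!!u v i. \<bar>truncated \<delta> u i - truncated \<delta> v i\<bar> <= C * (\<Sum>j\<in>Ix. \<bar>u j - v j\<bar>)"
  using truncated_lipschitz[OF \<delta>(1)] by blast
 have hc: "continuous_on {0..b} (\<lambda>t. h t j)" if "j \<in> Ix" for j using b(3) that by (simp add: evolves_def)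
 have "continuous_on {0..b} (\<lambda>t. truncated \<delta> (h t) i)"
  unfolding continuous_on_def
 proof
  fix s assume s: "s \<in> {0..b}"
  have "((\<lambda>t. C * (\<Sum>j\<in>Ix. \<bar>h t j - h s j\<bar>)) \<longlongrightarrow> C * (\<Sum>j\<in>Ix. \<bar>h s j - h s j\<bar>)) (at s within {0..b})"
   by (intro tendsto_intros) (use hc s in \<open>auto simp: continuous_on_def\<close>)
  then have z: "((\<lambda>t. C * (\<Sum>j\<in>Ix. \<bar>h t j - h s j\<bar>)) \<longlongrightarrow> 0) (at s within {0..b})" by simp
  have "((\<lambda>t. truncated \<delta> (h t) i - truncated \<delta> (h s) i) \<longlongrightarrow> 0) (at s within {0..b})"
   by (rule Lim_null_comparison[OF _ z]) (simp add: C(2))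
  then show "((\<lambda>t. truncated \<delta> (h t) i) \<longlongrightarrow> truncated \<delta> (h s) i) (at s within {0..b})" by (rule LIM_zero_cancel)
 qed
 then have "continuous_on {0..b} (\<lambda>t. - truncated \<delta> (h t) i)" by (rule continuous_on_minus)
 then have "continuous_on ({t. 0 < t \<and> ereal t < lifetime} \<inter> {..<b}) (\<lambda>t. - truncated \<delta> (h t) i)"
  by (rule continuous_on_subset) auto
 then have "continuous_on ({t. 0 < t \<and> ereal t < lifetime} \<inter> {..<b}) (\<lambda>t. curv (len (pos (heights t))) i)"
 proof (rule continuous_on_eq)
  fix s assume s: "s \<in> {t. 0 < t \<and> ereal t < lifetime} \<inter> {..<b}"
  then show "- truncated \<delta> (h s) i = curv (len (pos (heights s))) i"
   using truncated_eq[of \<delta> "h s" i] \<delta>(2)[of s] pos_heights[OF b(3), of s] by simp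
 qed
 then show "\<exists>U. open U \<and> t \<in> U \<and> continuous_on ({t. 0 < t \<and> ereal t < lifetime} \<inter> U) (\<lambda>t. curv (len (pos (heights t))) i)"
  using b(1) by (intro exI[of _ "{..<b}"]) auto
qed

lemma height_pos:
 assumes V: "placement (pos h)" and c: "compatible h" and i: "i \<in> Ix"
 shows "height (P i) (piece_at (net (pos h)) i) = h i"
proof -
 obtain X where X: "X \<in> ends i" using some_endpoint by blast
 then show ?thesis using height_net[OF V i X] pos_inner[OF c, of i X] i by (simp add: inc_iff)
qed

lemma flow_state:
 assumes "0 <= t" "ereal t < lifetime"
 shows "placement (pos (heights t))" "embedded (pos (heights t))" "!!i. i \<in> Ix ==> height (P i) (piece_at (flow t) i) = heights t i"
proof -
 obtain b h where b: "t < b" "0 <= b" "evolves b h" using below_lifetime[OF assms(2)] .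
 have eq: "pos (heights t) = pos (h t)" using pos_heights[OF b(3)] assms b by simp
 show V: "placement (pos (heights t))" unfolding eq by (rule evolves_placement[OF b(3)]) (use assms b in auto)
 show "embedded (pos (heights t))" unfolding eq by (rule evolves_embedded[OF b(3)]) (use assms b in auto)
 fix i assume i: "i \<in> Ix"
 have "compatible (h t)" using b assms by (simp add: evolves_def)
 then show "height (P i) (piece_at (flow t) i) = heights t i"
  using height_pos[of "h t", OF _ _ i] V heights_eq[OF b(3) assms(1) _ i] b(1) unfolding flow_def eq by simp
qed

lemma flow_initial: "flow 0 = S0"
proof -
 obtain b h where b: "0 < b" "0 <= b" "evolves b h" using below_lifetime[of 0] lifetime_pos by (metis zero_ereal_def)
 have "pos (heights 0) = (\<lambda>X. X)"
  by (rule pos_initial) (use heights_eq[OF b(3), of 0] b in \<open>auto simp: evolves_def\<close>)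
 then show ?thesis by (simp add: flow_def net_id)
qed

lemma placement_id: "placement (\<lambda>X. X)"
 using flow_state(1)[of 0] lifetime_pos flow_initial
proof -
 obtain b h where b: "0 < b" "0 <= b" "evolves b h" using below_lifetime[of 0] lifetime_pos by (metis zero_ereal_def)
 have "pos (h 0) = (\<lambda>X. X)" by (rule pos_initial) (use b in \<open>auto simp: evolves_def\<close>)
 then show ?thesis using evolves_placement[OF b(3), of 0] b by simp
qed

lemma phi_dual_normal: "i \<in> Ix ==> placement V ==> phi_dual (normal (piece_at (net V) i)) = 1"
 using normal_move[of V i] phi_dual_rot90[OF tangent_hexdir, of i] by (simp add: piece_at_net normal_def)

lemma flow_is_flow: "phi_curvature_flow S0 lifetime flow"
 unfolding phi_curvature_flow_def Let_def
proof (intro conjI ballI allI impI)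
 show "admissible S0" using simple by (simp add: simple_network_def)
 show "phi_regular S0" using net_phi_regular[OF placement_id embedded_id] by (simp add: net_id)
 show "0 < lifetime" by (rule lifetime_pos)
 show "flow 0 = S0" by (rule flow_initial)
 show "parallel_network S0 (flow t)" if "0 <= t \<and> ereal t < lifetime" for t
  unfolding flow_def by (rule parallel_net) (use flow_state that in auto)
 fix i assume i: "i \<in> Ix"
 have h: "height (P i) (piece_at (flow t) i) = heights t i" if "0 <= t" "ereal t < lifetime" for t
  by (rule flow_state(3)[OF that i])
 show "continuous_on {t. 0 <= t \<and> ereal t < lifetime} (\<lambda>t. height (P i) (piece_at (flow t) i))"
  by (rule continuous_on_eq[OF heights_continuous[OF i]]) (simp add: h)
 have op: "open {t. 0 < t \<and> ereal t < lifetime}"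
 proof -
  have "{t. 0 < t \<and> ereal t < lifetime} = {0<..} \<inter> ereal -` {..<lifetime}" by auto
  also have "open ..." by (intro open_Int open_greaterThan open_vimage open_lessThan continuous_on_ereal continuous_on_id)
  finally show ?thesis .
 qed
 have der: "((\<lambda>t. height (P i) (piece_at (flow t) i)) has_real_derivative - curv (len (pos (heights t))) i) (at t)"
  if t: "0 < t" "ereal t < lifetime" for t
  by (rule has_field_derivative_transform_within_open[OF heights_derivative[OF t i] op]) (use t h in auto)
 show "(\<lambda>t. height (P i) (piece_at (flow t) i)) C1_differentiable_on {t. 0 < t \<and> ereal t < lifetime}"
  unfolding C1_differentiable_on_def
 proof (intro exI[of _ "\<lambda>t. - curv (len (pos (heights t))) i"] conjI ballI)
  show "((\<lambda>t. height (P i) (piece_at (flow t) i)) has_vector_derivative - curv (len (pos (heights t))) i) (at t)"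
   if "t \<in> {t. 0 < t \<and> ereal t < lifetime}" for t
   using der[of t] that by (simp add: has_real_derivative_iff_has_vector_derivative)
  show "continuous_on {t. 0 < t \<and> ereal t < lifetime} (\<lambda>t. - curv (len (pos (heights t))) i)"
   by (rule continuous_on_minus[OF curvature_continuous[OF i]])
 qed
 fix t assume t: "0 < t \<and> ereal t < lifetime"
 have st: "placement (pos (heights t))" "embedded (pos (heights t))" using flow_state[of t] t by auto
 have "has_phi_curvature (flow t) i (curv (len (pos (heights t))) i)"
  unfolding flow_def phi_curvature_net[OF st i] ..
 moreover have "phi_dual (normal (piece_at (flow t) i)) = 1" unfolding flow_def by (rule phi_dual_normal[OF i st(1)])
 ultimately show "\<exists>\<kappa>. has_phi_curvature (flow t) i \<kappa> \<and>
   ((\<lambda>t. height (P i) (piece_at (flow t) i)) has_real_derivative - phi_dual (normal (piece_at (flow t) i)) * \<kappa>) (at t)"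
  using der[of t] t by (intro exI[of _ "curv (len (pos (heights t))) i"]) simp
qed

text \<open>Before embeddedness is known, the curvatures in the definition of a flow cannot be identified with
\<open>curv\<close>; this is why \<open>embedded_throughout\<close> is applied first.\<close>
lemma any_flow_evolves:
 assumes f: "phi_curvature_flow S0 T' S'" and b: "0 <= b" "ereal b < T'"
 defines "h \<equiv> \<lambda>t i. height (P i) (piece_at (S' t) i)"
 shows "evolves b h" "S' b = net (pos (h b))"
proof -
 have bt: "ereal t < T'" if "t <= b" for t using that b(2) by (meson ereal_less_eq(3) le_less_trans)
 have par: "parallel_network S0 (S' t)" if "0 <= t" "t <= b" for t
  using f that bt[of t] unfolding phi_curvature_flow_def by blast
 have S': "S' t = net (pos (h t))" "compatible (h t)" "placement (pos (h t))" if "0 <= t" "t <= b" for t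
  using parallel_network_heights(1,2,4)[OF par[OF that]] unfolding h_def by simp_all
 have ln: "0 < len (pos (h t)) i" if "0 <= t" "t <= b" "i \<in> segs" for t i
  using parallel_network_heights(3)[OF par[OF that(1,2)] that(3)] unfolding h_def .
 show "S' b = net (pos (h b))" using S'(1) b by simp
 have hc: "continuous_on {0..b} (\<lambda>t. h t i)" if i: "i \<in> Ix" for i
 proof (rule continuous_on_subset)
  show "continuous_on {t. 0 <= t \<and> ereal t < T'} (\<lambda>t. h t i)"
   using f i unfolding phi_curvature_flow_def h_def Let_def by blast
 qed (use bt in auto)
 have h0: "h 0 i = 0" if i: "i \<in> Ix" for i
 proof -
  have "S' 0 = net (\<lambda>X. X)" using f by (simp add: phi_curvature_flow_def net_id)
  moreover obtain X where "X \<in> ends i" using some_endpoint by blast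
  ultimately show ?thesis using height_net[OF placement_id i] by (simp add: h_def)
 qed
 have der: "((\<lambda>t. h t i) has_real_derivative - curv (len (pos (h t))) i) (at t)"
  if t: "0 < t" "t < b" and i: "i \<in> Ix" and E: "embedded (pos (h t))" for t i
 proof -
  have t': "0 <= t" "t <= b" "0 < t \<and> ereal t < T'" using t bt[of t] by auto
  obtain \<kappa> where \<kappa>: "has_phi_curvature (S' t) i \<kappa>" "((\<lambda>t. h t i) has_real_derivative - phi_dual (normal (piece_at (S' t) i)) * \<kappa>) (at t)"
   using f i t'(3) unfolding phi_curvature_flow_def h_def Let_def by blast
  have "\<kappa> = curv (len (pos (h t))) i"
   using \<kappa>(1) unfolding S'(1)[OF t'(1,2)] phi_curvature_net[OF S'(3)[OF t'(1,2)] E i] .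
  moreover have "phi_dual (normal (piece_at (S' t) i)) = 1"
   unfolding S'(1)[OF t'(1,2)] by (rule phi_dual_normal[OF i S'(3)[OF t'(1,2)]])
  ultimately show ?thesis using \<kappa>(2) by simp
 qed
 have emb: "embedded (pos (h t))" if "0 <= t" "t <= b" for t
  by (rule embedded_throughout[OF hc h0 S'(2) ln der that])
 show "evolves b h" unfolding evolves_def using hc h0 S'(2) ln der emb by auto
qed

lemma flow_unique:
 assumes f: "phi_curvature_flow S0 T' S'"
 shows "T' <= lifetime" "0 <= t ==> ereal t < T' ==> S' t = flow t"
proof -
 show "T' <= lifetime"
 proof (rule ccontr)
  assume "\<not> T' <= lifetime"
  then have "lifetime < T'" by simp
  then obtain b where b: "lifetime < ereal b" "ereal b < T'" using ereal_dense2 by blast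
  have "0 < ereal b" using lifetime_pos b(1) by (rule less_trans)
  then have b0: "0 <= b" by simp
  show False using le_lifetime[OF b0 any_flow_evolves(1)[OF f b0 b(2)]] b(1) by simp
 qed
 show "S' t = flow t" if t: "0 <= t" "ereal t < T'"
  using any_flow_evolves[OF f t] pos_heights[of t _ t] t(1) unfolding flow_def by simp
qed

lemma piece_length_segment:
 assumes V: "placement V" and i: "i \<in> segs"
 shows "piece_length (piece_at (net V) i) = ennreal (len V i)"
 unfolding piece_at_net[OF segs_Ix[OF i]] seg_ends(1)[OF i] using len_pos[OF V i]
 by (simp add: piece_length_def)

text \<open>Otherwise all lengths would be bounded from below up to the final time, and
\<open>extension\<close> would prolong the flow.\<close>
lemma flow_vanishes:
 assumes fin: "lifetime < \<infinity>"
 shows "some_segment_vanishes S0 (real_of_ereal lifetime) flow"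
proof (rule ccontr)
 assume no: "\<not> ?thesis"
 define T where "T = real_of_ereal lifetime"
 have T: "lifetime = ereal T" "0 < T" using fin lifetime_pos by (cases lifetime; simp add: T_def)+
 have len_flow: "piece_length (piece_at (flow t) i) = ennreal (len (pos (heights t)) i)" if "0 < t" "t < T" "i \<in> segs" for t i
  unfolding flow_def by (rule piece_length_segment[OF flow_state(1) that(3)]) (use that T in auto)
 have late: "\<exists>r>0. \<forall>\<^sub>F t in at_left T. r <= len (pos (heights t)) i" if i: "i \<in> segs" for i
 proof -
  have "Liminf (at_left T) (\<lambda>t. piece_length (piece_at (flow t) i)) ~= 0"
   using no i unfolding some_segment_vanishes_def T_def segs_def by blast
  then have "0 < Liminf (at_left T) (\<lambda>t. piece_length (piece_at (flow t) i))" by (simp add: zero_less_iff_neq_zero)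
  then obtain x where x: "0 < x" "x < Liminf (at_left T) (\<lambda>t. piece_length (piece_at (flow t) i))" using dense by blast
  have "x < top" using x(2) by (metis less_le_trans top_greatest)
  then obtain r where r: "x = ennreal r" "0 <= r" by (cases x) auto
  have "\<forall>\<^sub>F t in at_left T. x < piece_length (piece_at (flow t) i)" by (rule less_LiminfD[OF x(2)])
  moreover have "\<forall>\<^sub>F t in at_left T. 0 < t \<and> t < T" unfolding eventually_at_left_field using T(2) by blast
  ultimately have "\<forall>\<^sub>F t in at_left T. r <= len (pos (heights t)) i"
  proof eventually_elim
   case (elim t)
   then have "ennreal r < ennreal (len (pos (heights t)) i)" using len_flow[of t i] i r(1) by simp
   then show ?case using r(2) by (metis ennreal_less_iff less_imp_le)
  qed
  moreover have "0 < r" using x(1) r by simp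
  ultimately show ?thesis by blast
 qed
 then obtain r where r: "!!i. i \<in> segs ==> 0 < r i \<and> (\<forall>\<^sub>F t in at_left T. r i <= len (pos (heights t)) i)" by metis
 have "\<forall>\<^sub>F t in at_left T. \<forall>i\<in>segs. r i <= len (pos (heights t)) i"
  using r by (intro eventually_ball_finite) auto
 then obtain a where a: "a < T" "!!t. a < t ==> t < T ==> \<forall>i\<in>segs. r i <= len (pos (heights t)) i"
  unfolding eventually_at_left_field by blast
 obtain \<rho> where \<rho>: "0 < \<rho>" "!!i. i \<in> segs ==> \<rho> <= r i" using positive_min[OF finite_segs, of r] r by blast
 define c where "c = max 0 ((a + T) / 2)"
 have m: "a < (a + T) / 2" "(a + T) / 2 < T" using a(1) by simp_all
 have c: "0 <= c" "a < c" "c < T" using m T(2) by (simp_all add: c_def less_max_iff_disj)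
 obtain b h where b: "c < b" "0 <= b" "evolves b h" using below_lifetime[of c] c T by auto
 obtain \<delta> where \<delta>: "0 < \<delta>" "!!t i. 0 <= t ==> t <= b ==> i \<in> segs ==> \<delta> <= len (pos (h t)) i"
  using evolves_lower_bound[OF b(3)] by blast
 \<comment> \<open>\<open>\<rho>\<close> bounds the lengths after time \<open>c\<close>, and \<open>\<delta>\<close> those before\<close>
 define \<epsilon> where "\<epsilon> = min \<rho> \<delta> / 2"
 have \<epsilon>: "0 < \<epsilon>" "2 * \<epsilon> <= \<rho>" "2 * \<epsilon> <= \<delta>" using \<rho> \<delta> by (simp_all add: \<epsilon>_def)
 have low: "2 * \<epsilon> <= len (pos (heights t)) i" if t: "0 <= t" "t < T" and i: "i \<in> segs" for t i
 proof (cases "t <= c")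
  case True
  then have "\<delta> <= len (pos (heights t)) i" using \<delta>(2)[OF t(1) _ i] pos_heights[OF b(3) t(1)] b(1) by simp
  then show ?thesis using \<epsilon> by simp
 next
  case False
  then have "r i <= len (pos (heights t)) i" using a(2)[of t] t c i by simp
  then show ?thesis using \<epsilon> \<rho>(2)[OF i] by simp
 qed
 obtain b' h' where b': "T < b'" "evolves b' h'"
 proof (rule extension[of T \<epsilon>])
  have id: "pos (heights 0) = (\<lambda>X. X)"
   by (rule pos_initial) (use heights_eq[OF b(3), of 0] b in \<open>auto simp: evolves_def\<close>)
  show "2 * \<epsilon> <= len (\<lambda>X. X) i" if "i \<in> segs" for i using low[of 0 i] that T(2) unfolding id by simp
  fix s assume s: "0 <= s" "s < T"
  then obtain b2 h2 where h2: "s < b2" "evolves b2 h2" using below_lifetime[of s] T(1) by auto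
  have "2 * \<epsilon> <= len (pos (h2 t)) i" if "0 <= t" "t <= s" "i \<in> segs" for t i
   using low[of t i] pos_heights[OF h2(2), of t] that s h2(1) by simp
  then show "\<exists>h. evolves s h \<and> (\<forall>t i. 0 <= t \<and> t <= s \<and> i \<in> segs --> 2 * \<epsilon> <= len (pos (h t)) i)"
   using evolves_mono[OF h2(2)] h2(1) by (intro exI[of _ h2]) auto
 qed (use T \<epsilon> in auto)
 have "ereal b' <= lifetime" by (rule le_lifetime[OF _ b'(2)]) (use b' T in simp)
 then show False using b' T(1) by simp
qed

end

theorem theorem1p1:
  fixes S0 :: network
  assumes "simple_network S0"
  shows "\<exists>(T :: ereal) (S :: real \<Rightarrow> network).
    phi_curvature_flow S0 T S \<and>
    (\<forall>T' S'. phi_curvature_flow S0 T' S' \<longrightarrow>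
      T' \<le> T \<and> (\<forall>t. 0 \<le> t \<and> ereal t < T' \<longrightarrow> S' t = S t)) \<and>
    (T < \<infinity> \<longrightarrow> some_segment_vanishes S0 (real_of_ereal T) S)"
proof -
  interpret simple_net S0 by standard (rule assms)
  show ?thesis using flow_is_flow flow_unique flow_vanishes by blast
qed

end
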